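(* Let $\delta$ be a given positive number such that $\delta<\pi/2$. Let $B\subset\mathbb C\setminus\{0\}$ and $B_*\subset\mathbb C$ be given domains. Suppose that $\mathrm{dist}(\{-2\theta_0+\theta_\infty,\,2\theta_x-\theta_\infty\},B_* )>0$. Then the fifth Painlevé equation $(\mathrm V)$ admits a two-parameter family of solutions $\{y(c,\sigma,x);\ (c,\sigma)\in B\times B_*\}$ such that $y(c,\sigma,x)$ is holomorphic in $(c,\sigma,x)\in B\times D(B_*,\varepsilon',x'_\infty,\delta)$ and is expanded into the convergent series in $(e^xx^{\sigma-1},e^{-x}x^{-\sigma-1})$ $$y(c,\sigma,x)=c\,(1+[x^{-1}]_* )\,e^xx^\sigma\Big(1+\sum_{n=1}^\infty(a_n+[x^{-1}]_* )(e^xx^{\sigma-1})^n+\sum_{n=1}^\infty(b_n+[x^{-1}]_* )(e^{-x}x^{-\sigma-1})^n\Big)$$ with $a_n,b_n\in\mathbb Q_0:=\mathbb Q[\theta_0,\theta_x,\theta_\infty,c,c^{-1},\sigma,(\sigma+2\theta_0-\theta_\infty)^{-1},(-\sigma+2\theta_x-\theta_\infty)^{-1}]$, in particular $$a_1=c(-\sigma+\theta_0+\theta_x)/2,\qquad b_1=c^{-1}(\sigma+\theta_0+\theta_x)/2.$$ Here $\varepsilon'=\varepsilon'(B,B_*,\delta)$ (resp. $x'_\infty=x'_\infty(B,B_*,\delta)$) is a sufficiently small (resp. large) positive number depending on $(B,B_*,\delta)$, and each $[x^{-1}]_*$ is represented by an asymptotic series with coefficients in $\mathbb Q_0$ valid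 in $|\arg x-\pi/2|<\pi/2-\delta$, $|x|>x'_\infty$.
   Context: $\theta_0,\theta_x,\theta_\infty\in\mathbb C$ are fixed. The fifth Painlevé equation is $$\frac{d^2y}{dx^2}=\Big(\frac1{2y}+\frac1{y-1}\Big)\Big(\frac{dy}{dx}\Big)^2-\frac1x\frac{dy}{dx}+\frac{(y-1)^2}{8x^2}\Big((\theta_0-\theta_x+\theta_\infty)^2y-\frac{(\theta_0-\theta_x-\theta_\infty)^2}y\Big)+(1-\theta_0-\theta_x)\frac yx-\frac{y(y+1)}{2(y-1)}.\qquad(\mathrm V)$$ Powers $x^a$ are defined on the universal covering $\mathcal R(\mathbb C\setminus\{0\})$ of $\mathbb C\setminus\{0\}$ via $\log x=\log|x|+i\arg x$. For $x'_\infty>1/\varepsilon'$, $$\Sigma(\sigma,\varepsilon',x'_\infty,\delta)=\{x\in\mathcal R(\mathbb C\setminus\{0\}):\ |\arg x-\pi/2|<\pi/2-\delta,\ |e^xx^{\sigma-1}|<\varepsilon',\ |e^{-x}x^{-\sigma-1}|<\varepsilon',\ |x|>x'_\infty\},$$ $$D(B_*,\varepsilon',x'_\infty,\delta)=\bigcup_{\sigma\in B_*}\{\sigma\}\times\Sigma(\sigma,\varepsilon',x'_\infty,\delta).$$ $[x^{-1}]_*$ denotes a holomorphic function (possibly different at each occurrence) admitting an asymptotic representation $x^{-1}\sum_{j\ge0}f_jx^{-j}$ as $x\to\infty$ through the indicated sector, with coefficients $f_j$ (not necessarily nonzero) in the indicated ring.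
   Formalization: The domains B and B_* are taken to be bounded and 0 is not in the closure of B; without this the uniform constants ε' and x'_∞ cannot exist, because the solutions have poles near c e^x x^{σ-1} = -4/(σ-2θ_x+θ_∞), and similarly as c tends to 0. *)

theory Defs
  imports "HOL-Complex_Analysis.Complex_Analysis" "HOL-Library.Landau_Symbols"
begin

definition is_domain :: "complex set \<Rightarrow> bool" where
  "is_domain S \<longleftrightarrow> open S \<and> connected S \<and> S \<noteq> {}"

text \<open>Joint holomorphy in three complex variables: the real derivative exists and is complex-linear.\<close>

definition holomorphic3_on :: "(complex \<times> complex \<times> complex \<Rightarrow> complex)
    \<Rightarrow> (complex \<times> complex \<times> complex) set \<Rightarrow> bool" where
  "holomorphic3_on f S \<longleftrightarrow>
     (\<forall>p\<in>S. \<exists>\<alpha> \<beta> \<gamma>. (f has_derivative (\<lambda>(h, k, l). \<alpha> * h + \<beta> * k + \<gamma> * l)) (at p within S))"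

text \<open>The right-hand side of (V), where \<open>p\<close> stands for \<open>dy/dx\<close>.\<close>

definition PV_rhs :: "complex \<Rightarrow> complex \<Rightarrow> complex \<Rightarrow> complex \<Rightarrow> complex \<Rightarrow> complex \<Rightarrow> complex" where
  "PV_rhs \<theta>0 \<theta>x \<theta>inf x y p =
     (1 / (2 * y) + 1 / (y - 1)) * p ^ 2 - p / x
     + (y - 1) ^ 2 / (8 * x ^ 2)
         * ((\<theta>0 - \<theta>x + \<theta>inf) ^ 2 * y - (\<theta>0 - \<theta>x - \<theta>inf) ^ 2 / y)
     + (1 - \<theta>0 - \<theta>x) * (y / x) - y * (y + 1) / (2 * (y - 1))"

text \<open>A holomorphic solution may pass through the values 0 and 1, where the right-hand side of (V)
  is an undefined expression (and division by zero would give it a wrong value in HOL). The equation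
  is imposed at all other points; the exceptional points must be isolated, so that the constants 0
  and 1 are not solutions.\<close>

definition solves_PV_on :: "complex \<Rightarrow> complex \<Rightarrow> complex \<Rightarrow> (complex \<Rightarrow> complex) \<Rightarrow> complex set \<Rightarrow> bool" where
  "solves_PV_on \<theta>0 \<theta>x \<theta>inf y S \<longleftrightarrow>
     y holomorphic_on S \<and>
     (\<forall>x\<in>S. \<forall>\<^sub>F z in at x. y z \<noteq> 0 \<and> y z \<noteq> 1) \<and>
     (\<forall>x\<in>S. y x \<noteq> 0 \<and> y x \<noteq> 1 \<longrightarrow>
        (deriv ^^ 2) y x = PV_rhs \<theta>0 \<theta>x \<theta>inf x (y x) (deriv y x))"

text \<open>For \<open>\<delta> > 0\<close> the sector lies over the part \<open>0 < arg x < pi\<close> of the universal covering of the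
  punctured plane, which projects bijectively onto the upper half plane. There the logarithm of the
  covering is the principal branch, so that \<open>arg\<close> is \<open>Arg\<close> and powers are \<open>powr\<close>.\<close>

definition sector :: "real \<Rightarrow> real \<Rightarrow> complex set" where
  "sector \<delta> r = {x. x \<noteq> 0 \<and> \<bar>Arg x - pi / 2\<bar> < pi / 2 - \<delta> \<and> norm x > r}"

definition Xvar :: "complex \<Rightarrow> complex \<Rightarrow> complex" where
  "Xvar \<sigma> x = exp x * x powr (\<sigma> - 1)"

definition Yvar :: "complex \<Rightarrow> complex \<Rightarrow> complex" where
  "Yvar \<sigma> x = exp (- x) * x powr (- \<sigma> - 1)"

definition Sigma_dom :: "complex \<Rightarrow> real \<Rightarrow> real \<Rightarrow> real \<Rightarrow> complex set" where
  "Sigma_dom \<sigma> \<epsilon> r \<delta> = {x \<in> sector \<delta> r. norm (Xvar \<sigma> x) < \<epsilon> \<and> norm (Yvar \<sigma> x) < \<epsilon>}"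

definition D_dom :: "complex set \<Rightarrow> real \<Rightarrow> real \<Rightarrow> real \<Rightarrow> (complex \<times> complex) set" where
  "D_dom Bs \<epsilon> r \<delta> = (\<Union>\<sigma>\<in>Bs. {\<sigma>} \<times> Sigma_dom \<sigma> \<epsilon> r \<delta>)"

text \<open>The ring generated over the rationals by the (fixed) parameters and by the functions \<open>c\<close>, \<open>1/c\<close>,
  \<open>\<sigma>\<close>, \<open>1/(\<sigma> + 2\<theta>0 - \<theta>inf)\<close>, \<open>1/(-\<sigma> + 2\<theta>x - \<theta>inf)\<close> of \<open>(c, \<sigma>)\<close>. Its elements are only used where the
  denominators do not vanish.\<close>

inductive_set Q0 :: "complex \<Rightarrow> complex \<Rightarrow> complex \<Rightarrow> (complex \<Rightarrow> complex \<Rightarrow> complex) set"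
  for \<theta>0 \<theta>x \<theta>inf :: complex where
  Q0_rat: "q \<in> \<rat> \<Longrightarrow> (\<lambda>c \<sigma>. q) \<in> Q0 \<theta>0 \<theta>x \<theta>inf"
| Q0_theta0: "(\<lambda>c \<sigma>. \<theta>0) \<in> Q0 \<theta>0 \<theta>x \<theta>inf"
| Q0_thetax: "(\<lambda>c \<sigma>. \<theta>x) \<in> Q0 \<theta>0 \<theta>x \<theta>inf"
| Q0_thetainf: "(\<lambda>c \<sigma>. \<theta>inf) \<in> Q0 \<theta>0 \<theta>x \<theta>inf"
| Q0_c: "(\<lambda>c \<sigma>. c) \<in> Q0 \<theta>0 \<theta>x \<theta>inf"
| Q0_inv_c: "(\<lambda>c \<sigma>. inverse c) \<in> Q0 \<theta>0 \<theta>x \<theta>inf"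
| Q0_sigma: "(\<lambda>c \<sigma>. \<sigma>) \<in> Q0 \<theta>0 \<theta>x \<theta>inf"
| Q0_inv1: "(\<lambda>c \<sigma>. inverse (\<sigma> + 2 * \<theta>0 - \<theta>inf)) \<in> Q0 \<theta>0 \<theta>x \<theta>inf"
| Q0_inv2: "(\<lambda>c \<sigma>. inverse (- \<sigma> + 2 * \<theta>x - \<theta>inf)) \<in> Q0 \<theta>0 \<theta>x \<theta>inf"
| Q0_add: "f \<in> Q0 \<theta>0 \<theta>x \<theta>inf \<Longrightarrow> g \<in> Q0 \<theta>0 \<theta>x \<theta>inf \<Longrightarrow> (\<lambda>c \<sigma>. f c \<sigma> + g c \<sigma>) \<in> Q0 \<theta>0 \<theta>x \<theta>inf"
| Q0_mult: "f \<in> Q0 \<theta>0 \<theta>x \<theta>inf \<Longrightarrow> g \<in> Q0 \<theta>0 \<theta>x \<theta>inf \<Longrightarrow> (\<lambda>c \<sigma>. f c \<sigma> * g c \<sigma>) \<in> Q0 \<theta>0 \<theta>x \<theta>inf"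

text \<open>Poincare asymptotics \<open>g(x) ~ x^(-1) (f 0 + f 1 x^(-1) + ...)\<close> as \<open>x\<close> tends to infinity in \<open>S\<close>.\<close>

definition asymp_inv_series :: "complex set \<Rightarrow> (complex \<Rightarrow> complex) \<Rightarrow> (nat \<Rightarrow> complex) \<Rightarrow> bool" where
  "asymp_inv_series S g f \<longleftrightarrow>
     (\<forall>N. (\<lambda>x. g x - inverse x * (\<Sum>j<N. f j * inverse x ^ j))
            \<in> O[inf at_infinity (principal S)](\<lambda>x. inverse x ^ (N + 1)))"

text \<open>\<open>g\<close> is an admissible \<open>[x^(-1)]\<^sub>*\<close>.\<close>

definition bracket :: "complex \<Rightarrow> complex \<Rightarrow> complex \<Rightarrow> complex set \<Rightarrow> complex set \<Rightarrow> complex set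
    \<Rightarrow> (complex \<Rightarrow> complex \<Rightarrow> complex \<Rightarrow> complex) \<Rightarrow> bool" where
  "bracket \<theta>0 \<theta>x \<theta>inf B Bs S g \<longleftrightarrow>
     holomorphic3_on (\<lambda>(c, \<sigma>, x). g c \<sigma> x) (B \<times> Bs \<times> S) \<and>
     (\<exists>f. (\<forall>j. f j \<in> Q0 \<theta>0 \<theta>x \<theta>inf) \<and>
          (\<forall>c\<in>B. \<forall>\<sigma>\<in>Bs. asymp_inv_series S (g c \<sigma>) (\<lambda>j. f j c \<sigma>)))"

text \<open>The series \<open>\<Sum>n\<ge>1. (a n + g n) X^n\<close> has coefficients depending on \<open>x\<close>, and \<open>X\<close> is itself a
  function of \<open>x\<close>. Convergence of such a series is uniform convergence on the domain: mere pointwise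
  convergence would carry no information, since the remainders \<open>g n\<close> could then be used to represent
  quite arbitrary functions.\<close>

definition converges_on ::
  "(nat \<Rightarrow> complex \<Rightarrow> complex \<Rightarrow> complex) \<Rightarrow> (nat \<Rightarrow> complex \<Rightarrow> complex \<Rightarrow> complex \<Rightarrow> complex)
    \<Rightarrow> (complex \<Rightarrow> complex \<Rightarrow> complex) \<Rightarrow> (complex \<times> complex \<times> complex) set \<Rightarrow> bool" where
  "converges_on a g Z S \<longleftrightarrow>
     uniformly_convergent_on S (\<lambda>N (c, \<sigma>, x). \<Sum>n=1..N. (a n c \<sigma> + g n c \<sigma> x) * Z \<sigma> x ^ n)"

end

theory Submission
  imports Defs
begin

text \<open>(V) follows from the Jimbo--Miwa system
  \<open>x y' = x y - 2z(y-1)^2 - (y-1)(a y - \<theta>0 - b)\<close>, \<open>x z' = y z(z+a) - (z+\<theta>0)(z+b)/y\<close> with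
  \<open>a = (\<theta>0-\<theta>x+\<theta>inf)/2\<close>, \<open>b = (\<theta>0+\<theta>x+\<theta>inf)/2\<close>, which is regular where \<open>y = 1\<close>. Put
  \<open>X = c e^x x^(\<sigma>-1)\<close>, \<open>Y = c^(-1) e^(-x) x^(-\<sigma>-1)\<close>, so that \<open>XY = x^(-2)\<close>, and
  \<open>z = (\<sigma>-2\<theta>0-\<theta>inf)/4 + u\<close>, \<open>y = x X (1 + w)\<close>. Expanding \<open>u\<close> and \<open>w\<close> as double power series in \<open>X\<close>
  and \<open>Y\<close> with coefficients depending on \<open>x\<close> yields for the coefficient of \<open>X^m Y^n\<close> a linear
  first-order equation, whose right-hand side involves only lower coefficients. Its solution given by
  integration from infinity along a fixed direction is \<open>O(x^(min m n))\<close> with a constant independent of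
  \<open>(m, n)\<close>, and has an asymptotic expansion if the right-hand side has one. A majorant argument then
  gives convergence of the double series for small \<open>X\<close>, \<open>Y\<close> and large \<open>x\<close>. Finally
  \<open>X^(k+n) Y^n = x^(-2n) X^k\<close> collapses the double series to a series in the powers of \<open>X\<close> and one in
  the powers of \<open>Y\<close>, and dividing by the constant term gives the asserted form.\<close>

subsection \<open>Separately holomorphic functions\<close>

text \<open>The obstacle is the diagonal \<open>m = n\<close>: the monomial
  \<open>X^n Y^n = x^(-2n)\<close> carries no exponential, so integration from infinity costs one
  power of \<open>x\<close> there. Two facts pay for it. Every term of the right-hand sides contains
  a factor \<open>X\<close>, \<open>Y\<close> or \<open>1/x\<close>, hence its diagonal coefficients
  are one power smaller than \<open>x^n\<close>; and \<open>x^n (X Y)^n = x^(-n)\<close> is still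
  small, so growth of order \<open>x^(min m n)\<close> does no harm. Off the diagonal the decay of
  the exponential along the ray beats the factor \<open>x^((m-n) \<sigma>)\<close> once
  \<open>x\<close> is large compared with \<sigma>. The norm of the solution operator is therefore
  bounded in terms of \<delta> alone. With \<open>X\<close> and \<open>Y\<close> independent the
  recursion is triangular in the total degree. Existence of the formal solution is thus pure
  algebra, and the estimates only have to show that a ball of majorants is mapped into itself. The
  parameter \<open>c\<close> occurs in \<open>X\<close> and \<open>Y\<close> only: all coefficient
  functions depend on \<sigma> and \<open>x\<close>, and the powers of \<open>c\<close> are put back
  at the very end.\<close>

lemma continuous_on_deriv_param:
  fixes f :: "'a::heine_borel \<Rightarrow> complex \<Rightarrow> complex"
  assumes "open S" and cont: "continuous_on S (\<lambda>(a, w). f a w)"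
    and hol: "\<And>a. f a holomorphic_on {w. (a, w) \<in> S}"
  shows "continuous_on S (\<lambda>(a, w). deriv (f a) w)"
proof -
  have "\<exists>d>0. \<forall>p\<in>S. dist p p0 < d \<longrightarrow>
          dist ((\<lambda>(a, w). deriv (f a) w) p) ((\<lambda>(a, w). deriv (f a) w) p0) < e"
    if "p0 \<in> S" "0 < e" for p0 e
  proof -
    obtain a0 w0 where p0: "p0 = (a0, w0)" by (cases p0)
    from openE[OF \<open>open S\<close> \<open>p0 \<in> S\<close>] obtain R where R: "R > 0" "ball p0 R \<subseteq> S" by blast
    define \<rho> where "\<rho> = R / 3"
    have \<rho>: "\<rho> > 0" using R by (simp add: \<rho>_def)
    have sub: "cball a0 \<rho> \<times> cball w0 \<rho> \<subseteq> S"
    proof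
      fix q assume q: "q \<in> cball a0 \<rho> \<times> cball w0 \<rho>"
      obtain a w where aw: "q = (a, w)" by (cases q)
      have "dist p0 q \<le> dist a0 a + dist w0 w"
        unfolding p0 aw dist_prod_def by (simp add: sqrt_sum_squares_le_sum)
      also have "\<dots> < R" using q aw R by (auto simp: \<rho>_def)
      finally show "q \<in> S" using R by auto
    qed
    have "uniformly_continuous_on (cball a0 \<rho> \<times> cball w0 \<rho>) (\<lambda>(a, w). f a w)"
      by (intro compact_uniformly_continuous continuous_on_subset[OF cont sub] compact_Times) auto
    \<comment> \<open>On discs of radius \<open>\<rho>/2\<close> Cauchy's estimate turns the bound
      \<open>e'\<close> for values into \<open>e/4\<close> for derivatives.\<close>
    moreover define e' where "e' = e * \<rho> / 8"
    have "e' > 0" using \<rho> \<open>e > 0\<close> by (simp add: e'_def)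
    ultimately obtain d1 where d1: "d1 > 0"
      "\<And>q q'. q \<in> cball a0 \<rho> \<times> cball w0 \<rho> \<Longrightarrow> q' \<in> cball a0 \<rho> \<times> cball w0 \<rho> \<Longrightarrow> dist q' q < d1
        \<Longrightarrow> dist ((\<lambda>(a, w). f a w) q') ((\<lambda>(a, w). f a w) q) < e'"
      unfolding uniformly_continuous_on_def by metis
    have hol': "f a holomorphic_on ball w0 \<rho>" if "a \<in> cball a0 \<rho>" for a
      by (rule holomorphic_on_subset[OF hol[of a]]) (use sub that in auto)
    have "continuous_on (ball w0 \<rho>) (deriv (f a0))"
      by (intro holomorphic_on_imp_continuous_on holomorphic_deriv hol') (use \<rho> in auto)
    then have "isCont (deriv (f a0)) w0"
      using \<rho> by (simp add: continuous_on_eq_continuous_at)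
    then obtain d2 where d2: "d2 > 0" "\<And>w. dist w w0 < d2 \<Longrightarrow> dist (deriv (f a0) w) (deriv (f a0) w0) < e / 2"
      using \<open>e > 0\<close> unfolding continuous_at_eps_delta by (metis half_gt_zero)
    define d where "d = min (min d1 d2) (\<rho> / 2)"
    have "dist (deriv (f a) w) (deriv (f a0) w0) < e" if "dist (a, w) p0 < d" for a w
    proof -
      have da: "dist a a0 < d" and dw: "dist w w0 < d"
        using that dist_fst_le[of "(a, w)" p0] dist_snd_le[of "(a, w)" p0] by (auto simp: p0)
      have aC: "a \<in> cball a0 \<rho>" and wb: "w \<in> ball w0 \<rho>" using da dw \<rho> by (auto simp: d_def dist_commute)
      have cbs: "cball w (\<rho>/2) \<subseteq> ball w0 \<rho>"
      proof
        fix t assume "t \<in> cball w (\<rho>/2)"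
        then show "t \<in> ball w0 \<rho>" using dw dist_triangle[of w0 t w] by (auto simp: d_def dist_commute)
      qed
      \<comment> \<open>Cauchy's estimate is applied to the difference of two slices, which is
        uniformly small; variation inside the fixed slice \<open>a0\<close> is controlled by
        continuity of its own derivative.\<close>
      define h where "h = (\<lambda>t. f a t - f a0 t)"
      have hh: "h holomorphic_on ball w0 \<rho>"
        unfolding h_def by (intro holomorphic_intros hol') (use aC \<rho> in auto)
      have "norm ((deriv ^^ 1) h w) \<le> fact 1 * e' / (\<rho>/2) ^ 1"
      proof (rule Cauchy_higher_deriv_bound[where y = 0])
        show "h holomorphic_on ball w (\<rho>/2)"
          using hh cbs by (meson ball_subset_cball holomorphic_on_subset subset_trans)
        show "continuous_on (cball w (\<rho>/2)) h"
          using hh cbs by (meson continuous_on_subset holomorphic_on_imp_continuous_on)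
        fix t assume "t \<in> ball w (\<rho>/2)"
        then have t: "t \<in> cball w0 \<rho>" using cbs by (meson ball_subset_cball subsetD)
        have "dist (a, t) (a0, t) < d1" using da by (simp add: dist_Pair_Pair d_def)
        then have "dist (f a t) (f a0 t) < e'" using d1(2)[of "(a0, t)" "(a, t)"] t aC \<rho> by auto
        then show "h t \<in> ball 0 e'" by (simp add: h_def dist_norm norm_minus_commute)
      qed (use \<rho> in auto)
      then have "norm (deriv h w) \<le> e / 4" using \<rho> by (simp add: e'_def field_simps)
      moreover have "deriv h w = deriv (f a) w - deriv (f a0) w"
        unfolding h_def using hol'[OF aC] hol'[of a0] wb \<rho>
        by (intro deriv_diff holomorphic_on_imp_differentiable_at[of _ "ball w0 \<rho>"]) auto
      ultimately have "dist (deriv (f a) w) (deriv (f a0) w) \<le> e / 4" by (simp add: dist_norm)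
      moreover have "dist (deriv (f a0) w) (deriv (f a0) w0) < e / 2" using d2 dw by (simp add: d_def)
      ultimately show ?thesis
        using dist_triangle[of "deriv (f a) w" "deriv (f a0) w0" "deriv (f a0) w"] \<open>e > 0\<close> by linarith
    qed
    moreover have "d > 0" using d1 d2 \<rho> by (simp add: d_def)
    ultimately show ?thesis by (intro exI[of _ d]) (auto simp: p0)
  qed
  then show ?thesis unfolding continuous_on_iff by blast
qed

text \<open>One complex variable is added to a block of variables already treated. For the block,
  differentiability at the single point suffices; the new variable contributes a partial derivative
  that is continuous by \<open>continuous_on_deriv_param\<close>. Two applications cover three
  variables.\<close>

lemma osgood_step:
  fixes f :: "'a::{heine_borel,real_normed_vector} \<Rightarrow> complex \<Rightarrow> complex"
  assumes "open S" and cont: "continuous_on S (\<lambda>(a, w). f a w)"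
    and hol: "\<And>a. f a holomorphic_on {w. (a, w) \<in> S}"
    and p: "(a0, w0) \<in> S" and fx: "((\<lambda>a. f a w0) has_derivative fx) (at a0)"
  shows "((\<lambda>(a, w). f a w) has_derivative (\<lambda>(h, k). fx h + deriv (f a0) w0 * k)) (at (a0, w0))"
proof -
  from openE[OF \<open>open S\<close> p] obtain R where R: "R > 0" "ball (a0, w0) R \<subseteq> S" by blast
  define \<rho> where "\<rho> = R / 3"
  have \<rho>: "\<rho> > 0" using R by (simp add: \<rho>_def)
  define X where "X = ball a0 \<rho>"
  define Y where "Y = ball w0 \<rho>"
  have sub: "X \<times> Y \<subseteq> S"
  proof
    fix q assume q: "q \<in> X \<times> Y"
    obtain a w where aw: "q = (a, w)" by (cases q)
    have "dist (a0, w0) q \<le> dist a0 a + dist w0 w"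
      unfolding aw dist_prod_def by (simp add: sqrt_sum_squares_le_sum)
    also have "\<dots> < R" using q aw R by (auto simp: \<rho>_def X_def Y_def)
    finally show "q \<in> S" using R by auto
  qed
  define fy where "fy = (\<lambda>a w. blinfun_mult_right (deriv (f a) w))"
  have "((\<lambda>(a, w). f a w) has_derivative (\<lambda>(tx, ty). fx tx + fy a0 w0 ty)) (at (a0, w0) within X \<times> Y)"
  proof (rule has_derivative_partialsI)
    show "((\<lambda>a. f a w0) has_derivative fx) (at a0 within X)" using fx by (rule has_derivative_at_withinI)
  next
    fix a w assume "a \<in> X" "w \<in> Y"
    then have aw: "(a, w) \<in> S" using sub by auto
    have "open {w. (a, w) \<in> S}"
      using open_vimage[OF \<open>open S\<close>, of "\<lambda>w. (a, w)"] by (simp add: vimage_def continuous_on_Pair)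
    then have "(f a has_field_derivative deriv (f a) w) (at w)"
      using hol[of a] aw by (intro holomorphic_derivI) auto
    then have "(f a has_derivative blinfun_apply (fy a w)) (at w)"
      unfolding fy_def has_field_derivative_def by (simp add: blinfun_mult_right.rep_eq)
    then show "((\<lambda>w. f a w) has_derivative blinfun_apply (fy a w)) (at w within Y)"
      by (rule has_derivative_at_withinI)
  next
    have "continuous_on S (\<lambda>(a, w). deriv (f a) w)" by (rule continuous_on_deriv_param[OF assms(1-3)])
    then have "continuous_on (X \<times> Y) (\<lambda>p. deriv (f (fst p)) (snd p))"
      using sub continuous_on_subset by (auto simp: case_prod_unfold)
    then have "continuous_on (X \<times> Y) (\<lambda>p. blinfun_mult_right (deriv (f (fst p)) (snd p)))"
      by (intro bounded_linear.continuous_on[OF bounded_linear_blinfun_mult_right])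
    then show "continuous (at (a0, w0) within X \<times> Y) (\<lambda>(x, y). fy x y)"
      unfolding fy_def case_prod_unfold continuous_on_eq_continuous_within
      using \<rho> by (simp add: X_def Y_def)
  qed (use \<rho> in \<open>auto simp: Y_def\<close>)
  moreover have "at (a0, w0) within X \<times> Y = at (a0, w0)"
    by (rule at_within_open) (use \<rho> in \<open>auto simp: X_def Y_def open_Times\<close>)
  ultimately show ?thesis
    by (simp add: fy_def blinfun_mult_right.rep_eq)
qed

text \<open>Joint continuity with separate holomorphy is stable under products, ray integrals and
  locally uniform limits, and it is the input of Osgood's lemma. Two variables suffice for the
  coefficients, as these do not involve \<open>c\<close>.\<close>

definition hol2 :: "complex set \<Rightarrow> complex set \<Rightarrow> (complex \<Rightarrow> complex \<Rightarrow> complex) \<Rightarrow> bool" where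
  "hol2 A S g \<longleftrightarrow> continuous_on (A \<times> S) (\<lambda>(\<sigma>, x). g \<sigma> x)
     \<and> (\<forall>\<sigma>\<in>A. g \<sigma> holomorphic_on S) \<and> (\<forall>x\<in>S. (\<lambda>\<sigma>. g \<sigma> x) holomorphic_on A)"

text \<open>Osgood's lemma. The open set is arbitrary because the domain of the solution is cut out
  by inequalities coupling all three variables and is not a product.\<close>

lemma osgood3:
  assumes "open S" and cont: "continuous_on S (\<lambda>(c, \<sigma>, x). f c \<sigma> x)"
    and hc: "\<And>\<sigma> x. (\<lambda>c. f c \<sigma> x) holomorphic_on {c. (c, \<sigma>, x) \<in> S}"
    and h\<sigma>: "\<And>c x. (\<lambda>\<sigma>. f c \<sigma> x) holomorphic_on {\<sigma>. (c, \<sigma>, x) \<in> S}"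
    and hx: "\<And>c \<sigma>. (\<lambda>x. f c \<sigma> x) holomorphic_on {x. (c, \<sigma>, x) \<in> S}"
  shows "holomorphic3_on (\<lambda>(c, \<sigma>, x). f c \<sigma> x) S"
  unfolding holomorphic3_on_def
proof
  fix p assume "p \<in> S"
  obtain c \<sigma> x where p: "p = (c, \<sigma>, x)" by (cases p)
  define S2 where "S2 = {(c', \<sigma>'). (c', \<sigma>', x) \<in> S}"
  define S3 where "S3 = {((c', \<sigma>'), x'). (c', \<sigma>', x') \<in> S}"
  have o2: "open S2"
    using open_vimage[OF \<open>open S\<close>, of "\<lambda>q. (fst q, snd q, x)"]
    by (simp add: S2_def vimage_def case_prod_unfold continuous_on_Pair continuous_on_fst continuous_on_snd)
  have o3: "open S3"
    using open_vimage[OF \<open>open S\<close>, of "\<lambda>q. (fst (fst q), snd (fst q), snd q)"]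
    by (simp add: S3_def vimage_def case_prod_unfold continuous_on_Pair continuous_on_fst continuous_on_snd)
  have oc: "open {c. (c, \<sigma>, x) \<in> S}"
    using open_vimage[OF \<open>open S\<close>, of "\<lambda>c. (c, \<sigma>, x)"]
    by (simp add:  vimage_def case_prod_unfold continuous_on_Pair continuous_on_fst continuous_on_snd)
  define \<alpha> where "\<alpha> = deriv (\<lambda>c. f c \<sigma> x) c"
  define \<beta> where "\<beta> = deriv (\<lambda>\<sigma>. f c \<sigma> x) \<sigma>"
  define \<gamma> where "\<gamma> = deriv (\<lambda>x. f c \<sigma> x) x"
  have "((\<lambda>c. f c \<sigma> x) has_field_derivative \<alpha>) (at c)"
    unfolding \<alpha>_def using hc oc \<open>p \<in> S\<close> p by (intro holomorphic_derivI) auto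
  then have d1: "((\<lambda>c. f c \<sigma> x) has_derivative (\<lambda>h. \<alpha> * h)) (at c)"
    by (simp add: has_field_derivative_def)
  have d2: "((\<lambda>(c, \<sigma>). f c \<sigma> x) has_derivative (\<lambda>(h, k). \<alpha> * h + \<beta> * k)) (at (c, \<sigma>))"
    unfolding \<beta>_def
  proof (rule osgood_step[where f = "\<lambda>c \<sigma>. f c \<sigma> x", OF o2])
    have "continuous_on S2 ((\<lambda>(c, \<sigma>, x). f c \<sigma> x) \<circ> (\<lambda>q. (fst q, snd q, x)))"
      by (intro continuous_on_compose continuous_intros continuous_on_subset[OF cont]) (auto simp: S2_def)
    then show "continuous_on S2 (\<lambda>(c, \<sigma>). f c \<sigma> x)" by (simp add: comp_def case_prod_unfold)
  qed (use d1 h\<sigma> \<open>p \<in> S\<close> p in \<open>auto simp: S2_def\<close>)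
  have d3: "((\<lambda>(q, x). f (fst q) (snd q) x) has_derivative
       (\<lambda>(h, k). (\<lambda>(h, k). \<alpha> * h + \<beta> * k) h + deriv (f (fst (c, \<sigma>)) (snd (c, \<sigma>))) x * k)) (at ((c, \<sigma>), x))"
  proof (rule osgood_step[OF o3])
    have "continuous_on S3 ((\<lambda>(c, \<sigma>, x). f c \<sigma> x) \<circ> (\<lambda>q. (fst (fst q), snd (fst q), snd q)))"
      by (intro continuous_on_compose continuous_intros continuous_on_subset[OF cont]) (auto simp: S3_def)
    then show "continuous_on S3 (\<lambda>(q, x). f (fst q) (snd q) x)" by (simp add: comp_def case_prod_unfold)
    show "f (fst a) (snd a) holomorphic_on {w. (a, w) \<in> S3}" for a
      using hx[of "fst a" "snd a"] by (cases a) (auto simp: S3_def)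
  qed (use d2 \<open>p \<in> S\<close> p in \<open>auto simp: S3_def case_prod_unfold\<close>)
  have "((\<lambda>p. ((fst p, fst (snd p)), snd (snd p))) has_derivative (\<lambda>p. ((fst p, fst (snd p)), snd (snd p)))) (at (c, \<sigma>, x))"
    by (auto intro!: derivative_eq_intros)
  from has_derivative_compose[OF this,
      of "\<lambda>p. f (fst (fst p)) (snd (fst p)) (snd p)"
         "\<lambda>p. \<alpha> * fst (fst p) + \<beta> * snd (fst p) + \<gamma> * snd p"] d3
  have "((\<lambda>(c, \<sigma>, x). f c \<sigma> x) has_derivative (\<lambda>(h, k, l). \<alpha> * h + \<beta> * k + \<gamma> * l)) (at (c, \<sigma>, x))"
    by (simp add: case_prod_unfold \<gamma>_def)
  then show "\<exists>\<alpha> \<beta> \<gamma>. ((\<lambda>(c, \<sigma>, x). f c \<sigma> x) has_derivative (\<lambda>(h, k, l). \<alpha> * h + \<beta> * k + \<gamma> * l)) (at p within S)"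
    unfolding p by (blast intro: has_derivative_at_withinI)
qed

lemma hol2_cong:
  assumes "hol2 A S g" and eq: "\<And>\<sigma> x. \<sigma> \<in> A \<Longrightarrow> x \<in> S \<Longrightarrow> f \<sigma> x = g \<sigma> x"
  shows "hol2 A S f"
proof -
  have "continuous_on (A \<times> S) (\<lambda>(\<sigma>, x). f \<sigma> x) = continuous_on (A \<times> S) (\<lambda>(\<sigma>, x). g \<sigma> x)"
    by (rule continuous_on_cong) (auto simp: eq)
  moreover have "f \<sigma> holomorphic_on S \<longleftrightarrow> g \<sigma> holomorphic_on S" if "\<sigma> \<in> A" for \<sigma>
    by (rule holomorphic_cong) (use eq that in auto)
  moreover have "(\<lambda>\<sigma>. f \<sigma> x) holomorphic_on A \<longleftrightarrow> (\<lambda>\<sigma>. g \<sigma> x) holomorphic_on A" if "x \<in> S" for x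
    by (rule holomorphic_cong) (use eq that in auto)
  ultimately show ?thesis using assms(1) by (simp add: hol2_def)
qed

lemma hol2_param: assumes "f holomorphic_on A" shows "hol2 A S (\<lambda>\<sigma> x. f \<sigma>)"
proof -
  have "continuous_on (A \<times> S) (\<lambda>p. f (fst p))"
    by (rule continuous_on_compose2[OF holomorphic_on_imp_continuous_on[OF assms] continuous_on_fst]) auto
  then show ?thesis using assms by (simp add: hol2_def case_prod_unfold)
qed

lemma hol2_var: assumes "f holomorphic_on S" shows "hol2 A S (\<lambda>\<sigma> x. f x)"
proof -
  have "continuous_on (A \<times> S) (\<lambda>p. f (snd p))"
    by (rule continuous_on_compose2[OF holomorphic_on_imp_continuous_on[OF assms] continuous_on_snd]) auto
  then show ?thesis using assms by (simp add: hol2_def case_prod_unfold)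
qed

lemma hol2_const: "hol2 A S (\<lambda>\<sigma> x. c)"
  by (rule hol2_param) (rule holomorphic_on_const)

lemma hol2_add: "hol2 A S f \<Longrightarrow> hol2 A S g \<Longrightarrow> hol2 A S (\<lambda>\<sigma> x. f \<sigma> x + g \<sigma> x)"
  and hol2_mult: "hol2 A S f \<Longrightarrow> hol2 A S g \<Longrightarrow> hol2 A S (\<lambda>\<sigma> x. f \<sigma> x * g \<sigma> x)"
  and hol2_minus: "hol2 A S f \<Longrightarrow> hol2 A S (\<lambda>\<sigma> x. - f \<sigma> x)"
  and hol2_exp: "hol2 A S f \<Longrightarrow> hol2 A S (\<lambda>\<sigma> x. exp (f \<sigma> x))"
  unfolding hol2_def case_prod_unfold
  by (simp_all add: continuous_on_add continuous_on_mult continuous_on_minus continuous_on_exp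
      holomorphic_on_add holomorphic_on_mult holomorphic_on_minus holomorphic_on_exp')

lemma hol2_inverse:
  "hol2 A S f \<Longrightarrow> (\<And>\<sigma> x. \<sigma> \<in> A \<Longrightarrow> x \<in> S \<Longrightarrow> f \<sigma> x \<noteq> 0) \<Longrightarrow> hol2 A S (\<lambda>\<sigma> x. inverse (f \<sigma> x))"
  unfolding hol2_def case_prod_unfold
  by (simp add: continuous_on_inverse holomorphic_on_inverse mem_Times_iff)

lemma hol2_sum: "(\<And>i. i \<in> I \<Longrightarrow> hol2 A S (f i)) \<Longrightarrow> hol2 A S (\<lambda>\<sigma> x. \<Sum>i\<in>I. f i \<sigma> x)"
  by (induction I rule: infinite_finite_induct) (auto intro!: hol2_const hol2_add)

lemma hol2_power: "hol2 A S f \<Longrightarrow> hol2 A S (\<lambda>\<sigma> x. f \<sigma> x ^ n)"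
  by (induction n) (auto intro!: hol2_const hol2_mult)

section \<open>Locally uniform limits\<close>

lemma continuous_on_locally:
  fixes f :: "'a::t2_space \<Rightarrow> 'b::topological_space"
  assumes "\<And>p. p \<in> X \<Longrightarrow> \<exists>U. open U \<and> p \<in> U \<and> continuous_on U f"
  shows "continuous_on X f"
proof (intro continuous_at_imp_continuous_on ballI)
  fix p assume "p \<in> X"
  then obtain U where "open U" "p \<in> U" "continuous_on U f" using assms by blast
  then show "isCont f p" by (simp add: continuous_on_eq_continuous_at)
qed

lemma holomorphic_local_uniform_limit:
  fixes F :: "nat \<Rightarrow> complex \<Rightarrow> complex"
  assumes "open X" and hol: "\<And>n. F n holomorphic_on X"
    and lim: "\<And>z. z \<in> X \<Longrightarrow> \<exists>U. open U \<and> z \<in> U \<and> uniform_limit U F G sequentially"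
  shows "G holomorphic_on X"
proof (rule holomorphic_uniform_sequence[OF \<open>open X\<close> hol])
  fix z assume "z \<in> X"
  then obtain U where U: "open U" "z \<in> U" "uniform_limit U F G sequentially" using lim by blast
  have "open (U \<inter> X)" "z \<in> U \<inter> X" using U \<open>z \<in> X\<close> \<open>open X\<close> by auto
  then obtain d where "d > 0" "cball z d \<subseteq> U \<inter> X" using open_contains_cball by blast
  then show "\<exists>d>0. cball z d \<subseteq> X \<and> uniform_limit (cball z d) F G sequentially"
    using uniform_limit_on_subset[OF U(3), of "cball z d"] by blast
qed

text \<open>Weierstrass' theorem. The neighbourhoods are products, so that the uniform limit
  restricts to the slices in either variable.\<close>

lemma hol2_local_uniform_limit:
  fixes F :: "nat \<Rightarrow> complex \<Rightarrow> complex \<Rightarrow> complex"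
  assumes "open A" "open S" and hol: "\<And>n. hol2 A S (F n)"
    and lim: "\<And>\<sigma> x. \<sigma> \<in> A \<Longrightarrow> x \<in> S \<Longrightarrow> \<exists>U V. open U \<and> \<sigma> \<in> U \<and> U \<subseteq> A \<and> open V \<and> x \<in> V \<and> V \<subseteq> S \<and>
            uniform_limit (U \<times> V) (\<lambda>n (\<sigma>, x). F n \<sigma> x) (\<lambda>(\<sigma>, x). G \<sigma> x) sequentially"
  shows "hol2 A S G"
  unfolding hol2_def
proof (intro conjI ballI)
  show "continuous_on (A \<times> S) (\<lambda>(\<sigma>, x). G \<sigma> x)"
  proof (rule continuous_on_locally)
    fix p assume "p \<in> A \<times> S"
    then obtain \<sigma> x where p: "p = (\<sigma>, x)" "\<sigma> \<in> A" "x \<in> S" by auto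
    from lim[OF p(2,3)] obtain U V where UV: "open U" "\<sigma> \<in> U" "U \<subseteq> A" "open V" "x \<in> V" "V \<subseteq> S"
      "uniform_limit (U \<times> V) (\<lambda>n (\<sigma>, x). F n \<sigma> x) (\<lambda>(\<sigma>, x). G \<sigma> x) sequentially" by blast
    have "continuous_on (U \<times> V) (\<lambda>(\<sigma>, x). G \<sigma> x)"
    proof (rule uniform_limit_theorem[OF _ UV(7)])
      have "continuous_on (A \<times> S) (\<lambda>(\<sigma>, x). F n \<sigma> x)" for n using hol[of n] by (simp add: hol2_def)
      then have "continuous_on (U \<times> V) (\<lambda>(\<sigma>, x). F n \<sigma> x)" for n
        by (rule continuous_on_subset) (use UV in auto)
      then show "\<forall>\<^sub>F n in sequentially. continuous_on (U \<times> V) (\<lambda>(\<sigma>, x). F n \<sigma> x)" by simp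
    qed simp
    then show "\<exists>U. open U \<and> p \<in> U \<and> continuous_on U (\<lambda>(\<sigma>, x). G \<sigma> x)"
      using UV p by (intro exI[of _ "U \<times> V"]) (auto simp: open_Times)
  qed
next
  fix \<sigma> assume \<sigma>: "\<sigma> \<in> A"
  show "G \<sigma> holomorphic_on S"
  proof (rule holomorphic_local_uniform_limit[OF \<open>open S\<close>, of "\<lambda>n. F n \<sigma>"])
    show "F n \<sigma> holomorphic_on S" for n using hol \<sigma> by (auto simp: hol2_def)
    fix x assume "x \<in> S"
    from lim[OF \<sigma> this] obtain U V where UV: "open U" "\<sigma> \<in> U" "open V" "x \<in> V"
      "uniform_limit (U \<times> V) (\<lambda>n (\<sigma>, x). F n \<sigma> x) (\<lambda>(\<sigma>, x). G \<sigma> x) sequentially" by blast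
    have "uniform_limit V (\<lambda>n. F n \<sigma>) (G \<sigma>) sequentially"
      using uniform_limit_compose'[OF UV(5), of "\<lambda>x. (\<sigma>, x)" V] UV by auto
    with UV show "\<exists>U. open U \<and> x \<in> U \<and> uniform_limit U (\<lambda>n. F n \<sigma>) (G \<sigma>) sequentially" by blast
  qed
next
  fix x assume x: "x \<in> S"
  show "(\<lambda>\<sigma>. G \<sigma> x) holomorphic_on A"
  proof (rule holomorphic_local_uniform_limit[OF \<open>open A\<close>, of "\<lambda>n \<sigma>. F n \<sigma> x"])
    show "(\<lambda>\<sigma>. F n \<sigma> x) holomorphic_on A" for n using hol x by (auto simp: hol2_def)
    fix \<sigma> assume "\<sigma> \<in> A"
    from lim[OF this x] obtain U V where UV: "open U" "\<sigma> \<in> U" "open V" "x \<in> V"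
      "uniform_limit (U \<times> V) (\<lambda>n (\<sigma>, x). F n \<sigma> x) (\<lambda>(\<sigma>, x). G \<sigma> x) sequentially" by blast
    have "uniform_limit U (\<lambda>n \<sigma>. F n \<sigma> x) (\<lambda>\<sigma>. G \<sigma> x) sequentially"
      using uniform_limit_compose'[OF UV(5), of "\<lambda>\<sigma>. (\<sigma>, x)" U] UV by auto
    with UV show "\<exists>U. open U \<and> \<sigma> \<in> U \<and> uniform_limit U (\<lambda>n \<sigma>. F n \<sigma> x) (\<lambda>\<sigma>. G \<sigma> x) sequentially" by blast
  qed
qed

subsection \<open>Asymptotic expansions\<close>

text \<open>Real exponents accommodate remainders of order \<open>x^(p - J)\<close> with
  \<open>J > p\<close>.\<close>

definition bigO_on :: "complex set \<Rightarrow> real \<Rightarrow> (complex \<Rightarrow> complex) \<Rightarrow> bool" where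
  "bigO_on S q h \<longleftrightarrow> (\<exists>M \<rho>. \<forall>x\<in>S. \<rho> \<le> norm x \<longrightarrow> norm (h x) \<le> M * norm x powr q)"

text \<open>A Poincare expansion that may start at a positive power, since coefficients of the
  double series grow like \<open>x^(min m n)\<close>. As \<open>f 0\<close> may vanish,
  \<open>p\<close> is only an upper bound for the order.\<close>

definition asy :: "complex set \<Rightarrow> nat \<Rightarrow> (complex \<Rightarrow> complex) \<Rightarrow> (nat \<Rightarrow> complex) \<Rightarrow> bool" where
  "asy S p g f \<longleftrightarrow>
     (\<forall>J. bigO_on S (real p - real J) (\<lambda>x. g x - x ^ p * (\<Sum>j<J. f j * inverse x ^ j)))"

text \<open>Away from the unit disc, powers of \<open>norm x\<close> are monotone in the exponent,
  so different orders can be compared.\<close>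

locale far_set =
  fixes S :: "complex set"
  assumes far: "x \<in> S \<Longrightarrow> 1 \<le> norm x"
begin

lemma bigO_on_cong: "bigO_on S q g \<Longrightarrow> (\<And>x. x \<in> S \<Longrightarrow> f x = g x) \<Longrightarrow> bigO_on S q f"
  unfolding bigO_on_def by metis

lemma bigO_onI: "(\<And>x. x \<in> S \<Longrightarrow> norm (h x) \<le> M * norm x powr q) \<Longrightarrow> bigO_on S q h"
  unfolding bigO_on_def by blast

lemma bigO_onE:
  assumes "bigO_on S q h"
  obtains M \<rho> where "0 \<le> M" "\<And>x. x \<in> S \<Longrightarrow> \<rho> \<le> norm x \<Longrightarrow> norm (h x) \<le> M * norm x powr q"
proof -
  obtain M \<rho> where *: "\<And>x. x \<in> S \<Longrightarrow> \<rho> \<le> norm x \<Longrightarrow> norm (h x) \<le> M * norm x powr q"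
    using assms unfolding bigO_on_def by blast
  have "norm (h x) \<le> \<bar>M\<bar> * norm x powr q" if "x \<in> S" "\<rho> \<le> norm x" for x
    using *[OF that] by (rule order_trans) (intro mult_right_mono, auto)
  then show thesis using that[of "\<bar>M\<bar>" \<rho>] by auto
qed

lemma bigO_on_mono:
  assumes "bigO_on S q h" "q \<le> q'" shows "bigO_on S q' h"
proof -
  obtain M \<rho> where M: "0 \<le> M" "\<And>x. x \<in> S \<Longrightarrow> \<rho> \<le> norm x \<Longrightarrow> norm (h x) \<le> M * norm x powr q"
    using bigO_onE[OF assms(1)] by blast
  have "norm (h x) \<le> M * norm x powr q'" if "x \<in> S" "\<rho> \<le> norm x" for x
    using M(2)[OF that] by (rule order_trans) (intro mult_left_mono powr_mono assms far M that)
  then show ?thesis unfolding bigO_on_def by blast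
qed

lemma bigO_on_add:
  assumes "bigO_on S q g" "bigO_on S q h" shows "bigO_on S q (\<lambda>x. g x + h x)"
proof -
  obtain M1 \<rho>1 where 1: "\<And>x. x \<in> S \<Longrightarrow> \<rho>1 \<le> norm x \<Longrightarrow> norm (g x) \<le> M1 * norm x powr q"
    using bigO_onE[OF assms(1)] by blast
  obtain M2 \<rho>2 where 2: "\<And>x. x \<in> S \<Longrightarrow> \<rho>2 \<le> norm x \<Longrightarrow> norm (h x) \<le> M2 * norm x powr q"
    using bigO_onE[OF assms(2)] by blast
  have "norm (g x + h x) \<le> (M1 + M2) * norm x powr q" if "x \<in> S" "max \<rho>1 \<rho>2 \<le> norm x" for x
    using 1[OF that(1)] 2[OF that(1)] that norm_triangle_ineq[of "g x" "h x"] by (simp add: distrib_right)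
  then show ?thesis unfolding bigO_on_def by blast
qed

lemma bigO_on_mult:
  assumes "bigO_on S q g" "bigO_on S q' h" shows "bigO_on S (q + q') (\<lambda>x. g x * h x)"
proof -
  obtain M1 \<rho>1 where 1: "0 \<le> M1" "\<And>x. x \<in> S \<Longrightarrow> \<rho>1 \<le> norm x \<Longrightarrow> norm (g x) \<le> M1 * norm x powr q"
    using bigO_onE[OF assms(1)] by blast
  obtain M2 \<rho>2 where 2: "0 \<le> M2" "\<And>x. x \<in> S \<Longrightarrow> \<rho>2 \<le> norm x \<Longrightarrow> norm (h x) \<le> M2 * norm x powr q'"
    using bigO_onE[OF assms(2)] by blast
  have "norm (g x * h x) \<le> (M1 * M2) * norm x powr (q + q')" if "x \<in> S" "max \<rho>1 \<rho>2 \<le> norm x" for x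
  proof -
    have "norm (g x) * norm (h x) \<le> (M1 * norm x powr q) * (M2 * norm x powr q')"
      using 1 2 that by (intro mult_mono) auto
    then show ?thesis by (simp add: norm_mult powr_add algebra_simps)
  qed
  then show ?thesis unfolding bigO_on_def by blast
qed

lemma bigO_on_const: "bigO_on S 0 (\<lambda>x. c)"
  by (rule bigO_onI[of _ "norm c"]) (use far in force)

lemma bigO_on_power: "bigO_on S (real n) (\<lambda>x. x ^ n)"
proof (rule bigO_onI[of _ 1])
  fix x assume "x \<in> S"
  then have "0 < norm x" using far by force
  then show "norm (x ^ n) \<le> 1 * norm x powr real n" by (simp add: norm_power powr_realpow)
qed

lemma bigO_on_inverse_power: "bigO_on S (- real n) (\<lambda>x. inverse x ^ n)"
proof (rule bigO_onI[of _ 1])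
  fix x assume "x \<in> S"
  then have "0 < norm x" using far by force
  then show "norm (inverse x ^ n) \<le> 1 * norm x powr - real n"
    by (simp add: norm_power norm_inverse powr_minus powr_realpow power_inverse)
qed

lemma bigO_on_zero: "bigO_on S q (\<lambda>x. 0)"
  by (rule bigO_onI[of _ 0]) auto

lemma bigO_on_sum: "(\<And>i. i \<in> I \<Longrightarrow> bigO_on S q (h i)) \<Longrightarrow> bigO_on S q (\<lambda>x. \<Sum>i\<in>I. h i x)"
  by (induction I rule: infinite_finite_induct) (auto intro: bigO_on_zero bigO_on_add)

lemma bigO_on_term: "real p - real j \<le> q \<Longrightarrow> bigO_on S q (\<lambda>x. c * (x ^ p * inverse x ^ j))"
  by (rule bigO_on_mono[OF bigO_on_mult[OF bigO_on_const bigO_on_mult[OF bigO_on_power bigO_on_inverse_power]]])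
    simp

lemma asyD: "asy S p g f \<Longrightarrow> bigO_on S (real p - real J) (\<lambda>x. g x - x ^ p * (\<Sum>j<J. f j * inverse x ^ j))"
  by (simp add: asy_def)

lemma asy_bigO: "asy S p g f \<Longrightarrow> bigO_on S (real p) g"
  using asyD[of p g f 0] by simp

lemma asy_zero: "asy S p (\<lambda>x. 0) (\<lambda>j. 0)"
  by (simp add: asy_def bigO_on_zero)

lemma asy_const: "asy S 0 (\<lambda>x. c) (\<lambda>j. if j = 0 then c else 0)"
  unfolding asy_def
proof
  fix J show "bigO_on S (real 0 - real J) (\<lambda>x. c - x ^ 0 * (\<Sum>j<J. (if j = 0 then c else 0) * inverse x ^ j))"
    by (cases J) (simp_all add: bigO_on_const bigO_on_zero lessThan_Suc_eq_insert_0 sum.reindex)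
qed

lemma asy_add:
  assumes "asy S p g f" "asy S p h e" shows "asy S p (\<lambda>x. g x + h x) (\<lambda>j. f j + e j)"
  unfolding asy_def
proof
  fix J show "bigO_on S (real p - real J) (\<lambda>x. g x + h x - x ^ p * (\<Sum>j<J. (f j + e j) * inverse x ^ j))"
    using bigO_on_add[OF asyD[OF assms(1), of J] asyD[OF assms(2), of J]]
    by (simp add: algebra_simps sum.distrib)
qed

text \<open>With \<open>g_J\<close> the truncation of \<open>g\<close>, the error is
  \<open>(g - g_J) h\<close> plus the terms of \<open>g_J\<close> times remainders of
  \<open>h\<close>. Cutting \<open>h\<close> after \<open>J - i\<close> terms against the
  \<open>i\<close>-th term of \<open>g\<close> makes the retained products exactly the Cauchy
  product below order \<open>J\<close>.\<close>

lemma asy_mult: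
  assumes g: "asy S p g f" and h: "asy S q h e"
  shows "asy S (p + q) (\<lambda>x. g x * h x) (\<lambda>j. \<Sum>i\<le>j. f i * e (j - i))"
  unfolding asy_def
proof
  fix J
  have tri: "(\<Sum>j<J. (\<Sum>i\<le>j. f i * e (j - i)) * t ^ j)
      = (\<Sum>i<J. f i * t ^ i * (\<Sum>l<J - i. e l * t ^ l))" for t :: complex
  proof -
    have "(\<Sum>j<J. (\<Sum>i\<le>j. f i * e (j - i)) * t ^ j) = (\<Sum>j<J. \<Sum>i\<le>j. (f i * t ^ i) * (e (j - i) * t ^ (j - i)))"
      unfolding sum_distrib_right
      by (intro sum.cong refl) (simp add: mult_ac flip: power_add)
    also have "\<dots> = (\<Sum>(i, l)\<in>{(i, l). i + l < J}. (f i * t ^ i) * (e l * t ^ l))"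
      using sum.triangle_reindex[of "\<lambda>i l. (f i * t ^ i) * (e l * t ^ l)" J] by simp
    also have "{(i, l). i + l < J} = (SIGMA i:{..<J}. {..<J - i})" by auto
    also have "(\<Sum>(i, l)\<in>(SIGMA i:{..<J}. {..<J - i}). (f i * t ^ i) * (e l * t ^ l))
        = (\<Sum>i<J. f i * t ^ i * (\<Sum>l<J - i. e l * t ^ l))"
      by (subst sum.Sigma[symmetric]) (auto simp: sum_distrib_left)
    finally show ?thesis .
  qed
  let ?E = "\<lambda>i x. h x - x ^ q * (\<Sum>l<J - i. e l * inverse x ^ l)"
  have 1: "bigO_on S (real (p + q) - real J) (\<lambda>x. (g x - x ^ p * (\<Sum>i<J. f i * inverse x ^ i)) * h x)"
    by (rule bigO_on_mono[OF bigO_on_mult[OF asyD[OF g] asy_bigO[OF h]]]) auto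
  have 2: "bigO_on S (real (p + q) - real J) (\<lambda>x. \<Sum>i<J. f i * (x ^ p * inverse x ^ i) * ?E i x)"
  proof (rule bigO_on_sum)
    fix i assume "i \<in> {..<J}"
    then show "bigO_on S (real (p + q) - real J) (\<lambda>x. f i * (x ^ p * inverse x ^ i) * ?E i x)"
      by (intro bigO_on_mono[OF bigO_on_mult[OF bigO_on_term[OF order_refl] asyD[OF h]]])
        (auto simp: of_nat_diff)
  qed
  show "bigO_on S (real (p + q) - real J)
     (\<lambda>x. g x * h x - x ^ (p + q) * (\<Sum>j<J. (\<Sum>i\<le>j. f i * e (j - i)) * inverse x ^ j))"
  proof (rule bigO_on_cong[OF bigO_on_add[OF 1 2]])
    fix x assume "x \<in> S"
    show "g x * h x - x ^ (p + q) * (\<Sum>j<J. (\<Sum>i\<le>j. f i * e (j - i)) * inverse x ^ j)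
      = (g x - x ^ p * (\<Sum>i<J. f i * inverse x ^ i)) * h x
        + (\<Sum>i<J. f i * (x ^ p * inverse x ^ i) * ?E i x)"
      unfolding tri by (simp add: algebra_simps sum_subtractf sum_distrib_left sum_distrib_right power_add)
  qed
qed

text \<open>Brings expansions with different leading powers to a common one, so that they can be
  added.\<close>

lemma asy_raise:
  assumes "asy S p g f" shows "asy S (p + d) g (\<lambda>j. if j < d then 0 else f (j - d))"
  unfolding asy_def
proof
  fix J
  have eq: "x ^ (p + d) * (\<Sum>j<J. (if j < d then 0 else f (j - d)) * inverse x ^ j)
      = x ^ p * (\<Sum>j<J - d. f j * inverse x ^ j)" if "x \<in> S" for x
  proof -
    have x: "x \<noteq> 0" using far[OF that] by auto
    have "(\<Sum>j<J. (if j < d then 0 else f (j - d)) * inverse x ^ j) = (\<Sum>j\<in>{d..<J}. f (j - d) * inverse x ^ j)"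
      by (intro sum.mono_neutral_cong_right) auto
    also have "\<dots> = (\<Sum>j<J - d. f j * inverse x ^ (j + d))"
      by (intro sum.reindex_bij_witness[of _ "\<lambda>j. j + d" "\<lambda>j. j - d"]) auto
    finally have "x ^ (p + d) * (\<Sum>j<J. (if j < d then 0 else f (j - d)) * inverse x ^ j)
        = x ^ p * (\<Sum>j<J - d. f j * (x ^ d * inverse x ^ (j + d)))"
      by (simp add: power_add sum_distrib_left mult_ac)
    moreover have "x ^ d * inverse x ^ (j + d) = inverse x ^ j" for j
      using x by (simp add: power_add field_simps)
    ultimately show ?thesis by simp
  qed
  show "bigO_on S (real (p + d) - real J)
     (\<lambda>x. g x - x ^ (p + d) * (\<Sum>j<J. (if j < d then 0 else f (j - d)) * inverse x ^ j))"
    by (rule bigO_on_cong[OF bigO_on_mono[OF asyD[OF assms, of "J - d"]]]) (auto simp: eq)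
qed

lemma asy_divide_x:
  assumes "asy S (Suc p) g f" shows "asy S p (\<lambda>x. g x / x) f"
  unfolding asy_def
proof
  fix J
  show "bigO_on S (real p - real J) (\<lambda>x. g x / x - x ^ p * (\<Sum>j<J. f j * inverse x ^ j))"
  proof (rule bigO_on_cong)
    show "bigO_on S (real p - real J) (\<lambda>x. (g x - x ^ Suc p * (\<Sum>j<J. f j * inverse x ^ j)) * inverse x ^ 1)"
      by (rule bigO_on_mono[OF bigO_on_mult[OF asyD[OF assms] bigO_on_inverse_power]]) simp
    fix x assume "x \<in> S"
    then have "x \<noteq> 0" using far by force
    then show "g x / x - x ^ p * (\<Sum>j<J. f j * inverse x ^ j)
        = (g x - x ^ Suc p * (\<Sum>j<J. f j * inverse x ^ j)) * inverse x ^ 1"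
      by (simp add: field_simps)
  qed
qed

lemma asy_tendsto:
  assumes "asy S 0 g f" shows "(g \<longlongrightarrow> f 0) (inf at_infinity (principal S))"
proof -
  have "bigO_on S (- 1) (\<lambda>x. g x - f 0)" using asyD[OF assms, of 1] by simp
  then obtain M \<rho> where M: "\<And>x. x \<in> S \<Longrightarrow> \<rho> \<le> norm x \<Longrightarrow> norm (g x - f 0) \<le> M * norm x powr - 1"
    using bigO_onE by blast
  have "((\<lambda>x::complex. M * norm x powr - 1) \<longlongrightarrow> M * 0) at_infinity"
    by (intro tendsto_intros tendsto_neg_powr filterlim_at_infinity_imp_norm_at_top filterlim_ident) auto
  then have "((\<lambda>x::complex. M * norm x powr - 1) \<longlongrightarrow> 0) (inf at_infinity (principal S))"
    by (simp add: tendsto_mono[OF inf_le1])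
  moreover have "\<forall>\<^sub>F x in inf at_infinity (principal S). norm (g x - f 0) \<le> M * norm x powr - 1"
    unfolding eventually_inf_principal eventually_at_infinity using M by blast
  ultimately have "((\<lambda>x. g x - f 0) \<longlongrightarrow> 0) (inf at_infinity (principal S))"
    by (rule Lim_null_comparison[rotated])
  then show ?thesis by (simp add: LIM_zero_iff)
qed

text \<open>The product of \<open>g\<close> with the truncated formal inverse is
  \<open>1 + O(x^(-J))\<close> by \<open>asy_mult\<close>; multiplying by
  \<open>inverse (g x)\<close>, which is bounded by 2, transfers this error to the inverse.\<close>

lemma asy_inverse:
  assumes g: "asy S 0 g f" and f0: "f 0 = 1" and low: "\<And>x. x \<in> S \<Longrightarrow> 1/2 \<le> norm (g x)"
  shows "asy S 0 (\<lambda>x. inverse (g x)) (fps_nth (inverse (Abs_fps f)))"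
  unfolding asy_def
proof
  fix J
  define e where "e = fps_nth (inverse (Abs_fps f))"
  \<comment> \<open>Padded with zeros, the truncated inverse is an expansion in its own right, so
    \<open>asy_mult\<close> applies to it.\<close>
  define eJ where "eJ j = (if j < J then e j else 0)" for j
  define E where "E x = (\<Sum>j<J. e j * inverse x ^ j)" for x
  have E: "asy S 0 E eJ"
    unfolding asy_def
  proof
    fix K
    have "bigO_on S (- real K) (\<lambda>x. (\<Sum>j\<in>{..<J} - {..<K}. e j * (x ^ 0 * inverse x ^ j)))"
      by (intro bigO_on_sum bigO_on_term) auto
    moreover have "(\<Sum>j\<in>{..<J} - {..<K}. e j * (x ^ 0 * inverse x ^ j))
        = E x - x ^ 0 * (\<Sum>j<K. eJ j * inverse x ^ j)" for x
    proof -
      have "(\<Sum>j<K. eJ j * inverse x ^ j) = (\<Sum>j\<in>{..<J} \<inter> {..<K}. e j * inverse x ^ j)"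
        by (intro sum.mono_neutral_cong_right) (auto simp: eJ_def)
      moreover have "E x = (\<Sum>j\<in>{..<J} \<inter> {..<K}. e j * inverse x ^ j) + (\<Sum>j\<in>{..<J} - {..<K}. e j * inverse x ^ j)"
        unfolding E_def by (rule sum.Int_Diff) auto
      ultimately show ?thesis by simp
    qed
    ultimately show "bigO_on S (real 0 - real K) (\<lambda>x. E x - x ^ 0 * (\<Sum>j<K. eJ j * inverse x ^ j))" by simp
  qed
  have id: "(\<Sum>i\<le>j. f i * eJ (j - i)) = (if j = 0 then 1 else 0)" if "j < J" for j
  proof -
    have "(\<Sum>i\<le>j. f i * eJ (j - i)) = (\<Sum>i=0..j. f i * e (j - i))"
      using that by (intro sum.cong) (auto simp: eJ_def)
    also have "\<dots> = fps_nth (Abs_fps f * inverse (Abs_fps f)) j"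
      by (simp add: fps_mult_nth e_def)
    also have "Abs_fps f * inverse (Abs_fps f) = 1"
      using f0 by (metis fps_nth_Abs_fps inverse_mult_eq_1' zero_neq_one)
    finally show ?thesis by simp
  qed
  have sum1: "(\<Sum>j<J. (\<Sum>i\<le>j. f i * eJ (j - i)) * inverse x ^ j) = (if J = 0 then 0 else 1)" for x
  proof -
    have "(\<Sum>j<J. (\<Sum>i\<le>j. f i * eJ (j - i)) * inverse x ^ j) = (\<Sum>j<J. if j = 0 then 1 else 0)"
      by (intro sum.cong) (auto simp: id)
    then show ?thesis by (simp add: sum.delta')
  qed
  have *: "bigO_on S (- real J) (\<lambda>x. g x * E x - 1)"
  proof (cases "J = 0")
    case True
    then have "E x = 0" for x by (simp add: E_def)
    then show ?thesis using True bigO_on_const[of "-1"] by simp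
  next
    case False
    then show ?thesis using asyD[OF asy_mult[OF g E], of J] by (simp add: sum1)
  qed
  have inv: "bigO_on S 0 (\<lambda>x. - inverse (g x))"
  proof (rule bigO_onI[of _ 2])
    fix x assume x: "x \<in> S"
    have "norm (inverse (g x)) \<le> inverse (1/2)"
      unfolding norm_inverse using low[OF x] by (intro le_imp_inverse_le) auto
    then show "norm (- inverse (g x)) \<le> 2 * norm x powr 0" using far[OF x] by force
  qed
  show "bigO_on S (real 0 - real J)
      (\<lambda>x. inverse (g x) - x ^ 0 * (\<Sum>j<J. fps_nth (inverse (Abs_fps f)) j * inverse x ^ j))"
  proof (rule bigO_on_cong)
    show "bigO_on S (real 0 - real J) (\<lambda>x. (g x * E x - 1) * (- inverse (g x)))"
      using bigO_on_mult[OF * inv] by simp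
    fix x assume "x \<in> S"
    then have "g x \<noteq> 0" using low by force
    then show "inverse (g x) - x ^ 0 * (\<Sum>j<J. fps_nth (inverse (Abs_fps f)) j * inverse x ^ j)
       = (g x * E x - 1) * (- inverse (g x))"
      by (simp add: E_def e_def field_simps)
  qed
qed

text \<open>Splitting off the constant term shifts indices by one: \<open>N\<close> terms here
  correspond to \<open>Suc N\<close> terms of the full expansion.\<close>

lemma asy_imp_asymp_inv_series:
  assumes "asy S 0 g f"
  shows "asymp_inv_series S (\<lambda>x. g x - f 0) (\<lambda>j. f (Suc j))"
  unfolding asymp_inv_series_def
proof
  fix N
  obtain M \<rho> where M: "\<And>x. x \<in> S \<Longrightarrow> \<rho> \<le> norm x \<Longrightarrow>
      norm (g x - x ^ 0 * (\<Sum>j<Suc N. f j * inverse x ^ j)) \<le> M * norm x powr (real 0 - real (Suc N))"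
    using bigO_onE[OF asyD[OF assms, of "Suc N"]] by metis
  have "norm (g x - f 0 - inverse x * (\<Sum>j<N. f (Suc j) * inverse x ^ j)) \<le> M * norm (inverse x ^ (N + 1))"
    if "x \<in> S" "\<rho> \<le> norm x" for x
  proof -
    have "(\<Sum>j<Suc N. f j * inverse x ^ j) = f 0 + inverse x * (\<Sum>j<N. f (Suc j) * inverse x ^ j)"
      by (subst sum.lessThan_Suc_shift) (simp add: sum_distrib_left mult_ac)
    moreover have "norm x powr (- real (Suc N)) = norm (inverse x ^ (N + 1))"
    proof -
      have "0 < norm x" using far[OF that(1)] by linarith
      then show ?thesis by (simp add: powr_minus norm_power norm_inverse power_inverse powr_realpow
          del: of_nat_Suc power_Suc)
    qed
    ultimately show ?thesis using M[OF that] by (simp add: algebra_simps)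
  qed
  then show "(\<lambda>x. g x - f 0 - inverse x * (\<Sum>j<N. f (Suc j) * inverse x ^ j))
       \<in> O[inf at_infinity (principal S)](\<lambda>x. inverse x ^ (N + 1))"
    by (intro bigoI[of _ M]) (auto simp: eventually_inf_principal eventually_at_infinity)
qed

end

subsection \<open>Integrals along rays\<close>

lemma continuous_on_imp_integrable_dominated:
  fixes h :: "real \<Rightarrow> complex"
  assumes cont: "continuous_on {a..} h" and g: "g integrable_on {a..}"
    and le: "\<And>s. a \<le> s \<Longrightarrow> norm (h s) \<le> g s"
  shows "h integrable_on {a..}"
proof (rule integrable_on_all_intervals_integrable_bound[OF _ _ g])
  fix c d :: real
  have "h integrable_on {max a c..d}"
    by (rule integrable_continuous_interval) (rule continuous_on_subset[OF cont], auto)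
  moreover have "{a..} \<inter> cbox c d = {max a c..d}" by auto
  ultimately show "(\<lambda>x. if x \<in> {a..} then h x else 0) integrable_on cbox c d"
    by (subst integrable_restrict_Int) simp
qed (use le in auto)

lemma integral_tail_bound:
  fixes h :: "real \<Rightarrow> complex"
  assumes cont: "continuous_on {0..} h" and g: "g integrable_on {0..}"
    and le: "\<And>s. 0 \<le> s \<Longrightarrow> norm (h s) \<le> D * g s" and n: "0 \<le> n"
  shows "norm (integral {0..} h - integral {0..n} h) \<le> D * (integral {0..} g - integral {0..n} g)"
proof -
  have tail: "(f has_integral (integral {0..} f - integral {0..n} f)) {n<..}"
    if f: "f integrable_on {0..}" for f :: "real \<Rightarrow> 'b::banach"
  proof -
    have "f integrable_on {0..n}"
      using integrable_on_subinterval[OF f, of 0 n] by simp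
    then have "(f has_integral (integral {0..} f - integral {0..n} f)) ({0..} - {0..n})"
      by (intro has_integral_setdiff integrable_integral f) auto
    moreover have "{0..} - {0..n} = {n<..}" using n by auto
    ultimately show ?thesis by simp
  qed
  have Dg: "(\<lambda>s. D * g s) integrable_on {0..}" by (rule integrable_on_mult_right[OF g])
  have h: "h integrable_on {0..}"
    by (rule continuous_on_imp_integrable_dominated[OF cont Dg le])
  have "norm (integral {n<..} h) \<le> integral {n<..} (\<lambda>s. D * g s)"
    by (rule integral_norm_bound_integral)
      (use n le tail[OF h] tail[OF Dg] in \<open>auto simp: integrable_on_def\<close>)
  moreover have "integral {0..n} (\<lambda>s. D * g s) = D * integral {0..n} g" by simp
  moreover have "integral {0..} (\<lambda>s. D * g s) = D * integral {0..} g" by simp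
  ultimately show ?thesis
    using integral_unique[OF tail[OF h]] integral_unique[OF tail[OF Dg]] by (simp add: right_diff_distrib)
qed

text \<open>Differentiation under the integral sign needs both partial derivatives to be jointly
  continuous.\<close>

lemma hol2_swap_deriv:
  assumes "open A" "open S" "hol2 A S h"
  shows "continuous_on (A \<times> S) (\<lambda>(\<sigma>, x). deriv (h \<sigma>) x)"
    and "continuous_on (A \<times> S) (\<lambda>(\<sigma>, x). deriv (\<lambda>\<sigma>. h \<sigma> x) \<sigma>)"
proof -
  have o: "open (A \<times> S)" "open (S \<times> A)" using assms by (auto simp: open_Times)
  define h1 where "h1 = (\<lambda>\<sigma> x. if \<sigma> \<in> A then h \<sigma> x else 0)"
  have "continuous_on (A \<times> S) (\<lambda>(\<sigma>, x). deriv (h1 \<sigma>) x)"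
  proof (rule continuous_on_deriv_param[OF o(1)])
    show "continuous_on (A \<times> S) (\<lambda>(\<sigma>, x). h1 \<sigma> x)"
      using assms(3) unfolding hol2_def by (auto simp: h1_def elim!: continuous_on_eq)
    show "h1 a holomorphic_on {w. (a, w) \<in> A \<times> S}" for a
      using assms(3) by (cases "a \<in> A") (auto simp: h1_def hol2_def)
  qed
  then show "continuous_on (A \<times> S) (\<lambda>(\<sigma>, x). deriv (h \<sigma>) x)"
    by (rule continuous_on_eq) (auto simp: h1_def)
  define h2 where "h2 = (\<lambda>x \<sigma>. if x \<in> S then h \<sigma> x else 0)"
  have "continuous_on (S \<times> A) (\<lambda>(x, \<sigma>). deriv (h2 x) \<sigma>)"
  proof (rule continuous_on_deriv_param[OF o(2)])
    have "continuous_on (S \<times> A) ((\<lambda>(\<sigma>, x). h \<sigma> x) \<circ> prod.swap)"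
      by (rule continuous_on_compose[OF continuous_on_swap continuous_on_subset])
        (use assms(3) in \<open>auto simp: hol2_def\<close>)
    then show "continuous_on (S \<times> A) (\<lambda>(x, \<sigma>). h2 x \<sigma>)"
      by (rule continuous_on_eq) (auto simp: h2_def)
    show "h2 a holomorphic_on {w. (a, w) \<in> S \<times> A}" for a
      using assms(3) by (cases "a \<in> S") (auto simp: h2_def hol2_def)
  qed
  then have "continuous_on (A \<times> S) ((\<lambda>(x, \<sigma>). deriv (h2 x) \<sigma>) \<circ> prod.swap)"
    by (intro continuous_on_compose[OF continuous_on_swap continuous_on_subset]) auto
  then show "continuous_on (A \<times> S) (\<lambda>(\<sigma>, x). deriv (\<lambda>\<sigma>. h \<sigma> x) \<sigma>)"
    by (rule continuous_on_eq) (auto simp: h2_def)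
qed

text \<open>Differentiation under the integral over a finite piece of the ray; the infinite ray is
  reached by the locally uniform limit in \<open>hol2_RayI\<close>.\<close>

lemma hol2_ray_integral:
  assumes "open A" "open S" and h: "hol2 A S h" and n: "0 \<le> (n::real)"
    and ray: "\<And>x s. x \<in> S \<Longrightarrow> 0 \<le> s \<Longrightarrow> x + of_real s * \<omega> \<in> S"
  shows "hol2 A S (\<lambda>\<sigma> x. integral {0..n} (\<lambda>s. h \<sigma> (x + of_real s * \<omega>)))"
proof -
  have cont: "continuous_on ((A \<times> S) \<times> cbox 0 n) (\<lambda>(p, s). g (fst p) (snd p + of_real s * \<omega>))"
    if "continuous_on (A \<times> S) (\<lambda>(\<sigma>, x). g \<sigma> x)" for g :: "complex \<Rightarrow> complex \<Rightarrow> complex"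
  proof -
    have "continuous_on ((A \<times> S) \<times> cbox 0 n)
        (\<lambda>q. (\<lambda>(\<sigma>, x). g \<sigma> x) (fst (fst q), snd (fst q) + of_real (snd q) * \<omega>))"
    proof (rule continuous_on_compose2[OF that])
      show "continuous_on ((A \<times> S) \<times> cbox 0 n) (\<lambda>q. (fst (fst q), snd (fst q) + of_real (snd q) * \<omega>))"
        by (intro continuous_intros)
    qed (use ray in auto)
    then show ?thesis by (simp add: case_prod_unfold)
  qed
  have hc: "continuous_on (A \<times> S) (\<lambda>(\<sigma>, x). h \<sigma> x)"
    and hx: "\<And>\<sigma>. \<sigma> \<in> A \<Longrightarrow> h \<sigma> holomorphic_on S"
    and h\<sigma>: "\<And>x. x \<in> S \<Longrightarrow> (\<lambda>\<sigma>. h \<sigma> x) holomorphic_on A"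
    using h by (auto simp: hol2_def)
  have int: "(\<lambda>s. h \<sigma> (x + of_real s * \<omega>)) integrable_on cbox 0 n" if "\<sigma> \<in> A" "x \<in> S" for \<sigma> x
  proof (rule integrable_continuous)
    show "continuous_on (cbox 0 n) (\<lambda>s. h \<sigma> (x + of_real s * \<omega>))"
    proof (rule continuous_on_compose2[OF holomorphic_on_imp_continuous_on[OF hx[OF that(1)]]])
      show "continuous_on (cbox 0 n) (\<lambda>s. x + of_real s * \<omega>)" by (intro continuous_intros)
    qed (use ray that in auto)
  qed
  show ?thesis
    unfolding hol2_def
  proof (intro conjI ballI)
    show "continuous_on (A \<times> S) (\<lambda>(\<sigma>, x). integral {0..n} (\<lambda>s. h \<sigma> (x + of_real s * \<omega>)))"
      using integral_continuous_on_param[OF cont[OF hc]] by (simp add: case_prod_unfold)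
  next
    fix \<sigma> assume \<sigma>: "\<sigma> \<in> A"
    show "(\<lambda>x. integral {0..n} (\<lambda>s. h \<sigma> (x + of_real s * \<omega>))) holomorphic_on S"
      unfolding holomorphic_on_def
    proof
      fix x assume "x \<in> S"
      then obtain d where d: "d > 0" "ball x d \<subseteq> S" using \<open>open S\<close> openE by blast
      have "(\<lambda>x. integral (cbox 0 n) (\<lambda>s. h \<sigma> (x + of_real s * \<omega>))) holomorphic_on ball x d"
      proof (rule leibniz_rule_holomorphic[where fx = "\<lambda>x s. deriv (h \<sigma>) (x + of_real s * \<omega>)"])
        fix y s assume ys: "y \<in> ball x d" "s \<in> cbox 0 n"
        have "y + of_real s * \<omega> \<in> S" using ys d by (intro ray) auto
        then have "(h \<sigma> has_field_derivative deriv (h \<sigma>) (y + of_real s * \<omega>)) (at (y + of_real s * \<omega>))"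
          by (rule holomorphic_derivI[OF hx[OF \<sigma>] \<open>open S\<close>])
        then have "((\<lambda>y. h \<sigma> (y + of_real s * \<omega>)) has_field_derivative deriv (h \<sigma>) (y + of_real s * \<omega>)) (at y)"
          by (rule DERIV_shift[THEN iffD1])
        then show "((\<lambda>y. h \<sigma> (y + of_real s * \<omega>)) has_field_derivative deriv (h \<sigma>) (y + of_real s * \<omega>))
            (at y within ball x d)" by (rule has_field_derivative_at_within)
      next
        fix y assume "y \<in> ball x d"
        then show "(\<lambda>s. h \<sigma> (y + of_real s * \<omega>)) integrable_on cbox 0 n"
          by (intro int[OF \<sigma>]) (use d in blast)
      next
        have "continuous_on (ball x d \<times> cbox 0 n)
           (\<lambda>q. (\<lambda>(p, s). deriv (h (fst p)) (snd p + of_real s * \<omega>)) ((\<sigma>, fst q), snd q))"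
        proof (rule continuous_on_compose2[OF cont[OF hol2_swap_deriv(1)[OF \<open>open A\<close> \<open>open S\<close> h]]])
          show "continuous_on (ball x d \<times> cbox 0 n) (\<lambda>q. ((\<sigma>, fst q), snd q))" by (intro continuous_intros)
          show "(\<lambda>q. ((\<sigma>, fst q), snd q)) ` (ball x d \<times> cbox 0 n) \<subseteq> (A \<times> S) \<times> cbox 0 n"
            using subsetD[OF d(2)] \<sigma> by (intro image_subsetI) (simp add: mem_Times_iff)
        qed
        then show "continuous_on (ball x d \<times> cbox 0 n) (\<lambda>(x, s). deriv (h \<sigma>) (x + of_real s * \<omega>))"
          by (simp add: case_prod_unfold)
      qed simp
      then show "(\<lambda>x. integral {0..n} (\<lambda>s. h \<sigma> (x + of_real s * \<omega>))) field_differentiable at x within S"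
        using d holomorphic_on_imp_differentiable_at[of _ "ball x d"]
        by (simp add: field_differentiable_at_within)
    qed
  next
    fix x assume x: "x \<in> S"
    show "(\<lambda>\<sigma>. integral {0..n} (\<lambda>s. h \<sigma> (x + of_real s * \<omega>))) holomorphic_on A"
      unfolding holomorphic_on_def
    proof
      fix \<sigma> assume "\<sigma> \<in> A"
      then obtain d where d: "d > 0" "ball \<sigma> d \<subseteq> A" using \<open>open A\<close> openE by blast
      have "(\<lambda>\<sigma>. integral (cbox 0 n) (\<lambda>s. h \<sigma> (x + of_real s * \<omega>))) holomorphic_on ball \<sigma> d"
      proof (rule leibniz_rule_holomorphic[where fx = "\<lambda>\<sigma> s. deriv (\<lambda>\<sigma>. h \<sigma> (x + of_real s * \<omega>)) \<sigma>"])
        fix y s assume ys: "y \<in> ball \<sigma> d" "s \<in> cbox 0 n"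
        have "x + of_real s * \<omega> \<in> S" "y \<in> A" using ys d x by (auto intro: ray)
        then have "((\<lambda>\<sigma>. h \<sigma> (x + of_real s * \<omega>)) has_field_derivative deriv (\<lambda>\<sigma>. h \<sigma> (x + of_real s * \<omega>)) y) (at y)"
          by (intro holomorphic_derivI[OF h\<sigma> \<open>open A\<close>])
        then show "((\<lambda>\<sigma>. h \<sigma> (x + of_real s * \<omega>)) has_field_derivative deriv (\<lambda>\<sigma>. h \<sigma> (x + of_real s * \<omega>)) y)
            (at y within ball \<sigma> d)" by (rule has_field_derivative_at_within)
      next
        fix y assume "y \<in> ball \<sigma> d"
        then show "(\<lambda>s. h y (x + of_real s * \<omega>)) integrable_on cbox 0 n"
          by (intro int[OF _ x]) (use d in blast)
      next
        have "continuous_on (ball \<sigma> d \<times> cbox 0 n)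
           (\<lambda>q. (\<lambda>(p, s). (\<lambda>\<sigma> x. deriv (\<lambda>\<sigma>. h \<sigma> x) \<sigma>) (fst p) (snd p + of_real s * \<omega>)) ((fst q, x), snd q))"
        proof (rule continuous_on_compose2[OF cont[OF hol2_swap_deriv(2)[OF \<open>open A\<close> \<open>open S\<close> h]]])
          show "continuous_on (ball \<sigma> d \<times> cbox 0 n) (\<lambda>q. ((fst q, x), snd q))" by (intro continuous_intros)
          show "(\<lambda>q. ((fst q, x), snd q)) ` (ball \<sigma> d \<times> cbox 0 n) \<subseteq> (A \<times> S) \<times> cbox 0 n"
            using subsetD[OF d(2)] x by (intro image_subsetI) (simp add: mem_Times_iff)
        qed
        then show "continuous_on (ball \<sigma> d \<times> cbox 0 n) (\<lambda>(\<sigma>, s). deriv (\<lambda>\<sigma>. h \<sigma> (x + of_real s * \<omega>)) \<sigma>)"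
          by (simp add: case_prod_unfold)
      qed simp
      then show "(\<lambda>\<sigma>. integral {0..n} (\<lambda>s. h \<sigma> (x + of_real s * \<omega>))) field_differentiable at \<sigma> within A"
        using d holomorphic_on_imp_differentiable_at[of _ "ball \<sigma> d"]
        by (simp add: field_differentiable_at_within)
    qed
  qed
qed

subsection \<open>The sector\<close>

text \<open>Replaces the condition on \<open>Arg\<close> by the convex cone
  \<open>sin \<delta> * norm x < Im x\<close>, in which estimates along rays are elementary.\<close>

lemma sector_iff:
  assumes "0 < \<delta>" "\<delta> < pi / 2" "0 \<le> r"
  shows "x \<in> sector \<delta> r \<longleftrightarrow> sin \<delta> * norm x < Im x \<and> r < norm x"
proof (cases "x = 0")
  case False
  then have n: "norm x > 0" by simp
  have Im: "Im x = norm x * sin (Arg x)"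
    using False by (metis Im_rcis rcis_cmod_Arg)
  have A: "- pi < Arg x" "Arg x \<le> pi" using Arg_bounded[of x] by auto
  have "\<bar>Arg x - pi / 2\<bar> < pi / 2 - \<delta> \<longleftrightarrow> sin \<delta> < sin (Arg x)"
  proof
    assume "\<bar>Arg x - pi / 2\<bar> < pi / 2 - \<delta>"
    then have B: "\<delta> < Arg x" "Arg x < pi - \<delta>" by linarith+
    show "sin \<delta> < sin (Arg x)"
    proof (cases "Arg x \<le> pi / 2")
      case True
      then show ?thesis using B assms by (intro sin_monotone_2pi) auto
    next
      case False
      then have "sin \<delta> < sin (pi - Arg x)" using B assms by (intro sin_monotone_2pi) auto
      then show ?thesis by simp
    qed
  next
    assume s: "sin \<delta> < sin (Arg x)"
    have "0 < sin \<delta>" using assms by (intro sin_gt_zero) auto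
    then have pos: "0 < sin (Arg x)" using s by simp
    then have "0 < Arg x" using A sin_ge_zero[of "- Arg x"] by (cases "Arg x \<le> 0") auto
    have "\<delta> < Arg x"
    proof (rule ccontr)
      assume "\<not> \<delta> < Arg x"
      then have "sin (Arg x) \<le> sin \<delta>" using \<open>0 < Arg x\<close> assms by (intro sin_monotone_2pi_le) auto
      then show False using s by simp
    qed
    moreover have "Arg x < pi - \<delta>"
    proof (rule ccontr)
      assume "\<not> Arg x < pi - \<delta>"
      then have "sin (pi - Arg x) \<le> sin \<delta>" using A assms by (intro sin_monotone_2pi_le) auto
      then show False using s by simp
    qed
    ultimately show "\<bar>Arg x - pi / 2\<bar> < pi / 2 - \<delta>" by linarith
  qed
  then show ?thesis using False n by (simp add: sector_def Im mult.commute)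
qed (use assms in \<open>simp add: sector_def\<close>)

definition slope :: "real \<Rightarrow> real" where "slope \<delta> = sin \<delta> * cos \<delta>"

text \<open>Along this direction \<open>|exp (k t)|\<close> decreases for \<open>k \<noteq> 0\<close>, and a ray starting in the sector stays
  in it; the slope is chosen such that moreover \<open>|t|\<close> does not decrease on the ray.\<close>

definition dir :: "real \<Rightarrow> int \<Rightarrow> complex" where
  "dir \<delta> k = Complex (- slope \<delta> * of_int (sgn k)) 1"

text \<open>The bound by \<open>sin \<delta>\<close> makes \<open>norm\<close> grow along the rays
  and the last inequality keeps the rays in the cone; the bound by \<open>1/2\<close> serves
  numerical constants such as \<open>8 \<le> 4 / slope \<delta>\<close>.\<close>

lemma slope_bounds:
  assumes "0 < \<delta>" "\<delta> < pi / 2"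
  shows "0 < sin \<delta>" "0 < slope \<delta>" "slope \<delta> \<le> sin \<delta>" "slope \<delta> \<le> 1 / 2"
    "(sin \<delta>)\<^sup>2 * (1 + (slope \<delta>)\<^sup>2) \<le> 1"
proof -
  have s: "0 < sin \<delta>" "0 < cos \<delta>" using assms by (auto intro: sin_gt_zero cos_gt_zero)
  then show "0 < sin \<delta>" "0 < slope \<delta>" by (auto simp: slope_def)
  show "slope \<delta> \<le> sin \<delta>" using s unfolding slope_def by (simp add: mult_le_cancel_left1)
  have "0 \<le> (sin \<delta> - cos \<delta>)\<^sup>2" by simp
  also have "\<dots> = 1 - 2 * slope \<delta>" unfolding slope_def power2_diff by (simp add: sin_squared_eq)
  finally show "slope \<delta> \<le> 1 / 2" by simp
  have "(slope \<delta>)\<^sup>2 \<le> (cos \<delta>)\<^sup>2"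
    using s unfolding slope_def by (intro power_mono) (auto simp: mult_le_cancel_right1)
  then have "(sin \<delta>)\<^sup>2 * (slope \<delta>)\<^sup>2 \<le> 1 * (cos \<delta>)\<^sup>2"
    by (intro mult_mono) (auto simp: abs_square_le_1)
  then show "(sin \<delta>)\<^sup>2 * (1 + (slope \<delta>)\<^sup>2) \<le> 1"
    using sin_cos_squared_add[of \<delta>] unfolding distrib_left by linarith
qed

lemma norm_dir_le: "0 < \<delta> \<Longrightarrow> \<delta> < pi / 2 \<Longrightarrow> norm (dir \<delta> k) \<le> 2"
  using cmod_le[of "dir \<delta> k"] slope_bounds[of \<delta>] by (auto simp: dir_def sgn_if)

lemma dir_nonzero: "dir \<delta> k \<noteq> 0"
  by (simp add: dir_def complex_eq_iff)

lemma norm_dir_sq: "(norm (dir \<delta> k))\<^sup>2 = 1 + (slope \<delta> * of_int (sgn k))\<^sup>2"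
  by (simp add: cmod_power2 dir_def)

text \<open>Along the ray \<open>Im\<close> grows at rate 1, whereas
  \<open>sin \<delta> * norm\<close> grows at most at rate
  \<open>sin \<delta> * norm (dir \<delta> k) \<le> 1\<close>; this preserves the cone. In the
  expansion of the squared norm the mixed term is nonnegative because
  \<open>slope \<delta> * \<bar>Re x\<bar> \<le> Im x\<close> in the sector. The quadratic lower
  bound is what makes the integrals for \<open>k = 0\<close> converge.\<close>

lemma sector_ray:
  assumes \<delta>: "0 < \<delta>" "\<delta> < pi / 2" "0 \<le> r" and x: "x \<in> sector \<delta> r" and s: "0 \<le> s"
  shows "x + of_real s * dir \<delta> k \<in> sector \<delta> r" (is ?in)
    and "(norm x)\<^sup>2 + s\<^sup>2 \<le> (norm (x + of_real s * dir \<delta> k))\<^sup>2" (is ?sq)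
    and "norm x \<le> norm (x + of_real s * dir \<delta> k)" (is ?ge)
proof -
  note sl = slope_bounds[OF \<delta>(1,2)]
  define t where "t = x + of_real s * dir \<delta> k"
  define e where "e = real_of_int (sgn k)"
  have e: "\<bar>e\<bar> \<le> 1" "e\<^sup>2 \<le> 1" by (auto simp: e_def sgn_if)
  have x': "sin \<delta> * norm x < Im x" "r < norm x" using x by (auto simp: sector_iff[OF \<delta>])
  have "\<bar>Re x * (- slope \<delta> * e)\<bar> \<le> norm x * (sin \<delta> * 1)"
    unfolding abs_mult using sl e abs_Re_le_cmod[of x] by (intro mult_mono) auto
  then have pos: "0 \<le> Re x * (- slope \<delta> * e) + Im x" using x' by (simp add: mult.commute)
  have "(norm t)\<^sup>2 = (norm x)\<^sup>2 + 2 * s * (Re x * (- slope \<delta> * e) + Im x) + s\<^sup>2 * (1 + (slope \<delta> * e)\<^sup>2)"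
    unfolding t_def cmod_power2 dir_def e_def by (simp add: power2_eq_square algebra_simps)
  moreover have "s\<^sup>2 * 1 \<le> s\<^sup>2 * (1 + (slope \<delta> * e)\<^sup>2)" by (intro mult_left_mono) auto
  moreover have "0 \<le> 2 * s * (Re x * (- slope \<delta> * e) + Im x)" using pos s by simp
  ultimately show sq: ?sq unfolding t_def by linarith
  then have "(norm x)\<^sup>2 \<le> (norm (x + of_real s * dir \<delta> k))\<^sup>2"
    using zero_le_power2[of s] by linarith
  then show ge: ?ge by (rule power2_le_imp_le) simp
  have "(sin \<delta> * norm (dir \<delta> k))\<^sup>2 \<le> 1"
  proof -
    have "(sin \<delta> * norm (dir \<delta> k))\<^sup>2 = (sin \<delta>)\<^sup>2 * (1 + (slope \<delta>)\<^sup>2 * e\<^sup>2)"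
      by (simp add: power_mult_distrib norm_dir_sq e_def)
    also have "\<dots> \<le> (sin \<delta>)\<^sup>2 * (1 + (slope \<delta>)\<^sup>2 * 1)"
      using e by (intro mult_left_mono add_left_mono) auto
    finally show ?thesis using sl(5) by simp
  qed
  then have "sin \<delta> * norm (dir \<delta> k) \<le> 1" by (simp add: abs_square_le_1)
  then have "s * (sin \<delta> * norm (dir \<delta> k)) \<le> s * 1" using s by (intro mult_left_mono) auto
  moreover have "norm t \<le> norm x + s * norm (dir \<delta> k)"
    unfolding t_def using norm_triangle_ineq[of x "of_real s * dir \<delta> k"] s by (simp add: norm_mult)
  then have "sin \<delta> * norm t \<le> sin \<delta> * (norm x + s * norm (dir \<delta> k))" using sl by (intro mult_left_mono) auto
  moreover have "Im t = Im x + s" by (simp add: t_def dir_def)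
  ultimately have "sin \<delta> * norm t < Im t" using x' by (simp add: distrib_left mult_ac)
  then show ?in using x' ge by (simp add: sector_iff[OF \<delta>] t_def)
qed

lemma open_sector:
  assumes "0 < \<delta>" "\<delta> < pi / 2" "0 \<le> r" shows "open (sector \<delta> r)"
proof -
  have "sector \<delta> r = {x. sin \<delta> * norm x < Im x} \<inter> {x. r < norm x}"
    using sector_iff[OF assms] by auto
  then show ?thesis by (simp add: open_Int open_Collect_less continuous_intros)
qed

subsection \<open>Bounded solutions of the linear equations\<close>

text \<open>The dominating function for \<open>k = 0\<close>. It is normalized so that its integral
  does not depend on the starting distance \<open>X\<close>.\<close>

lemma has_integral_inverse_square_shift:
  assumes "0 < (X::real)"
  shows "((\<lambda>s. 2 * X / (X + s)\<^sup>2) has_integral 2) {0..}"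
proof (rule has_integral_to_inf)
  have *: "((\<lambda>s. 2 * X / (X + s)\<^sup>2) has_integral (- 2 * X / (X + y) - (- 2 * X / (X + 0)))) {0..y}"
    if "y \<ge> 0" for y
  proof (rule fundamental_theorem_of_calculus[OF that])
    fix s assume s: "s \<in> {0..y}"
    have "((\<lambda>s. - 2 * X / (X + s)) has_real_derivative 2 * X / (X + s)\<^sup>2) (at s within {0..y})"
      using s assms by (auto intro!: derivative_eq_intros simp: power2_eq_square)
    then show "((\<lambda>s. - 2 * X / (X + s)) has_vector_derivative 2 * X / (X + s)\<^sup>2) (at s within {0..y})"
      by (simp add: has_real_derivative_iff_has_vector_derivative)
  qed
  show "(\<lambda>s. 2 * X / (X + s)\<^sup>2) integrable_on {0..y}" for y
    using * by (cases "y \<ge> 0") (auto simp: integrable_on_def)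
  have "\<forall>\<^sub>F y in at_top. integral {0..y} (\<lambda>s. 2 * X / (X + s)\<^sup>2) = - 2 * X / (X + y) + 2"
    using eventually_ge_at_top[of "0::real"]
    by eventually_elim (use assms in \<open>simp add: integral_unique[OF *]\<close>)
  moreover have "((\<lambda>y. - 2 * X / (X + y) + 2) \<longlongrightarrow> 2) at_top" by real_asymp
  ultimately show "((\<lambda>y. integral {0..y} (\<lambda>s. 2 * X / (X + s)\<^sup>2)) \<longlongrightarrow> 2) at_top"
    by (simp add: filterlim_cong)
qed (use assms in auto)

text \<open>The bound \<open>4 * Smax \<le> slope \<delta> * r\<close> lets half of the exponential
  decay along a ray absorb the factor \<open>x^(k \<sigma>)\<close>, for all \<sigma> and
  \<open>k\<close> at once.\<close>

locale far_sector =
  fixes \<delta> r Smax :: real and A :: "complex set"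
  assumes \<delta>: "0 < \<delta>" "\<delta> < pi / 2" and r: "1 \<le> r" and open_A: "open A"
    and Smax: "\<And>\<sigma>. \<sigma> \<in> A \<Longrightarrow> norm \<sigma> \<le> Smax" and r_large: "4 * Smax \<le> slope \<delta> * r"
begin

abbreviation "S \<equiv> sector \<delta> r"

lemma r0: "0 \<le> r" using r by simp

lemmas slope = slope_bounds[OF \<delta>]
lemmas S_iff = sector_iff[OF \<delta> r0]
lemmas ray_in = sector_ray(1)[OF \<delta> r0]
lemmas ray_sq = sector_ray(2)[OF \<delta> r0]
lemmas ray_ge = sector_ray(3)[OF \<delta> r0]
lemmas open_S = open_sector[OF \<delta> r0]
lemmas dir_le = norm_dir_le[OF \<delta>]

sublocale far_set S
  by unfold_locales (use r in \<open>auto simp: S_iff\<close>)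

lemma S_pos: "x \<in> S \<Longrightarrow> 0 < norm x" "x \<in> S \<Longrightarrow> x \<noteq> 0"
  using far[of x] by auto

lemma S_notin_nonpos: "x \<in> S \<Longrightarrow> x \<notin> \<real>\<^sub>\<le>\<^sub>0"
  using slope(1) S_pos[of x] by (auto simp: S_iff complex_nonpos_Reals_iff zero_less_mult_iff not_less)
    (smt (verit) mult_nonneg_nonneg norm_ge_zero)

text \<open>For \<open>k = 0\<close> the operator \<open>Sol\<close> below gains no exponential decay, and a right-hand side of order
  \<open>x^(q-1)\<close> is needed to get a solution of order \<open>x^q\<close>.\<close>

definition kap :: "int \<Rightarrow> real" where "kap k = (if k = 0 then 1 else 0)"

definition Ef :: "int \<Rightarrow> nat \<Rightarrow> complex \<Rightarrow> complex \<Rightarrow> complex" where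
  "Ef k N \<sigma> x = exp (of_int k * (x + \<sigma> * Ln x)) / x ^ N"

text \<open>Dominates the integrand on the ray relative to its size at the starting point. For
  \<open>k\<close> nonzero half of the decay rate is left, the other half being spent on
  \<open>x^(k \<sigma>)\<close>.\<close>

definition dom :: "int \<Rightarrow> real \<Rightarrow> real \<Rightarrow> real" where
  "dom k X s = (if k = 0 then 2 * X / (X + s)\<^sup>2 else exp (- (slope \<delta> / 2) * s))"

definition RayI :: "int \<Rightarrow> nat \<Rightarrow> complex \<Rightarrow> (complex \<Rightarrow> complex) \<Rightarrow> complex \<Rightarrow> complex" where
  "RayI k N \<sigma> f x = integral {0..} (\<lambda>s. Ef k N \<sigma> (x + of_real s * dir \<delta> k) * f (x + of_real s * dir \<delta> k))"

text \<open>\<open>Ef\<close> is an integrating factor of \<open>g' + (k (1 + \<sigma>/x) - N/x) g = f\<close>, and \<open>Sol\<close> is the solution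
  obtained by integrating from infinity.\<close>

definition Sol :: "int \<Rightarrow> nat \<Rightarrow> complex \<Rightarrow> (complex \<Rightarrow> complex) \<Rightarrow> complex \<Rightarrow> complex" where
  "Sol k N \<sigma> f x = - dir \<delta> k * RayI k N \<sigma> f x / Ef k N \<sigma> x"

lemma Ef_nonzero: "x \<in> S \<Longrightarrow> Ef k N \<sigma> x \<noteq> 0"
  using S_pos[of x] by (simp add: Ef_def)

lemma Ef_deriv:
  assumes "x \<in> S"
  shows "(Ef k N \<sigma> has_field_derivative (of_int k * (1 + \<sigma> / x) - of_nat N / x) * Ef k N \<sigma> x) (at x)"
proof -
  have "((\<lambda>x. exp (of_int k * (x + \<sigma> * Ln x)) * inverse x ^ N) has_field_derivative
      (exp (of_int k * (x + \<sigma> * Ln x)) * (of_int k * (1 + \<sigma> * inverse x))) * inverse x ^ N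
       + (of_nat N * (inverse x ^ (N - 1) * (- (inverse x * inverse x)))) * exp (of_int k * (x + \<sigma> * Ln x))) (at x)"
    using S_pos[OF assms] S_notin_nonpos[OF assms]
    by (auto intro!: derivative_eq_intros simp: power2_eq_square)
  moreover have "of_nat N * (inverse x ^ (N - 1) * (- (inverse x * inverse x))) = - of_nat N * inverse x * inverse x ^ N"
    by (cases N) (simp_all add: mult_ac del: of_nat_Suc)
  ultimately have "((\<lambda>x. exp (of_int k * (x + \<sigma> * Ln x)) * inverse x ^ N) has_field_derivative
      exp (of_int k * (x + \<sigma> * Ln x)) * (of_int k * (1 + \<sigma> * inverse x)) * inverse x ^ N
       + (- of_nat N * inverse x * inverse x ^ N) * exp (of_int k * (x + \<sigma> * Ln x))) (at x)"
    by (simp only:)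
  moreover have "Ef k N \<sigma> = (\<lambda>x. exp (of_int k * (x + \<sigma> * Ln x)) * inverse x ^ N)"
    by (simp add: Ef_def fun_eq_iff divide_inverse power_inverse)
  ultimately show ?thesis
    by (simp add: algebra_simps divide_inverse)
qed

lemma hol2_Ef: "hol2 A S (Ef k N)"
proof -
  have "hol2 A S (\<lambda>\<sigma> x. exp (of_int k * (x + \<sigma> * Ln x)) * inverse x ^ N)"
    by (intro hol2_mult hol2_exp hol2_add hol2_const hol2_var hol2_param holomorphic_intros)
      (use S_pos S_notin_nonpos in auto)
  then show ?thesis
    by (rule hol2_cong) (simp add: Ef_def divide_inverse power_inverse)
qed

text \<open>Since \<open>norm\<close> does not decrease along the ray, the derivative of
  \<open>Ln\<close> is at most \<open>1 / norm x\<close> on the whole segment; the factor 2 bounds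
  \<open>norm (dir \<delta> k)\<close>.\<close>

lemma Ln_ray:
  assumes x: "x \<in> S" and s: "0 \<le> s"
  shows "norm (Ln (x + of_real s * dir \<delta> k) - Ln x) \<le> 2 * s / norm x"
proof -
  let ?t = "x + of_real s * dir \<delta> k"
  have seg: "z \<in> S \<and> norm x \<le> norm z" if z: "z \<in> closed_segment x ?t" for z
  proof -
    obtain u where u: "0 \<le> u" "u \<le> 1" "z = (1 - u) *\<^sub>R x + u *\<^sub>R ?t"
      using z by (auto simp: in_segment)
    have "z = x + of_real (u * s) * dir \<delta> k"
      unfolding u by (simp add: algebra_simps scaleR_conv_of_real)
    then show ?thesis using ray_in[OF x, of "u * s"] ray_ge[OF x, of "u * s"] u s by simp
  qed
  have "norm (Ln ?t - Ln x) \<le> inverse (norm x) * norm (?t - x)"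
  proof (rule field_differentiable_bound[of "closed_segment x ?t" Ln inverse])
    fix z assume z: "z \<in> closed_segment x ?t"
    then show "(Ln has_field_derivative inverse z) (at z within closed_segment x ?t)"
      using seg[OF z] S_notin_nonpos by (blast intro: has_field_derivative_Ln has_field_derivative_at_within)
    show "norm (inverse z) \<le> inverse (norm x)"
      using seg[OF z] S_pos(1)[OF x] by (simp add: norm_inverse le_imp_inverse_le)
  qed auto
  also have "norm (?t - x) \<le> s * 2"
    using s dir_le[of k] by (simp add: norm_mult mult_left_mono)
  finally show ?thesis using S_pos[OF x] by (simp add: field_simps)
qed

text \<open>The exponential decays at rate \<open>slope \<delta> * \<bar>k\<bar>\<close>, and by
  \<open>Ln_ray\<close> and the size of \<open>r\<close> the logarithm takes back at most half of
  it. The powers of \<open>x\<close> are kept apart, to be combined later with those of the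
  right-hand side.\<close>

lemma Ef_ratio:
  fixes k :: int
  assumes \<sigma>: "\<sigma> \<in> A" and x: "x \<in> S" and s: "0 \<le> s"
  defines "t \<equiv> x + of_real s * dir \<delta> k"
  shows "norm (Ef k N \<sigma> t) * norm t ^ N
           \<le> norm (Ef k N \<sigma> x) * norm x ^ N * exp (- (slope \<delta> / 2) * \<bar>of_int k\<bar> * s)"
proof -
  have tS: "t \<in> S" unfolding t_def by (rule ray_in[OF x s])
  have E: "norm (Ef k N \<sigma> y) * norm y ^ N = exp (Re (of_int k * (y + \<sigma> * Ln y)))" if "y \<in> S" for y
    using S_pos[OF that] by (simp add: Ef_def norm_divide norm_power)
  have "Re (of_int k * (t - x)) = - slope \<delta> * \<bar>of_int k\<bar> * s"
    by (simp add: t_def dir_def abs_if sgn_if)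
  moreover have "Re (of_int k * (\<sigma> * (Ln t - Ln x))) \<le> \<bar>of_int k\<bar> * (slope \<delta> / 2 * s)"
  proof -
    have "norm \<sigma> * norm (Ln t - Ln x) \<le> Smax * (2 * s / norm x)"
      using Smax[OF \<sigma>] Ln_ray[OF x s] order_trans[OF norm_ge_zero Smax[OF \<sigma>]] unfolding t_def
      by (intro mult_mono) auto
    also have "\<dots> \<le> slope \<delta> / 2 * s"
    proof -
      have "4 * Smax \<le> slope \<delta> * norm x"
        using r_large slope x by (smt (verit) S_iff mult_left_mono)
      then have "4 * Smax * s \<le> slope \<delta> * norm x * s" using s by (rule mult_right_mono)
      then show ?thesis using S_pos[OF x] by (simp add: field_simps)
    qed
    finally have "norm \<sigma> * norm (Ln t - Ln x) \<le> slope \<delta> / 2 * s" .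
    then have "\<bar>of_int k\<bar> * (norm \<sigma> * norm (Ln t - Ln x)) \<le> \<bar>of_int k\<bar> * (slope \<delta> / 2 * s)"
      by (rule mult_left_mono) simp
    moreover have "Re (of_int k * (\<sigma> * (Ln t - Ln x))) \<le> norm (of_int k * (\<sigma> * (Ln t - Ln x)))"
      by (rule complex_Re_le_cmod)
    ultimately show ?thesis by (simp add: norm_mult)
  qed
  moreover define a where "a = Re (of_int k * (t + \<sigma> * Ln t))"
  moreover define b where "b = Re (of_int k * (x + \<sigma> * Ln x))"
  ultimately have ab: "a \<le> b + - (slope \<delta> / 2) * \<bar>of_int k\<bar> * s"
    by (simp add: algebra_simps)
  have "norm (Ef k N \<sigma> t) * norm t ^ N = exp a" unfolding a_def by (rule E[OF tS])
  also have "\<dots> \<le> exp (b + - (slope \<delta> / 2) * \<bar>of_int k\<bar> * s)" using ab by (rule exp_le_cancel_iff[THEN iffD2])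
  also have "\<dots> = exp b * exp (- (slope \<delta> / 2) * \<bar>of_int k\<bar> * s)" by (rule exp_add)
  also have "exp b = norm (Ef k N \<sigma> x) * norm x ^ N" unfolding b_def by (rule E[OF x, symmetric])
  finally show ?thesis .
qed

text \<open>The condition on \<open>q\<close> makes the net power of \<open>t\<close> nonpositive,
  so it may be evaluated at the start of the ray. No constant depends on \<open>k\<close>,
  \<open>N\<close> or \<open>q\<close>, which makes the majorant argument uniform in the
  degree.\<close>

lemma ray_bound:
  fixes k :: int and N :: nat and M q s :: real and f :: "complex \<Rightarrow> complex"
  assumes \<sigma>: "\<sigma> \<in> A" and x: "x \<in> S" and s: "0 \<le> s" and M: "0 \<le> M"
    and q: "q \<le> real N - kap k"
  defines "t \<equiv> x + of_real s * dir \<delta> k"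
  assumes f: "norm (f t) \<le> M * norm t powr (q - kap k)"
  shows "norm (Ef k N \<sigma> t * f t) \<le> (M * norm (Ef k N \<sigma> x) * norm x powr q) * dom k (norm x) s"
proof -
  define X where "X = norm x"
  define T where "T = norm t"
  have X: "0 < X" and XT: "X \<le> T"
    using S_pos[OF x] ray_ge[OF x s] by (auto simp: X_def T_def t_def)
  then have T: "0 < T" by simp
  define E where "E = norm (Ef k N \<sigma> x)"
  have E0: "0 \<le> E" by (simp add: E_def)
  have 1: "norm (Ef k N \<sigma> t) \<le> E * X ^ N * exp (- (slope \<delta> / 2) * \<bar>of_int k\<bar> * s) * T powr (- real N)"
  proof -
    have "norm (Ef k N \<sigma> t) = (norm (Ef k N \<sigma> t) * T ^ N) * T powr (- real N)"
      using T by (simp add: powr_minus powr_realpow)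
    also have "\<dots> \<le> (E * X ^ N * exp (- (slope \<delta> / 2) * \<bar>of_int k\<bar> * s)) * T powr (- real N)"
      using Ef_ratio[OF \<sigma> x s, of k N] unfolding E_def X_def T_def t_def by (intro mult_right_mono) auto
    finally show ?thesis .
  qed
  have "norm (Ef k N \<sigma> t * f t)
      \<le> (E * X ^ N * exp (- (slope \<delta> / 2) * \<bar>of_int k\<bar> * s) * T powr (- real N)) * (M * T powr (q - kap k))"
    unfolding norm_mult using 1 f E0 X by (intro mult_mono) (auto simp: T_def)
  also have "\<dots> = M * E * X ^ N * exp (- (slope \<delta> / 2) * \<bar>of_int k\<bar> * s) * T powr (q - kap k - real N)"
    by (simp add: mult_ac powr_add[symmetric])
  also have "\<dots> \<le> (M * E * X powr q) * dom k X s"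
  proof (cases "k = 0")
    case True
    \<comment> \<open>Two powers of \<open>1/T\<close> are set aside for integrability; the exponent
      left over is still nonpositive since \<open>q \<le> real N - 1\<close>.\<close>
    have "T powr (q - kap k - real N) = T powr (q + 1 - real N) * T powr (- 2)"
      using True by (simp add: kap_def powr_add[symmetric] algebra_simps)
    also have "\<dots> \<le> X powr (q + 1 - real N) * T powr (- 2)"
      using q True X XT by (intro mult_right_mono powr_mono2') (auto simp: kap_def)
    also have "\<dots> \<le> X powr (q + 1 - real N) * (2 / (X + s)\<^sup>2)"
    proof (rule mult_left_mono)
      have "0 \<le> (X - s)\<^sup>2" by simp
      then have "(X + s)\<^sup>2 \<le> 2 * (X\<^sup>2 + s\<^sup>2)" by (simp add: power2_eq_square algebra_simps)
      also have "\<dots> \<le> 2 * T\<^sup>2" using ray_sq[OF x s, of k] by (simp add: X_def T_def t_def)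
      finally have "(X + s)\<^sup>2 \<le> 2 * T\<^sup>2" .
      moreover have "0 < X + s" using X s by simp
      ultimately have "2 / (2 * T\<^sup>2) \<le> 2 / (X + s)\<^sup>2" using T by (intro divide_left_mono) auto
      moreover have "T powr 2 = T\<^sup>2" using powr_realpow[OF T, of 2] by simp
      then have "T powr (- 2) = inverse (T\<^sup>2)" by (simp only: powr_minus)
      then have "T powr (- 2) = 2 / (2 * T\<^sup>2)" by (simp only: divide_inverse) simp
      ultimately show "T powr (- 2) \<le> 2 / (X + s)\<^sup>2" by simp
    qed simp
    also have "X powr (q + 1 - real N) = X powr q * X / X ^ N"
      using X by (simp add: powr_add powr_diff powr_realpow)
    finally have "X ^ N * T powr (q - kap k - real N) \<le> X ^ N * (X powr q * X / X ^ N * (2 / (X + s)\<^sup>2))"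
      using X by (intro mult_left_mono) auto
    also have "\<dots> = X powr q * (2 * X / (X + s)\<^sup>2)" using X by simp
    finally have "X ^ N * T powr (q - kap k - real N) \<le> X powr q * (2 * X / (X + s)\<^sup>2)" .
    then have "(M * E) * (X ^ N * T powr (q - kap k - real N)) \<le> (M * E) * (X powr q * (2 * X / (X + s)\<^sup>2))"
      using M E0 by (intro mult_left_mono) auto
    then show ?thesis using True by (simp add: dom_def mult_ac)
  next
    case False
    have "T powr (q - kap k - real N) \<le> X powr (q - kap k - real N)"
      using q X XT False by (intro powr_mono2') (auto simp: kap_def)
    also have "X powr (q - kap k - real N) = X powr q / X ^ N"
      using X False by (simp add: kap_def powr_diff powr_realpow)
    finally have a: "X ^ N * T powr (q - kap k - real N) \<le> X powr q" using X by (simp add: field_simps)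
    \<comment> \<open>Giving up the extra decay for larger \<open>\<bar>k\<bar>\<close> leaves one
      dominating function for all nonzero \<open>k\<close>.\<close>
    have "1 \<le> \<bar>real_of_int k\<bar>" using False by linarith
    then have "slope \<delta> / 2 * s * 1 \<le> slope \<delta> / 2 * s * \<bar>real_of_int k\<bar>"
      using slope s by (intro mult_left_mono) auto
    then have "exp (- (slope \<delta> / 2) * \<bar>of_int k\<bar> * s) \<le> exp (- (slope \<delta> / 2) * s)"
      by (simp add: mult_ac)
    with a have "(X ^ N * T powr (q - kap k - real N)) * exp (- (slope \<delta> / 2) * \<bar>of_int k\<bar> * s)
        \<le> X powr q * exp (- (slope \<delta> / 2) * s)"
      by (intro mult_mono) auto
    then have "(M * E) * ((X ^ N * T powr (q - kap k - real N)) * exp (- (slope \<delta> / 2) * \<bar>of_int k\<bar> * s))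
        \<le> (M * E) * (X powr q * exp (- (slope \<delta> / 2) * s))"
      using M E0 by (intro mult_left_mono) auto
    then show ?thesis using False by (simp add: dom_def mult_ac)
  qed
  finally show ?thesis by (simp add: E_def X_def)
qed

lemma dom_integral:
  assumes "0 < X" shows "dom k X integrable_on {0..}" "integral {0..} (dom k X) \<le> 2 / slope \<delta>"
proof -
  have "(dom k X has_integral (if k = 0 then 2 else 2 / slope \<delta>)) {0..}"
  proof (cases "k = 0")
    case True
    then have "dom k X = (\<lambda>s. 2 * X / (X + s)\<^sup>2)" by (simp add: dom_def fun_eq_iff)
    then show ?thesis using has_integral_inverse_square_shift[OF assms] True by simp
  next
    case False
    then have "dom k X = (\<lambda>s. exp (- (slope \<delta> / 2) * s))" by (simp add: dom_def fun_eq_iff)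
    then show ?thesis using has_integral_exp_minus_to_infinity[of "slope \<delta> / 2" 0] slope False by simp
  qed
  moreover have "2 \<le> 2 / slope \<delta>" using slope by (simp add: field_simps)
  ultimately show "dom k X integrable_on {0..}" "integral {0..} (dom k X) \<le> 2 / slope \<delta>"
    by (auto simp: integrable_on_def dest: integral_unique split: if_splits)
qed

text \<open>Compares with the single function \<open>dom k 1\<close>, whose tails are independent of
  \<open>x\<close>. The price is a factor \<open>X\<close>, which is bounded on compact
  sets.\<close>

lemma dom_le: assumes "1 \<le> X" "0 \<le> s" shows "dom k X s \<le> X * dom k 1 s" "0 \<le> dom k X s"
proof -
  have "2 * X / (X + s)\<^sup>2 \<le> X * (2 / (1 + s)\<^sup>2)"
    using assms by (simp add: frac_le power_mono)
  moreover have "exp (- (slope \<delta> / 2) * s) \<le> X * exp (- (slope \<delta> / 2) * s)"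
    using assms by simp
  ultimately show "dom k X s \<le> X * dom k 1 s" by (simp add: dom_def)
  show "0 \<le> dom k X s" using assms by (simp add: dom_def)
qed

lemma continuous_on_ray:
  assumes "x \<in> S" "continuous_on S f"
  shows "continuous_on {0..} (\<lambda>s. Ef k N \<sigma> (x + of_real s * dir \<delta> k) * f (x + of_real s * dir \<delta> k))"
proof -
  have "continuous_on S (Ef k N \<sigma>)"
    by (rule continuous_at_imp_continuous_on) (use Ef_deriv DERIV_isCont in blast)
  with assms(2) have "continuous_on S (\<lambda>t. Ef k N \<sigma> t * f t)" by (rule continuous_on_mult[rotated])
  then show ?thesis
    by (rule continuous_on_compose2[where f = "\<lambda>s. x + of_real s * dir \<delta> k"])
      (use ray_in[OF assms(1)] in \<open>auto intro!: continuous_intros\<close>)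
qed

text \<open>The constant is \<open>norm (dir \<delta> k) \<le> 2\<close> times the integral
  \<open>\<le> 2 / slope \<delta>\<close> of the dominating function. The bound on \<open>f\<close>
  is asked only at distance at least \<open>norm x\<close>, so that it can be applied to remainders
  controlled only far out.\<close>

lemma Sol_integrable:
  assumes \<sigma>: "\<sigma> \<in> A" and x: "x \<in> S" and M: "0 \<le> M" and q: "q \<le> real N - kap k"
    and f: "continuous_on S f" "\<And>t. t \<in> S \<Longrightarrow> norm x \<le> norm t \<Longrightarrow> norm (f t) \<le> M * norm t powr (q - kap k)"
  shows "(\<lambda>s. Ef k N \<sigma> (x + of_real s * dir \<delta> k) * f (x + of_real s * dir \<delta> k)) integrable_on {0..}"
    and "norm (Sol k N \<sigma> f x) \<le> 4 / slope \<delta> * M * norm x powr q"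
proof -
  define D where "D = M * norm (Ef k N \<sigma> x) * norm x powr q"
  let ?h = "\<lambda>s. Ef k N \<sigma> (x + of_real s * dir \<delta> k) * f (x + of_real s * dir \<delta> k)"
  have le: "norm (?h s) \<le> D * dom k (norm x) s" if "0 \<le> s" for s
    unfolding D_def by (rule ray_bound[OF \<sigma> x that M q]) (intro f ray_in ray_ge x that)
  have D: "(\<lambda>s. D * dom k (norm x) s) integrable_on {0..}"
    by (intro integrable_on_mult_right dom_integral S_pos x)
  show int: "?h integrable_on {0..}"
    by (rule continuous_on_imp_integrable_dominated[OF continuous_on_ray[OF x f(1)] D le])
  have "norm (RayI k N \<sigma> f x) \<le> integral {0..} (\<lambda>s. D * dom k (norm x) s)"
    unfolding RayI_def by (rule integral_norm_bound_integral[OF int D]) (use le in auto)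
  also have "\<dots> = D * integral {0..} (dom k (norm x))" by simp
  also have "\<dots> \<le> D * (2 / slope \<delta>)"
    by (intro mult_left_mono dom_integral S_pos x) (use M in \<open>simp add: D_def\<close>)
  finally have "norm (dir \<delta> k) * norm (RayI k N \<sigma> f x) \<le> 2 * (D * (2 / slope \<delta>))"
    using dir_le by (intro mult_mono) auto
  then have "norm (dir \<delta> k) * norm (RayI k N \<sigma> f x) / norm (Ef k N \<sigma> x)
      \<le> 2 * (D * (2 / slope \<delta>)) / norm (Ef k N \<sigma> x)"
    by (rule divide_right_mono) simp
  also have "\<dots> = 4 / slope \<delta> * M * norm x powr q"
    using Ef_nonzero[OF x] by (simp add: D_def)
  finally show "norm (Sol k N \<sigma> f x) \<le> 4 / slope \<delta> * M * norm x powr q"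
    by (simp add: Sol_def norm_divide norm_mult)
qed

lemma RayI_tail:
  assumes \<sigma>: "\<sigma> \<in> A" and x: "x \<in> S" and M: "0 \<le> M" and q: "q \<le> real N - kap k" and n: "0 \<le> n"
    and f: "continuous_on S f" "\<And>t. t \<in> S \<Longrightarrow> norm (f t) \<le> M * norm t powr (q - kap k)"
  shows "norm (RayI k N \<sigma> f x
      - integral {0..n} (\<lambda>s. Ef k N \<sigma> (x + of_real s * dir \<delta> k) * f (x + of_real s * dir \<delta> k)))
    \<le> (M * norm (Ef k N \<sigma> x) * norm x powr (q + 1)) * (integral {0..} (dom k 1) - integral {0..n} (dom k 1))"
  unfolding RayI_def
proof (rule integral_tail_bound[OF continuous_on_ray[OF x f(1)] dom_integral(1) _ n])
  fix s :: real assume s: "0 \<le> s"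
  have "norm (Ef k N \<sigma> (x + of_real s * dir \<delta> k) * f (x + of_real s * dir \<delta> k))
      \<le> (M * norm (Ef k N \<sigma> x) * norm x powr q) * dom k (norm x) s"
    by (rule ray_bound[OF \<sigma> x s M q]) (intro f ray_in x s)
  also have "\<dots> \<le> (M * norm (Ef k N \<sigma> x) * norm x powr q) * (norm x * dom k 1 s)"
    using M by (intro mult_left_mono dom_le far x s) auto
  finally show "norm (Ef k N \<sigma> (x + of_real s * dir \<delta> k) * f (x + of_real s * dir \<delta> k))
      \<le> (M * norm (Ef k N \<sigma> x) * norm x powr (q + 1)) * dom k 1 s"
    using S_pos(1)[OF x] by (simp add: powr_add mult_ac)
qed simp

lemma dom_tail: "(\<lambda>n. integral {0..} (dom k 1) - integral {0..real n} (dom k 1)) \<longlonglongrightarrow> 0"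
proof -
  have c: "continuous_on {0..} (dom k 1)"
    unfolding dom_def by (cases "k = 0") (auto intro!: continuous_intros)
  have "(\<lambda>n. integral {0..real n} (dom k 1)) \<longlonglongrightarrow> integral {0..} (dom k 1)"
  proof -
    define f where "f = (\<lambda>n s. if s \<in> {0..real n} then dom k 1 s else 0)"
    have I: "(f n has_integral integral {0..real n} (dom k 1)) {0..}" for n
      unfolding f_def
      by (subst has_integral_restrict)
        (auto intro!: integrable_integral integrable_continuous_interval continuous_on_subset[OF c])
    have "(\<lambda>n. integral {0..} (f n)) \<longlonglongrightarrow> integral {0..} (dom k 1)"
    proof (rule dominated_convergence(2)[OF _ dom_integral(1)[of 1 k]])
      show "f n integrable_on {0..}" for n using I by blast
      show "norm (f n s) \<le> dom k 1 s" if "s \<in> {0..}" for n s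
        using dom_le(2)[of 1 s k] that by (auto simp: f_def)
      show "(\<lambda>n. f n s) \<longlonglongrightarrow> dom k 1 s" if "s \<in> {0..}" for s
      proof (rule tendsto_eventually)
        have "\<forall>\<^sub>F n in sequentially. s \<le> real n" by (rule eventually_ge_at_top[THEN eventually_compose_filterlim[OF _ filterlim_real_sequentially]])
        then show "\<forall>\<^sub>F n in sequentially. f n s = dom k 1 s"
          by eventually_elim (use that in \<open>auto simp: f_def\<close>)
      qed
    qed simp
    then show ?thesis using integral_unique[OF I] by simp
  qed
  from tendsto_diff[OF tendsto_const this, of "integral {0..} (dom k 1)"] show ?thesis by simp
qed

end

section \<open>Holomorphy and differential equation of the ray integrals\<close>

context far_sector begin

lemma RayI_limit:
  assumes \<sigma>: "\<sigma> \<in> A" and x: "x \<in> S" and M: "0 \<le> M" and q: "q \<le> real N - kap k"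
    and f: "continuous_on S f" "\<And>t. t \<in> S \<Longrightarrow> norm (f t) \<le> M * norm t powr (q - kap k)"
  shows "(\<lambda>n. integral {0..real n} (\<lambda>s. Ef k N \<sigma> (x + of_real s * dir \<delta> k) * f (x + of_real s * dir \<delta> k)))
     \<longlonglongrightarrow> RayI k N \<sigma> f x"
proof -
  let ?I = "\<lambda>n. integral {0..real n} (\<lambda>s. Ef k N \<sigma> (x + of_real s * dir \<delta> k) * f (x + of_real s * dir \<delta> k))"
  have "(\<lambda>n. RayI k N \<sigma> f x - ?I n) \<longlonglongrightarrow> 0"
  proof (rule Lim_null_comparison[OF always_eventually[OF allI]])
    show "norm (RayI k N \<sigma> f x - ?I n) \<le> (M * norm (Ef k N \<sigma> x) * norm x powr (q + 1))
        * (integral {0..} (dom k 1) - integral {0..real n} (dom k 1))" for n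
      by (rule RayI_tail[OF \<sigma> x M q _ f]) simp
    show "(\<lambda>n. (M * norm (Ef k N \<sigma> x) * norm x powr (q + 1))
        * (integral {0..} (dom k 1) - integral {0..real n} (dom k 1))) \<longlonglongrightarrow> 0"
      by (rule tendsto_mult_right_zero[OF dom_tail])
  qed
  from tendsto_diff[OF tendsto_const this, of "RayI k N \<sigma> f x"] show ?thesis by simp
qed

lemma hol2_RayI:
  assumes f: "hol2 A S f" and M: "0 \<le> M" and q: "q \<le> real N - kap k"
    and bound: "\<And>\<sigma> t. \<sigma> \<in> A \<Longrightarrow> t \<in> S \<Longrightarrow> norm (f \<sigma> t) \<le> M * norm t powr (q - kap k)"
  shows "hol2 A S (\<lambda>\<sigma> x. RayI k N \<sigma> (f \<sigma>) x)"
proof (rule hol2_local_uniform_limit[OF open_A open_S])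
  define h where "h = (\<lambda>\<sigma> x. Ef k N \<sigma> x * f \<sigma> x)"
  define F where "F = (\<lambda>n \<sigma> x. integral {0..real n} (\<lambda>s. h \<sigma> (x + of_real s * dir \<delta> k)))"
  have h: "hol2 A S h" unfolding h_def by (intro hol2_mult hol2_Ef f)
  show "hol2 A S (F n)" for n
    unfolding F_def by (rule hol2_ray_integral[OF open_A open_S h]) (auto intro: ray_in)
  \<comment> \<open>The factor in the tail estimate \<open>RayI_tail\<close>. Being continuous it is
    bounded on a compact polydisc, where the tails therefore vanish uniformly.\<close>
  define K where "K = (\<lambda>(\<sigma>, x). M * norm (Ef k N \<sigma> x) * norm x powr (q + 1))"
  have cK: "continuous_on (A \<times> S) K"
  proof -
    have "continuous_on (A \<times> S) (\<lambda>p. Ef k N (fst p) (snd p))"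
      using hol2_Ef[of k N] by (simp add: hol2_def case_prod_unfold)
    moreover have "continuous_on (A \<times> S) (\<lambda>p. norm (snd p) powr (q + 1))"
      by (intro continuous_intros) (use S_pos in auto)
    ultimately show ?thesis unfolding K_def case_prod_unfold
      by (intro continuous_on_mult continuous_on_norm continuous_on_const)
  qed
  fix \<sigma> x assume \<sigma>: "\<sigma> \<in> A" and x: "x \<in> S"
  obtain d1 where d1: "0 < d1" "cball \<sigma> d1 \<subseteq> A" using open_A \<sigma> open_contains_cball by blast
  obtain d2 where d2: "0 < d2" "cball x d2 \<subseteq> S" using open_S x open_contains_cball by blast
  have "compact (K ` (cball \<sigma> d1 \<times> cball x d2))"
    by (rule compact_continuous_image[OF continuous_on_subset[OF cK]]) (use d1 d2 in \<open>auto intro: compact_Times\<close>)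
  then obtain D where D: "\<And>p. p \<in> cball \<sigma> d1 \<times> cball x d2 \<Longrightarrow> \<bar>K p\<bar> \<le> D"
    using compact_imp_bounded bounded_iff by (metis imageI real_norm_def)
  define \<tau> where "\<tau> n = integral {0..} (dom k 1) - integral {0..real n} (dom k 1)" for n
  have le: "norm (RayI k N s (f s) y - F n s y) \<le> D * \<bar>\<tau> n\<bar>" if "s \<in> cball \<sigma> d1" "y \<in> cball x d2" for n s y
  proof -
    have sA: "s \<in> A" and yS: "y \<in> S" using that d1 d2 by auto
    have "continuous_on S (f s)" using f sA by (auto simp: hol2_def intro: holomorphic_on_imp_continuous_on)
    then have "norm (RayI k N s (f s) y - F n s y) \<le> K (s, y) * \<tau> n"
      unfolding F_def h_def K_def \<tau>_def case_prod_conv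
      by (rule RayI_tail[OF sA yS M q of_nat_0_le_iff _ bound[OF sA]])
    also have "\<dots> \<le> \<bar>K (s, y)\<bar> * \<bar>\<tau> n\<bar>" by (metis abs_ge_self abs_mult)
    also have "\<dots> \<le> D * \<bar>\<tau> n\<bar>" using D[of "(s, y)"] that by (intro mult_right_mono) auto
    finally show ?thesis .
  qed
  have lim: "(\<lambda>n. D * \<bar>\<tau> n\<bar>) \<longlonglongrightarrow> 0"
    unfolding \<tau>_def by (rule tendsto_mult_right_zero[OF tendsto_rabs_zero[OF dom_tail]])
  have "uniform_limit (ball \<sigma> d1 \<times> ball x d2) (\<lambda>n (\<sigma>, x). F n \<sigma> x) (\<lambda>(\<sigma>, x). RayI k N \<sigma> (f \<sigma>) x) sequentially"
    unfolding uniform_limit_iff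
  proof (intro allI impI)
    fix e :: real assume "0 < e"
    with lim have "\<forall>\<^sub>F n in sequentially. D * \<bar>\<tau> n\<bar> < e" by (rule order_tendstoD(2))
    then show "\<forall>\<^sub>F n in sequentially. \<forall>p\<in>ball \<sigma> d1 \<times> ball x d2.
        dist ((\<lambda>(\<sigma>, x). F n \<sigma> x) p) ((\<lambda>(\<sigma>, x). RayI k N \<sigma> (f \<sigma>) x) p) < e"
    proof eventually_elim
      fix n assume n: "D * \<bar>\<tau> n\<bar> < e"
      show "\<forall>p\<in>ball \<sigma> d1 \<times> ball x d2.
        dist ((\<lambda>(\<sigma>, x). F n \<sigma> x) p) ((\<lambda>(\<sigma>, x). RayI k N \<sigma> (f \<sigma>) x) p) < e"
      proof
        fix p assume "p \<in> ball \<sigma> d1 \<times> ball x d2"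
        then have "norm (RayI k N (fst p) (f (fst p)) (snd p) - F n (fst p) (snd p)) \<le> D * \<bar>\<tau> n\<bar>"
          by (intro le) auto
        then show "dist ((\<lambda>(\<sigma>, x). F n \<sigma> x) p) ((\<lambda>(\<sigma>, x). RayI k N \<sigma> (f \<sigma>) x) p) < e"
          using n by (simp add: dist_norm norm_minus_commute case_prod_unfold)
      qed
    qed
  qed
  then show "\<exists>U V. open U \<and> \<sigma> \<in> U \<and> U \<subseteq> A \<and> open V \<and> x \<in> V \<and> V \<subseteq> S \<and>
      uniform_limit (U \<times> V) (\<lambda>n (\<sigma>, x). F n \<sigma> x) (\<lambda>(\<sigma>, x). RayI k N \<sigma> (f \<sigma>) x) sequentially"
    using d1 d2 by (intro exI[of _ "ball \<sigma> d1"] exI[of _ "ball x d2"]) auto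
qed

lemma hol2_Sol:
  assumes "hol2 A S f" "0 \<le> M" "q \<le> real N - kap k"
    and "\<And>\<sigma> t. \<sigma> \<in> A \<Longrightarrow> t \<in> S \<Longrightarrow> norm (f \<sigma> t) \<le> M * norm t powr (q - kap k)"
  shows "hol2 A S (\<lambda>\<sigma> x. Sol k N \<sigma> (f \<sigma>) x)"
proof -
  have "hol2 A S (\<lambda>\<sigma> x. - dir \<delta> k * RayI k N \<sigma> (f \<sigma>) x * inverse (Ef k N \<sigma> x))"
    by (intro hol2_mult hol2_inverse hol2_Ef hol2_const hol2_RayI[OF assms] Ef_nonzero) auto
  then show ?thesis by (simp add: Sol_def divide_inverse)
qed

text \<open>Holomorphy being known, the derivative may be computed in the single direction
  \<open>dir \<delta> k\<close>. Moving the starting point in that direction only removes an initial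
  piece of the same ray.\<close>

lemma RayI_deriv:
  assumes \<sigma>: "\<sigma> \<in> A" and x: "x \<in> S" and M: "0 \<le> M" and q: "q \<le> real N - kap k"
    and f: "f holomorphic_on S" "\<And>t. t \<in> S \<Longrightarrow> norm (f t) \<le> M * norm t powr (q - kap k)"
  shows "(RayI k N \<sigma> f has_field_derivative - Ef k N \<sigma> x * f x / dir \<delta> k) (at x)"
proof -
  let ?\<omega> = "dir \<delta> k"
  have fc: "continuous_on S f" by (rule holomorphic_on_imp_continuous_on[OF f(1)])
  have "hol2 A S (\<lambda>\<sigma> x. RayI k N \<sigma> f x)"
    by (rule hol2_RayI[OF hol2_var[OF f(1)] M q f(2)])
  then have "RayI k N \<sigma> f holomorphic_on S" using \<sigma> by (simp add: hol2_def)
  then have D: "(RayI k N \<sigma> f has_field_derivative deriv (RayI k N \<sigma> f) x) (at x)"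
    using open_S x by (rule holomorphic_derivI)
  define h where "h s = Ef k N \<sigma> (x + of_real s * ?\<omega>) * f (x + of_real s * ?\<omega>)" for s
  have hc: "continuous_on {0..} h" unfolding h_def by (rule continuous_on_ray[OF x fc])
  have lin: "((\<lambda>u. x + of_real u * ?\<omega>) has_vector_derivative ?\<omega>) (at 0 within {0..1})"
    by (auto intro!: derivative_eq_intros)
  have v1: "((\<lambda>u. RayI k N \<sigma> f (x + of_real u * ?\<omega>)) has_vector_derivative ?\<omega> * deriv (RayI k N \<sigma> f) x) (at 0 within {0..1})"
    using field_vector_diff_chain_within[OF lin, of "RayI k N \<sigma> f"] D
    by (simp add: o_def has_field_derivative_at_within)
  have split: "RayI k N \<sigma> f (x + of_real u * ?\<omega>) = RayI k N \<sigma> f x - integral {0..u} h" if u: "u \<in> {0..1}" for u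
  proof -
    have xu: "x + of_real u * ?\<omega> \<in> S" using ray_in[OF x] u by auto
    \<comment> \<open>The shift by \<open>u\<close> removes the piece \<open>{0..u}\<close> and adds
      one of length \<open>u\<close> at \<open>n\<close>, whose contribution tends to 0.\<close>
    have "(\<lambda>n. integral {0..real n} h - integral {0..u} h + integral {real n..real n + u} h) \<longlonglongrightarrow> RayI k N \<sigma> f x - integral {0..u} h + 0"
    proof (intro tendsto_add tendsto_diff tendsto_const)
      show lim: "(\<lambda>n. integral {0..real n} h) \<longlonglongrightarrow> RayI k N \<sigma> f x"
        unfolding h_def by (rule RayI_limit[OF \<sigma> x M q fc f(2)])
      show "(\<lambda>n. integral {real n..real n + u} h) \<longlonglongrightarrow> 0"
      proof -
        define K where "K = (M * norm (Ef k N \<sigma> x) * norm x powr q)"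
        have K: "0 \<le> K" using M by (simp add: K_def)
        have hb: "norm (h s) \<le> K * dom k (norm x) s" if "0 \<le> s" for s
          unfolding h_def K_def by (rule ray_bound[OF \<sigma> x that M q]) (intro f ray_in x that)
        have dmono: "dom k (norm x) s \<le> dom k (norm x) t" if "0 \<le> t" "t \<le> s" for s t
        proof -
          have X: "0 < norm x" by (rule S_pos(1)[OF x])
          then have "2 * norm x / (norm x + s)\<^sup>2 \<le> 2 * norm x / (norm x + t)\<^sup>2"
            using that by (intro frac_le power_mono zero_less_power) linarith+
          moreover have "exp (- (slope \<delta> / 2) * s) \<le> exp (- (slope \<delta> / 2) * t)"
            using that slope(2) by simp
          ultimately show ?thesis by (simp add: dom_def)
        qed
        have "norm (integral {real n..real n + u} h) \<le> K * dom k (norm x) (real n)" for n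
        proof -
          have "norm (integral {real n..real n + u} h) \<le> K * dom k (norm x) (real n) * (real n + u - real n)"
          proof (rule integral_bound)
            show "continuous_on {real n..real n + u} h" by (rule continuous_on_subset[OF hc]) auto
            fix s assume s: "s \<in> {real n..real n + u}"
            have "K * dom k (norm x) s \<le> K * dom k (norm x) (real n)"
              using s K by (intro mult_left_mono dmono) auto
            then show "norm (h s) \<le> K * dom k (norm x) (real n)" using hb[of s] s by auto
          qed (use u in auto)
          also have "\<dots> \<le> K * dom k (norm x) (real n) * 1"
            using u K dom_le(2)[OF far[OF x], of "real n" k] by (intro mult_left_mono) auto
          finally show ?thesis by simp
        qed
        moreover have "(\<lambda>n. K * dom k (norm x) (real n)) \<longlonglongrightarrow> 0"
        proof (rule tendsto_mult_right_zero)
          have "(\<lambda>n. 2 * norm x / (norm x + real n)\<^sup>2) \<longlonglongrightarrow> 0" by real_asymp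
          moreover have "(\<lambda>n. exp (- (slope \<delta> / 2) * real n)) \<longlonglongrightarrow> 0" using slope(2) by real_asymp
          ultimately show "(\<lambda>n. dom k (norm x) (real n)) \<longlonglongrightarrow> 0" 
            unfolding dom_def by (cases "k = 0") (simp_all only: if_True if_False refl)
        qed
        ultimately show ?thesis by (rule Lim_null_comparison[OF always_eventually[OF allI]])
      qed
    qed
    moreover have "integral {0..real n} h - integral {0..u} h + integral {real n..real n + u} h
        = integral {0..real n} (\<lambda>s. h (s + u))" for n
    proof -
      have i: "h integrable_on {0..c}" for c
        by (rule integrable_continuous_interval[OF continuous_on_subset[OF hc]]) auto
      have "integral {0..real n} h + integral {real n..real n + u} h = integral {0..real n + u} h"
        using u by (intro Henstock_Kurzweil_Integration.integral_combine i) auto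
      moreover have "integral {0..u} h + integral {u..real n + u} h = integral {0..real n + u} h"
        using u by (intro Henstock_Kurzweil_Integration.integral_combine i) auto
      moreover have "integral {u..real n + u} h = integral {0..real n} (\<lambda>s. h (s + u))"
        using integral_shift_Icc_real[of 0 "real n" h u] by (simp add: o_def add.commute)
      ultimately show ?thesis by (simp add: algebra_simps)
    qed
    moreover have "(\<lambda>n. integral {0..real n} (\<lambda>s. h (s + u))) \<longlonglongrightarrow> RayI k N \<sigma> f (x + of_real u * ?\<omega>)"
      using RayI_limit[OF \<sigma> xu M q fc f(2)] by (simp add: h_def algebra_simps)
    ultimately show ?thesis using LIMSEQ_unique by fastforce
  qed
  have "((\<lambda>u. integral {0..u} h) has_vector_derivative h 0) (at 0 within {0..1})"
    by (rule integral_has_vector_derivative) (auto intro: continuous_on_subset[OF hc])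
  then have "((\<lambda>u. RayI k N \<sigma> f x - integral {0..u} h) has_vector_derivative 0 - h 0) (at 0 within {0..1})"
    by (intro has_vector_derivative_diff has_vector_derivative_const)
  then have v2: "((\<lambda>u. RayI k N \<sigma> f (x + of_real u * ?\<omega>)) has_vector_derivative - h 0) (at 0 within {0..1})"
    by (intro has_vector_derivative_transform[OF _ split]) auto
  have "?\<omega> * deriv (RayI k N \<sigma> f) x = - h 0"
    by (rule vector_derivative_unique_within[OF _ v1 v2]) (simp add: trivial_limit_within islimpt_greaterThanLessThan1 islimpt_subset)
  then have "deriv (RayI k N \<sigma> f) x = - Ef k N \<sigma> x * f x / ?\<omega>"
    using dir_nonzero[of \<delta> k] by (simp add: h_def field_simps)
  with D show ?thesis by simp
qed

lemma Sol_deriv: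
  assumes \<sigma>: "\<sigma> \<in> A" and x: "x \<in> S" and M: "0 \<le> M" and q: "q \<le> real N - kap k"
    and f: "f holomorphic_on S" "\<And>t. t \<in> S \<Longrightarrow> norm (f t) \<le> M * norm t powr (q - kap k)"
  shows "(Sol k N \<sigma> f has_field_derivative f x - (of_int k * (1 + \<sigma> / x) - of_nat N / x) * Sol k N \<sigma> f x) (at x)"
proof -
  define L where "L = of_int k * (1 + \<sigma> / x) - of_nat N / x"
  have "((\<lambda>x. - dir \<delta> k * RayI k N \<sigma> f x / Ef k N \<sigma> x) has_field_derivative
     ((- dir \<delta> k * (- Ef k N \<sigma> x * f x / dir \<delta> k)) * Ef k N \<sigma> x
       - (- dir \<delta> k * RayI k N \<sigma> f x) * (L * Ef k N \<sigma> x))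
      / (Ef k N \<sigma> x * Ef k N \<sigma> x)) (at x)"
    unfolding L_def by (intro DERIV_divide DERIV_cmult RayI_deriv[OF assms] Ef_deriv x Ef_nonzero)
  moreover have "((- dir \<delta> k * (- Ef k N \<sigma> x * f x / dir \<delta> k)) * Ef k N \<sigma> x
       - (- dir \<delta> k * RayI k N \<sigma> f x) * (L * Ef k N \<sigma> x))
      / (Ef k N \<sigma> x * Ef k N \<sigma> x) = f x - L * Sol k N \<sigma> f x"
    using Ef_nonzero[OF x, of k N \<sigma>] dir_nonzero[of \<delta> k] unfolding Sol_def by (simp add: field_simps)
  ultimately show ?thesis unfolding Sol_def[abs_def] L_def by simp
qed

text \<open>Uniqueness among solutions of admissible size: \<open>Ef\<close> times such a solution
  tends to 0 along the ray, so no solution of the homogeneous equation can be added. It is used for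
  truncated expansions in the role of \<open>g\<close>.\<close>

lemma Sol_left_inverse:
  assumes \<sigma>: "\<sigma> \<in> A" and x: "x \<in> S" and M: "0 \<le> M" and q: "q \<le> real N - kap k"
    and f: "continuous_on S f" "\<And>t. t \<in> S \<Longrightarrow> norm (f t) \<le> M * norm t powr (q - kap k)"
    and g: "\<And>t. t \<in> S \<Longrightarrow> norm (g t) \<le> M * norm t powr q"
    and g': "\<And>t. t \<in> S \<Longrightarrow>
      (g has_field_derivative f t - (of_int k * (1 + \<sigma> / t) - of_nat N / t) * g t) (at t)"
  shows "Sol k N \<sigma> f x = g x"
proof -
  let ?\<omega> = "dir \<delta> k"
  let ?t = "\<lambda>s. x + of_real s * ?\<omega>"
  define H where "H t = Ef k N \<sigma> t * g t" for t
  have H': "(H has_field_derivative Ef k N \<sigma> t * f t) (at t)" if "t \<in> S" for t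
  proof -
    have "(H has_field_derivative ((of_int k * (1 + \<sigma> / t) - of_nat N / t) * Ef k N \<sigma> t) * g t
        + (f t - (of_int k * (1 + \<sigma> / t) - of_nat N / t) * g t) * Ef k N \<sigma> t) (at t)"
      unfolding H_def[abs_def] by (rule DERIV_mult[OF Ef_deriv[OF that] g'[OF that]])
    then show ?thesis by (simp add: algebra_simps)
  qed
  have FTC: "integral {0..real n} (\<lambda>s. Ef k N \<sigma> (?t s) * f (?t s)) = (H (?t (real n)) - H x) / ?\<omega>" for n
  proof -
    have "((\<lambda>s. Ef k N \<sigma> (?t s) * f (?t s)) has_integral H (?t (real n)) / ?\<omega> - H (?t 0) / ?\<omega>) {0..real n}"
    proof (rule fundamental_theorem_of_calculus)
      fix s assume "s \<in> {0..real n}"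
      then have tS: "?t s \<in> S" using ray_in[OF x] by auto
      have "(?t has_vector_derivative ?\<omega>) (at s within {0..real n})"
        by (auto intro!: derivative_eq_intros)
      from field_vector_diff_chain_within[OF this has_field_derivative_at_within[OF H'[OF tS]]]
      have "((\<lambda>s. H (?t s)) has_vector_derivative ?\<omega> * (Ef k N \<sigma> (?t s) * f (?t s))) (at s within {0..real n})"
        by (simp add: o_def)
      from has_vector_derivative_divide[OF this, of ?\<omega>]
      show "((\<lambda>s. H (?t s) / ?\<omega>) has_vector_derivative Ef k N \<sigma> (?t s) * f (?t s)) (at s within {0..real n})"
        using dir_nonzero[of \<delta> k] by simp
    qed simp
    then show ?thesis by (simp add: integral_unique diff_divide_distrib)
  qed
  have "(\<lambda>n. H (?t (real n))) \<longlonglongrightarrow> 0"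
  proof -
    define X where "X = norm x"
    have X: "1 \<le> X" unfolding X_def by (rule far[OF x])
    define K where "K = M * norm (Ef k N \<sigma> x) * X powr q"
    have hb: "norm (H (?t s)) \<le> K * (if k = 0 then 2 * X * (X + 2 * s) / (X + s)\<^sup>2 else exp (- (slope \<delta> / 2) * s))"
      if s: "0 \<le> s" for s
    proof (cases "k = 0")
      case False
      have "norm (Ef k N \<sigma> (?t s) * g (?t s)) \<le> K * dom k X s"
        unfolding K_def X_def
        by (rule ray_bound[OF \<sigma> x s M q]) (use False g ray_in[OF x s] in \<open>simp add: kap_def\<close>)
      then show ?thesis using False by (simp add: H_def dom_def)
    next
      \<comment> \<open>For \<open>k = 0\<close> the function \<open>g\<close> is one power too
        large for \<open>ray_bound\<close>, which is applied to \<open>g t / t\<close> instead. The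
        missing factor \<open>norm t\<close> grows linearly in \<open>s\<close>, the dominating
        function decays quadratically.\<close>
      case True
      have tS: "?t s \<in> S" by (rule ray_in[OF x s])
      have nt: "norm (?t s) \<le> X + 2 * s"
        using norm_triangle_ineq[of x "of_real s * ?\<omega>"] mult_left_mono[OF dir_le[of k] s] s
        by (simp add: norm_mult X_def)
      have "norm (Ef k N \<sigma> (?t s) * (\<lambda>t. g t / t) (?t s)) \<le> K * dom k X s"
        unfolding K_def X_def
      proof (rule ray_bound[OF \<sigma> x s M q])
        have "norm (g (?t s)) / norm (?t s) \<le> M * norm (?t s) powr q / norm (?t s)"
          by (intro divide_right_mono g tS) simp
        then show "norm (g (?t s) / ?t s) \<le> M * norm (?t s) powr (q - kap k)"
          using True S_pos(1)[OF tS] by (simp add: norm_divide kap_def powr_diff)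
      qed
      then have "norm (H (?t s)) / norm (?t s) \<le> K * dom k X s"
        by (simp add: H_def norm_mult norm_divide)
      then have "norm (H (?t s)) \<le> (K * dom k X s) * norm (?t s)"
        using S_pos(1)[OF tS] by (simp add: field_simps)
      also have "\<dots> \<le> (K * dom k X s) * (X + 2 * s)"
        using M dom_le(2)[OF X s] by (intro mult_left_mono nt) (auto simp: K_def)
      finally show ?thesis using True by (simp add: dom_def mult_ac)
    qed
    have lim: "(\<lambda>n. K * (if k = 0 then 2 * X * (X + 2 * real n) / (X + real n)\<^sup>2
        else exp (- (slope \<delta> / 2) * real n))) \<longlonglongrightarrow> 0"
    proof (rule tendsto_mult_right_zero)
      have "(\<lambda>n. 2 * X * (X + 2 * real n) / (X + real n)\<^sup>2) \<longlonglongrightarrow> 0" by real_asymp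
      moreover have "(\<lambda>n. exp (- (slope \<delta> / 2) * real n)) \<longlonglongrightarrow> 0" using slope(2) by real_asymp
      ultimately show "(\<lambda>n. if k = 0 then 2 * X * (X + 2 * real n) / (X + real n)\<^sup>2
        else exp (- (slope \<delta> / 2) * real n)) \<longlonglongrightarrow> 0"
        by (cases "k = 0") (simp_all only: if_True if_False refl)
    qed
    show ?thesis
      by (rule Lim_null_comparison[OF always_eventually[OF allI] lim]) (rule hb[OF of_nat_0_le_iff])
  qed
  from tendsto_divide[OF tendsto_diff[OF this tendsto_const] tendsto_const dir_nonzero]
  have "(\<lambda>n. (H (?t (real n)) - H x) / ?\<omega>) \<longlonglongrightarrow> (0 - H x) / ?\<omega>" .
  moreover have "(\<lambda>n. (H (?t (real n)) - H x) / ?\<omega>) \<longlonglongrightarrow> RayI k N \<sigma> f x"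
    using RayI_limit[OF \<sigma> x M q f] unfolding FTC .
  ultimately have "RayI k N \<sigma> f x = (0 - H x) / ?\<omega>" using LIMSEQ_unique by blast
  then show ?thesis
    using Ef_nonzero[OF x, of k N \<sigma>] dir_nonzero[of \<delta> k] by (simp add: Sol_def H_def)
qed

section \<open>Asymptotic expansions of the solutions\<close>

lemma bigO_Sol_remainder:
  assumes \<sigma>: "\<sigma> \<in> A" and M: "0 \<le> M" and q: "q \<le> real N - kap k" and q': "q' \<le> q"
    and f: "continuous_on S f" "\<And>t. t \<in> S \<Longrightarrow> norm (f t) \<le> M * norm t powr (q - kap k)"
    and fg: "continuous_on S fg" "\<And>t. t \<in> S \<Longrightarrow> norm (fg t) \<le> M * norm t powr (q - kap k)"
    and g: "\<And>t. t \<in> S \<Longrightarrow> norm (g t) \<le> M * norm t powr q"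
    and g': "\<And>t. t \<in> S \<Longrightarrow>
      (g has_field_derivative fg t - (of_int k * (1 + \<sigma> / t) - of_nat N / t) * g t) (at t)"
    and rem: "bigO_on S (q' - kap k) (\<lambda>t. f t - fg t)"
  shows "bigO_on S q' (\<lambda>x. Sol k N \<sigma> f x - g x)"
proof -
  obtain D \<rho> where D: "0 \<le> D"
    "\<And>t. t \<in> S \<Longrightarrow> \<rho> \<le> norm t \<Longrightarrow> norm (f t - fg t) \<le> D * norm t powr (q' - kap k)"
    using bigO_onE[OF rem] by blast
  have "norm (Sol k N \<sigma> f x - g x) \<le> 4 / slope \<delta> * D * norm x powr q'" if x: "x \<in> S" "\<rho> \<le> norm x" for x
  proof -
    \<comment> \<open>\<open>g\<close> solves the equation with right-hand side \<open>fg\<close>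
      exactly, so \<open>Sol\<close> reproduces it; by linearity the error comes from
      \<open>f - fg\<close> alone.\<close>
    have 1: "Sol k N \<sigma> fg x = g x" by (rule Sol_left_inverse[OF \<sigma> x(1) M q fg g g'])
    have "RayI k N \<sigma> f x - RayI k N \<sigma> fg x = RayI k N \<sigma> (\<lambda>t. f t - fg t) x"
      unfolding RayI_def right_diff_distrib
      by (rule integral_diff[symmetric]; rule Sol_integrable(1)[OF \<sigma> x(1) M q]) (use f fg in auto)
    then have "Sol k N \<sigma> f x - Sol k N \<sigma> fg x = Sol k N \<sigma> (\<lambda>t. f t - fg t) x"
      unfolding Sol_def by (simp add: algebra_simps diff_divide_distrib flip: \<open>_ = RayI k N \<sigma> _ x\<close>)
    also have "norm \<dots> \<le> 4 / slope \<delta> * D * norm x powr q'"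
      by (rule Sol_integrable(2)[OF \<sigma> x(1) D(1)])
        (use q q' D(2) x in \<open>auto intro: continuous_on_diff f fg\<close>)
    finally show ?thesis by (simp add: 1)
  qed
  then show ?thesis unfolding bigO_on_def by blast
qed

lemma power_shift_deriv:
  assumes "t \<noteq> (0::complex)"
  shows "((\<lambda>t. t ^ p * inverse t ^ j) has_field_derivative (of_nat p - of_nat j) / t * (t ^ p * inverse t ^ j)) (at t)"
proof -
  have "((\<lambda>t. t ^ p * inverse t ^ j) has_field_derivative
     (of_nat p * t ^ (p - Suc 0)) * inverse t ^ j + (of_nat j * (inverse t ^ (j - Suc 0) * (- (inverse t * inverse t)))) * t ^ p) (at t)"
    using assms by (auto intro!: derivative_eq_intros simp: power2_eq_square)
  moreover have e1: "of_nat p * t ^ (p - Suc 0) = of_nat p / t * t ^ p"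
    using assms by (cases p) (simp_all add: field_simps del: of_nat_Suc)
  have e2: "of_nat j * (inverse t ^ (j - Suc 0) * (- (inverse t * inverse t))) = - of_nat j / t * inverse t ^ j"
    using assms by (cases j) (simp_all add: divide_inverse mult_ac del: of_nat_Suc)
  have "(of_nat p * t ^ (p - Suc 0)) * inverse t ^ j + (of_nat j * (inverse t ^ (j - Suc 0) * (- (inverse t * inverse t)))) * t ^ p
      = (of_nat p - of_nat j) / t * (t ^ p * inverse t ^ j)"
    unfolding e1 e2 by (simp add: algebra_simps diff_divide_distrib)
  ultimately show ?thesis by simp
qed

lemma truncated_series_bound:
  "\<exists>D. \<forall>t\<in>S. norm (t ^ p * (\<Sum>j<J. u j * inverse t ^ j)) \<le> D * norm t powr p"
proof (intro exI ballI)
  fix t assume t: "t \<in> S"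
  have "norm (t ^ p * (\<Sum>j<J. u j * inverse t ^ j)) \<le> norm t ^ p * (\<Sum>j<J. norm (u j) * 1)"
    unfolding norm_mult norm_power
  proof (intro mult_left_mono order_trans[OF norm_sum] sum_mono)
    fix j
    have "norm (inverse t) ^ j \<le> 1"
      using far[OF t] by (intro power_le_one) (auto simp: norm_inverse inverse_le_1_iff)
    then show "norm (u j * inverse t ^ j) \<le> norm (u j) * 1"
      unfolding norm_mult norm_power by (intro mult_left_mono) auto
  qed simp
  also have "norm t ^ p = norm t powr p" using S_pos(1)[OF t] by (simp add: powr_realpow)
  finally show "norm (t ^ p * (\<Sum>j<J. u j * inverse t ^ j)) \<le> (\<Sum>j<J. norm (u j)) * norm t powr p"
    by (simp add: mult.commute)
qed

lemma truncated_series_deriv: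
  assumes "t \<in> S"
  shows "((\<lambda>t. t ^ p * (\<Sum>j<J. u j * inverse t ^ j)) has_field_derivative
      t ^ p * (\<Sum>j<J. u j * (of_nat p - of_nat j) * inverse t ^ j) / t) (at t)"
proof -
  have "((\<lambda>t. \<Sum>j<J. u j * (t ^ p * inverse t ^ j)) has_field_derivative
     (\<Sum>j<J. u j * ((of_nat p - of_nat j) / t * (t ^ p * inverse t ^ j)))) (at t)"
    by (intro DERIV_sum DERIV_cmult power_shift_deriv S_pos(2) assms)
  moreover have "(\<Sum>j<J. u j * ((of_nat p - of_nat j) / t * (t ^ p * inverse t ^ j)))
      = t ^ p * (\<Sum>j<J. u j * (of_nat p - of_nat j) * inverse t ^ j) / t"
    by (simp add: sum_distrib_left sum_divide_distrib mult_ac)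
  ultimately show ?thesis by (simp add: sum_distrib_left mult_ac)
qed

text \<open>The recursion results from inserting the expansion into the differential equation.\<close>

fun sol_coeff :: "complex \<Rightarrow> int \<Rightarrow> nat \<Rightarrow> nat \<Rightarrow> (nat \<Rightarrow> complex) \<Rightarrow> nat \<Rightarrow> complex" where
  "sol_coeff \<sigma> k N p f 0 = f 0 / of_int k"
| "sol_coeff \<sigma> k N p f (Suc j) =
     (f (Suc j) - (of_nat p - of_nat j + of_int k * \<sigma> - of_nat N) * sol_coeff \<sigma> k N p f j) / of_int k"

lemma asy_Sol_nonresonant:
  assumes \<sigma>: "\<sigma> \<in> A" and k: "k \<noteq> 0" and p: "p \<le> N"
    and f: "continuous_on S f" "\<And>t. t \<in> S \<Longrightarrow> norm (f t) \<le> M * norm t powr p" and a: "asy S p f c"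
  shows "asy S p (Sol k N \<sigma> f) (sol_coeff \<sigma> k N p c)"
  unfolding asy_def
proof
  fix J
  define u where "u = sol_coeff \<sigma> k N p c"
  define v where "v j = u j * (of_nat p - of_nat j)" for j
  define g where "g = (\<lambda>t. t ^ p * (\<Sum>j<J. u j * inverse t ^ j))"
  define gd where "gd = (\<lambda>t. t ^ p * (\<Sum>j<J. v j * inverse t ^ j))"
  \<comment> \<open>The right-hand side for which the truncated series \<open>g\<close> is an exact
    solution.\<close>
  define fg where "fg = (\<lambda>t. gd t / t + (of_int k * (1 + \<sigma> / t) - of_nat N / t) * g t)"
  have kap: "kap k = 0" using k by (simp add: kap_def)
  have q: "real p \<le> real N - kap k" using p kap by simp
  obtain D1 where D1: "\<And>t. t \<in> S \<Longrightarrow> norm (g t) \<le> D1 * norm t powr p"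
    using truncated_series_bound[where p = p and J = J and u = u] by (auto simp: g_def)
  obtain D2 where D2: "\<And>t. t \<in> S \<Longrightarrow> norm (gd t) \<le> D2 * norm t powr p"
    using truncated_series_bound[where p = p and J = J and u = v] by (auto simp: gd_def)
  define E where "E = \<bar>of_int k\<bar> * (1 + norm \<sigma>) + real N"
  \<comment> \<open>One constant serving \<open>f\<close>, \<open>fg\<close> and \<open>g\<close>
    simultaneously, as \<open>bigO_Sol_remainder\<close> requires.\<close>
  define M' where "M' = \<bar>M\<bar> + \<bar>D1\<bar> + \<bar>D2\<bar> + E * \<bar>D1\<bar>"
  have E: "0 \<le> E" by (simp add: E_def)
  have up: "norm z \<le> M' * norm t powr p" if "norm z \<le> d * norm t powr p" "\<bar>d\<bar> \<le> M'" for d and z t :: complex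
  proof -
    have "d * norm t powr p \<le> M' * norm t powr p" using that by (intro mult_right_mono) auto
    with that show ?thesis by linarith
  qed
  have gc: "continuous_on S g" "continuous_on S gd"
    unfolding g_def gd_def by (intro continuous_intros; use S_pos in auto)+
  have fgc: "continuous_on S fg"
    unfolding fg_def by (intro continuous_intros gc) (use S_pos in auto)
  have fgb: "norm (fg t) \<le> M' * norm t powr p" if t: "t \<in> S" for t
  proof (rule up)
    have t1: "1 \<le> norm t" by (rule far[OF t])
    have "norm (gd t / t) \<le> norm (gd t)"
      using t1 by (simp add: norm_divide divide_le_eq mult_left_le mult_le_cancel_left1)
    also have "\<dots> \<le> \<bar>D2\<bar> * norm t powr p"
      using D2[OF t] by (rule order_trans) (intro mult_right_mono, auto)
    finally have 1: "norm (gd t / t) \<le> \<bar>D2\<bar> * norm t powr p" .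
    have "norm (of_int k * (1 + \<sigma> / t) - of_nat N / t) \<le> \<bar>of_int k\<bar> * (1 + norm \<sigma>) + real N"
    proof (rule order_trans[OF norm_triangle_ineq4 add_mono])
      have "norm (1 + \<sigma> / t) \<le> 1 + norm \<sigma>"
      proof (rule order_trans[OF norm_triangle_ineq])
        show "norm (1::complex) + norm (\<sigma> / t) \<le> 1 + norm \<sigma>"
          using t1 by (simp add: norm_divide divide_le_eq mult_le_cancel_left1)
      qed
      then show "norm (of_int k * (1 + \<sigma> / t)) \<le> \<bar>of_int k\<bar> * (1 + norm \<sigma>)"
        unfolding norm_mult by (simp add: mult_left_mono)
      show "norm (of_nat N / t) \<le> real N"
        using t1 by (simp add: norm_divide divide_le_eq mult_le_cancel_left1)
    qed
    then have "norm ((of_int k * (1 + \<sigma> / t) - of_nat N / t) * g t) \<le> E * (\<bar>D1\<bar> * norm t powr p)"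
      unfolding norm_mult E_def
      by (intro mult_mono order_trans[OF D1[OF t]] mult_right_mono) auto
    with 1 show "norm (fg t) \<le> (\<bar>D2\<bar> + E * \<bar>D1\<bar>) * norm t powr p"
      unfolding fg_def by (intro order_trans[OF norm_triangle_ineq]) (simp add: algebra_simps)
  qed (use E in \<open>auto simp: M'_def\<close>)
  have g': "(g has_field_derivative fg t - (of_int k * (1 + \<sigma> / t) - of_nat N / t) * g t) (at t)" if t: "t \<in> S" for t
    using truncated_series_deriv[OF t, where p = p and J = J and u = u] by (simp add: fg_def g_def gd_def v_def)
  have rem: "bigO_on S (real p - real J) (\<lambda>t. f t - fg t)"
  proof (cases J)
    case 0
    then have "fg = (\<lambda>t. 0)" by (simp add: fg_def gd_def g_def fun_eq_iff)
    then show ?thesis using asyD[OF a, of 0] 0 by simp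
  next
    case (Suc J')
    define w where "w j = (of_nat p - of_nat j + of_int k * \<sigma> - of_nat N) * u j" for j
    have rec: "c 0 = of_int k * u 0" "c (Suc j) = of_int k * u (Suc j) + w j" for j
      using k by (simp_all add: u_def w_def)
    \<comment> \<open>By the recursion \<open>fg\<close> has the coefficients of \<open>f\<close>
      below order \<open>J\<close>. Apart from the remainder of \<open>f\<close>, the difference
      \<open>f - fg\<close> is the single term with coefficient \<open>w J'\<close>, of order
      \<open>x^(p - J)\<close>.\<close>
    have tele: "(\<Sum>j<Suc n. c j * s ^ j) = (\<Sum>j<Suc n. of_int k * u j * s ^ j) + s * (\<Sum>j<n. w j * s ^ j)" for n and s :: complex
      by (induction n) (simp_all add: rec algebra_simps)
    have e: "f t - fg t = (f t - t ^ p * (\<Sum>j<J. c j * inverse t ^ j)) + - w J' * (t ^ p * inverse t ^ J)" if t: "t \<in> S" for t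
    proof -
      have "fg t = t ^ p * ((\<Sum>j<J. of_int k * u j * inverse t ^ j) + inverse t * (\<Sum>j<J. w j * inverse t ^ j))"
        unfolding fg_def g_def gd_def v_def w_def
        by (simp add: algebra_simps sum.distrib sum_subtractf sum_distrib_left divide_inverse)
      also have "\<dots> = t ^ p * (\<Sum>j<J. c j * inverse t ^ j) + w J' * (t ^ p * inverse t ^ J)"
        unfolding Suc tele by (simp add: algebra_simps)
      finally show ?thesis by simp
    qed
    show ?thesis
      by (rule bigO_on_cong[OF bigO_on_add[OF asyD[OF a, of J] bigO_on_term] e]) simp_all
  qed
  show "bigO_on S (real p - real J) (\<lambda>x. Sol k N \<sigma> f x - x ^ p * (\<Sum>j<J. sol_coeff \<sigma> k N p c j * inverse x ^ j))"
  proof -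
    have "bigO_on S (real p - real J) (\<lambda>x. Sol k N \<sigma> f x - g x)"
    proof (rule bigO_Sol_remainder[OF \<sigma> _ q _ f(1) _ fgc _ _ g'])
      show "0 \<le> M'" using E by (simp add: M'_def)
      show "norm (f t) \<le> M' * norm t powr (real p - kap k)" if "t \<in> S" for t
        using f(2)[OF that] E by (simp add: kap) (rule up, auto simp: M'_def)
      show "norm (fg t) \<le> M' * norm t powr (real p - kap k)" if "t \<in> S" for t
        using fgb[OF that] by (simp add: kap)
      show "norm (g t) \<le> M' * norm t powr real p" if "t \<in> S" for t
        by (rule up[OF D1[OF that]]) (use E in \<open>auto simp: M'_def\<close>)
      show "bigO_on S (real p - real J - kap k) (\<lambda>t. f t - fg t)" using rem by (simp add: kap)
    qed auto
    then show ?thesis by (simp add: g_def u_def)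
  qed
qed

text \<open>For \<open>k = 0\<close> the equation \<open>g' - N g / x = f\<close> acts diagonally on
  powers: \<open>x^(p + 1 - j)\<close> is mapped to \<open>p + 1 - j - N\<close> times
  \<open>x^(p - j)\<close>. The divisor is never 0 because \<open>Suc p < N\<close>, and the
  solution is one power larger than \<open>f\<close>.\<close>

lemma asy_Sol_resonant:
  assumes \<sigma>: "\<sigma> \<in> A" and p: "Suc p < N"
    and f: "continuous_on S f" "\<And>t. t \<in> S \<Longrightarrow> norm (f t) \<le> M * norm t powr p" and a: "asy S p f c"
  shows "asy S (Suc p) (Sol 0 N \<sigma> f) (\<lambda>j. c j / (of_nat (Suc p) - of_nat j - of_nat N))"
  unfolding asy_def
proof
  fix J
  define u where "u j = c j / (of_nat (Suc p) - of_nat j - of_nat N)" for j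
  have uc: "u j * (of_nat (Suc p) - of_nat j - of_nat N) = c j" for j
  proof -
    have "of_nat (Suc p) \<noteq> (of_nat (j + N) :: complex)"
      using p by (subst of_nat_eq_iff) auto
    then have "of_nat (Suc p) - of_nat j - of_nat N \<noteq> (0 :: complex)"
      by (simp add: diff_diff_eq del: of_nat_Suc)
    then show ?thesis by (simp add: u_def del: of_nat_Suc)
  qed
  define g where "g = (\<lambda>t. t ^ Suc p * (\<Sum>j<J. u j * inverse t ^ j))"
  define fg where "fg = (\<lambda>t. t ^ p * (\<Sum>j<J. c j * inverse t ^ j))"
  have kap: "kap 0 = 1" by (simp add: kap_def)
  obtain D1 where D1: "\<And>t. t \<in> S \<Longrightarrow> norm (g t) \<le> D1 * norm t powr Suc p"
    using truncated_series_bound[where p = "Suc p" and J = J and u = u] by (auto simp: g_def)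
  obtain D2 where D2: "\<And>t. t \<in> S \<Longrightarrow> norm (fg t) \<le> D2 * norm t powr p"
    using truncated_series_bound[where p = p and J = J and u = c] by (auto simp: fg_def)
  define M' where "M' = \<bar>M\<bar> + \<bar>D1\<bar> + \<bar>D2\<bar>"
  have up: "norm z \<le> M' * norm t powr e" if "norm z \<le> d * norm t powr e" "\<bar>d\<bar> \<le> M'" for d e and z t :: complex
  proof -
    have "d * norm t powr e \<le> M' * norm t powr e" using that by (intro mult_right_mono) auto
    with that show ?thesis by linarith
  qed
  have fgc: "continuous_on S fg"
    unfolding fg_def by (intro continuous_intros) (use S_pos in auto)
  have g': "(g has_field_derivative fg t - (of_int 0 * (1 + \<sigma> / t) - of_nat N / t) * g t) (at t)" if t: "t \<in> S" for t
  proof -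
    have "t ^ Suc p * (\<Sum>j<J. u j * (of_nat (Suc p) - of_nat j) * inverse t ^ j) / t
       = t ^ p * (\<Sum>j<J. u j * (of_nat (Suc p) - of_nat j - of_nat N) * inverse t ^ j) + of_nat N / t * g t"
    proof -
      define a where "a = (of_nat (Suc p) :: complex)"
      have c: "t ^ Suc p * X / t = t ^ p * X" "of_nat N / t * (t ^ Suc p * X) = t ^ p * (of_nat N * X)" for X
        using S_pos(2)[OF t] by simp_all
      show ?thesis
        unfolding g_def c a_def[symmetric]
        by (simp add: algebra_simps sum.distrib sum_subtractf sum_distrib_left)
    qed
    then show ?thesis
      using truncated_series_deriv[OF t, where p = "Suc p" and J = J and u = u] by (simp add: uc fg_def g_def del: of_nat_Suc)
  qed
  have "bigO_on S (real (Suc p) - real J) (\<lambda>x. Sol 0 N \<sigma> f x - g x)"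
  proof (rule bigO_Sol_remainder[OF \<sigma> _ _ _ f(1) _ fgc _ _ g'])
    show "0 \<le> M'" by (simp add: M'_def)
    show "real (Suc p) \<le> real N - kap 0" using p by (simp add: kap)
    show "norm (f t) \<le> M' * norm t powr (real (Suc p) - kap 0)" if "t \<in> S" for t
      using f(2)[OF that] by (simp add: kap) (rule up, auto simp: M'_def)
    show "norm (fg t) \<le> M' * norm t powr (real (Suc p) - kap 0)" if "t \<in> S" for t
      using D2[OF that] by (simp add: kap) (rule up, auto simp: M'_def)
    show "norm (g t) \<le> M' * norm t powr real (Suc p)" if "t \<in> S" for t
      using D1[OF that] by (rule up) (auto simp: M'_def)
    show "bigO_on S (real (Suc p) - real J - kap 0) (\<lambda>t. f t - fg t)"
      using asyD[OF a, of J] by (simp add: kap fg_def)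
  qed auto
  then show "bigO_on S (real (Suc p) - real J) (\<lambda>x. Sol 0 N \<sigma> f x
      - x ^ Suc p * (\<Sum>j<J. c j / (of_nat (Suc p) - of_nat j - of_nat N) * inverse x ^ j))"
    by (simp add: g_def u_def)
qed

end

subsection \<open>The coefficient ring\<close>

lemma Q0_of_nat: "(\<lambda>c \<sigma>. of_nat n) \<in> Q0 \<theta>0 \<theta>x \<theta>inf"
  by (rule Q0_rat) simp

lemma Q0_of_int: "(\<lambda>c \<sigma>. of_int n) \<in> Q0 \<theta>0 \<theta>x \<theta>inf"
  by (rule Q0_rat) simp

lemma Q0_uminus: "f \<in> Q0 \<theta>0 \<theta>x \<theta>inf \<Longrightarrow> (\<lambda>c \<sigma>. - f c \<sigma>) \<in> Q0 \<theta>0 \<theta>x \<theta>inf"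
  using Q0_mult[OF Q0_rat[of "- 1"]] by simp

lemma Q0_diff:
  "f \<in> Q0 \<theta>0 \<theta>x \<theta>inf \<Longrightarrow> g \<in> Q0 \<theta>0 \<theta>x \<theta>inf \<Longrightarrow> (\<lambda>c \<sigma>. f c \<sigma> - g c \<sigma>) \<in> Q0 \<theta>0 \<theta>x \<theta>inf"
  using Q0_add[OF _ Q0_uminus] by simp

text \<open>Covers the divisions by \<open>of_int k\<close> and by integer differences in the
  coefficient formulas of the expansions.\<close>

lemma Q0_divide_rat:
  "f \<in> Q0 \<theta>0 \<theta>x \<theta>inf \<Longrightarrow> q \<in> \<rat> \<Longrightarrow> (\<lambda>c \<sigma>. f c \<sigma> / q) \<in> Q0 \<theta>0 \<theta>x \<theta>inf"
  using Q0_mult[OF _ Q0_rat[of "inverse q"]] by (simp add: divide_inverse)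

lemma Q0_sum: "(\<And>i. i \<in> I \<Longrightarrow> f i \<in> Q0 \<theta>0 \<theta>x \<theta>inf) \<Longrightarrow> (\<lambda>c \<sigma>. \<Sum>i\<in>I. f i c \<sigma>) \<in> Q0 \<theta>0 \<theta>x \<theta>inf"
proof (induction I rule: infinite_finite_induct)
  case (insert i I)
  then show ?case using Q0_add[of "f i" _ _ _ "\<lambda>c \<sigma>. \<Sum>i\<in>I. f i c \<sigma>"] by simp
qed (simp_all add: Q0_rat)

lemma Q0_power: "f \<in> Q0 \<theta>0 \<theta>x \<theta>inf \<Longrightarrow> (\<lambda>c \<sigma>. f c \<sigma> ^ n) \<in> Q0 \<theta>0 \<theta>x \<theta>inf"
  by (induction n) (auto intro: Q0_rat Q0_mult)

subsection \<open>Double power series with coefficients on the sector\<close>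

text \<open>\<open>X m n \<sigma> x\<close> is the coefficient of the monomial of degree \<open>m\<close> in \<open>c e^x x^(\<sigma>-1)\<close> and degree \<open>n\<close> in
  \<open>c^(-1) e^(-x) x^(-\<sigma>-1)\<close>; these two variables are treated as independent.\<close>

type_synonym arr = "nat \<Rightarrow> nat \<Rightarrow> complex \<Rightarrow> complex \<Rightarrow> complex"

definition conv :: "arr \<Rightarrow> arr \<Rightarrow> arr" where
  "conv X Y m n \<sigma> x = (\<Sum>i\<le>m. \<Sum>j\<le>n. X i j \<sigma> x * Y (m - i) (n - j) \<sigma> x)"

definition add :: "arr \<Rightarrow> arr \<Rightarrow> arr" where "add X Y m n \<sigma> x = X m n \<sigma> x + Y m n \<sigma> x"

definition neg :: "arr \<Rightarrow> arr" where "neg X m n \<sigma> x = - X m n \<sigma> x"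

definition cst :: "(complex \<Rightarrow> complex) \<Rightarrow> arr" where
  "cst e m n \<sigma> x = (if m = 0 \<and> n = 0 then e \<sigma> else 0)"

definition shiftX :: "arr \<Rightarrow> arr" where
  "shiftX X m n \<sigma> x = (if m = 0 then 0 else X (m - 1) n \<sigma> x)"

definition shiftY :: "arr \<Rightarrow> arr" where
  "shiftY X m n \<sigma> x = (if n = 0 then 0 else X m (n - 1) \<sigma> x)"

definition divx :: "arr \<Rightarrow> arr" where "divx X m n \<sigma> x = X m n \<sigma> x / x"

text \<open>The order allowed for right-hand sides: one less than \<open>min m n\<close> in the resonant case \<open>m = n\<close>.
  For \<open>m = n = 0\<close> the truncated subtraction is harmless, since there the right-hand sides vanish.\<close>

definition rexp :: "nat \<Rightarrow> nat \<Rightarrow> nat" where "rexp m n = (if m = n then n - 1 else min m n)"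

lemma sum_triangle_le:
  fixes f :: "nat \<Rightarrow> nat \<Rightarrow> real"
  assumes "\<And>i k. 0 \<le> f i k"
  shows "(\<Sum>m\<le>N. \<Sum>i\<le>m. f i (m - i)) \<le> (\<Sum>i\<le>N. \<Sum>k\<le>N. f i k)"
proof -
  have "(\<Sum>m\<le>N. \<Sum>i\<le>m. f i (m - i)) = (\<Sum>(i, k)\<in>{(i, k). i + k \<le> N}. f i k)"
    by (rule sum.triangle_reindex_eq[symmetric])
  also have "\<dots> \<le> (\<Sum>(i, k)\<in>{..N} \<times> {..N}. f i k)"
    by (rule sum_mono2) (use assms in auto)
  finally show ?thesis by (simp add: sum.cartesian_product)
qed

text \<open>The product of two square truncations contains all terms of the truncated convolution.
  Hence the weighted norm behind \<open>bnd\<close> is submultiplicative.\<close>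

lemma sum_conv_le:
  fixes a b :: "nat \<Rightarrow> nat \<Rightarrow> real"
  assumes a: "\<And>i j. 0 \<le> a i j" and b: "\<And>i j. 0 \<le> b i j"
  shows "(\<Sum>m\<le>N. \<Sum>n\<le>N. \<Sum>i\<le>m. \<Sum>j\<le>n. a i j * b (m - i) (n - j))
    \<le> (\<Sum>i\<le>N. \<Sum>j\<le>N. a i j) * (\<Sum>i\<le>N. \<Sum>j\<le>N. b i j)"
proof -
  have "(\<Sum>m\<le>N. \<Sum>n\<le>N. \<Sum>i\<le>m. \<Sum>j\<le>n. a i j * b (m - i) (n - j))
      = (\<Sum>m\<le>N. \<Sum>i\<le>m. \<Sum>n\<le>N. \<Sum>j\<le>n. a i j * b (m - i) (n - j))"
    by (intro sum.cong refl sum.swap)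
  also have "\<dots> \<le> (\<Sum>i\<le>N. \<Sum>k\<le>N. \<Sum>n\<le>N. \<Sum>j\<le>n. a i j * b k (n - j))"
    by (rule sum_triangle_le[where f = "\<lambda>i k. \<Sum>n\<le>N. \<Sum>j\<le>n. a i j * b k (n - j)"])
      (intro sum_nonneg mult_nonneg_nonneg a b)
  also have "\<dots> \<le> (\<Sum>i\<le>N. \<Sum>k\<le>N. \<Sum>j\<le>N. \<Sum>l\<le>N. a i j * b k l)"
    by (intro sum_mono sum_triangle_le mult_nonneg_nonneg a b)
  also have "\<dots> = (\<Sum>i\<le>N. \<Sum>j\<le>N. \<Sum>k\<le>N. \<Sum>l\<le>N. a i j * b k l)"
    by (intro sum.cong refl sum.swap)
  also have "\<dots> = (\<Sum>i\<le>N. \<Sum>j\<le>N. a i j * (\<Sum>i\<le>N. \<Sum>j\<le>N. b i j))"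
    by (simp add: sum_distrib_left)
  finally show ?thesis by (simp only: sum_distrib_right)
qed

section \<open>Weighted majorants for double series\<close>

locale pv_arrays = far_sector \<delta> r Smax A for \<delta> r Smax A +
  fixes \<theta>0 \<theta>x \<theta>inf :: complex and \<epsilon> :: real
  assumes \<epsilon>: "0 < \<epsilon>"
begin

abbreviation "Q \<equiv> Q0 \<theta>0 \<theta>x \<theta>inf"

text \<open>The same ring elements serve for all \<sigma>. Arrays do not involve \<open>c\<close>;
  the quantifier over \<open>c\<close> merely matches the two arguments of elements of
  \<open>Q\<close>.\<close>

definition ASY :: "nat \<Rightarrow> (complex \<Rightarrow> complex \<Rightarrow> complex) \<Rightarrow> bool" where
  "ASY p g \<longleftrightarrow> (\<exists>f. (\<forall>j. f j \<in> Q) \<and> (\<forall>c. \<forall>\<sigma>\<in>A. asy S p (g \<sigma>) (\<lambda>j. f j c \<sigma>)))"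

lemma ASY_zero: "ASY p (\<lambda>\<sigma> x. 0)"
  unfolding ASY_def by (rule exI[of _ "\<lambda>j c \<sigma>. 0"]) (auto intro: asy_zero Q0_rat)

lemma ASY_param: assumes "(\<lambda>c \<sigma>. e \<sigma>) \<in> Q" shows "ASY 0 (\<lambda>\<sigma> x. e \<sigma>)"
  unfolding ASY_def
proof (intro exI conjI allI ballI)
  show "(if j = 0 then (\<lambda>c \<sigma>. e \<sigma>) else (\<lambda>c \<sigma>. 0)) \<in> Q" for j :: nat
    using assms by (auto intro: Q0_rat)
  show "asy S 0 (\<lambda>x. e \<sigma>) (\<lambda>j. (if j = 0 then (\<lambda>c \<sigma>. e \<sigma>) else (\<lambda>c \<sigma>. 0)) c \<sigma>)" for c \<sigma>
    using asy_const[of "e \<sigma>"] by (auto cong: if_cong simp: if_distrib[of "\<lambda>f. f c \<sigma>"])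
qed

lemma ASY_add: assumes "ASY p g" "ASY p h" shows "ASY p (\<lambda>\<sigma> x. g \<sigma> x + h \<sigma> x)"
proof -
  obtain f e where "\<And>j. f j \<in> Q" "\<And>c \<sigma>. \<sigma> \<in> A \<Longrightarrow> asy S p (g \<sigma>) (\<lambda>j. f j c \<sigma>)"
    "\<And>j. e j \<in> Q" "\<And>c \<sigma>. \<sigma> \<in> A \<Longrightarrow> asy S p (h \<sigma>) (\<lambda>j. e j c \<sigma>)"
    using assms unfolding ASY_def by metis
  then show ?thesis unfolding ASY_def
    by (intro exI[of _ "\<lambda>j c \<sigma>. f j c \<sigma> + e j c \<sigma>"]) (auto intro: Q0_add asy_add)
qed

lemma ASY_sum: "(\<And>i. i \<in> I \<Longrightarrow> ASY p (g i)) \<Longrightarrow> ASY p (\<lambda>\<sigma> x. \<Sum>i\<in>I. g i \<sigma> x)"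
  by (induction I rule: infinite_finite_induct) (auto intro: ASY_zero ASY_add)

lemma ASY_mult: assumes "ASY p g" "ASY q h" shows "ASY (p + q) (\<lambda>\<sigma> x. g \<sigma> x * h \<sigma> x)"
proof -
  obtain f e where "\<And>j. f j \<in> Q" "\<And>c \<sigma>. \<sigma> \<in> A \<Longrightarrow> asy S p (g \<sigma>) (\<lambda>j. f j c \<sigma>)"
    "\<And>j. e j \<in> Q" "\<And>c \<sigma>. \<sigma> \<in> A \<Longrightarrow> asy S q (h \<sigma>) (\<lambda>j. e j c \<sigma>)"
    using assms unfolding ASY_def by metis
  then show ?thesis unfolding ASY_def
    by (intro exI[of _ "\<lambda>j c \<sigma>. \<Sum>i\<le>j. f i c \<sigma> * e (j - i) c \<sigma>"]) (auto intro!: Q0_sum Q0_mult asy_mult)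
qed

lemma ASY_uminus: assumes "ASY p g" shows "ASY p (\<lambda>\<sigma> x. - g \<sigma> x)"
  using ASY_mult[OF ASY_param[of "\<lambda>_. - 1"] assms] by (simp add: Q0_rat)

lemma ASY_raise: assumes "ASY p g" "p \<le> q" shows "ASY q g"
proof -
  obtain f where "\<And>j. f j \<in> Q" "\<And>c \<sigma>. \<sigma> \<in> A \<Longrightarrow> asy S p (g \<sigma>) (\<lambda>j. f j c \<sigma>)"
    using assms(1) unfolding ASY_def by metis
  moreover from this(2) have "\<sigma> \<in> A \<Longrightarrow> asy S q (g \<sigma>) (\<lambda>j. if j < q - p then 0 else f (j - (q - p)) c \<sigma>)" for c \<sigma>
    using asy_raise[of p "g \<sigma>" "\<lambda>j. f j c \<sigma>" "q - p"] assms(2) by simp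
  ultimately show ?thesis unfolding ASY_def
    by (intro exI[of _ "\<lambda>j. if j < q - p then (\<lambda>c \<sigma>. 0) else f (j - (q - p))"])
      (auto intro: Q0_rat cong: if_cong simp: if_distrib[of "\<lambda>f. f _ _"])
qed

lemma ASY_divide_x: assumes "ASY p g" shows "ASY (p - 1) (\<lambda>\<sigma> x. g \<sigma> x / x)"
proof -
  have *: "ASY p' (\<lambda>\<sigma> x. g \<sigma> x / x)" if "ASY (Suc p') g" for p'
    using that asy_divide_x unfolding ASY_def by meson
  show ?thesis
  proof (cases p)
    \<comment> \<open>The quotient is recorded with leading power \<open>x^0\<close> although its
      constant coefficient vanishes: the expansion is first raised to \<open>x^1\<close>.\<close>
    case 0
    then show ?thesis using *[OF ASY_raise[OF assms]] by simp
  next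
    case (Suc p')
    then show ?thesis using * assms by simp
  qed
qed

lemma Q0_sol_coeff:
  assumes f: "\<And>j. f j \<in> Q"
  shows "(\<lambda>c \<sigma>. sol_coeff \<sigma> k N p (\<lambda>j. f j c \<sigma>) j) \<in> Q"
proof (induction j)
  case 0
  show ?case unfolding sol_coeff.simps by (intro Q0_divide_rat f) simp
next
  case (Suc j)
  show ?case
    unfolding sol_coeff.simps
    by (intro Q0_divide_rat Q0_diff Q0_mult Q0_add f Suc Q0_of_nat Q0_of_int Q0_sigma) simp
qed

text \<open>\<open>R\<close> bounds a weighted \<open>l^1\<close> norm with radius \<epsilon> in
  both variables. Bounding finite square sums avoids any summability condition and is directly
  compatible with limits taken degree by degree.\<close>

definition bnd :: "(nat \<Rightarrow> nat \<Rightarrow> nat) \<Rightarrow> real \<Rightarrow> arr \<Rightarrow> bool" where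
  "bnd w R X \<longleftrightarrow> (\<exists>M. (\<forall>m n. 0 \<le> M m n) \<and>
     (\<forall>m n. \<forall>\<sigma>\<in>A. \<forall>x\<in>S. norm (X m n \<sigma> x) \<le> M m n * norm x ^ w m n) \<and>
     (\<forall>N. (\<Sum>m\<le>N. \<Sum>n\<le>N. M m n * \<epsilon> ^ (m + n)) \<le> R))"

definition good :: "(nat \<Rightarrow> nat \<Rightarrow> nat) \<Rightarrow> real \<Rightarrow> arr \<Rightarrow> bool" where
  "good w R X \<longleftrightarrow> (\<forall>m n. hol2 A S (X m n) \<and> ASY (w m n) (X m n)) \<and> bnd w R X"

lemma good_bnd: "good w R X \<Longrightarrow> bnd w R X"
  by (simp add: good_def)

lemma bndE:
  assumes "bnd w R X"
  obtains M where "\<And>m n. 0 \<le> M m n"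
    "\<And>m n \<sigma> x. \<sigma> \<in> A \<Longrightarrow> x \<in> S \<Longrightarrow> norm (X m n \<sigma> x) \<le> M m n * norm x ^ w m n"
    "\<And>N. (\<Sum>m\<le>N. \<Sum>n\<le>N. M m n * \<epsilon> ^ (m + n)) \<le> R"
proof -
  from assms obtain M where "\<forall>m n. 0 \<le> M m n"
    "\<forall>m n. \<forall>\<sigma>\<in>A. \<forall>x\<in>S. norm (X m n \<sigma> x) \<le> M m n * norm x ^ w m n"
    "\<forall>N. (\<Sum>m\<le>N. \<Sum>n\<le>N. M m n * \<epsilon> ^ (m + n)) \<le> R"
    unfolding bnd_def by blast
  then show thesis by (intro that[of M]) auto
qed

lemma bndI:
  assumes "\<And>m n. 0 \<le> M m n"
    "\<And>m n \<sigma> x. \<sigma> \<in> A \<Longrightarrow> x \<in> S \<Longrightarrow> norm (X m n \<sigma> x) \<le> M m n * norm x ^ w m n"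
    "\<And>N. (\<Sum>m\<le>N. \<Sum>n\<le>N. M m n * \<epsilon> ^ (m + n)) \<le> R"
  shows "bnd w R X"
  using assms unfolding bnd_def by (intro exI[of _ M]) auto

lemma bnd_mono: assumes "bnd w R X" "R \<le> R'" shows "bnd w R' X"
proof -
  obtain M where "\<And>m n. 0 \<le> M m n"
    "\<And>m n \<sigma> x. \<sigma> \<in> A \<Longrightarrow> x \<in> S \<Longrightarrow> norm (X m n \<sigma> x) \<le> M m n * norm x ^ w m n"
    "\<And>N. (\<Sum>m\<le>N. \<Sum>n\<le>N. M m n * \<epsilon> ^ (m + n)) \<le> R" using bndE[OF assms(1)] by blast
  then show ?thesis by (intro bndI[of M]) (auto intro: order_trans[OF _ assms(2)])
qed

lemma good_mono: "good w R X \<Longrightarrow> R \<le> R' \<Longrightarrow> good w R' X"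
  unfolding good_def using bnd_mono by blast

lemma bnd_nonneg: "bnd w R X \<Longrightarrow> 0 \<le> R"
proof (erule bndE)
  fix M assume M: "\<And>m n. 0 \<le> M m n" "\<And>N. (\<Sum>m\<le>N. \<Sum>n\<le>N. M m n * \<epsilon> ^ (m + n)) \<le> R"
  have "0 \<le> M 0 0 * \<epsilon> ^ (0 + 0)" using M(1)[of 0 0] by simp
  also have "\<dots> \<le> R" using M(2)[of 0] by simp
  finally show "0 \<le> R" .
qed

lemma bnd_add: assumes "bnd w R X" "bnd w R' Y" shows "bnd w (R + R') (add X Y)"
proof -
  obtain M1 where M1: "\<And>m n. 0 \<le> M1 m n"
    "\<And>m n \<sigma> x. \<sigma> \<in> A \<Longrightarrow> x \<in> S \<Longrightarrow> norm (X m n \<sigma> x) \<le> M1 m n * norm x ^ w m n"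
    "\<And>N. (\<Sum>m\<le>N. \<Sum>n\<le>N. M1 m n * \<epsilon> ^ (m + n)) \<le> R" using bndE[OF assms(1)] by blast
  obtain M2 where M2: "\<And>m n. 0 \<le> M2 m n"
    "\<And>m n \<sigma> x. \<sigma> \<in> A \<Longrightarrow> x \<in> S \<Longrightarrow> norm (Y m n \<sigma> x) \<le> M2 m n * norm x ^ w m n"
    "\<And>N. (\<Sum>m\<le>N. \<Sum>n\<le>N. M2 m n * \<epsilon> ^ (m + n)) \<le> R'" using bndE[OF assms(2)] by blast
  show ?thesis
  proof (rule bndI[of "\<lambda>m n. M1 m n + M2 m n"])
    show "norm (add X Y m n \<sigma> x) \<le> (M1 m n + M2 m n) * norm x ^ w m n" if "\<sigma> \<in> A" "x \<in> S" for m n \<sigma> x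
      unfolding add_def using M1(2)[OF that] M2(2)[OF that]
      by (intro order_trans[OF norm_triangle_ineq]) (simp add: distrib_right add_mono)
    show "(\<Sum>m\<le>N. \<Sum>n\<le>N. (M1 m n + M2 m n) * \<epsilon> ^ (m + n)) \<le> R + R'" for N
      using M1(3)[of N] M2(3)[of N] by (simp add: distrib_right sum.distrib)
  qed (use M1 M2 in auto)
qed

lemma good_add: "good w R X \<Longrightarrow> good w R' Y \<Longrightarrow> good w (R + R') (add X Y)"
  using bnd_add unfolding good_def add_def[abs_def] by (auto intro: hol2_add ASY_add)

lemma good_neg: "good w R X \<Longrightarrow> good w R (neg X)"
  unfolding good_def neg_def[abs_def] by (auto intro: hol2_minus ASY_uminus simp: bnd_def)

lemma bnd_conv: assumes "bnd min R X" "bnd min R' Y" shows "bnd min (R * R') (conv X Y)"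
proof -
  obtain M1 where M1: "\<And>m n. 0 \<le> M1 m n"
    "\<And>m n \<sigma> x. \<sigma> \<in> A \<Longrightarrow> x \<in> S \<Longrightarrow> norm (X m n \<sigma> x) \<le> M1 m n * norm x ^ min m n"
    "\<And>N. (\<Sum>m\<le>N. \<Sum>n\<le>N. M1 m n * \<epsilon> ^ (m + n)) \<le> R" using bndE[OF assms(1)] by blast
  obtain M2 where M2: "\<And>m n. 0 \<le> M2 m n"
    "\<And>m n \<sigma> x. \<sigma> \<in> A \<Longrightarrow> x \<in> S \<Longrightarrow> norm (Y m n \<sigma> x) \<le> M2 m n * norm x ^ min m n"
    "\<And>N. (\<Sum>m\<le>N. \<Sum>n\<le>N. M2 m n * \<epsilon> ^ (m + n)) \<le> R'" using bndE[OF assms(2)] by blast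
  show ?thesis
  proof (rule bndI[of "\<lambda>m n. \<Sum>i\<le>m. \<Sum>j\<le>n. M1 i j * M2 (m - i) (n - j)"])
    show "0 \<le> (\<Sum>i\<le>m. \<Sum>j\<le>n. M1 i j * M2 (m - i) (n - j))" for m n
      by (intro sum_nonneg mult_nonneg_nonneg M1 M2)
    show "norm (conv X Y m n \<sigma> x) \<le> (\<Sum>i\<le>m. \<Sum>j\<le>n. M1 i j * M2 (m - i) (n - j)) * norm x ^ min m n"
      if \<sigma>: "\<sigma> \<in> A" and x: "x \<in> S" for m n \<sigma> x
      unfolding conv_def sum_distrib_right
    proof (intro order_trans[OF norm_sum] sum_mono)
      fix i j assume ij: "i \<in> {..m}" "j \<in> {..n}"
      have "norm (X i j \<sigma> x * Y (m - i) (n - j) \<sigma> x)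
          \<le> (M1 i j * norm x ^ min i j) * (M2 (m - i) (n - j) * norm x ^ min (m - i) (n - j))"
        unfolding norm_mult by (intro mult_mono M1 M2 \<sigma> x mult_nonneg_nonneg) auto
      also have "\<dots> = M1 i j * M2 (m - i) (n - j) * norm x ^ (min i j + min (m - i) (n - j))"
        by (simp add: power_add mult_ac)
      \<comment> \<open>\<open>min\<close> is superadditive, and \<open>norm x\<close> is at least
        1.\<close>
      also have "\<dots> \<le> M1 i j * M2 (m - i) (n - j) * norm x ^ min m n"
        using ij by (intro mult_left_mono power_increasing far x mult_nonneg_nonneg M1 M2) auto
      finally show "norm (X i j \<sigma> x * Y (m - i) (n - j) \<sigma> x) \<le> M1 i j * M2 (m - i) (n - j) * norm x ^ min m n" .
    qed
    fix N :: nat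
    have "(\<Sum>m\<le>N. \<Sum>n\<le>N. (\<Sum>i\<le>m. \<Sum>j\<le>n. M1 i j * M2 (m - i) (n - j)) * \<epsilon> ^ (m + n))
        = (\<Sum>m\<le>N. \<Sum>n\<le>N. \<Sum>i\<le>m. \<Sum>j\<le>n. (M1 i j * \<epsilon> ^ (i + j)) * (M2 (m - i) (n - j) * \<epsilon> ^ (m - i + (n - j))))"
      unfolding sum_distrib_right
    proof (intro sum.cong refl)
      fix m n i j :: nat assume "i \<in> {..m}" "j \<in> {..n}"
      then have "\<epsilon> ^ (m + n) = \<epsilon> ^ (i + j) * \<epsilon> ^ (m - i + (n - j))" by (simp flip: power_add)
      then show "M1 i j * M2 (m - i) (n - j) * \<epsilon> ^ (m + n)
          = (M1 i j * \<epsilon> ^ (i + j)) * (M2 (m - i) (n - j) * \<epsilon> ^ (m - i + (n - j)))" by simp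
    qed
    also have "\<dots> \<le> (\<Sum>i\<le>N. \<Sum>j\<le>N. M1 i j * \<epsilon> ^ (i + j)) * (\<Sum>i\<le>N. \<Sum>j\<le>N. M2 i j * \<epsilon> ^ (i + j))"
      using \<epsilon> M1(1) M2(1) by (intro sum_conv_le[where a = "\<lambda>i j. M1 i j * \<epsilon> ^ (i + j)"
            and b = "\<lambda>i j. M2 i j * \<epsilon> ^ (i + j)"]) auto
    also have "\<dots> \<le> R * R'"
      using \<epsilon> M1 M2 bnd_nonneg[OF assms(1)] by (intro mult_mono sum_nonneg) auto
    finally show "(\<Sum>m\<le>N. \<Sum>n\<le>N. (\<Sum>i\<le>m. \<Sum>j\<le>n. M1 i j * M2 (m - i) (n - j)) * \<epsilon> ^ (m + n)) \<le> R * R'" .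
  qed
qed

lemma good_conv: assumes "good min R X" "good min R' Y" shows "good min (R * R') (conv X Y)"
  unfolding good_def
proof (intro conjI allI)
  show "bnd min (R * R') (conv X Y)" using assms bnd_conv by (auto simp: good_def)
  fix m n
  show "hol2 A S (conv X Y m n)"
    unfolding conv_def[abs_def] using assms by (intro hol2_sum hol2_mult) (auto simp: good_def)
  show "ASY (min m n) (conv X Y m n)"
    unfolding conv_def[abs_def]
  proof (intro ASY_sum)
    fix i j assume "i \<in> {..m}" "j \<in> {..n}"
    then have "min i j + min (m - i) (n - j) \<le> min m n" by auto
    moreover have "ASY (min i j + min (m - i) (n - j)) (\<lambda>\<sigma> x. X i j \<sigma> x * Y (m - i) (n - j) \<sigma> x)"
      using assms by (intro ASY_mult) (auto simp: good_def)
    ultimately show "ASY (min m n) (\<lambda>\<sigma> x. X i j \<sigma> x * Y (m - i) (n - j) \<sigma> x)"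
      using ASY_raise by blast
  qed
qed

lemma good_cst:
  assumes "(\<lambda>c \<sigma>. e \<sigma>) \<in> Q" "e holomorphic_on A" "\<And>\<sigma>. \<sigma> \<in> A \<Longrightarrow> norm (e \<sigma>) \<le> K" "0 \<le> K"
  shows "good min K (cst e)"
  unfolding good_def
proof (intro conjI allI)
  fix m n
  have c: "cst e m n = (if m = 0 \<and> n = 0 then (\<lambda>\<sigma> x. e \<sigma>) else (\<lambda>\<sigma> x. 0))"
    by (simp add: cst_def fun_eq_iff)
  show "hol2 A S (cst e m n)" unfolding c using assms by (auto intro: hol2_param hol2_const)
  show "ASY (min m n) (cst e m n)" unfolding c using assms by (auto intro: ASY_param ASY_zero)
next
  show "bnd min K (cst e)"
  proof (rule bndI[of "\<lambda>m n. if m = 0 \<and> n = 0 then K else 0"])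
    fix N :: nat
    have "(\<Sum>m\<le>N. \<Sum>n\<le>N. (if m = 0 \<and> n = 0 then K else 0) * \<epsilon> ^ (m + n))
        = (\<Sum>m\<le>N. \<Sum>n\<le>N. if n = 0 then (if m = 0 then K else 0) else 0)"
      by (intro sum.cong) auto
    also have "\<dots> = K" by (simp add: sum.delta')
    finally show "(\<Sum>m\<le>N. \<Sum>n\<le>N. (if m = 0 \<and> n = 0 then K else 0) * \<epsilon> ^ (m + n)) \<le> K" by simp
  qed (use assms in \<open>auto simp: cst_def\<close>)
qed

lemma sum_shift_le:
  fixes f :: "nat \<Rightarrow> real" assumes "\<And>i. 0 \<le> f i"
  shows "(\<Sum>m\<le>N. if m = 0 then 0 else f (m - 1)) \<le> (\<Sum>m\<le>N. f m)"
proof -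
  have "(\<Sum>m\<le>N. if m = 0 then 0 else f (m - 1)) = (\<Sum>m<N. f m)"
    by (subst lessThan_Suc_atMost[symmetric], subst sum.lessThan_Suc_shift) simp
  also have "\<dots> \<le> (\<Sum>m\<le>N. f m)" by (rule sum_mono2) (use assms in auto)
  finally show ?thesis .
qed

text \<open>On the diagonal the shift lowers \<open>min\<close> by one, which is just the order
  demanded by \<open>rexp\<close>; so shifted arrays are admissible right-hand sides. The factor
  \<epsilon> is the source of smallness in the iteration.\<close>

lemma good_shiftX: assumes "good min R X" shows "good rexp (\<epsilon> * R) (shiftX X)"
  unfolding good_def
proof (intro conjI allI)
  have w: "min (m - 1) n \<le> rexp m n" if "m \<noteq> 0" for m n :: nat
    using that by (auto simp: rexp_def)
  fix m n
  have c: "shiftX X m n = (if m = 0 then (\<lambda>\<sigma> x. 0) else X (m - 1) n)"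
    by (simp add: shiftX_def fun_eq_iff)
  show "hol2 A S (shiftX X m n)" unfolding c using assms by (auto intro: hol2_const simp: good_def)
  show "ASY (rexp m n) (shiftX X m n)"
  proof (cases "m = 0")
    case False
    have "ASY (min (m - 1) n) (X (m - 1) n)" using assms by (simp add: good_def)
    then show ?thesis unfolding c if_not_P[OF False] using w[OF False] by (rule ASY_raise)
  next
    case True
    then show ?thesis unfolding c by (simp add: ASY_zero)
  qed
next
  have w: "min (m - 1) n \<le> rexp m n" if "m \<noteq> 0" for m n :: nat
    using that by (auto simp: rexp_def)
  obtain M where M: "\<And>m n. 0 \<le> M m n"
    "\<And>m n \<sigma> x. \<sigma> \<in> A \<Longrightarrow> x \<in> S \<Longrightarrow> norm (X m n \<sigma> x) \<le> M m n * norm x ^ min m n"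
    "\<And>N. (\<Sum>m\<le>N. \<Sum>n\<le>N. M m n * \<epsilon> ^ (m + n)) \<le> R" using bndE[OF good_bnd[OF assms]] by blast
  show "bnd rexp (\<epsilon> * R) (shiftX X)"
  proof (rule bndI[of "\<lambda>m n. if m = 0 then 0 else M (m - 1) n"])
    show "norm (shiftX X m n \<sigma> x) \<le> (if m = 0 then 0 else M (m - 1) n) * norm x ^ rexp m n"
      if "\<sigma> \<in> A" "x \<in> S" for m n \<sigma> x
    proof (cases "m = 0")
      case False
      have "norm (X (m - 1) n \<sigma> x) \<le> M (m - 1) n * norm x ^ min (m - 1) n" by (rule M(2)[OF that])
      also have "\<dots> \<le> M (m - 1) n * norm x ^ rexp m n"
        using w[OF False] by (intro mult_left_mono power_increasing far that M)
      finally show ?thesis using False by (simp add: shiftX_def)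
    qed (simp add: shiftX_def)
    fix N :: nat
    have "(\<Sum>m\<le>N. \<Sum>n\<le>N. (if m = 0 then 0 else M (m - 1) n) * \<epsilon> ^ (m + n))
        = (\<Sum>m\<le>N. if m = 0 then 0 else \<epsilon> * (\<Sum>n\<le>N. M (m - 1) n * \<epsilon> ^ (m - 1 + n)))"
    proof (intro sum.cong refl)
      fix m
      show "(\<Sum>n\<le>N. (if m = 0 then 0 else M (m - 1) n) * \<epsilon> ^ (m + n))
        = (if m = 0 then 0 else \<epsilon> * (\<Sum>n\<le>N. M (m - 1) n * \<epsilon> ^ (m - 1 + n)))"
        by (cases m) (simp_all add: sum_distrib_left mult_ac)
    qed
    also have "\<dots> \<le> (\<Sum>m\<le>N. \<epsilon> * (\<Sum>n\<le>N. M m n * \<epsilon> ^ (m + n)))"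
      using \<epsilon> M(1) by (intro sum_shift_le mult_nonneg_nonneg sum_nonneg) auto
    also have "\<dots> = \<epsilon> * (\<Sum>m\<le>N. \<Sum>n\<le>N. M m n * \<epsilon> ^ (m + n))" by (simp add: sum_distrib_left)
    also have "\<dots> \<le> \<epsilon> * R" using \<epsilon> M(3) by (intro mult_left_mono) auto
    finally show "(\<Sum>m\<le>N. \<Sum>n\<le>N. (if m = 0 then 0 else M (m - 1) n) * \<epsilon> ^ (m + n)) \<le> \<epsilon> * R" .
  qed (use M in auto)
qed

text \<open>Exchanging the two variables reduces statements about the second one to the
  first.\<close>

definition swap :: "arr \<Rightarrow> arr" where "swap X m n = X n m"

lemma good_swap: assumes "good w R X" "\<And>m n. w n m = w m n" shows "good w R (swap X)"
  unfolding good_def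
proof (intro conjI allI)
  obtain M where M: "\<And>m n. 0 \<le> M m n"
    "\<And>m n \<sigma> x. \<sigma> \<in> A \<Longrightarrow> x \<in> S \<Longrightarrow> norm (X m n \<sigma> x) \<le> M m n * norm x ^ w m n"
    "\<And>N. (\<Sum>m\<le>N. \<Sum>n\<le>N. M m n * \<epsilon> ^ (m + n)) \<le> R" using bndE[OF good_bnd[OF assms(1)]] by blast
  show "bnd w R (swap X)"
  proof (rule bndI[of "\<lambda>m n. M n m"])
    show "(\<Sum>m\<le>N. \<Sum>n\<le>N. M n m * \<epsilon> ^ (m + n)) \<le> R" for N
      using M(3)[of N] by (subst sum.swap) (simp add: add.commute)
    show "norm (swap X m n \<sigma> x) \<le> M n m * norm x ^ w m n" if "\<sigma> \<in> A" "x \<in> S" for m n \<sigma> x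
      using M(2)[OF that, of n m] by (simp add: swap_def assms(2)[of m n])
  qed (use M in auto)
  show "hol2 A S (swap X m n)" "ASY (w m n) (swap X m n)" for m n
    using assms(1) unfolding good_def swap_def by (blast, metis assms(2))
qed

lemma shiftY_swap: "shiftY X = swap (shiftX (swap X))"
  by (simp add: swap_def shiftX_def shiftY_def fun_eq_iff)

lemma good_shiftY: "good min R X \<Longrightarrow> good rexp (\<epsilon> * R) (shiftY X)"
  unfolding shiftY_swap
  by (intro good_swap good_shiftX) (auto simp: min.commute rexp_def)

text \<open>Division by \<open>x\<close> supplies the missing power on the diagonal but no factor
  \<epsilon>. For this reason \<open>u\<close>, to which it is applied, has to be small
  itself.\<close>

lemma good_divx: assumes "good min R X" shows "good rexp R (divx X)"
  unfolding good_def
proof (intro conjI allI)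
  have w: "min m n - 1 \<le> rexp m n" for m n by (auto simp: rexp_def)
  fix m n
  have "hol2 A S (\<lambda>\<sigma> x. X m n \<sigma> x * inverse x)"
    using assms S_pos by (intro hol2_mult hol2_var holomorphic_intros) (auto simp: good_def)
  then show "hol2 A S (divx X m n)" by (simp add: divx_def[abs_def] divide_inverse)
  have "ASY (min m n - 1) (divx X m n)"
    unfolding divx_def[abs_def] using assms by (intro ASY_divide_x) (auto simp: good_def)
  then show "ASY (rexp m n) (divx X m n)" using w ASY_raise by blast
next
  obtain M where M: "\<And>m n. 0 \<le> M m n"
    "\<And>m n \<sigma> x. \<sigma> \<in> A \<Longrightarrow> x \<in> S \<Longrightarrow> norm (X m n \<sigma> x) \<le> M m n * norm x ^ min m n"
    "\<And>N. (\<Sum>m\<le>N. \<Sum>n\<le>N. M m n * \<epsilon> ^ (m + n)) \<le> R" using bndE[OF good_bnd[OF assms]] by blast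
  show "bnd rexp R (divx X)"
  proof (rule bndI[OF M(1) _ M(3)])
    fix m n \<sigma> x assume \<sigma>: "\<sigma> \<in> A" and x: "x \<in> S"
    have "norm (divx X m n \<sigma> x) \<le> M m n * norm x ^ min m n / norm x"
      unfolding divx_def norm_divide by (intro divide_right_mono M \<sigma> x) simp
    also have "\<dots> = M m n * (norm x ^ min m n / norm x)" by simp
    also have "\<dots> \<le> M m n * norm x ^ rexp m n"
    proof (rule mult_left_mono[OF _ M(1)])
      have x1: "1 \<le> norm x" by (rule far[OF x])
      then have "norm x ^ min m n \<le> norm x ^ Suc (rexp m n)"
        by (intro power_increasing) (auto simp: rexp_def)
      then show "norm x ^ min m n / norm x \<le> norm x ^ rexp m n" using S_pos(1)[OF x] by (simp add: field_simps)
    qed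
    finally show "norm (divx X m n \<sigma> x) \<le> M m n * norm x ^ rexp m n" .
  qed
qed

text \<open>The inverse of \<open>d/dx\<close> on double series without constant term; the linear equation of \<open>Sol\<close> arises from
  the logarithmic derivatives \<open>1 + (\<sigma>-1)/x\<close> and \<open>-1 - (\<sigma>+1)/x\<close> of the two variables.\<close>

definition Lop :: "arr \<Rightarrow> arr" where
  "Lop F m n \<sigma> x = (if m = 0 \<and> n = 0 then 0 else Sol (int m - int n) (m + n) \<sigma> (F m n \<sigma>) x)"

lemma rexp_powr:
  assumes "x \<in> S" "m \<noteq> 0 \<or> n \<noteq> 0"
  shows "norm x ^ rexp m n = norm x powr (real (min m n) - kap (int m - int n))"
proof -
  have "real (rexp m n) = real (min m n) - kap (int m - int n)"
    using assms(2) by (auto simp: rexp_def kap_def of_nat_diff)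
  then show ?thesis using S_pos(1)[OF assms(1)] by (metis powr_realpow)
qed

text \<open>The order condition \<open>q \<le> real N - kap k\<close> of the ray estimates for
  \<open>N = m + n\<close>. On the diagonal it reads \<open>n \<le> 2 n - 1\<close>.\<close>

lemma min_le_kap: "m \<noteq> 0 \<or> n \<noteq> 0 \<Longrightarrow> real (min m n) \<le> real (m + n) - kap (int m - int n)"
  by (auto simp: kap_def)

text \<open>Every coefficient is estimated with the same constant, so the majorant as a whole is
  multiplied by \<open>4 / slope \<delta>\<close>.\<close>

lemma good_Lop: assumes "good rexp R F" shows "good min (4 / slope \<delta> * R) (Lop F)"
  unfolding good_def
proof (intro conjI allI)
  obtain M where M: "\<And>m n. 0 \<le> M m n"
    "\<And>m n \<sigma> x. \<sigma> \<in> A \<Longrightarrow> x \<in> S \<Longrightarrow> norm (F m n \<sigma> x) \<le> M m n * norm x ^ rexp m n"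
    "\<And>N. (\<Sum>m\<le>N. \<Sum>n\<le>N. M m n * \<epsilon> ^ (m + n)) \<le> R" using bndE[OF good_bnd[OF assms]] by blast
  have F: "norm (F m n \<sigma> x) \<le> M m n * norm x powr (real (min m n) - kap (int m - int n))"
    if "\<sigma> \<in> A" "x \<in> S" "m \<noteq> 0 \<or> n \<noteq> 0" for m n \<sigma> x
    using M(2)[OF that(1,2), of m n] rexp_powr[OF that(2,3)] by simp
  have h: "hol2 A S (F m n)" for m n using assms by (auto simp: good_def)
  have c: "continuous_on S (F m n \<sigma>)" if "\<sigma> \<in> A" for m n \<sigma>
    using h[of m n] that by (auto simp: hol2_def intro: holomorphic_on_imp_continuous_on)
  show "bnd min (4 / slope \<delta> * R) (Lop F)"
  proof (rule bndI[of "\<lambda>m n. 4 / slope \<delta> * M m n"])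
    show "0 \<le> 4 / slope \<delta> * M m n" for m n using slope M(1)[of m n] by simp
    show "norm (Lop F m n \<sigma> x) \<le> 4 / slope \<delta> * M m n * norm x ^ min m n" if \<sigma>: "\<sigma> \<in> A" and x: "x \<in> S" for m n \<sigma> x
    proof (cases "m = 0 \<and> n = 0")
      case True
      then show ?thesis using slope M(1)[of m n] by (simp add: Lop_def)
    next
      case False
      then have mn: "m \<noteq> 0 \<or> n \<noteq> 0" by simp
      have "norm (Sol (int m - int n) (m + n) \<sigma> (F m n \<sigma>) x) \<le> 4 / slope \<delta> * M m n * norm x powr real (min m n)"
        by (rule Sol_integrable(2)[OF \<sigma> x M(1) min_le_kap[OF mn] c[OF \<sigma>] F[OF \<sigma> _ mn]])
      moreover have "Lop F m n \<sigma> x = Sol (int m - int n) (m + n) \<sigma> (F m n \<sigma>) x"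
        using mn by (auto simp: Lop_def)
      moreover have "norm x powr real (min m n) = norm x ^ min m n"
        using S_pos(1)[OF x] by (rule powr_realpow)
      ultimately show ?thesis by simp
    qed
    show "(\<Sum>m\<le>N. \<Sum>n\<le>N. 4 / slope \<delta> * M m n * \<epsilon> ^ (m + n)) \<le> 4 / slope \<delta> * R" for N
    proof -
      have "(\<Sum>m\<le>N. \<Sum>n\<le>N. 4 / slope \<delta> * M m n * \<epsilon> ^ (m + n)) = 4 / slope \<delta> * (\<Sum>m\<le>N. \<Sum>n\<le>N. M m n * \<epsilon> ^ (m + n))"
        by (simp add: sum_distrib_left mult_ac)
      also have "\<dots> \<le> 4 / slope \<delta> * R" using slope M(3) by (intro mult_left_mono) auto
      finally show ?thesis .
    qed
  qed
  fix m n
  have L: "Lop F m n = (if m = 0 \<and> n = 0 then (\<lambda>\<sigma> x. 0) else (\<lambda>\<sigma> x. Sol (int m - int n) (m + n) \<sigma> (F m n \<sigma>) x))"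
    by (simp add: Lop_def fun_eq_iff)
  show "hol2 A S (Lop F m n)"
  proof (cases "m = 0 \<and> n = 0")
    case True
    then show ?thesis unfolding L by (simp add: hol2_const)
  next
    case False
    then have mn: "m \<noteq> 0 \<or> n \<noteq> 0" by simp
    have "hol2 A S (\<lambda>\<sigma> x. Sol (int m - int n) (m + n) \<sigma> (F m n \<sigma>) x)"
      by (rule hol2_Sol[OF h M(1) min_le_kap[OF mn] F[OF _ _ mn]])
    then show ?thesis unfolding L if_not_P[OF False] .
  qed
  show "ASY (min m n) (Lop F m n)"
  proof (cases "m = 0 \<and> n = 0")
    case True
    then show ?thesis unfolding L by (simp add: ASY_zero)
  next
    case False
    then have mn: "m \<noteq> 0 \<or> n \<noteq> 0" by simp
    obtain f where f: "\<And>j. f j \<in> Q" "\<And>c \<sigma>. \<sigma> \<in> A \<Longrightarrow> asy S (rexp m n) (F m n \<sigma>) (\<lambda>j. f j c \<sigma>)"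
      using assms unfolding good_def ASY_def by metis
    have Fr: "norm (F m n \<sigma> t) \<le> M m n * norm t powr (rexp m n)" if "\<sigma> \<in> A" "t \<in> S" for \<sigma> t
      using M(2)[OF that, of m n] S_pos(1)[OF that(2)] by (simp add: powr_realpow)
    have "ASY (min m n) (\<lambda>\<sigma> x. Sol (int m - int n) (m + n) \<sigma> (F m n \<sigma>) x)"
    proof (cases "m = n")
      case True
      \<comment> \<open>A diagonal right-hand side has order \<open>x^(n-1)\<close>; the power
        gained by \<open>asy_Sol_resonant\<close> leads to \<open>x^n\<close>, with
        \<open>n = min m n\<close>.\<close>
      define p where "p = n - 1"
      have p: "Suc p = n" "rexp m n = p" "Suc p < m + n" using True mn by (auto simp: p_def rexp_def)
      show ?thesis
        unfolding ASY_def
      proof (intro exI conjI allI ballI)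
        show "(\<lambda>c \<sigma>. f j c \<sigma> / (of_nat (Suc p) - of_nat j - of_nat (m + n))) \<in> Q" for j
          by (intro Q0_divide_rat f) auto
        show "asy S (min m n) (Sol (int m - int n) (m + n) \<sigma> (F m n \<sigma>))
            (\<lambda>j. f j c \<sigma> / (of_nat (Suc p) - of_nat j - of_nat (m + n)))" if \<sigma>: "\<sigma> \<in> A" for c \<sigma>
          using asy_Sol_resonant[OF \<sigma> p(3) c[OF \<sigma>], of m n "M m n" "\<lambda>j. f j c \<sigma>"] Fr[OF \<sigma>] f(2)[OF \<sigma>] p True
          by (simp del: of_nat_Suc of_nat_add)
      qed
    next
      case False
      have k: "int m - int n \<noteq> 0" using False by simp
      have re: "rexp m n = min m n" using False by (simp add: rexp_def)
      show ?thesis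
        unfolding ASY_def
      proof (intro exI conjI allI ballI)
        show "(\<lambda>c \<sigma>. sol_coeff \<sigma> (int m - int n) (m + n) (min m n) (\<lambda>j. f j c \<sigma>) j) \<in> Q" for j
          by (rule Q0_sol_coeff[OF f(1)])
        show "asy S (min m n) (Sol (int m - int n) (m + n) \<sigma> (F m n \<sigma>))
            (\<lambda>j. sol_coeff \<sigma> (int m - int n) (m + n) (min m n) (\<lambda>j. f j c \<sigma>) j)" if \<sigma>: "\<sigma> \<in> A" for c \<sigma>
          by (rule asy_Sol_nonresonant[where M = "M m n", OF \<sigma> k _ c[OF \<sigma>]])
            (use Fr[OF \<sigma>] f(2)[OF \<sigma>] re in auto)
      qed
    qed
    then show ?thesis unfolding L if_not_P[OF False] .
  qed
qed

text \<open>At degree \<open>(0, 0)\<close> the operator is set to 0, which solves the equation only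
  if the right-hand side vanishes there.\<close>

lemma Lop_deriv:
  assumes F: "good rexp R F" and \<sigma>: "\<sigma> \<in> A" and x: "x \<in> S" and 0: "m = 0 \<and> n = 0 \<Longrightarrow> F m n \<sigma> x = 0"
  shows "(Lop F m n \<sigma> has_field_derivative F m n \<sigma> x
     - (of_int (int m - int n) * (1 + \<sigma> / x) - of_nat (m + n) / x) * Lop F m n \<sigma> x) (at x)"
proof (cases "m = 0 \<and> n = 0")
  case True
  then have "Lop F m n \<sigma> = (\<lambda>x. 0)" by (simp add: Lop_def fun_eq_iff)
  then show ?thesis using 0[OF True] by simp
next
  case False
  then have mn: "m \<noteq> 0 \<or> n \<noteq> 0" by simp
  obtain M where M: "\<And>m n. 0 \<le> M m n"
    "\<And>m n \<sigma> x. \<sigma> \<in> A \<Longrightarrow> x \<in> S \<Longrightarrow> norm (F m n \<sigma> x) \<le> M m n * norm x ^ rexp m n"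
    "\<And>N. (\<Sum>m\<le>N. \<Sum>n\<le>N. M m n * \<epsilon> ^ (m + n)) \<le> R"
    using bndE[OF good_bnd[OF F]] by blast
  have Fb: "norm (F m n \<sigma> t) \<le> M m n * norm t powr (real (min m n) - kap (int m - int n))" if "t \<in> S" for t
    using M(2)[OF \<sigma> that, of m n] rexp_powr[OF that mn] by simp
  have "F m n \<sigma> holomorphic_on S" using F \<sigma> by (auto simp: good_def hol2_def)
  then have "(Sol (int m - int n) (m + n) \<sigma> (F m n \<sigma>) has_field_derivative F m n \<sigma> x
     - (of_int (int m - int n) * (1 + \<sigma> / x) - of_nat (m + n) / x) * Sol (int m - int n) (m + n) \<sigma> (F m n \<sigma>) x) (at x)"
    by (rule Sol_deriv[OF \<sigma> x M(1) min_le_kap[OF mn] _ Fb])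
  moreover have "Lop F m n \<sigma> = Sol (int m - int n) (m + n) \<sigma> (F m n \<sigma>)"
    using mn by (auto simp: Lop_def fun_eq_iff)
  ultimately show ?thesis by simp
qed

end

subsection \<open>The formal solution\<close>

text \<open>Closeness in the adic topology given by the total degree; it turns the construction of
  the formal solution into a fixed point argument free of estimates.\<close>

definition agree :: "nat \<Rightarrow> arr \<Rightarrow> arr \<Rightarrow> bool" where
  "agree N X Y \<longleftrightarrow> (\<forall>m n. m + n < N \<longrightarrow> X m n = Y m n)"

lemma agreeD: "agree N X Y \<Longrightarrow> m + n < N \<Longrightarrow> X m n = Y m n"
  by (simp add: agree_def)

lemma agree_refl: "agree N X X"
  by (simp add: agree_def)

lemma agree_mono: "agree N X Y \<Longrightarrow> N' \<le> N \<Longrightarrow> agree N' X Y"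
  by (simp add: agree_def)

lemma agree_add: "agree N X Y \<Longrightarrow> agree N X' Y' \<Longrightarrow> agree N (add X X') (add Y Y')"
  by (simp add: agree_def add_def[abs_def])

lemma agree_neg: "agree N X Y \<Longrightarrow> agree N (neg X) (neg Y)"
  by (simp add: agree_def neg_def[abs_def])

lemma agree_divx: "agree N X Y \<Longrightarrow> agree N (divx X) (divx Y)"
  by (simp add: agree_def divx_def[abs_def])

lemma agree_shiftX: "agree N X Y \<Longrightarrow> agree (Suc N) (shiftX X) (shiftX Y)"
  unfolding agree_def shiftX_def[abs_def] fun_eq_iff by auto

lemma agree_shiftY: "agree N X Y \<Longrightarrow> agree (Suc N) (shiftY X) (shiftY Y)"
  unfolding agree_def shiftY_def[abs_def] fun_eq_iff by auto

lemma agree_conv: assumes "agree N X Y" "agree N X' Y'" shows "agree N (conv X X') (conv Y Y')"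
  unfolding agree_def conv_def[abs_def] fun_eq_iff
proof (intro allI impI sum.cong refl)
  fix m n i j \<sigma> x assume "m + n < N" "i \<in> {..m}" "j \<in> {..n}"
  then show "X i j \<sigma> x * X' (m - i) (n - j) \<sigma> x = Y i j \<sigma> x * Y' (m - i) (n - j) \<sigma> x"
    using agreeD[OF assms(1), of i j] agreeD[OF assms(2), of "m - i" "n - j"] by simp
qed

text \<open>Without constant term in \<open>X\<close>, the coefficients of the product of total
  degree \<open>N\<close> meet \<open>X'\<close> only in degrees below \<open>N\<close>. The array
  \<open>Y\<close> has no constant term either, by agreement with \<open>X\<close>.\<close>

lemma agree_conv_Suc:
  assumes "agree (Suc N) X Y" "agree N X' Y'" "X 0 0 = (\<lambda>\<sigma> x. 0)"
  shows "agree (Suc N) (conv X X') (conv Y Y')"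
  unfolding agree_def conv_def[abs_def] fun_eq_iff
proof (intro allI impI sum.cong refl)
  fix m n i j \<sigma> x assume mn: "m + n < Suc N" and ij: "i \<in> {..m}" "j \<in> {..n}"
  show "X i j \<sigma> x * X' (m - i) (n - j) \<sigma> x = Y i j \<sigma> x * Y' (m - i) (n - j) \<sigma> x"
  proof (cases "i = 0 \<and> j = 0")
    case True
    then show ?thesis using assms(3) agreeD[OF assms(1), of 0 0] by simp
  next
    case False
    then have "m - i + (n - j) < N" "i + j < Suc N" using mn ij by auto
    then show ?thesis
      using agreeD[OF assms(1), of i j] agreeD[OF assms(2), of "m - i" "n - j"] by simp
  qed
qed

abbreviation one :: arr where "one \<equiv> cst (\<lambda>\<sigma>. 1)"

context pv_arrays
begin

lemma agree_Lop: "agree N X Y \<Longrightarrow> agree N (Lop X) (Lop Y)"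
  unfolding agree_def by (intro allI impI) (simp add: Lop_def[abs_def] cong: if_cong)

text \<open>The majorants of the approximants may change with \<open>N\<close>. The suprema of the
  weighted coefficients of \<open>X\<close> itself lie below all of them in the relevant degrees and
  thus form a single majorant.\<close>

lemma bnd_limit:
  assumes "\<And>N. \<exists>Y. agree N X Y \<and> bnd w R Y"
  shows "bnd w R X"
proof -
  \<comment> \<open>Inserting 0 keeps the set nonempty and its supremum nonnegative even if there
    are no points.\<close>
  define V where "V m n = insert 0 {norm (X m n \<sigma> x) / norm x ^ w m n | \<sigma> x. \<sigma> \<in> A \<and> x \<in> S}" for m n
  have V: "Sup (V m n) \<le> M m n" "bdd_above (V m n)"
    if M: "\<And>m n. 0 \<le> M m n"
      "\<And>m n \<sigma> x. \<sigma> \<in> A \<Longrightarrow> x \<in> S \<Longrightarrow> norm (Y m n \<sigma> x) \<le> M m n * norm x ^ w m n"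
      and ag: "agree N X Y" "m + n < N" for m n N M Y
  proof -
    have le: "z \<le> M m n" if "z \<in> V m n" for z
      using that M(1)[of m n] M(2)[of _ _ m n] agreeD[OF ag] S_pos
      by (auto simp: V_def divide_le_eq)
    then show "Sup (V m n) \<le> M m n" by (intro cSup_least) (auto simp: V_def)
    show "bdd_above (V m n)" using le by (rule bdd_aboveI)
  qed
  have ex: "\<exists>M Y. (\<forall>m n. 0 \<le> M m n) \<and>
      (\<forall>m n. \<forall>\<sigma>\<in>A. \<forall>x\<in>S. norm (Y m n \<sigma> x) \<le> M m n * norm x ^ w m n) \<and>
      (\<forall>N. (\<Sum>m\<le>N. \<Sum>n\<le>N. M m n * \<epsilon> ^ (m + n)) \<le> R) \<and> agree N X Y" for N
    using assms[of N] unfolding bnd_def by blast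
  have bdd: "bdd_above (V m n)" for m n
  proof -
    obtain M Y where M: "\<forall>m n. 0 \<le> M m n"
      "\<forall>m n. \<forall>\<sigma>\<in>A. \<forall>x\<in>S. norm (Y m n \<sigma> x) \<le> M m n * norm x ^ w m n" "agree (Suc (m + n)) X Y"
      using ex[of "Suc (m + n)"] by blast
    show ?thesis by (rule V(2)[of M Y "Suc (m + n)"]) (use M in auto)
  qed
  show ?thesis
  proof (rule bndI[of "\<lambda>m n. Sup (V m n)"])
    show "0 \<le> Sup (V m n)" for m n
      by (rule cSup_upper[OF _ bdd]) (simp add: V_def)
    show "norm (X m n \<sigma> x) \<le> Sup (V m n) * norm x ^ w m n" if "\<sigma> \<in> A" "x \<in> S" for m n \<sigma> x
    proof -
      have "norm (X m n \<sigma> x) / norm x ^ w m n \<le> Sup (V m n)"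
        by (rule cSup_upper[OF _ bdd]) (use that in \<open>auto simp: V_def\<close>)
      then show ?thesis using S_pos(1)[OF that(2)] by (simp add: divide_le_eq)
    qed
    fix N :: nat
    \<comment> \<open>The square of side \<open>N\<close> contains total degrees up to
      \<open>N + N\<close>.\<close>
    obtain M Y where M: "\<forall>m n. 0 \<le> M m n"
      "\<forall>m n. \<forall>\<sigma>\<in>A. \<forall>x\<in>S. norm (Y m n \<sigma> x) \<le> M m n * norm x ^ w m n"
      "\<forall>N. (\<Sum>m\<le>N. \<Sum>n\<le>N. M m n * \<epsilon> ^ (m + n)) \<le> R" "agree (Suc (N + N)) X Y"
      using ex[of "Suc (N + N)"] by blast
    have "(\<Sum>m\<le>N. \<Sum>n\<le>N. Sup (V m n) * \<epsilon> ^ (m + n)) \<le> (\<Sum>m\<le>N. \<Sum>n\<le>N. M m n * \<epsilon> ^ (m + n))"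
      using \<epsilon> M(1,2) by (intro sum_mono mult_right_mono V(1)[OF _ _ M(4)]) auto
    also have "\<dots> \<le> R" using M(3) by blast
    finally show "(\<Sum>m\<le>N. \<Sum>n\<le>N. Sup (V m n) * \<epsilon> ^ (m + n)) \<le> R" .
  qed
qed

lemma good_limit:
  assumes "\<And>N. \<exists>Y. agree N X Y \<and> good w R Y"
  shows "good w R X"
  unfolding good_def
proof (intro conjI allI)
  have "\<exists>Y. agree N X Y \<and> bnd w R Y" for N using assms[of N] good_bnd by blast
  then show "bnd w R X" by (rule bnd_limit)
  fix m n
  obtain Y where "agree (Suc (m + n)) X Y" "good w R Y" using assms by blast
  then show "hol2 A S (X m n)" "ASY (w m n) (X m n)"
    using agreeD[of "Suc (m + n)" X Y m n] by (auto simp: good_def)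
qed

definition pa :: complex where "pa = (\<theta>0 - \<theta>x + \<theta>inf) / 2"
definition pb :: complex where "pb = (\<theta>0 + \<theta>x + \<theta>inf) / 2"
text \<open>In the equation for \<open>y\<close>, the coefficient of the first power of
  \<open>y\<close> is \<open>x + 4 z + a + \<theta>0 + b\<close>. This value of \<open>z\<close>
  makes it \<open>x + \<sigma>\<close>, so that \<open>y\<close> behaves like
  \<open>c e^x x^\<sigma>\<close> to leading order.\<close>

definition zeta :: "complex \<Rightarrow> complex" where "zeta \<sigma> = (\<sigma> - 2 * \<theta>0 - \<theta>inf) / 4"
text \<open>\<open>P0 + P1 u + u^2\<close> and \<open>R0 + R1 u + u^2\<close> are \<open>z(z+a)\<close> and \<open>(z+\<theta>0)(z+b)\<close> at \<open>z = zeta + u\<close>.\<close>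

definition P0 :: "complex \<Rightarrow> complex" where "P0 \<sigma> = zeta \<sigma> * (zeta \<sigma> + pa)"
definition P1 :: "complex \<Rightarrow> complex" where "P1 \<sigma> = 2 * zeta \<sigma> + pa"
definition R0 :: "complex \<Rightarrow> complex" where "R0 \<sigma> = (zeta \<sigma> + \<theta>0) * (zeta \<sigma> + pb)"
definition R1 :: "complex \<Rightarrow> complex" where "R1 \<sigma> = 2 * zeta \<sigma> + \<theta>0 + pb"

text \<open>The third series \<open>v\<close> is defined by \<open>1 + v = 1 / (1 + w)\<close>, that is \<open>v = - (w + w v)\<close>.\<close>

definition rhs_u :: "arr \<Rightarrow> arr \<Rightarrow> arr \<Rightarrow> arr" where
  "rhs_u u w v = add
     (shiftX (conv (add one w) (add (cst P0) (add (conv (cst P1) u) (conv u u)))))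
     (neg (shiftY (conv (add one v) (add (cst R0) (add (conv (cst R1) u) (conv u u))))))"

text \<open>The equation for \<open>y\<close> divided by \<open>x X\<close>: the logarithmic
  derivative of \<open>x X\<close> cancels \<open>x + \<sigma>\<close>, and the term free of
  \<open>y\<close> is multiplied by \<open>1 / (x^2 X) = Y\<close>. In the \<open>divx\<close> term
  \<open>u\<close> is the first factor, since it has no constant term and
  \<open>agree_conv_Suc\<close> then gains a degree.\<close>

definition rhs_w :: "arr \<Rightarrow> arr \<Rightarrow> arr" where
  "rhs_w u w = add (divx (conv u (conv (cst (\<lambda>\<sigma>. 4)) (add one w))))
     (neg (add (shiftX (conv (conv (add one w) (add one w)) (add (cst P1) (add u u))))
               (shiftY (add (cst R1) (add u u)))))"

text \<open>Each new component is used at once in the next. The \<open>divx\<close> term in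
  \<open>rhs_w\<close> is not shifted, so one more correct degree of \<open>w'\<close> requires
  \<open>u'\<close> to be already correct in that degree; likewise for \<open>v'\<close> and
  \<open>w'\<close>.\<close>

definition step :: "arr \<times> arr \<times> arr \<Rightarrow> arr \<times> arr \<times> arr" where
  "step = (\<lambda>(u, w, v). let u' = Lop (rhs_u u w v); w' = Lop (rhs_w u' w)
     in (u', w', neg (add w' (conv w' v))))"

definition iter :: "nat \<Rightarrow> arr \<times> arr \<times> arr" where
  "iter k = (step ^^ k) (cst (\<lambda>\<sigma>. 0), cst (\<lambda>\<sigma>. 0), cst (\<lambda>\<sigma>. 0))"

definition agree3 :: "nat \<Rightarrow> arr \<times> arr \<times> arr \<Rightarrow> arr \<times> arr \<times> arr \<Rightarrow> bool" where
  "agree3 N p q \<longleftrightarrow> agree N (fst p) (fst q) \<and> agree N (fst (snd p)) (fst (snd q)) \<and> agree N (snd (snd p)) (snd (snd q))"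

lemma Lop00: "Lop F 0 0 = (\<lambda>\<sigma> x. 0)"
  by (simp add: Lop_def[abs_def])

lemma agree_rhs_u: "agree N u u' \<Longrightarrow> agree N w w' \<Longrightarrow> agree N v v' \<Longrightarrow> agree (Suc N) (rhs_u u w v) (rhs_u u' w' v')"
  unfolding rhs_u_def
  by (intro agree_add agree_neg agree_shiftX agree_shiftY agree_conv agree_refl) 

lemma agree_rhs_w:
  assumes "agree (Suc N) u u'" "agree N w w'" "u 0 0 = (\<lambda>\<sigma> x. 0)"
  shows "agree (Suc N) (rhs_w u w) (rhs_w u' w')"
proof -
  have "agree N u u'" using assms(1) by (rule agree_mono) simp
  with assms show ?thesis unfolding rhs_w_def
    by (intro agree_add agree_neg agree_shiftX agree_shiftY agree_divx agree_conv_Suc agree_conv agree_refl)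
qed

lemma agree_step:
  assumes "agree3 N p q" shows "agree3 (Suc N) (step p) (step q)"
proof -
  obtain u w v u' w' v' where p: "p = (u, w, v)" "q = (u', w', v')" by (metis prod_cases3)
  have a: "agree N u u'" "agree N w w'" "agree N v v'" using assms by (auto simp: agree3_def p)
  have 1: "agree (Suc N) (Lop (rhs_u u w v)) (Lop (rhs_u u' w' v'))"
    by (intro agree_Lop agree_rhs_u a)
  have 2: "agree (Suc N) (Lop (rhs_w (Lop (rhs_u u w v)) w)) (Lop (rhs_w (Lop (rhs_u u' w' v')) w'))"
    by (intro agree_Lop agree_rhs_w 1 a Lop00)
  have "agree (Suc N) (neg (add (Lop (rhs_w (Lop (rhs_u u w v)) w)) (conv (Lop (rhs_w (Lop (rhs_u u w v)) w)) v)))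
     (neg (add (Lop (rhs_w (Lop (rhs_u u' w' v')) w')) (conv (Lop (rhs_w (Lop (rhs_u u' w' v')) w')) v')))"
    by (intro agree_neg agree_add 2 agree_conv_Suc a Lop00)
  with 1 2 show ?thesis by (simp add: agree3_def p step_def Let_def)
qed

lemma agree_iter_Suc: "agree3 k (iter k) (iter (Suc k))"
proof (induction k)
  case 0
  show ?case by (simp add: agree3_def agree_def)
next
  case (Suc k)
  then show ?case using agree_step[of k "iter k" "iter (Suc k)"] by (simp add: iter_def)
qed

lemma agree3_trans: "agree3 N p q \<Longrightarrow> agree3 N q s \<Longrightarrow> agree3 N p s"
  by (simp add: agree3_def agree_def)

lemma agree3_mono: "agree3 N p q \<Longrightarrow> N' \<le> N \<Longrightarrow> agree3 N' p q"
  using agree_mono unfolding agree3_def by blast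

lemma agree_iter: "k \<le> l \<Longrightarrow> agree3 k (iter k) (iter l)"
proof (induction l rule: dec_induct)
  case base
  show ?case by (simp add: agree3_def agree_refl)
next
  case (step l)
  show ?case by (rule agree3_trans[OF step.IH agree3_mono[OF agree_iter_Suc step.hyps(1)]])
qed

text \<open>The coefficients of total degree below \<open>N\<close> are stationary after \<open>N\<close> steps of the iteration.\<close>

definition U :: arr where "U m n = fst (iter (Suc (m + n))) m n"
definition W :: arr where "W m n = fst (snd (iter (Suc (m + n)))) m n"
definition V :: arr where "V m n = snd (snd (iter (Suc (m + n)))) m n"

lemma agree_limit: "agree3 k (U, W, V) (iter k)"
proof -
  have "U m n = fst (iter k) m n \<and> W m n = fst (snd (iter k)) m n \<and> V m n = snd (snd (iter k)) m n"
    if "m + n < k" for m n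
    using agree_iter[of "Suc (m + n)" k] that by (simp add: agree3_def agree_def U_def W_def V_def)
  then show ?thesis by (simp add: agree3_def agree_def)
qed

text \<open>The limit agrees with the \<open>k\<close>-th iterate below degree \<open>k\<close>, and
  \<open>step\<close> raises this by one; hence its image agrees with it in every degree.\<close>

lemma step_limit: "step (U, W, V) = (U, W, V)"
proof -
  have ag: "agree3 (Suc k) (step (U, W, V)) (U, W, V)" for k
  proof (rule agree3_trans)
    show "agree3 (Suc k) (step (U, W, V)) (iter (Suc k))"
      using agree_step[OF agree_limit[of k]] by (simp add: iter_def)
    show "agree3 (Suc k) (iter (Suc k)) (U, W, V)"
      using agree_limit[of "Suc k"] by (simp add: agree3_def agree_def)
  qed
  obtain u w v where s: "step (U, W, V) = (u, w, v)" by (metis prod_cases3)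
  have "u m n = U m n \<and> w m n = W m n \<and> v m n = V m n" for m n
    using ag[of "m + n"] by (simp add: s agree3_def agree_def)
  then show ?thesis by (simp add: s fun_eq_iff)
qed

lemma U_eq: "U = Lop (rhs_u U W V)" and W_eq: "W = Lop (rhs_w U W)" and V_eq: "V = neg (add W (conv W V))"
proof -
  have e: "Lop (rhs_u U W V) = U" "Lop (rhs_w (Lop (rhs_u U W V)) W) = W"
    "neg (add (Lop (rhs_w (Lop (rhs_u U W V)) W)) (conv (Lop (rhs_w (Lop (rhs_u U W V)) W)) V)) = V"
    using step_limit unfolding step_def Let_def prod.case prod.inject by blast+
  show "U = Lop (rhs_u U W V)" using e(1) by simp
  show "W = Lop (rhs_w U W)" using e(2)[unfolded e(1)] by simp
  show "V = neg (add W (conv W V))" using e(3)[unfolded e(1), unfolded e(2)[unfolded e(1)]] by simp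
qed

end

section \<open>A ball of majorants invariant under the iteration\<close>

locale pv_small = pv_arrays +
  fixes K :: real
  assumes K1: "1 \<le> K"
    and K: "\<And>\<sigma>. \<sigma> \<in> A \<Longrightarrow> norm (P0 \<sigma>) \<le> K" "\<And>\<sigma>. \<sigma> \<in> A \<Longrightarrow> norm (P1 \<sigma>) \<le> K"
      "\<And>\<sigma>. \<sigma> \<in> A \<Longrightarrow> norm (R0 \<sigma>) \<le> K" "\<And>\<sigma>. \<sigma> \<in> A \<Longrightarrow> norm (R1 \<sigma>) \<le> K"
    and r_eps: "1 \<le> r * \<epsilon>\<^sup>2"
    and \<epsilon>_small: "200 * K * (4 / slope \<delta>)\<^sup>2 * \<epsilon> \<le> 1"
begin

definition C :: real where "C = 4 / slope \<delta>"

lemma C_ge: "8 \<le> C"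
  using slope by (simp add: C_def field_simps)

lemma Q0_half: "f \<in> Q \<Longrightarrow> (\<lambda>c \<sigma>. f c \<sigma> / 2) \<in> Q" "f \<in> Q \<Longrightarrow> (\<lambda>c \<sigma>. f c \<sigma> / 4) \<in> Q"
  by (rule Q0_divide_rat; simp)+

lemma Q0_two: "f \<in> Q \<Longrightarrow> (\<lambda>c \<sigma>. 2 * f c \<sigma>) \<in> Q"
  by (rule Q0_mult[OF Q0_rat]) simp_all

lemma Q_pa: "(\<lambda>c \<sigma>. pa) \<in> Q" and Q_pb: "(\<lambda>c \<sigma>. pb) \<in> Q" and Q_zeta: "(\<lambda>c \<sigma>. zeta \<sigma>) \<in> Q"
  unfolding pa_def pb_def zeta_def
  by (intro Q0_half Q0_two Q0_add Q0_diff Q0_theta0 Q0_thetax Q0_thetainf Q0_sigma)+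

lemma Q_PR: "(\<lambda>c \<sigma>. P0 \<sigma>) \<in> Q" "(\<lambda>c \<sigma>. P1 \<sigma>) \<in> Q" "(\<lambda>c \<sigma>. R0 \<sigma>) \<in> Q" "(\<lambda>c \<sigma>. R1 \<sigma>) \<in> Q"
  unfolding P0_def P1_def R0_def R1_def
  by (intro Q0_two Q0_add Q0_mult Q_pa Q_pb Q_zeta Q0_theta0)+

lemma hol_PR: "P0 holomorphic_on A" "P1 holomorphic_on A" "R0 holomorphic_on A" "R1 holomorphic_on A"
  unfolding P0_def[abs_def] P1_def[abs_def] R0_def[abs_def] R1_def[abs_def] zeta_def[abs_def]
  by (intro holomorphic_intros; simp)+

lemma good_PR: "good min K (cst P0)" "good min K (cst P1)" "good min K (cst R0)" "good min K (cst R1)"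
  using K1 by (auto intro!: good_cst Q_PR hol_PR K)

lemma good_cst_rat: "q \<in> \<rat> \<Longrightarrow> norm q \<le> R \<Longrightarrow> good min R (cst (\<lambda>\<sigma>. q))"
  by (rule good_cst) (auto intro: Q0_rat order_trans[OF norm_ge_zero])

lemma good_one: "good min 1 one"
  by (rule good_cst_rat) auto

text \<open>The radius for \<open>u\<close>: the norm \<open>C\<close> of \<open>Lop\<close> times
  the bound \<open>12 * K * \<epsilon>\<close> for \<open>rhs_u\<close>. It must be of order
  \<epsilon>, because \<open>rhs_w\<close> contains \<open>u\<close> without a further factor
  \<epsilon>.\<close>

definition Ru :: real where "Ru = 12 * K * C * \<epsilon>"

text \<open>All three follow from \<open>200 * K * C^2 * \<epsilon> \<le> 1\<close> and
  \<open>8 \<le> C\<close>. The last one says that \<open>Lop\<close> maps the bound for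
  \<open>rhs_w\<close> below the radius \<open>1/2\<close> of \<open>w\<close>.\<close>

lemma Ru_bounds: "0 \<le> Ru" "Ru \<le> 1" "C * (6 * Ru + 4 * \<epsilon> * (3 * K)) \<le> 1 / 2"
proof -
  have p: "0 < K * C * \<epsilon>" using K1 C_ge \<epsilon> by auto
  show "0 \<le> Ru" using K1 C_ge \<epsilon> by (simp add: Ru_def)
  have e: "200 * (K * C * \<epsilon>) * C \<le> 1" using \<epsilon>_small by (simp add: C_def power2_eq_square mult_ac)
  have "(K * C * \<epsilon>) * 8 \<le> (K * C * \<epsilon>) * C" using p C_ge by (intro mult_left_mono) auto
  then have "1600 * (K * C * \<epsilon>) \<le> 1" using e by linarith
  then show "Ru \<le> 1" by (simp add: Ru_def)
  have "C * (6 * Ru + 4 * \<epsilon> * (3 * K)) = 72 * (K * C * \<epsilon> * C) + 12 * (K * C * \<epsilon>)"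
    by (simp add: Ru_def algebra_simps)
  also have "\<dots> \<le> 74 * (K * C * \<epsilon> * C)" using \<open>K * C * \<epsilon> * 8 \<le> _\<close> p by linarith
  also have "\<dots> \<le> 1 / 2" using e by linarith
  finally show "C * (6 * Ru + 4 * \<epsilon> * (3 * K)) \<le> 1 / 2" .
qed

text \<open>The radii \<open>1/2\<close> for \<open>w\<close> and \<open>1\<close> for
  \<open>v\<close> fit together: the new \<open>v\<close> is \<open>- (w + w v)\<close>, of norm at
  most \<open>1/2 + 1/2 * 1\<close>. The value \<open>1/2\<close> also keeps \<open>1 + w\<close>
  away from 0.\<close>

definition good3 :: "arr \<times> arr \<times> arr \<Rightarrow> bool" where
  "good3 p \<longleftrightarrow> good min Ru (fst p) \<and> good min (1/2) (fst (snd p)) \<and> good min 1 (snd (snd p))"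

lemma good_rhs_u:
  assumes "good min Ru u" "good min (1/2) w" "good min 1 v"
  shows "good rexp (12 * K * \<epsilon>) (rhs_u u w v)"
proof -
  have s: "Ru * Ru \<le> 1 * K" "K * Ru \<le> K * 1"
    using Ru_bounds K1 mult_mono[of Ru 1 Ru K] mult_left_mono[of Ru 1 K] by auto
  have 1: "good min (3 * K) (add (cst P0) (add (conv (cst P1) u) (conv u u)))"
    by (rule good_mono[OF good_add[OF good_PR(1) good_add[OF good_conv[OF good_PR(2) assms(1)] good_conv[OF assms(1,1)]]]])
      (use s in auto)
  have 2: "good min (3 * K) (add (cst R0) (add (conv (cst R1) u) (conv u u)))"
    by (rule good_mono[OF good_add[OF good_PR(3) good_add[OF good_conv[OF good_PR(4) assms(1)] good_conv[OF assms(1,1)]]]])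
      (use s in auto)
  have "good rexp (\<epsilon> * ((1 + 1/2) * (3 * K)) + \<epsilon> * ((1 + 1) * (3 * K))) (rhs_u u w v)"
    unfolding rhs_u_def
    by (intro good_add good_neg good_shiftX good_shiftY good_conv 1 2 good_one assms)
  \<comment> \<open>The two products contribute \<open>9/2\<close> and \<open>6\<close> times
    \<open>K * \<epsilon>\<close>.\<close>
  moreover have "\<epsilon> * ((1 + 1/2) * (3 * K)) + \<epsilon> * ((1 + 1) * (3 * K)) \<le> 12 * K * \<epsilon>"
    using \<epsilon> K1 by (simp add: algebra_simps)
  ultimately show ?thesis by (rule good_mono)
qed

lemma good_rhs_w:
  assumes "good min Ru u" "good min (1/2) w"
  shows "good rexp (6 * Ru + 4 * \<epsilon> * (3 * K)) (rhs_w u w)"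
proof -
  have 4: "good min 4 (cst (\<lambda>\<sigma>. 4))" by (rule good_cst_rat) auto
  have W: "good min (1 + 1/2) (add one w)" by (rule good_add[OF good_one assms(2)])
  have 1: "good min (K + (Ru + Ru)) (add (cst P1) (add u u))" "good min (K + (Ru + Ru)) (add (cst R1) (add u u))"
    by (intro good_add good_PR assms)+
  have "good rexp (Ru * (4 * (1 + 1/2)) + (\<epsilon> * (((1 + 1/2) * (1 + 1/2)) * (K + (Ru + Ru))) + \<epsilon> * (K + (Ru + Ru)))) (rhs_w u w)"
    unfolding rhs_w_def
    by (intro good_add[of rexp] good_neg good_divx good_shiftX good_shiftY good_conv 1 W 4 assms)
  moreover have "Ru * (4 * (1 + 1/2)) + (\<epsilon> * (((1 + 1/2) * (1 + 1/2)) * (K + (Ru + Ru))) + \<epsilon> * (K + (Ru + Ru)))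
      \<le> 6 * Ru + 4 * \<epsilon> * (3 * K)"
  proof -
    have "K + (Ru + Ru) \<le> 3 * K" using Ru_bounds K1 by simp
    \<comment> \<open>Here \<open>13/4\<close> is \<open>(3/2)^2\<close> from the square of
      \<open>1 + w\<close>, plus 1 from the term with \<open>Y\<close>.\<close>
    then have "(13/4 * \<epsilon>) * (K + (Ru + Ru)) \<le> (13/4 * \<epsilon>) * (3 * K)" using \<epsilon> by (intro mult_left_mono) auto
    moreover have "(13/4 * \<epsilon>) * (3 * K) \<le> (4 * \<epsilon>) * (3 * K)" using \<epsilon> K1 by (intro mult_right_mono) auto
    moreover have "Ru * (4 * (1 + 1/2)) + (\<epsilon> * (((1 + 1/2) * (1 + 1/2)) * (K + (Ru + Ru))) + \<epsilon> * (K + (Ru + Ru)))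
        = 6 * Ru + (13/4 * \<epsilon>) * (K + (Ru + Ru))"
      by (simp add: field_simps)
    ultimately show ?thesis by linarith
  qed
  ultimately show ?thesis by (rule good_mono)
qed

lemma good_step: assumes "good3 p" shows "good3 (step p)"
proof -
  obtain u w v where p: "p = (u, w, v)" by (metis prod_cases3)
  have a: "good min Ru u" "good min (1/2) w" "good min 1 v" using assms by (auto simp: good3_def p)
  have 1: "good min Ru (Lop (rhs_u u w v))"
    using good_Lop[OF good_rhs_u[OF a]] by (simp add: Ru_def C_def mult_ac)
  have 2: "good min (1/2) (Lop (rhs_w (Lop (rhs_u u w v)) w))"
    by (rule good_mono[OF good_Lop[OF good_rhs_w[OF 1 a(2)]]]) (use Ru_bounds(3) in \<open>simp add: C_def\<close>)
  have "good min 1 (neg (add (Lop (rhs_w (Lop (rhs_u u w v)) w)) (conv (Lop (rhs_w (Lop (rhs_u u w v)) w)) v)))"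
    by (rule good_mono[OF good_neg[OF good_add[OF 2 good_conv[OF 2 a(3)]]]]) simp
  with 1 2 show ?thesis by (simp add: good3_def p step_def Let_def)
qed

lemma good_iter: "good3 (iter k)"
proof (induction k)
  case 0
  show ?case using Ru_bounds by (auto simp: good3_def iter_def intro!: good_cst_rat)
next
  case (Suc k)
  then show ?case using good_step by (simp add: iter_def)
qed

lemma good_U: "good min Ru U" and good_W: "good min (1/2) W" and good_V: "good min 1 V"
proof -
  have "agree3 k (U, W, V) (iter k) \<and> good3 (iter k)" for k
    using agree_limit good_iter by blast
  then have *: "agree k U (fst (iter k)) \<and> good min Ru (fst (iter k))"
    "agree k W (fst (snd (iter k))) \<and> good min (1/2) (fst (snd (iter k)))"
    "agree k V (snd (snd (iter k))) \<and> good min 1 (snd (snd (iter k)))" for k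
    by (simp_all add: agree3_def good3_def)
  show "good min Ru U" by (rule good_limit) (use *(1) in blast)
  show "good min (1/2) W" by (rule good_limit) (use *(2) in blast)
  show "good min 1 V" by (rule good_limit) (use *(3) in blast)
qed

end

subsection \<open>Absolutely convergent double series\<close>

abbreviation abssum :: "('a \<Rightarrow> 'b::real_normed_vector) \<Rightarrow> 'a set \<Rightarrow> bool" where
  "abssum f X \<equiv> (\<lambda>p. norm (f p)) summable_on X"

definition double_sum :: "(nat \<Rightarrow> nat \<Rightarrow> 'a::real_normed_vector) \<Rightarrow> 'a" where
  "double_sum t = (\<Sum>\<^sub>\<infinity>(m, n). t m n)"

definition square_sum :: "nat \<Rightarrow> (nat \<Rightarrow> nat \<Rightarrow> 'a::comm_monoid_add) \<Rightarrow> 'a" where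
  "square_sum N t = (\<Sum>m\<le>N. \<Sum>n\<le>N. t m n)"

lemma square_sum_eq: "square_sum N t = (\<Sum>(m, n)\<in>{..N} \<times> {..N}. t m n)"
  by (simp add: square_sum_def sum.cartesian_product)

lemma finite_subset_square:
  assumes "finite (F :: (nat \<times> nat) set)" obtains N where "F \<subseteq> {..N} \<times> {..N}"
proof -
  define N where "N = Max (insert 0 (fst ` F \<union> snd ` F))"
  have "fst p \<le> N \<and> snd p \<le> N" if "p \<in> F" for p
    unfolding N_def using assms that by (auto intro!: Max_ge)
  then have "F \<subseteq> {..N} \<times> {..N}" by auto
  then show thesis by (rule that)
qed

lemma dominated_summable:
  fixes t :: "nat \<Rightarrow> nat \<Rightarrow> 'a::real_normed_vector"
  assumes t: "\<And>m n. norm (t m n) \<le> M m n" and M: "\<And>N. square_sum N M \<le> R"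
  shows "abssum (\<lambda>(m, n). t m n) UNIV" and "(\<Sum>\<^sub>\<infinity>(m, n). norm (t m n)) \<le> R"
proof -
  have fin: "(\<Sum>p\<in>F. norm (case p of (m, n) \<Rightarrow> t m n)) \<le> R" if F: "finite F" for F
  proof -
    obtain N where N: "F \<subseteq> {..N} \<times> {..N}" using finite_subset_square[OF F] by blast
    have "(\<Sum>p\<in>F. norm (case p of (m, n) \<Rightarrow> t m n)) \<le> (\<Sum>p\<in>{..N} \<times> {..N}. norm (case p of (m, n) \<Rightarrow> t m n))"
      by (rule sum_mono2[OF _ N]) auto
    also have "\<dots> \<le> (\<Sum>(m, n)\<in>{..N} \<times> {..N}. M m n)"
      by (rule sum_mono) (auto simp: t)
    also have "\<dots> \<le> R" using M[of N] by (simp add: square_sum_eq)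
    finally show ?thesis .
  qed
  then show s: "abssum (\<lambda>(m, n). t m n) UNIV"
    by (intro nonneg_bdd_above_summable_on) (auto intro!: bdd_aboveI2[where M = R])
  have "(\<Sum>\<^sub>\<infinity>p. norm (case p of (m, n) \<Rightarrow> t m n)) \<le> R"
    by (rule infsum_le_finite_sums[OF s fin])
  then show "(\<Sum>\<^sub>\<infinity>(m, n). norm (t m n)) \<le> R" by (simp add: case_prod_unfold)
qed

text \<open>The tail of the majorant controls the error. It depends on none of the parameters hidden
  in \<open>t\<close>, which yields uniform convergence wherever \<open>M\<close> is a common
  majorant.\<close>

lemma double_sum_diff_square:
  fixes t :: "nat \<Rightarrow> nat \<Rightarrow> 'a::banach"
  assumes t: "\<And>m n. norm (t m n) \<le> M m n" and M: "\<And>N. square_sum N M \<le> R"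
  shows "norm (double_sum t - square_sum N t) \<le> double_sum M - square_sum N M"
proof -
  let ?B = "{..N} \<times> {..N}"
  have M0: "norm (M m n) \<le> M m n" for m n using order_trans[OF norm_ge_zero t[of m n]] by simp
  have s: "abssum (\<lambda>(m, n). t m n) UNIV" "abssum (\<lambda>(m, n). M m n) UNIV"
    by (rule dominated_summable(1)[OF t M], rule dominated_summable(1)[OF M0 M])
  have sp: "double_sum f - square_sum N f = (\<Sum>\<^sub>\<infinity>(m, n)\<in>UNIV - ?B. f m n)"
    if "abssum (\<lambda>(m, n). f m n) UNIV" for f :: "nat \<Rightarrow> nat \<Rightarrow> 'b::banach"
  proof -
    have "(\<lambda>(m, n). f m n) summable_on UNIV" using that by (rule abs_summable_summable)
    then have "infsum (\<lambda>(m, n). f m n) (UNIV - ?B) = infsum (\<lambda>(m, n). f m n) UNIV - infsum (\<lambda>(m, n). f m n) ?B"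
      by (intro infsum_Diff) auto
    then show ?thesis by (simp add: double_sum_def square_sum_eq)
  qed
  have s': "abssum (\<lambda>(m, n). t m n) (UNIV - ?B)" "(\<lambda>(m, n). M m n) summable_on (UNIV - ?B)"
    using summable_on_subset_banach[OF s(1)] summable_on_subset_banach[OF abs_summable_summable[OF s(2)]] by auto
  have "norm (double_sum t - square_sum N t) \<le> (\<Sum>\<^sub>\<infinity>p\<in>UNIV - ?B. norm (case p of (m, n) \<Rightarrow> t m n))"
    unfolding sp[OF s(1)] by (rule norm_infsum_bound[OF s'(1)])
  also have "\<dots> \<le> (\<Sum>\<^sub>\<infinity>(m, n)\<in>UNIV - ?B. M m n)"
    by (rule infsum_mono[OF s'(1) s'(2)]) (auto simp: t)
  also have "\<dots> = double_sum M - square_sum N M" using sp[OF s(2)] by simp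
  finally show ?thesis .
qed

lemma square_sum_tendsto_double_sum:
  fixes t :: "nat \<Rightarrow> nat \<Rightarrow> 'a::banach"
  assumes "(\<lambda>(m, n). t m n) summable_on UNIV"
  shows "(\<lambda>N. square_sum N t) \<longlonglongrightarrow> double_sum t"
proof -
  have "((\<lambda>(m, n). t m n) has_sum double_sum t) UNIV"
    unfolding double_sum_def by (rule has_sum_infsum[OF assms])
  then have "(sum (\<lambda>(m, n). t m n) \<longlongrightarrow> double_sum t) (finite_subsets_at_top UNIV)"
    by (simp add: has_sum_def)
  moreover have "filterlim (\<lambda>N. {..N} \<times> {..N}) (finite_subsets_at_top (UNIV :: (nat \<times> nat) set)) sequentially"
    unfolding filterlim_finite_subsets_at_top
  proof (intro allI impI)
    fix F :: "(nat \<times> nat) set" assume "finite F \<and> F \<subseteq> UNIV"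
    then obtain N where N: "F \<subseteq> {..N} \<times> {..N}" using finite_subset_square by blast
    show "\<forall>\<^sub>F N in sequentially. finite ({..N} \<times> {..N}) \<and> F \<subseteq> {..N} \<times> {..N} \<and> {..N} \<times> {..N} \<subseteq> UNIV"
      using eventually_ge_at_top[of N] by eventually_elim (use N in force)
  qed
  ultimately have "(\<lambda>N. sum (\<lambda>(m, n). t m n) ({..N} \<times> {..N})) \<longlonglongrightarrow> double_sum t"
    by (rule filterlim_compose)
  then show ?thesis by (simp add: square_sum_eq)
qed

lemma double_sum_add:
  fixes s t :: "nat \<Rightarrow> nat \<Rightarrow> 'a::banach"
  assumes "(\<lambda>(m, n). s m n) summable_on UNIV" "(\<lambda>(m, n). t m n) summable_on UNIV"
  shows "double_sum (\<lambda>m n. s m n + t m n) = double_sum s + double_sum t"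
  using infsum_add[OF assms] by (simp add: double_sum_def case_prod_unfold)

lemma double_sum_cmult: "double_sum (\<lambda>m n. c * t m n) = c * double_sum t" for c :: complex
  using infsum_cmult_right'[of c "\<lambda>(m, n). t m n" UNIV] by (simp add: double_sum_def case_prod_unfold)

lemma double_sum_shift:
  fixes t :: "nat \<Rightarrow> nat \<Rightarrow> complex"
  shows "double_sum (\<lambda>m n. if m = 0 then 0 else t (m - 1) n) = double_sum t"
proof -
  have "(\<Sum>\<^sub>\<infinity>(m, n). if m = 0 then 0 else t (m - 1) n)
      = (\<Sum>\<^sub>\<infinity>(m, n)\<in>(\<lambda>(m, n). (Suc m, n)) ` UNIV. if m = 0 then 0 else t (m - 1) n)"
  proof (rule infsum_cong_neutral)
    fix p :: "nat \<times> nat" assume "p \<in> UNIV - (\<lambda>(m, n). (Suc m, n)) ` UNIV"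
    then have "fst p = 0" by (cases p; cases "fst p") (auto simp: image_iff)
    then show "(case p of (m, n) \<Rightarrow> if m = 0 then 0 else t (m - 1) n) = 0" by (simp add: case_prod_unfold)
  qed auto
  also have "\<dots> = (\<Sum>\<^sub>\<infinity>(m, n). t m n)"
    by (subst infsum_reindex) (auto simp: inj_on_def o_def case_prod_unfold)
  finally show ?thesis by (simp add: double_sum_def)
qed

lemma double_sum_swap: "double_sum (\<lambda>m n. t n m) = double_sum t" for t :: "nat \<Rightarrow> nat \<Rightarrow> complex"
proof -
  have "(\<Sum>\<^sub>\<infinity>p\<in>prod.swap ` UNIV. case p of (m, n) \<Rightarrow> t m n) = (\<Sum>\<^sub>\<infinity>p. case prod.swap p of (m, n) \<Rightarrow> t m n)"
    by (subst infsum_reindex) (auto simp: o_def)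
  then show ?thesis by (simp add: double_sum_def case_prod_unfold)
qed

text \<open>Absolute convergence of the fourfold series permits grouping it by the total exponents;
  the groups are finite boxes.\<close>

lemma double_sum_conv:
  fixes s t :: "nat \<Rightarrow> nat \<Rightarrow> complex"
  assumes s: "abssum (\<lambda>(m, n). s m n) UNIV" and t: "abssum (\<lambda>(m, n). t m n) UNIV"
  shows "double_sum (\<lambda>m n. \<Sum>i\<le>m. \<Sum>j\<le>n. s i j * t (m - i) (n - j)) = double_sum s * double_sum t"
proof -
  define s' where "s' = (\<lambda>(m, n). s m n)"
  define t' where "t' = (\<lambda>(m, n). t m n)"
  have ss: "abssum s' UNIV" "abssum t' UNIV" using s t by (auto simp: s'_def t'_def)
  have prod: "abssum (\<lambda>(p, q). s' p * t' q) (UNIV \<times> UNIV)"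
  proof (subst Infinite_Sum.abs_summable_on_Sigma_iff, intro conjI ballI)
    show "abssum (\<lambda>q. case (p, q) of (p, q) \<Rightarrow> s' p * t' q) UNIV" for p
      using summable_on_cmult_right[OF ss(2), of "norm (s' p)"] by (simp add: norm_mult)
    show "abssum (\<lambda>p. \<Sum>\<^sub>\<infinity>q. norm (case (p, q) of (p, q) \<Rightarrow> s' p * t' q)) UNIV"
      using summable_on_cmult_left[OF ss(1), of "\<Sum>\<^sub>\<infinity>q. norm (t' q)"]
      by (simp add: norm_mult infsum_cmult_right' infsum_nonneg)
  qed
  have "double_sum s * double_sum t = (\<Sum>\<^sub>\<infinity>p. \<Sum>\<^sub>\<infinity>q. s' p * t' q)"
    unfolding double_sum_def s'_def[symmetric] t'_def[symmetric]
    by (simp add: infsum_cmult_left' infsum_cmult_right')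
  also have "\<dots> = (\<Sum>\<^sub>\<infinity>(p, q)\<in>UNIV \<times> UNIV. s' p * t' q)"
    by (rule infsum_Sigma'_banach[OF abs_summable_summable[OF prod]])
  also have "\<dots> = (\<Sum>\<^sub>\<infinity>((m, n), (i, j))\<in>(SIGMA p:UNIV. {..fst p} \<times> {..snd p}). s i j * t (m - i) (n - j))"
    by (rule infsum_reindex_bij_witness[of _ "\<lambda>((m, n), (i, j)). ((i, j), (m - i, n - j))"
          "\<lambda>((i, j), (k, l)). ((i + k, j + l), (i, j))"]) (auto simp: s'_def t'_def)
  also have "\<dots> = (\<Sum>\<^sub>\<infinity>p. \<Sum>\<^sub>\<infinity>q\<in>{..fst p} \<times> {..snd p}. s (fst q) (snd q) * t (fst p - fst q) (snd p - snd q))"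
  proof -
    have "(\<lambda>(p, q). s (fst q) (snd q) * t (fst p - fst q) (snd p - snd q)) summable_on (SIGMA p:UNIV. {..fst p} \<times> {..snd p})
        \<longleftrightarrow> (\<lambda>(p, q). s' p * t' q) summable_on (UNIV \<times> UNIV)"
      by (rule summable_on_reindex_bij_witness[of _ "\<lambda>((i, j), (k, l)). ((i + k, j + l), (i, j))"
          "\<lambda>((m, n), (i, j)). ((i, j), (m - i, n - j))"]) (auto simp: s'_def t'_def)
    then have "(\<lambda>(p, q). s (fst q) (snd q) * t (fst p - fst q) (snd p - snd q)) summable_on (SIGMA p:UNIV. {..fst p} \<times> {..snd p})"
      using abs_summable_summable[OF prod] by simp
    from infsum_Sigma'_banach[OF this] show ?thesis by (simp add: case_prod_unfold)
  qed
  also have "\<dots> = double_sum (\<lambda>m n. \<Sum>i\<le>m. \<Sum>j\<le>n. s i j * t (m - i) (n - j))"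
    by (simp add: double_sum_def case_prod_unfold sum.cartesian_product)
  finally show ?thesis by simp
qed

text \<open>Grouping by the difference of the indices. The second family starts at difference
  \<open>Suc 0\<close>, so the main diagonal is counted once.\<close>

lemma double_sum_diagonals:
  fixes t :: "nat \<Rightarrow> nat \<Rightarrow> complex"
  assumes t: "abssum (\<lambda>(m, n). t m n) UNIV"
  shows "double_sum t = (\<Sum>k. \<Sum>n. t (k + n) n) + (\<Sum>k. \<Sum>n. t n (Suc k + n))"
    and "summable (\<lambda>k. \<Sum>n. t (k + n) n)" "summable (\<lambda>k. \<Sum>n. t n (Suc k + n))"
proof -
  define f where "f = (\<lambda>(m, n). t m n)"
  have f: "f summable_on X" for X
    using summable_on_subset_banach[OF abs_summable_summable[OF t]] by (auto simp: f_def)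
  have fs: "abssum f X" for X
    using summable_on_subset_banach[OF t] by (auto simp: f_def)
  define D1 where "D1 = (\<lambda>(k, n). (k + n, n)) ` (UNIV :: (nat \<times> nat) set)"
  define D2 where "D2 = (\<lambda>(k, n). (n, Suc k + n)) ` (UNIV :: (nat \<times> nat) set)"
  have i1: "inj (\<lambda>(k, n). (k + n, n :: nat))" "inj (\<lambda>(k, n). (n :: nat, Suc k + n))"
    by (auto simp: inj_on_def)
  have U: "UNIV = D1 \<union> D2"
  proof -
    have "(m, n) \<in> D1 \<union> D2" for m n
    proof (cases "n \<le> m")
      case True
      then have "(m, n) = (\<lambda>(k, n). (k + n, n)) (m - n, n)" by simp
      then show ?thesis unfolding D1_def by blast
    next
      case False
      then have "(m, n) = (\<lambda>(k, n). (n, Suc k + n)) (n - m - 1, m)" by simp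
      then show ?thesis unfolding D2_def by blast
    qed
    then show ?thesis by auto
  qed
  have disj: "D1 \<inter> D2 = {}" by (auto simp: D1_def D2_def)
  have ser: "g sums infsum g UNIV" "summable g" if "g summable_on UNIV" for g :: "nat \<Rightarrow> complex"
    using has_sum_imp_sums[OF has_sum_infsum[OF that]] by (auto simp: sums_iff)
  have conv: "infsum f (h ` UNIV) = (\<Sum>k. \<Sum>n. f (h (k, n))) \<and> summable (\<lambda>k. \<Sum>n. f (h (k, n)))"
    if "inj h" for h :: "nat \<times> nat \<Rightarrow> nat \<times> nat"
  proof -
    have s: "(\<lambda>(k, n). f (h (k, n))) summable_on (UNIV \<times> UNIV)"
      using f[of "h ` UNIV"] summable_on_reindex[OF that, of f] by (simp add: o_def case_prod_unfold)
    have "(\<lambda>n. f (h (k, n))) summable_on UNIV" for k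
    proof -
      have "f summable_on (\<lambda>n. h (k, n)) ` UNIV" by (rule f)
      then show ?thesis
        by (subst (asm) summable_on_reindex) (use that in \<open>auto simp: inj_on_def o_def\<close>)
    qed
    then have e: "infsum (\<lambda>n. f (h (k, n))) UNIV = (\<Sum>n. f (h (k, n)))" for k
      using ser(1) sums_unique by blast
    have "infsum f (h ` UNIV) = infsum (\<lambda>(k, n). f (h (k, n))) (UNIV \<times> UNIV)"
      by (subst infsum_reindex[OF that]) (simp add: o_def case_prod_unfold)
    also have "\<dots> = infsum (\<lambda>k. \<Sum>n. f (h (k, n))) UNIV"
      using infsum_Sigma'_banach[OF s] by (simp add: e)
    finally have 1: "infsum f (h ` UNIV) = infsum (\<lambda>k. \<Sum>n. f (h (k, n))) UNIV" .
    have 2: "(\<lambda>k. \<Sum>n. f (h (k, n))) summable_on UNIV"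
      using summable_on_Sigma_banach[OF s] by (simp add: e)
    from 1 ser[OF 2] show ?thesis by (simp add: sums_iff)
  qed
  have "double_sum t = infsum f D1 + infsum f D2"
    unfolding double_sum_def f_def[symmetric] U by (rule infsum_Un_disjoint[OF f f disj])
  then show "double_sum t = (\<Sum>k. \<Sum>n. t (k + n) n) + (\<Sum>k. \<Sum>n. t n (Suc k + n))"
    using conv[OF i1(1)] conv[OF i1(2)] by (simp add: D1_def D2_def f_def)
  show "summable (\<lambda>k. \<Sum>n. t (k + n) n)" "summable (\<lambda>k. \<Sum>n. t n (Suc k + n))"
    using conv[OF i1(1)] conv[OF i1(2)] by (simp_all add: f_def)
qed

subsection \<open>From the first-order system to the fifth Painleve equation\<close>

text \<open>Elimination of \<open>z\<close>. Differentiating \<open>x y' = q\<close> brings in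
  \<open>z'\<close>, which the second equation replaces by a quadratic polynomial in
  \<open>z\<close>; squaring \<open>E = x y'\<close> produces the same quadratic terms, so
  \<open>z\<close> cancels.\<close>

lemma PV_from_system:
  fixes \<theta>0 \<theta>x \<theta>inf :: complex and y z :: "complex \<Rightarrow> complex"
  defines "a \<equiv> (\<theta>0 - \<theta>x + \<theta>inf) / 2" and "b \<equiv> (\<theta>0 + \<theta>x + \<theta>inf) / 2"
  assumes "open D" and x: "x \<in> D" and x0: "\<And>t. t \<in> D \<Longrightarrow> t \<noteq> 0" and y0: "\<And>t. t \<in> D \<Longrightarrow> y t \<noteq> 0"
    and y: "\<And>t. t \<in> D \<Longrightarrow> (y has_field_derivative
      (t * y t - 2 * z t * (y t - 1)\<^sup>2 - (y t - 1) * (a * y t - (\<theta>0 + b))) / t) (at t)"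
    and z: "\<And>t. t \<in> D \<Longrightarrow> (z has_field_derivative
      (y t * (z t * (z t + a)) - (z t + \<theta>0) * (z t + b) / y t) / t) (at t)"
    and y1: "y x \<noteq> 1"
  shows "(deriv ^^ 2) y x = PV_rhs \<theta>0 \<theta>x \<theta>inf x (y x) (deriv y x)"
proof -
  define q where "q t = t * y t - 2 * z t * (y t - 1)\<^sup>2 - (y t - 1) * (a * y t - (\<theta>0 + b))" for t
  define s where "s t = (y t * (z t * (z t + a)) - (z t + \<theta>0) * (z t + b) / y t) / t" for t
  have dy: "deriv y t = q t / t" if "t \<in> D" for t
    using DERIV_imp_deriv[OF y[OF that]] by (simp add: q_def)
  have yx: "(y has_field_derivative q x / x) (at x)" using y[OF x] by (simp add: q_def)
  have zx: "(z has_field_derivative s x) (at x)" using z[OF x] by (simp add: s_def)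
  define p where "p = q x / x"
  have q': "(q has_field_derivative y x + x * p - 2 * (s x * (y x - 1)\<^sup>2 + z x * (2 * (y x - 1) * p))
      - (p * (a * y x - (\<theta>0 + b)) + (y x - 1) * (a * p))) (at x)"
    unfolding q_def[abs_def] using yx zx
    by (auto intro!: derivative_eq_intros simp: p_def[symmetric] power2_eq_square algebra_simps)
  define d where "d = y x + x * p - 2 * (s x * (y x - 1)\<^sup>2 + z x * (2 * (y x - 1) * p))
      - (p * (a * y x - (\<theta>0 + b)) + (y x - 1) * (a * p))"
  have "((\<lambda>t. q t / t) has_field_derivative (d * x - q x * 1) / (x * x)) (at x)"
    unfolding d_def by (rule DERIV_divide[OF q' DERIV_ident x0[OF x]])
  moreover have "\<forall>\<^sub>F t in nhds x. deriv y t = q t / t"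
    using eventually_nhds_in_open[OF \<open>open D\<close> x] by eventually_elim (rule dy)
  ultimately have "deriv (deriv y) x = (d * x - q x) / (x * x)"
    using deriv_cong_ev[of "deriv y" "\<lambda>t. q t / t" x x] DERIV_imp_deriv by fastforce
  then have 2: "(deriv ^^ 2) y x = (d * x - q x) / (x * x)" by (simp add: numeral_2_eq_2)
  define Y where "Y = y x"
  define Z where "Z = z x"
  define E where "E = q x"
  have nz: "x \<noteq> 0" "Y \<noteq> 0" "Y - 1 \<noteq> 0" using x0[OF x] y0[OF x] y1 by (auto simp: Y_def)
  have E: "E = x * Y - 2 * Z * (Y - 1)\<^sup>2 - (Y - 1) * (a * Y - (\<theta>0 + b))" by (simp add: E_def q_def Y_def Z_def)
  have xp: "x * p = E" using nz by (simp add: p_def E_def)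
  have xs: "Y * (x * s x) = Y\<^sup>2 * (Z * (Z + a)) - (Z + \<theta>0) * (Z + b)"
    using nz by (simp add: s_def Y_def Z_def power2_eq_square field_simps)
  have dx: "Y * (d * x) = Y * (x * Y) + Y * (x * E) - 2 * (Y * (x * s x)) * (Y - 1)\<^sup>2 - 4 * Y * Z * (Y - 1) * E
      - Y * E * (a * Y - (\<theta>0 + b)) - Y * (Y - 1) * a * E"
    unfolding xp[symmetric] d_def Y_def[symmetric] Z_def[symmetric] by (simp add: algebra_simps)
  \<comment> \<open>With \<open>E\<close> and \<open>x z'\<close> inserted this is a polynomial
    identity in \<open>x\<close>, \<open>Y\<close>, \<open>Z\<close> and the parameters. The left
    side is \<open>x^2 y''\<close> times \<open>2 Y (Y - 1)\<close>, since
    \<open>d * x - E = x^2 y''\<close>.\<close>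
  have key: "2 * (Y - 1) * (Y * (d * x) - Y * E)
     = (Y - 1) * E\<^sup>2 + 2 * Y * E\<^sup>2 - 2 * Y * (Y - 1) * E + (Y - 1) ^ 3 * (a\<^sup>2 * Y\<^sup>2 - (\<theta>0 - b)\<^sup>2)
       + 2 * (1 - \<theta>0 - (b - a)) * x * Y\<^sup>2 * (Y - 1) - x\<^sup>2 * Y\<^sup>2 * (Y + 1)"
    unfolding dx xs E by algebra
  have par: "\<theta>0 - \<theta>x + \<theta>inf = 2 * a" "\<theta>0 - \<theta>x - \<theta>inf = 2 * (\<theta>0 - b)" "1 - \<theta>0 - \<theta>x = 1 - \<theta>0 - (b - a)"
    by (simp_all add: a_def b_def field_simps)
  \<comment> \<open>Denominators are cleared term by term, so that the equation can be compared with
    the polynomial identity.\<close>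
  have "PV_rhs \<theta>0 \<theta>x \<theta>inf x Y p * (2 * x\<^sup>2 * Y * (Y - 1))
     = (Y - 1) * (x * p)\<^sup>2 + 2 * Y * (x * p)\<^sup>2 - 2 * Y * (Y - 1) * (x * p) + (Y - 1) ^ 3 * (a\<^sup>2 * Y\<^sup>2 - (\<theta>0 - b)\<^sup>2)
       + 2 * (1 - \<theta>0 - (b - a)) * x * Y\<^sup>2 * (Y - 1) - x\<^sup>2 * Y\<^sup>2 * (Y + 1)"
  proof -
    have e1: "(1 / (2 * Y) + 1 / (Y - 1)) * p\<^sup>2 * (2 * x\<^sup>2 * Y * (Y - 1)) = (Y - 1) * (x * p)\<^sup>2 + 2 * Y * (x * p)\<^sup>2"
      using nz by (simp add: field_simps power2_eq_square)
    have e2: "p / x * (2 * x\<^sup>2 * Y * (Y - 1)) = 2 * Y * (Y - 1) * (x * p)"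
      using nz by (simp add: field_simps power2_eq_square)
    have g1: "(Y - 1)\<^sup>2 / (8 * x\<^sup>2) * G * (2 * x\<^sup>2 * Y * (Y - 1)) = (Y - 1) ^ 3 * (G * Y) / 4" for G
      using nz(1) by (simp add: power3_eq_cube power2_eq_square)
    have g2: "(u * Y - v / Y) * Y = u * Y\<^sup>2 - v" for u v
      using nz(2) by (simp add: left_diff_distrib power2_eq_square)
    have e3: "(Y - 1)\<^sup>2 / (8 * x\<^sup>2) * ((2 * a)\<^sup>2 * Y - (2 * (\<theta>0 - b))\<^sup>2 / Y) * (2 * x\<^sup>2 * Y * (Y - 1))
        = (Y - 1) ^ 3 * (a\<^sup>2 * Y\<^sup>2 - (\<theta>0 - b)\<^sup>2)"
    proof -
      have sq: "(2 * w)\<^sup>2 = 4 * w\<^sup>2" for w :: complex by (simp add: power_mult_distrib)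
      show ?thesis unfolding g1 g2 sq by (simp add: field_simps)
    qed
    have e4: "c * (Y / x) * (2 * x\<^sup>2 * Y * (Y - 1)) = 2 * c * x * Y\<^sup>2 * (Y - 1)" for c
      using nz by (simp add: power2_eq_square)
    have g5: "w \<noteq> 0 \<Longrightarrow> A / (2 * w) * (2 * B * w) = A * B" for w A B :: complex
      by simp
    have e5: "Y * (Y + 1) / (2 * (Y - 1)) * (2 * x\<^sup>2 * Y * (Y - 1)) = x\<^sup>2 * Y\<^sup>2 * (Y + 1)"
      using g5[OF nz(3), of "Y * (Y + 1)" "x\<^sup>2 * Y"] by (simp add: power2_eq_square mult_ac)
    show ?thesis
      unfolding PV_rhs_def par distrib_right[of _ _ "2 * x\<^sup>2 * Y * (Y - 1)"] left_diff_distrib[of _ _ "2 * x\<^sup>2 * Y * (Y - 1)"]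
        e1 e2 e3 e4 e5 by simp
  qed
  also have "\<dots> = (d * x - E) / (x * x) * (2 * x\<^sup>2 * Y * (Y - 1))"
  proof -
    have "F / (x * x) * (2 * x\<^sup>2 * Y * (Y - 1)) = 2 * (Y - 1) * (Y * F)" for F
      using nz(1) by (simp add: power2_eq_square)
    then show ?thesis unfolding xp key[symmetric] by (simp add: right_diff_distrib)
  qed
  finally have "PV_rhs \<theta>0 \<theta>x \<theta>inf x Y p * (2 * x\<^sup>2 * Y * (Y - 1)) = (d * x - E) / (x * x) * (2 * x\<^sup>2 * Y * (Y - 1))" .
  moreover have "2 * x\<^sup>2 * Y * (Y - 1) \<noteq> 0" using nz by simp
  ultimately have "PV_rhs \<theta>0 \<theta>x \<theta>inf x Y p = (d * x - E) / (x * x)"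
    using mult_right_cancel by blast
  then show ?thesis using 2 dy[OF x] by (simp add: p_def E_def Y_def)
qed

context pv_small
begin

subsection \<open>Evaluation of the formal solution\<close>

text \<open>The third condition absorbs the growth \<open>O(x^(min m n))\<close> of the coefficients; it holds on the domain because
  the product of the two variables is \<open>x^(-2)\<close>.\<close>

definition adm :: "complex \<Rightarrow> complex \<Rightarrow> complex \<Rightarrow> bool" where
  "adm a b x \<longleftrightarrow> norm a \<le> \<epsilon> \<and> norm b \<le> \<epsilon> \<and> norm a * norm b * norm x \<le> \<epsilon>\<^sup>2"

definition trm :: "arr \<Rightarrow> complex \<Rightarrow> complex \<Rightarrow> complex \<Rightarrow> complex \<Rightarrow> nat \<Rightarrow> nat \<Rightarrow> complex" where
  "trm X a b \<sigma> x m n = X m n \<sigma> x * (a ^ m * b ^ n)"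

definition ev :: "arr \<Rightarrow> complex \<Rightarrow> complex \<Rightarrow> complex \<Rightarrow> complex \<Rightarrow> complex" where
  "ev X a b \<sigma> x = double_sum (trm X a b \<sigma> x)"

text \<open>For \<open>n \<le> m\<close> the monomial is split into \<open>a^(m-n)\<close> and
  \<open>(a b)^n\<close>; the second factor takes up all powers of \<open>x\<close> by the third
  condition in \<open>adm\<close>.\<close>

lemma adm_power:
  assumes "adm a b x" shows "norm x ^ min m n * (norm a ^ m * norm b ^ n) \<le> \<epsilon> ^ (m + n)"
proof -
  have *: "norm x ^ n * (s ^ m * t ^ n) \<le> \<epsilon> ^ (m + n)"
    if "n \<le> m" "0 \<le> s" "0 \<le> t" "s \<le> \<epsilon>" "s * t * norm x \<le> \<epsilon>\<^sup>2" for s t :: real and m n :: nat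
  proof -
    have "norm x ^ n * (s ^ m * t ^ n) = s ^ (m - n) * (s * t * norm x) ^ n"
      using that(1) power_add[of s "m - n" n] by (simp add: power_mult_distrib)
    also have "\<dots> \<le> \<epsilon> ^ (m - n) * (\<epsilon>\<^sup>2) ^ n"
      using that \<epsilon> by (intro mult_mono power_mono) auto
    also have "\<dots> = \<epsilon> ^ (m + n)" using that(1) by (simp add: add.commute flip: power_add power_mult)
    finally show ?thesis .
  qed
  show ?thesis
  proof (cases "n \<le> m")
    case True
    then show ?thesis using *[OF True, of "norm a" "norm b"] assms by (simp add: adm_def min_absorb2)
  next
    case False
    then show ?thesis using *[of m n "norm b" "norm a"] assms by (simp add: adm_def mult_ac add.commute)
  qed
qed

text \<open>One majorant for all admissible \<open>a\<close>, \<open>b\<close> and all \<sigma>,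
  \<open>x\<close>; this is the source of every uniform convergence statement for the double
  series.\<close>

lemma trm_majorant:
  assumes "bnd min R X"
  obtains M where "\<And>m n a b \<sigma> x. \<sigma> \<in> A \<Longrightarrow> x \<in> S \<Longrightarrow> adm a b x \<Longrightarrow> norm (trm X a b \<sigma> x m n) \<le> M m n"
    "\<And>N. square_sum N M \<le> R"
proof -
  obtain M where M: "\<And>m n. 0 \<le> M m n"
    "\<And>m n \<sigma> x. \<sigma> \<in> A \<Longrightarrow> x \<in> S \<Longrightarrow> norm (X m n \<sigma> x) \<le> M m n * norm x ^ min m n"
    "\<And>N. (\<Sum>m\<le>N. \<Sum>n\<le>N. M m n * \<epsilon> ^ (m + n)) \<le> R" using bndE[OF assms] by blast
  show thesis
  proof (rule that[of "\<lambda>m n. M m n * \<epsilon> ^ (m + n)"])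
    fix m n a b \<sigma> x assume *: "\<sigma> \<in> A" "x \<in> S" "adm a b x"
    have "norm (trm X a b \<sigma> x m n) \<le> (M m n * norm x ^ min m n) * (norm a ^ m * norm b ^ n)"
      unfolding trm_def norm_mult norm_power by (intro mult_right_mono M *) simp
    also have "\<dots> = M m n * (norm x ^ min m n * (norm a ^ m * norm b ^ n))" by simp
    also have "\<dots> \<le> M m n * \<epsilon> ^ (m + n)" by (intro mult_left_mono adm_power * M)
    finally show "norm (trm X a b \<sigma> x m n) \<le> M m n * \<epsilon> ^ (m + n)" .
  qed (use M(3) in \<open>simp add: square_sum_def\<close>)
qed

text \<open>Lets right-hand sides, which obey the stricter order \<open>rexp\<close>, be evaluated
  like the other arrays.\<close>

lemma bnd_rexp_min: assumes "bnd rexp R X" shows "bnd min R X"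
proof -
  obtain M where M: "\<And>m n. 0 \<le> M m n"
    "\<And>m n \<sigma> x. \<sigma> \<in> A \<Longrightarrow> x \<in> S \<Longrightarrow> norm (X m n \<sigma> x) \<le> M m n * norm x ^ rexp m n"
    "\<And>N. (\<Sum>m\<le>N. \<Sum>n\<le>N. M m n * \<epsilon> ^ (m + n)) \<le> R" using bndE[OF assms] by blast
  show ?thesis
  proof (rule bndI[OF M(1) _ M(3)])
    fix m n \<sigma> x assume *: "\<sigma> \<in> A" "x \<in> S"
    have "norm x ^ rexp m n \<le> norm x ^ min m n"
      using far[OF *(2)] by (intro power_increasing) (auto simp: rexp_def)
    then show "norm (X m n \<sigma> x) \<le> M m n * norm x ^ min m n"
      using M(2)[OF *, of m n] M(1)[of m n] mult_left_mono by fastforce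
  qed
qed

context
  fixes \<sigma> x a b :: complex
  assumes \<sigma>: "\<sigma> \<in> A" and x: "x \<in> S" and adm: "adm a b x"
begin

lemma ev_abs_summable: assumes "bnd min R X" shows "abssum (\<lambda>(m, n). trm X a b \<sigma> x m n) UNIV"
proof -
  obtain M where "\<And>m n a b \<sigma> x. \<sigma> \<in> A \<Longrightarrow> x \<in> S \<Longrightarrow> adm a b x \<Longrightarrow> norm (trm X a b \<sigma> x m n) \<le> M m n"
    "\<And>N. square_sum N M \<le> R" using trm_majorant[OF assms] by blast
  then show ?thesis using \<sigma> x adm by (intro dominated_summable(1)[where M = M and R = R]) auto
qed

lemma ev_summable: "bnd min R X \<Longrightarrow> (\<lambda>(m, n). trm X a b \<sigma> x m n) summable_on UNIV"
  by (rule abs_summable_summable[OF ev_abs_summable])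

lemma ev_add: assumes "bnd min R X" "bnd min R' Y" shows "ev (add X Y) a b \<sigma> x = ev X a b \<sigma> x + ev Y a b \<sigma> x"
proof -
  have "trm (add X Y) a b \<sigma> x = (\<lambda>m n. trm X a b \<sigma> x m n + trm Y a b \<sigma> x m n)"
    by (simp add: trm_def add_def fun_eq_iff distrib_right)
  then show ?thesis unfolding ev_def using double_sum_add[OF ev_summable[OF assms(1)] ev_summable[OF assms(2)]] by simp
qed

lemma ev_neg: "ev (neg X) a b \<sigma> x = - ev X a b \<sigma> x"
proof -
  have "trm (neg X) a b \<sigma> x = (\<lambda>m n. - 1 * trm X a b \<sigma> x m n)"
    by (simp add: trm_def neg_def fun_eq_iff)
  then show ?thesis unfolding ev_def by (simp only: double_sum_cmult) simp
qed

lemma ev_divx: "ev (divx X) a b \<sigma> x = ev X a b \<sigma> x / x"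
proof -
  have "trm (divx X) a b \<sigma> x = (\<lambda>m n. inverse x * trm X a b \<sigma> x m n)"
    by (simp add: trm_def divx_def fun_eq_iff divide_inverse)
  then show ?thesis unfolding ev_def by (simp only: double_sum_cmult) (simp add: divide_inverse)
qed

lemma ev_shiftX: "ev (shiftX X) a b \<sigma> x = a * ev X a b \<sigma> x"
proof -
  have "trm (shiftX X) a b \<sigma> x = (\<lambda>m n. if m = 0 then 0 else a * trm X a b \<sigma> x (m - 1) n)"
    by (auto simp: trm_def shiftX_def fun_eq_iff power_eq_if)
  then show ?thesis
    unfolding ev_def using double_sum_shift[of "\<lambda>m n. a * trm X a b \<sigma> x m n"] by (simp only: double_sum_cmult)
qed

lemma ev_conv:
  assumes "bnd min R X" "bnd min R' Y"
  shows "ev (conv X Y) a b \<sigma> x = ev X a b \<sigma> x * ev Y a b \<sigma> x"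
proof -
  have "trm (conv X Y) a b \<sigma> x = (\<lambda>m n. \<Sum>i\<le>m. \<Sum>j\<le>n. trm X a b \<sigma> x i j * trm Y a b \<sigma> x (m - i) (n - j))"
  proof (intro ext)
    fix m n
    show "trm (conv X Y) a b \<sigma> x m n = (\<Sum>i\<le>m. \<Sum>j\<le>n. trm X a b \<sigma> x i j * trm Y a b \<sigma> x (m - i) (n - j))"
      unfolding trm_def conv_def sum_distrib_right
    proof (intro sum.cong refl)
      fix i j assume "i \<in> {..m}" "j \<in> {..n}"
      then have "a ^ m = a ^ i * a ^ (m - i)" "b ^ n = b ^ j * b ^ (n - j)" by (simp_all flip: power_add)
      then show "X i j \<sigma> x * Y (m - i) (n - j) \<sigma> x * (a ^ m * b ^ n)
          = X i j \<sigma> x * (a ^ i * b ^ j) * (Y (m - i) (n - j) \<sigma> x * (a ^ (m - i) * b ^ (n - j)))"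
        by simp
    qed
  qed
  then show ?thesis
    unfolding ev_def using double_sum_conv[OF ev_abs_summable[OF assms(1)] ev_abs_summable[OF assms(2)]] by simp
qed

lemma ev_cst: "ev (cst e) a b \<sigma> x = e \<sigma>"
proof -
  have "(\<Sum>\<^sub>\<infinity>(m, n). trm (cst e) a b \<sigma> x m n) = (\<Sum>\<^sub>\<infinity>(m, n)\<in>{(0, 0)}. trm (cst e) a b \<sigma> x m n)"
    by (rule infsum_cong_neutral) (auto simp: trm_def cst_def split: if_splits)
  then show ?thesis by (simp add: ev_def double_sum_def trm_def cst_def)
qed

end

lemma adm_swap: "adm a b x \<Longrightarrow> adm b a x"
  by (simp add: adm_def mult_ac)

lemma ev_swap: "ev (swap X) b a \<sigma> x = ev X a b \<sigma> x"
proof -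
  have "trm (swap X) b a \<sigma> x = (\<lambda>m n. trm X a b \<sigma> x n m)"
    by (simp add: trm_def swap_def fun_eq_iff)
  then show ?thesis unfolding ev_def by (simp only: double_sum_swap[of "trm X a b \<sigma> x"])
qed

lemma ev_shiftY:
  assumes "\<sigma> \<in> A" "x \<in> S" "adm a b x" shows "ev (shiftY X) a b \<sigma> x = b * ev X a b \<sigma> x"
proof -
  have "ev (shiftY X) a b \<sigma> x = ev (shiftX (swap X)) b a \<sigma> x" unfolding shiftY_swap by (rule ev_swap)
  also have "\<dots> = b * ev (swap X) b a \<sigma> x" by (rule ev_shiftX[OF assms(1,2) adm_swap[OF assms(3)]])
  also have "ev (swap X) b a \<sigma> x = ev X a b \<sigma> x" by (rule ev_swap)
  finally show ?thesis .
qed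

section \<open>Substitution of the exponential variables\<close>

definition Xc :: "complex \<Rightarrow> complex \<Rightarrow> complex \<Rightarrow> complex" where "Xc c \<sigma> x = c * Xvar \<sigma> x"
definition Yc :: "complex \<Rightarrow> complex \<Rightarrow> complex \<Rightarrow> complex" where "Yc c \<sigma> x = inverse c * Yvar \<sigma> x"

definition Dom :: "complex \<Rightarrow> complex \<Rightarrow> complex set" where
  "Dom c \<sigma> = {x \<in> S. norm (Xc c \<sigma> x) < \<epsilon> \<and> norm (Yc c \<sigma> x) < \<epsilon>}"

lemma XcYc: assumes "x \<noteq> 0" "c \<noteq> 0" shows "Xc c \<sigma> x * Yc c \<sigma> x = 1 / x\<^sup>2"
proof -
  have "x powr (\<sigma> - 1) * x powr (- \<sigma> - 1) = x powr (- 2)"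
    by (simp add: powr_add[symmetric])
  also have "\<dots> = 1 / x\<^sup>2"
    unfolding powr_minus using assms by (simp add: divide_inverse)
  finally have "exp x * exp (- x) * (x powr (\<sigma> - 1) * x powr (- \<sigma> - 1)) = 1 / x\<^sup>2"
    by (simp add: exp_minus_inverse)
  then show ?thesis using assms by (simp add: Xc_def Yc_def Xvar_def Yvar_def mult_ac)
qed

lemma S_large: "x \<in> S \<Longrightarrow> 1 \<le> norm x * \<epsilon>\<^sup>2"
proof -
  assume "x \<in> S"
  then have "r * \<epsilon>\<^sup>2 \<le> norm x * \<epsilon>\<^sup>2" by (intro mult_right_mono) (auto simp: S_iff)
  then show ?thesis using r_eps by linarith
qed

text \<open>Because \<open>Xc * Yc = 1 / x^2\<close>, the third condition amounts to
  \<open>1 / norm x \<le> \<epsilon>^2\<close>, which holds by the choice of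
  \<open>r\<close>.\<close>

lemma Dom_adm: assumes "x \<in> Dom c \<sigma>" "c \<noteq> 0" shows "adm (Xc c \<sigma> x) (Yc c \<sigma> x) x"
proof -
  have x: "x \<in> S" using assms by (simp add: Dom_def)
  have "norm (Xc c \<sigma> x) * norm (Yc c \<sigma> x) * norm x = norm (Xc c \<sigma> x * Yc c \<sigma> x) * norm x"
    by (simp add: norm_mult)
  also have "\<dots> = 1 / norm x"
    using XcYc[OF S_pos(2)[OF x] assms(2)] S_pos(1)[OF x] by (simp add: norm_divide norm_mult power2_eq_square)
  also have "\<dots> \<le> \<epsilon>\<^sup>2" using S_large[OF x] S_pos(1)[OF x] by (simp add: field_simps)
  finally show ?thesis using assms by (auto simp: adm_def Dom_def)
qed

lemma Xc_deriv: assumes "x \<in> S" shows "(Xc c \<sigma> has_field_derivative (1 + (\<sigma> - 1) / x) * Xc c \<sigma> x) (at x)"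
proof -
  have "((\<lambda>x. c * (exp x * x powr (\<sigma> - 1))) has_field_derivative
      c * (exp x * x powr (\<sigma> - 1) + ((\<sigma> - 1) * x powr (\<sigma> - 1 - 1)) * exp x)) (at x)"
    using S_pos[OF assms] S_notin_nonpos[OF assms] by (auto intro!: derivative_eq_intros)
  moreover have "x powr (\<sigma> - 1 - 1) = x powr (\<sigma> - 1) / x"
    unfolding powr_diff[of x "\<sigma> - 1" 1] using S_pos(2)[OF assms] by simp
  ultimately show ?thesis unfolding Xc_def[abs_def] Xvar_def
    by (simp add: algebra_simps add_divide_distrib diff_divide_distrib)
qed

lemma Yc_deriv: assumes "x \<in> S" shows "(Yc c \<sigma> has_field_derivative (- 1 - (\<sigma> + 1) / x) * Yc c \<sigma> x) (at x)"
proof -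
  have "((\<lambda>x. inverse c * (exp (- x) * x powr (- \<sigma> - 1))) has_field_derivative
      inverse c * (- exp (- x) * x powr (- \<sigma> - 1) + ((- \<sigma> - 1) * x powr (- \<sigma> - 1 - 1)) * exp (- x))) (at x)"
    using S_pos[OF assms] S_notin_nonpos[OF assms] by (auto intro!: derivative_eq_intros)
  moreover have "x powr (- \<sigma> - 1 - 1) = x powr (- \<sigma> - 1) / x"
    unfolding powr_diff[of x "- \<sigma> - 1" 1] using S_pos(2)[OF assms] by simp
  ultimately show ?thesis unfolding Yc_def[abs_def] Yvar_def
    by (simp add: algebra_simps add_divide_distrib diff_divide_distrib)
qed

lemma open_Dom: "open (Dom c \<sigma>)"
proof -
  have c: "continuous_on S (Xc c \<sigma>)" "continuous_on S (Yc c \<sigma>)"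
    by (rule continuous_at_imp_continuous_on; use Xc_deriv Yc_deriv DERIV_isCont in blast)+
  have "open (S \<inter> (\<lambda>x. (norm (Xc c \<sigma> x), norm (Yc c \<sigma> x))) -` ({..<\<epsilon>} \<times> {..<\<epsilon>}))"
    by (rule continuous_open_preimage)
      (auto intro!: continuous_on_Pair continuous_on_norm c open_S open_Times)
  moreover have "S \<inter> (\<lambda>x. (norm (Xc c \<sigma> x), norm (Yc c \<sigma> x))) -` ({..<\<epsilon>} \<times> {..<\<epsilon>}) = Dom c \<sigma>"
    by (auto simp: Dom_def)
  ultimately show ?thesis by simp
qed

text \<open>The logarithmic derivative of \<open>Xc^m Yc^n\<close> is
  \<open>(m - n) (1 + \<sigma>/x) - (m + n) / x\<close> and cancels the homogeneous part of the
  equation in \<open>Lop_deriv\<close>. This fixes the parameters \<open>k = m - n\<close> and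
  \<open>N = m + n\<close> in \<open>Lop\<close>.\<close>

lemma trm_deriv:
  assumes F: "good rexp R F" and \<sigma>: "\<sigma> \<in> A" and x: "x \<in> S" and 0: "m = 0 \<and> n = 0 \<Longrightarrow> F m n \<sigma> x = 0"
  shows "((\<lambda>x. trm (Lop F) (Xc c \<sigma> x) (Yc c \<sigma> x) \<sigma> x m n) has_field_derivative
      trm F (Xc c \<sigma> x) (Yc c \<sigma> x) \<sigma> x m n) (at x)"
proof -
  let ?X = "Xc c \<sigma> x" and ?Y = "Yc c \<sigma> x" and ?L = "Lop F m n \<sigma> x"
  have pX: "((\<lambda>x. Xc c \<sigma> x ^ m) has_field_derivative of_nat m * (1 + (\<sigma> - 1) / x) * ?X ^ m) (at x)"
  proof -
    have "((\<lambda>x. Xc c \<sigma> x ^ m) has_field_derivative of_nat m * ((1 + (\<sigma> - 1) / x) * ?X * ?X ^ (m - Suc 0))) (at x)"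
      by (rule DERIV_power[OF Xc_deriv[OF x]])
    then show ?thesis by (cases m) (simp_all add: mult_ac)
  qed
  have pY: "((\<lambda>x. Yc c \<sigma> x ^ n) has_field_derivative of_nat n * (- 1 - (\<sigma> + 1) / x) * ?Y ^ n) (at x)"
  proof -
    have "((\<lambda>x. Yc c \<sigma> x ^ n) has_field_derivative of_nat n * ((- 1 - (\<sigma> + 1) / x) * ?Y * ?Y ^ (n - Suc 0))) (at x)"
      by (rule DERIV_power[OF Yc_deriv[OF x]])
    then show ?thesis by (cases n) (simp_all add: mult_ac)
  qed
  define \<Lambda> where "\<Lambda> = of_int (int m - int n) * (1 + \<sigma> / x) - of_nat (m + n) / x"
  have \<Lambda>: "of_nat m * (1 + (\<sigma> - 1) / x) + of_nat n * (- 1 - (\<sigma> + 1) / x) = \<Lambda>"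
    by (simp add: \<Lambda>_def algebra_simps diff_divide_distrib add_divide_distrib)
  have "((\<lambda>x. Lop F m n \<sigma> x * (Xc c \<sigma> x ^ m * Yc c \<sigma> x ^ n)) has_field_derivative
     (F m n \<sigma> x - \<Lambda> * ?L) * (?X ^ m * ?Y ^ n)
      + ((of_nat m * (1 + (\<sigma> - 1) / x) * ?X ^ m) * ?Y ^ n + (of_nat n * (- 1 - (\<sigma> + 1) / x) * ?Y ^ n) * ?X ^ m) * ?L) (at x)"
    unfolding \<Lambda>_def by (intro DERIV_mult pX pY Lop_deriv[OF F \<sigma> x 0])
  moreover have "(F m n \<sigma> x - \<Lambda> * ?L) * (?X ^ m * ?Y ^ n)
      + ((of_nat m * (1 + (\<sigma> - 1) / x) * ?X ^ m) * ?Y ^ n + (of_nat n * (- 1 - (\<sigma> + 1) / x) * ?Y ^ n) * ?X ^ m) * ?L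
      = F m n \<sigma> x * (?X ^ m * ?Y ^ n)"
    unfolding \<Lambda>[symmetric] by (simp add: algebra_simps)
  ultimately show ?thesis unfolding trm_def by simp
qed

text \<open>Term by term differentiation, justified by locally uniform convergence of the square
  sums; the derived series converges because the right-hand side has a majorant too.\<close>

lemma ev_deriv:
  assumes F: "good rexp R F" and \<sigma>: "\<sigma> \<in> A" and c: "c \<noteq> 0" and x: "x \<in> Dom c \<sigma>"
    and 0: "\<And>x. x \<in> S \<Longrightarrow> F 0 0 \<sigma> x = 0"
  shows "((\<lambda>x. ev (Lop F) (Xc c \<sigma> x) (Yc c \<sigma> x) \<sigma> x) has_field_derivative
      ev F (Xc c \<sigma> x) (Yc c \<sigma> x) \<sigma> x) (at x)"
proof -
  define f where "f N x = square_sum N (trm (Lop F) (Xc c \<sigma> x) (Yc c \<sigma> x) \<sigma> x)" for N x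
  define f' where "f' N x = square_sum N (trm F (Xc c \<sigma> x) (Yc c \<sigma> x) \<sigma> x)" for N x
  have b: "bnd min (4 / slope \<delta> * R) (Lop F)" by (rule good_bnd[OF good_Lop[OF F]])
  obtain M where M: "\<And>m n a b \<sigma> x. \<sigma> \<in> A \<Longrightarrow> x \<in> S \<Longrightarrow> adm a b x \<Longrightarrow> norm (trm (Lop F) a b \<sigma> x m n) \<le> M m n"
    "\<And>N. square_sum N M \<le> 4 / slope \<delta> * R" using trm_majorant[OF b] by blast
  have DS: "y \<in> S" if "y \<in> Dom c \<sigma>" for y using that by (simp add: Dom_def)
  have Mn: "norm (M m n) \<le> M m n" for m n
    using order_trans[OF norm_ge_zero M(1)[OF \<sigma> DS[OF x] Dom_adm[OF x c]]] by simp
  have \<tau>: "(\<lambda>N. double_sum M - square_sum N M) \<longlonglongrightarrow> 0"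
  proof -
    have "(\<lambda>(m, n). M m n) summable_on UNIV"
      by (rule abs_summable_summable[OF dominated_summable(1)[OF Mn M(2)]])
    from tendsto_diff[OF tendsto_const square_sum_tendsto_double_sum[OF this], of "double_sum M"] show ?thesis by simp
  qed
  have "\<exists>g'. \<forall>x\<in>Dom c \<sigma>. ((\<lambda>x. ev (Lop F) (Xc c \<sigma> x) (Yc c \<sigma> x) \<sigma> x) has_field_derivative g' x) (at x)
      \<and> (\<lambda>N. f' N x) \<longlonglongrightarrow> g' x"
  proof (rule has_complex_derivative_uniform_sequence[OF open_Dom])
    show "(f N has_field_derivative f' N y) (at y)" if "y \<in> Dom c \<sigma>" for N y
      unfolding f_def[abs_def] f'_def square_sum_def
      by (intro DERIV_sum trm_deriv[OF F \<sigma> DS[OF that]]) (use 0[OF DS[OF that]] in auto)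
    fix y assume "y \<in> Dom c \<sigma>"
    then obtain d where d: "d > 0" "cball y d \<subseteq> Dom c \<sigma>" using open_Dom open_contains_cball by blast
    have "uniform_limit (cball y d) f (\<lambda>x. ev (Lop F) (Xc c \<sigma> x) (Yc c \<sigma> x) \<sigma> x) sequentially"
      unfolding uniform_limit_iff
    proof (intro allI impI)
      fix e :: real assume "e > 0"
      with \<tau> have "\<forall>\<^sub>F N in sequentially. double_sum M - square_sum N M < e" by (rule order_tendstoD(2))
      then show "\<forall>\<^sub>F N in sequentially. \<forall>t\<in>cball y d. dist (f N t) (ev (Lop F) (Xc c \<sigma> t) (Yc c \<sigma> t) \<sigma> t) < e"
      proof eventually_elim
        case (elim N)
        show ?case
        proof
          fix t assume "t \<in> cball y d"
          then have t: "t \<in> Dom c \<sigma>" using d by auto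
          have "norm (ev (Lop F) (Xc c \<sigma> t) (Yc c \<sigma> t) \<sigma> t - f N t) \<le> double_sum M - square_sum N M"
            unfolding ev_def f_def
            by (rule double_sum_diff_square[OF M(1)[OF \<sigma> DS[OF t] Dom_adm[OF t c]] M(2)])
          then show "dist (f N t) (ev (Lop F) (Xc c \<sigma> t) (Yc c \<sigma> t) \<sigma> t) < e"
            using elim by (simp add: dist_norm norm_minus_commute)
        qed
      qed
    qed
    with d show "\<exists>d>0. cball y d \<subseteq> Dom c \<sigma> \<and>
        uniform_limit (cball y d) f (\<lambda>x. ev (Lop F) (Xc c \<sigma> x) (Yc c \<sigma> x) \<sigma> x) sequentially" by blast
  qed
  then obtain g' where g': "((\<lambda>x. ev (Lop F) (Xc c \<sigma> x) (Yc c \<sigma> x) \<sigma> x) has_field_derivative g' x) (at x)"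
    "(\<lambda>N. f' N x) \<longlonglongrightarrow> g' x" using x by blast
  have "(\<lambda>N. f' N x) \<longlonglongrightarrow> ev F (Xc c \<sigma> x) (Yc c \<sigma> x) \<sigma> x"
    unfolding f'_def ev_def
    by (rule square_sum_tendsto_double_sum[OF ev_summable[OF \<sigma> DS[OF x] Dom_adm[OF x c]
            bnd_rexp_min[OF good_bnd[OF F]]]])
  then have "g' x = ev F (Xc c \<sigma> x) (Yc c \<sigma> x) \<sigma> x" using g'(2) LIMSEQ_unique by blast
  with g'(1) show ?thesis by simp
qed

end

lemma holomorphic3_on_cong:
  assumes "holomorphic3_on f S" "\<And>p. p \<in> S \<Longrightarrow> g p = f p" shows "holomorphic3_on g S"
  unfolding holomorphic3_on_def
proof
  fix p assume p: "p \<in> S"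
  then obtain \<alpha> \<beta> \<gamma> where "(f has_derivative (\<lambda>(h, k, l). \<alpha> * h + \<beta> * k + \<gamma> * l)) (at p within S)"
    using assms(1) unfolding holomorphic3_on_def by blast
  from has_derivative_transform[OF p assms(2) this]
  show "\<exists>\<alpha> \<beta> \<gamma>. (g has_derivative (\<lambda>(h, k, l). \<alpha> * h + \<beta> * k + \<gamma> * l)) (at p within S)" by blast
qed

lemma holomorphic3_on_subset:
  "holomorphic3_on f S \<Longrightarrow> T \<subseteq> S \<Longrightarrow> holomorphic3_on f T"
  unfolding holomorphic3_on_def by (meson has_derivative_subset subsetD)

section \<open>The solution of the first-order system\<close>

context pv_small
begin

text \<open>Hiding the radii makes the side conditions of evaluation automatic. \<open>fin\<close>
  is for arrays built by sums and products, \<open>Bd\<close> covers also shifts and quotients by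
  \<open>x\<close>.\<close>

definition fin :: "arr \<Rightarrow> bool" where "fin X \<longleftrightarrow> (\<exists>R. good min R X)"
definition Bd :: "arr \<Rightarrow> bool" where "Bd X \<longleftrightarrow> (\<exists>R. bnd min R X)"

lemma fin_Bd: "fin X \<Longrightarrow> Bd X"
  unfolding fin_def Bd_def using good_bnd by blast

lemma finI: "fin U" "fin W" "fin V" "fin (cst P0)" "fin (cst P1)" "fin (cst R0)" "fin (cst R1)" "fin one" "fin (cst (\<lambda>\<sigma>. 4))"
  unfolding fin_def using good_U good_W good_V good_PR good_one good_cst_rat[of 4 4] by (blast, blast, blast, blast, blast, blast, blast, blast, auto)

lemma fin_add: "fin X \<Longrightarrow> fin Y \<Longrightarrow> fin (add X Y)" and fin_conv: "fin X \<Longrightarrow> fin Y \<Longrightarrow> fin (conv X Y)"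
  unfolding fin_def using good_add good_conv by blast+

lemma Bd_rexp: "good rexp R X \<Longrightarrow> Bd X"
  unfolding Bd_def using bnd_rexp_min good_bnd by blast

lemma Bd_shift: "fin X \<Longrightarrow> Bd (shiftX X)" "fin X \<Longrightarrow> Bd (shiftY X)" "fin X \<Longrightarrow> Bd (divx X)"
  unfolding fin_def using good_shiftX good_shiftY good_divx Bd_rexp by blast+

lemma Bd_add: "Bd X \<Longrightarrow> Bd Y \<Longrightarrow> Bd (add X Y)"
  unfolding Bd_def using bnd_add by blast

lemma Bd_neg: "Bd X \<Longrightarrow> Bd (neg X)"
  unfolding Bd_def bnd_def neg_def by simp

definition zf :: "complex \<Rightarrow> complex \<Rightarrow> complex \<Rightarrow> complex" where
  "zf c \<sigma> x = zeta \<sigma> + ev U (Xc c \<sigma> x) (Yc c \<sigma> x) \<sigma> x"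

definition Wf :: "complex \<Rightarrow> complex \<Rightarrow> complex \<Rightarrow> complex" where
  "Wf c \<sigma> x = 1 + ev W (Xc c \<sigma> x) (Yc c \<sigma> x) \<sigma> x"

definition yf :: "complex \<Rightarrow> complex \<Rightarrow> complex \<Rightarrow> complex" where
  "yf c \<sigma> x = c * (exp x * x powr \<sigma>) * Wf c \<sigma> x"

lemma exp_powr_Xc: assumes "x \<noteq> 0" shows "c * (exp x * x powr \<sigma>) = x * Xc c \<sigma> x"
proof -
  have "x powr \<sigma> = x powr (\<sigma> - 1) * x" using assms by (simp add: powr_diff)
  then show ?thesis by (simp add: Xc_def Xvar_def)
qed

lemma U00: "U 0 0 = (\<lambda>\<sigma> x. 0)" and W00: "W 0 0 = (\<lambda>\<sigma> x. 0)"
  by (subst U_eq, rule Lop00) (subst W_eq, rule Lop00)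

lemma rhs_u00: "rhs_u U W V 0 0 \<sigma> x = 0"
  by (simp add: rhs_u_def add_def neg_def shiftX_def shiftY_def)

lemma rhs_w00: "rhs_w U W 0 0 \<sigma> x = 0"
  by (simp add: rhs_w_def add_def neg_def shiftX_def shiftY_def divx_def conv_def U00)

context
  fixes \<sigma> c x :: complex
  assumes \<sigma>: "\<sigma> \<in> A" and c: "c \<noteq> 0" and x: "x \<in> Dom c \<sigma>"
begin

private lemma xS: "x \<in> S" using x by (simp add: Dom_def)
private lemma adm: "adm (Xc c \<sigma> x) (Yc c \<sigma> x) x" by (rule Dom_adm[OF x c])

private abbreviation "\<X> \<equiv> Xc c \<sigma> x"
private abbreviation "\<Y> \<equiv> Yc c \<sigma> x"
private abbreviation "evx X \<equiv> ev X \<X> \<Y> \<sigma> x"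

private lemma evx_add: "Bd X \<Longrightarrow> Bd Y \<Longrightarrow> evx (add X Y) = evx X + evx Y"
  unfolding Bd_def using ev_add[OF \<sigma> xS adm] by blast

private lemma evx_conv: "Bd X \<Longrightarrow> Bd Y \<Longrightarrow> evx (conv X Y) = evx X * evx Y"
  unfolding Bd_def using ev_conv[OF \<sigma> xS adm] by blast

private lemmas evx_rest = ev_neg[OF \<sigma> xS adm] ev_cst[OF \<sigma> xS adm] ev_shiftX[OF \<sigma> xS adm] ev_shiftY[OF \<sigma> xS adm] ev_divx[OF \<sigma> xS adm]

private lemmas Bd_intros = Bd_add Bd_neg Bd_shift fin_Bd fin_add fin_conv finI

text \<open>Thus \<open>Wf\<close> has no zeros and \<open>1 + v\<close> evaluates to its inverse;
  this is what allows \<open>1/y\<close> to be handled inside the double series.\<close>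

lemma WV: "Wf c \<sigma> x * (1 + ev V \<X> \<Y> \<sigma> x) = 1"
proof -
  have "evx V = evx (neg (add W (conv W V)))" using V_eq by simp
  also have "\<dots> = - (evx W + evx W * evx V)"
    by (simp add: evx_rest evx_add evx_conv Bd_intros)
  finally show ?thesis by (simp add: Wf_def algebra_simps)
qed

lemma zf_deriv: "(zf c \<sigma> has_field_derivative
    \<X> * Wf c \<sigma> x * (zf c \<sigma> x * (zf c \<sigma> x + pa))
    - \<Y> * (1 + ev V \<X> \<Y> \<sigma> x) * ((zf c \<sigma> x + \<theta>0) * (zf c \<sigma> x + pb))) (at x)"
proof -
  have "((\<lambda>x. ev U (Xc c \<sigma> x) (Yc c \<sigma> x) \<sigma> x) has_field_derivative evx (rhs_u U W V)) (at x)"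
    using ev_deriv[OF good_rhs_u[OF good_U good_W good_V] \<sigma> c x rhs_u00] by (simp flip: U_eq)
  then have "(zf c \<sigma> has_field_derivative evx (rhs_u U W V)) (at x)"
    unfolding zf_def[abs_def] by (auto intro!: derivative_eq_intros)
  moreover have "evx (rhs_u U W V) = \<X> * ((1 + evx W) * (P0 \<sigma> + (P1 \<sigma> * evx U + evx U * evx U)))
      - \<Y> * ((1 + evx V) * (R0 \<sigma> + (R1 \<sigma> * evx U + evx U * evx U)))"
    unfolding rhs_u_def by (simp add: evx_rest evx_add evx_conv Bd_intros)
  moreover have "P0 \<sigma> + (P1 \<sigma> * evx U + evx U * evx U) = zf c \<sigma> x * (zf c \<sigma> x + pa)"
    "R0 \<sigma> + (R1 \<sigma> * evx U + evx U * evx U) = (zf c \<sigma> x + \<theta>0) * (zf c \<sigma> x + pb)"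
    by (simp_all add: P0_def P1_def R0_def R1_def zf_def algebra_simps)
  ultimately show ?thesis by (simp add: Wf_def mult.assoc)
qed

lemma Wf_deriv: "(Wf c \<sigma> has_field_derivative
    4 * ev U \<X> \<Y> \<sigma> x * Wf c \<sigma> x / x - \<X> * (Wf c \<sigma> x)\<^sup>2 * (P1 \<sigma> + 2 * ev U \<X> \<Y> \<sigma> x)
    - \<Y> * (R1 \<sigma> + 2 * ev U \<X> \<Y> \<sigma> x)) (at x)"
proof -
  have "((\<lambda>x. ev W (Xc c \<sigma> x) (Yc c \<sigma> x) \<sigma> x) has_field_derivative evx (rhs_w U W)) (at x)"
    using ev_deriv[OF good_rhs_w[OF good_U good_W] \<sigma> c x rhs_w00] by (simp flip: W_eq)
  then have "(Wf c \<sigma> has_field_derivative evx (rhs_w U W)) (at x)"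
    unfolding Wf_def[abs_def] by (auto intro!: derivative_eq_intros)
  moreover have "evx (rhs_w U W) = evx U * (4 * (1 + evx W)) / x
      - (\<X> * ((1 + evx W) * (1 + evx W) * (P1 \<sigma> + (evx U + evx U))) + \<Y> * (R1 \<sigma> + (evx U + evx U)))"
    unfolding rhs_w_def by (simp add: evx_rest evx_add evx_conv Bd_intros)
  moreover have "evx U * (4 * (1 + evx W)) / x
      - (\<X> * ((1 + evx W) * (1 + evx W) * (P1 \<sigma> + (evx U + evx U))) + \<Y> * (R1 \<sigma> + (evx U + evx U)))
      = 4 * ev U \<X> \<Y> \<sigma> x * Wf c \<sigma> x / x - \<X> * (Wf c \<sigma> x)\<^sup>2 * (P1 \<sigma> + 2 * ev U \<X> \<Y> \<sigma> x)
        - \<Y> * (R1 \<sigma> + 2 * ev U \<X> \<Y> \<sigma> x)"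
    unfolding Wf_def power2_eq_square mult_2 by (simp add: mult_ac)
  ultimately show ?thesis by (simp only:)
qed

lemma yf_nonzero: "yf c \<sigma> x \<noteq> 0"
  using WV c S_pos(2)[OF xS] by (auto simp: yf_def)

lemma yf_system: "(yf c \<sigma> has_field_derivative
    (x * yf c \<sigma> x - 2 * zf c \<sigma> x * (yf c \<sigma> x - 1)\<^sup>2 - (yf c \<sigma> x - 1) * (pa * yf c \<sigma> x - (\<theta>0 + pb))) / x) (at x)"
  and zf_system: "(zf c \<sigma> has_field_derivative
    (yf c \<sigma> x * (zf c \<sigma> x * (zf c \<sigma> x + pa)) - (zf c \<sigma> x + \<theta>0) * (zf c \<sigma> x + pb) / yf c \<sigma> x) / x) (at x)"
proof -
  have x0: "x \<noteq> 0" by (rule S_pos(2)[OF xS])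
  define y where "y = yf c \<sigma> x"
  define w where "w = Wf c \<sigma> x"
  define u where "u = evx U"
  define v where "v = 1 + evx V"
  define z where "z = zf c \<sigma> x"
  have y: "y = x * \<X> * w" by (simp add: y_def yf_def exp_powr_Xc[OF x0] w_def)
  \<comment> \<open>This turns \<open>1/y\<close> into \<open>x * \<Y> * v\<close>, and the term
    with \<open>\<Y>\<close> in the equation for \<open>w\<close> into the term free of
    \<open>y\<close>.\<close>
  have XY: "x * x * \<X> * \<Y> = 1" using XcYc[OF x0 c, of \<sigma>] x0 by (simp add: power2_eq_square field_simps)
  have wv: "w * v = 1" using WV by (simp add: w_def v_def)
  have y0: "y \<noteq> 0" using yf_nonzero by (simp add: y_def)
  have iy: "1 / y = x * \<Y> * v"
  proof -
    have "y * (x * \<Y> * v) = (x * x * \<X> * \<Y>) * (w * v)" by (simp add: y mult_ac)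
    then have "y * (x * \<Y> * v) = 1" by (simp only: XY wv mult_1)
    then show ?thesis using y0 by (simp add: divide_eq_eq mult.commute)
  qed
  have "\<X> * w * (z * (z + pa)) - \<Y> * v * ((z + \<theta>0) * (z + pb))
      = (y * (z * (z + pa)) - (z + \<theta>0) * (z + pb) * (x * \<Y> * v)) / x"
    using x0 by (simp add: y diff_divide_distrib)
  then have "\<X> * w * (z * (z + pa)) - \<Y> * v * ((z + \<theta>0) * (z + pb))
      = (y * (z * (z + pa)) - (z + \<theta>0) * (z + pb) * (1 / y)) / x"
    by (simp only: iy)
  then show "(zf c \<sigma> has_field_derivative
    (yf c \<sigma> x * (zf c \<sigma> x * (zf c \<sigma> x + pa)) - (zf c \<sigma> x + \<theta>0) * (zf c \<sigma> x + pb) / yf c \<sigma> x) / x) (at x)"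
    using zf_deriv by (simp add: w_def z_def v_def y_def)
  define D where "D = (1 + \<sigma> / x) * (x * \<X>) * w + (4 * u * w / x - \<X> * w\<^sup>2 * (P1 \<sigma> + 2 * u) - \<Y> * (R1 \<sigma> + 2 * u)) * (x * \<X>)"
  have T: "((\<lambda>x. c * (exp x * x powr \<sigma>)) has_field_derivative (1 + \<sigma> / x) * (x * \<X>)) (at x)"
  proof -
    have "((\<lambda>x. c * (exp x * x powr \<sigma>)) has_field_derivative
        c * (exp x * x powr \<sigma> + (\<sigma> * x powr (\<sigma> - 1)) * exp x)) (at x)"
      using x0 S_notin_nonpos[OF xS] by (auto intro!: derivative_eq_intros)
    moreover have "c * (exp x * x powr \<sigma> + (\<sigma> * x powr (\<sigma> - 1)) * exp x) = x * \<X> + \<sigma> * \<X>"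
      using exp_powr_Xc[OF x0, of c \<sigma>] by (simp add: algebra_simps Xc_def Xvar_def)
    moreover have "x * \<X> + \<sigma> * \<X> = (1 + \<sigma> / x) * (x * \<X>)" using x0 by (simp add: field_simps)
    ultimately show ?thesis by simp
  qed
  have "(yf c \<sigma> has_field_derivative D) (at x)"
    unfolding yf_def[abs_def] D_def w_def u_def
    using DERIV_mult[OF T Wf_deriv] unfolding exp_powr_Xc[OF x0] .
  moreover have "D = (x * y - 2 * z * (y - 1)\<^sup>2 - (y - 1) * (pa * y - (\<theta>0 + pb))) / x"
  proof -
    have "x * D = x * (x * \<X> * w) + \<sigma> * (x * \<X> * w) + 4 * u * (x * \<X> * w) - (x * \<X> * w)\<^sup>2 * (P1 \<sigma> + 2 * u)
        - (x * x * \<X> * \<Y>) * (R1 \<sigma> + 2 * u)"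
      unfolding D_def using x0 by (simp add: power2_eq_square algebra_simps)
    also have "\<dots> = x * y + \<sigma> * y + 4 * u * y - y\<^sup>2 * (P1 \<sigma> + 2 * u) - (R1 \<sigma> + 2 * u)"
      unfolding XY y[symmetric] by simp
    also have "\<dots> = x * y - 2 * z * (y - 1)\<^sup>2 - (y - 1) * (pa * y - (\<theta>0 + pb))"
    proof -
      \<comment> \<open>The defining property of \<open>zeta\<close>: the factor
        \<open>x + \<sigma> + 4 u\<close> of \<open>y\<close> becomes
        \<open>x + 4 z + pa + \<theta>0 + pb\<close>, as the system demands.\<close>
      have s: "\<sigma> = 4 * zeta \<sigma> + pa + \<theta>0 + pb" by (simp add: zeta_def pa_def pb_def field_simps)
      have P: "P1 \<sigma> = 2 * zeta \<sigma> + pa" "R1 \<sigma> = 2 * zeta \<sigma> + \<theta>0 + pb" by (simp_all add: P1_def R1_def)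
      have z: "z = zeta \<sigma> + u" by (simp add: z_def u_def zf_def)
      define \<zeta> where "\<zeta> = zeta \<sigma>"
      have "x * y + (4 * \<zeta> + pa + \<theta>0 + pb) * y + 4 * u * y - y\<^sup>2 * (2 * \<zeta> + pa + 2 * u) - (2 * \<zeta> + \<theta>0 + pb + 2 * u)
          = x * y - 2 * (\<zeta> + u) * (y - 1)\<^sup>2 - (y - 1) * (pa * y - (\<theta>0 + pb))"
        by (simp add: power2_eq_square algebra_simps)
      then show ?thesis unfolding P z \<zeta>_def using s by simp
    qed
    finally show ?thesis using x0 by (simp add: field_simps)
  qed
  ultimately show "(yf c \<sigma> has_field_derivative
    (x * yf c \<sigma> x - 2 * zf c \<sigma> x * (yf c \<sigma> x - 1)\<^sup>2 - (yf c \<sigma> x - 1) * (pa * yf c \<sigma> x - (\<theta>0 + pb))) / x) (at x)"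
    by (simp add: y_def z_def)
qed

end

text \<open>The system gives \<open>y' = 1\<close> wherever \<open>y = 1\<close>, so that these points are isolated.\<close>

lemma yf_not_one:
  assumes \<sigma>: "\<sigma> \<in> A" and c: "c \<noteq> 0" and x: "x \<in> Dom c \<sigma>"
  shows "\<forall>\<^sub>F t in at x. yf c \<sigma> t \<noteq> 1"
proof (cases "yf c \<sigma> x = 1")
  case False
  have "isCont (yf c \<sigma>) x" using yf_system[OF assms] by (rule DERIV_isCont)
  then have "(yf c \<sigma> \<longlongrightarrow> yf c \<sigma> x) (at x)" by (simp add: isCont_def)
  then show ?thesis by (rule tendsto_imp_eventually_ne[OF _ False])
next
  case True
  have x0: "x \<noteq> 0" using x by (auto simp: Dom_def dest: S_pos(2))
  have "((\<lambda>t. (yf c \<sigma> t - 1) / (t - x)) \<longlongrightarrow> 1) (at x)"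
    using yf_system[OF assms] x0 unfolding True has_field_derivative_iff by simp
  then have "\<forall>\<^sub>F t in at x. (yf c \<sigma> t - 1) / (t - x) \<noteq> 0"
    by (rule tendsto_imp_eventually_ne) simp
  then show ?thesis by eventually_elim auto
qed

lemma yf_solves:
  assumes \<sigma>: "\<sigma> \<in> A" and c: "c \<noteq> 0" and sub: "X \<subseteq> Dom c \<sigma>"
  shows "solves_PV_on \<theta>0 \<theta>x \<theta>inf (yf c \<sigma>) X"
  unfolding solves_PV_on_def
proof (intro conjI ballI impI)
  show "yf c \<sigma> holomorphic_on X"
    unfolding holomorphic_on_def field_differentiable_def
    using yf_system[OF \<sigma> c] sub has_field_derivative_at_within by blast
  fix x assume "x \<in> X"
  then have x: "x \<in> Dom c \<sigma>" using sub by blast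
  have "\<forall>\<^sub>F t in at x. t \<in> Dom c \<sigma>"
    using eventually_nhds_in_open[OF open_Dom x] by (auto simp: eventually_at_filter elim: eventually_mono)
  with yf_not_one[OF \<sigma> c x] show "\<forall>\<^sub>F t in at x. yf c \<sigma> t \<noteq> 0 \<and> yf c \<sigma> t \<noteq> 1"
    by eventually_elim (use yf_nonzero[OF \<sigma> c] in auto)
  assume "yf c \<sigma> x \<noteq> 0 \<and> yf c \<sigma> x \<noteq> 1"
  then have y1: "yf c \<sigma> x \<noteq> 1" by simp
  have D0: "t \<noteq> 0" if "t \<in> Dom c \<sigma>" for t using that by (auto simp: Dom_def dest: S_pos(2))
  show "(deriv ^^ 2) (yf c \<sigma>) x = PV_rhs \<theta>0 \<theta>x \<theta>inf x (yf c \<sigma> x) (deriv (yf c \<sigma>) x)"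
    by (rule PV_from_system[OF open_Dom x D0 yf_nonzero[OF \<sigma> c]
          yf_system[OF \<sigma> c, unfolded pa_def pb_def] zf_system[OF \<sigma> c, unfolded pa_def pb_def] y1])
qed

subsection \<open>Joint holomorphy of the solution\<close>

lemma hol2_Xvar: "hol2 A S Xvar" and hol2_Yvar: "hol2 A S Yvar"
proof -
  have "hol2 A S (\<lambda>\<sigma> x. exp (x + (\<sigma> + - 1) * Ln x))" "hol2 A S (\<lambda>\<sigma> x. exp (- x + (- \<sigma> + - 1) * Ln x))"
    by (intro hol2_exp hol2_add hol2_mult hol2_var hol2_param hol2_const holomorphic_intros;
        use S_notin_nonpos in auto)+
  note e = this
  show "hol2 A S Xvar"
    by (rule hol2_cong[OF e(1)]) (simp add: Xvar_def powr_def S_pos flip: exp_add)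
  show "hol2 A S Yvar"
    by (rule hol2_cong[OF e(2)]) (simp add: Yvar_def powr_def S_pos flip: exp_add)
qed

text \<open>All nonzero \<open>c\<close> at once give an open set on which joint holomorphy can be
  proved and then restricted.\<close>

definition Dall :: "(complex \<times> complex \<times> complex) set" where
  "Dall = {(c, \<sigma>, x). c \<noteq> 0 \<and> \<sigma> \<in> A \<and> x \<in> Dom c \<sigma>}"

lemma continuous_on_hol2_triple:
  assumes "hol2 A S h" shows "continuous_on ((- {0}) \<times> A \<times> S) (\<lambda>(c, \<sigma>, x). h \<sigma> x)"
proof -
  have "continuous_on ((- {0}) \<times> A \<times> S) (\<lambda>p. (\<lambda>(\<sigma>, x). h \<sigma> x) (snd p))"
    by (rule continuous_on_compose2[OF _ continuous_on_snd[OF continuous_on_id]]) (use assms in \<open>auto simp: hol2_def\<close>)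
  then show ?thesis by (simp add: case_prod_unfold)
qed

lemma open_Dall: "open Dall"
proof -
  let ?P = "(- {0 :: complex}) \<times> A \<times> S"
  have o: "open ?P" by (intro open_Times open_A open_S) (simp add: open_Compl)
  have "continuous_on ?P (\<lambda>(c, \<sigma>, x). norm (Xc c \<sigma> x))" "continuous_on ?P (\<lambda>(c, \<sigma>, x). norm (Yc c \<sigma> x))"
    using continuous_on_hol2_triple[OF hol2_Xvar] continuous_on_hol2_triple[OF hol2_Yvar]
    unfolding Xc_def Yc_def case_prod_unfold by (auto intro!: continuous_intros)
  then have "continuous_on ?P (\<lambda>p. (norm (Xc (fst p) (fst (snd p)) (snd (snd p))), norm (Yc (fst p) (fst (snd p)) (snd (snd p)))))"
    unfolding case_prod_unfold by (rule continuous_on_Pair)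
  from continuous_open_preimage[OF this o, of "{..<\<epsilon>} \<times> {..<\<epsilon>}"]
  have "open (?P \<inter> (\<lambda>p. (norm (Xc (fst p) (fst (snd p)) (snd (snd p))), norm (Yc (fst p) (fst (snd p)) (snd (snd p))))) -` ({..<\<epsilon>} \<times> {..<\<epsilon>}))"
    by (simp add: open_Times)
  moreover have "?P \<inter> (\<lambda>p. (norm (Xc (fst p) (fst (snd p)) (snd (snd p))), norm (Yc (fst p) (fst (snd p)) (snd (snd p))))) -` ({..<\<epsilon>} \<times> {..<\<epsilon>}) = Dall"
    by (auto simp: Dall_def Dom_def)
  ultimately show ?thesis by simp
qed

lemma Dall_sub: "Dall \<subseteq> (- {0}) \<times> A \<times> S"
  by (auto simp: Dall_def Dom_def)

lemma open_fibers:
  "open {c. (c, \<sigma>, x) \<in> Dall}" "open {\<sigma>. (c, \<sigma>, x) \<in> Dall}" "open {x. (c, \<sigma>, x) \<in> Dall}"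
  using open_vimage[OF open_Dall, of "\<lambda>c. (c, \<sigma>, x)"] open_vimage[OF open_Dall, of "\<lambda>\<sigma>. (c, \<sigma>, x)"]
    open_vimage[OF open_Dall, of "\<lambda>x. (c, \<sigma>, x)"]
  by (simp_all add: vimage_def continuous_on_Pair)

lemma hol_fibers:
  assumes h: "hol2 A S h"
  shows "(\<lambda>\<sigma>. h \<sigma> x) holomorphic_on {\<sigma>. (c, \<sigma>, x) \<in> Dall}" "h \<sigma> holomorphic_on {x. (c, \<sigma>, x) \<in> Dall}"
proof -
  show "(\<lambda>\<sigma>. h \<sigma> x) holomorphic_on {\<sigma>. (c, \<sigma>, x) \<in> Dall}"
  proof (cases "x \<in> S")
    case True
    then have "(\<lambda>\<sigma>. h \<sigma> x) holomorphic_on A" using h by (simp add: hol2_def)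
    then show ?thesis by (rule holomorphic_on_subset) (use Dall_sub in auto)
  next
    case False
    then have "{\<sigma>. (c, \<sigma>, x) \<in> Dall} = {}" using Dall_sub by auto
    then show ?thesis by (simp add: holomorphic_on_def)
  qed
  show "h \<sigma> holomorphic_on {x. (c, \<sigma>, x) \<in> Dall}"
  proof (cases "\<sigma> \<in> A")
    case True
    then have "h \<sigma> holomorphic_on S" using h by (simp add: hol2_def)
    then show ?thesis by (rule holomorphic_on_subset) (use Dall_sub in auto)
  next
    case False
    then have "{x. (c, \<sigma>, x) \<in> Dall} = {}" using Dall_sub by auto
    then show ?thesis by (simp add: holomorphic_on_def)
  qed
qed

lemma yf_holomorphic3: "holomorphic3_on (\<lambda>(c, \<sigma>, x). yf c \<sigma> x) Dall"
proof -
  \<comment> \<open>Separates \<open>c\<close>: each term is \<open>c^m c^(-n)\<close> times a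
    function of \<sigma> and \<open>x\<close> alone.\<close>
  define h where "h m n \<sigma> x = W m n \<sigma> x * (Xvar \<sigma> x ^ m * Yvar \<sigma> x ^ n)" for m n \<sigma> x
  define f where "f N c \<sigma> x = square_sum N (trm W (Xc c \<sigma> x) (Yc c \<sigma> x) \<sigma> x)" for N c \<sigma> x
  have f: "f N c \<sigma> x = (\<Sum>m\<le>N. \<Sum>n\<le>N. c ^ m * inverse c ^ n * h m n \<sigma> x)" for N c \<sigma> x
    by (simp add: f_def square_sum_def trm_def h_def Xc_def Yc_def power_mult_distrib mult_ac)
  have h: "hol2 A S (h m n)" for m n
    unfolding h_def by (intro hol2_mult hol2_power hol2_Xvar hol2_Yvar) (use good_W in \<open>auto simp: good_def\<close>)
  have xX: "hol2 A S (\<lambda>\<sigma> x. x * Xvar \<sigma> x)"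
    by (intro hol2_mult hol2_Xvar hol2_var holomorphic_intros)
  obtain M where M: "\<And>m n a b \<sigma> x. \<sigma> \<in> A \<Longrightarrow> x \<in> S \<Longrightarrow> adm a b x \<Longrightarrow> norm (trm W a b \<sigma> x m n) \<le> M m n"
    "\<And>N. square_sum N M \<le> 1 / 2" using trm_majorant[OF good_bnd[OF good_W]] by blast
  have ul: "uniform_limit Dall (\<lambda>N (c, \<sigma>, x). f N c \<sigma> x) (\<lambda>(c, \<sigma>, x). ev W (Xc c \<sigma> x) (Yc c \<sigma> x) \<sigma> x) sequentially"
  proof (cases "Dall = {}")
    case False
    have P: "\<sigma> \<in> A" "x \<in> S" "adm (Xc c \<sigma> x) (Yc c \<sigma> x) x" if "(c, \<sigma>, x) \<in> Dall" for c \<sigma> x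
      using that Dom_adm by (auto simp: Dall_def Dom_def)
    \<comment> \<open>A point of the domain is needed to see that the majorant is
      nonnegative.\<close>
    obtain c0 \<sigma>0 x0 where "(c0, \<sigma>0, x0) \<in> Dall" using False by auto
    then have "0 \<le> M m n" for m n using order_trans[OF norm_ge_zero M(1)[OF P]] by blast
    then have Mn: "norm (M m n) \<le> M m n" for m n by simp
    have \<tau>: "(\<lambda>N. double_sum M - square_sum N M) \<longlonglongrightarrow> 0"
    proof -
      have "(\<lambda>(m, n). M m n) summable_on UNIV"
        by (rule abs_summable_summable[OF dominated_summable(1)[OF Mn M(2)]])
      from tendsto_diff[OF tendsto_const square_sum_tendsto_double_sum[OF this], of "double_sum M"] show ?thesis by simp
    qed
    show ?thesis unfolding uniform_limit_iff
    proof (intro allI impI)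
      fix e :: real assume "e > 0"
      with \<tau> have "\<forall>\<^sub>F N in sequentially. double_sum M - square_sum N M < e" by (rule order_tendstoD(2))
      then show "\<forall>\<^sub>F N in sequentially. \<forall>p\<in>Dall. dist ((\<lambda>(c, \<sigma>, x). f N c \<sigma> x) p)
          ((\<lambda>(c, \<sigma>, x). ev W (Xc c \<sigma> x) (Yc c \<sigma> x) \<sigma> x) p) < e"
      proof eventually_elim
        case (elim N)
        have "dist (f N c \<sigma> x) (ev W (Xc c \<sigma> x) (Yc c \<sigma> x) \<sigma> x) < e" if p: "(c, \<sigma>, x) \<in> Dall" for c \<sigma> x
        proof -
          have "norm (ev W (Xc c \<sigma> x) (Yc c \<sigma> x) \<sigma> x - f N c \<sigma> x) \<le> double_sum M - square_sum N M"
            unfolding ev_def f_def by (rule double_sum_diff_square[OF M(1)[OF P[OF p]] M(2)])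
          then show ?thesis using elim by (simp add: dist_norm norm_minus_commute)
        qed
        then show ?case by auto
      qed
    qed
  qed auto
  have fc: "continuous_on Dall (\<lambda>(c, \<sigma>, x). f N c \<sigma> x)" for N
  proof -
    have "continuous_on ((- {0}) \<times> A \<times> S) (\<lambda>p. \<Sum>m\<le>N. \<Sum>n\<le>N. fst p ^ m * inverse (fst p) ^ n * h m n (fst (snd p)) (snd (snd p)))"
      using continuous_on_hol2_triple[OF h] unfolding case_prod_unfold
      by (intro continuous_on_sum continuous_on_mult continuous_on_power continuous_on_inverse continuous_on_fst continuous_on_id) auto
    then show ?thesis unfolding f case_prod_unfold by (rule continuous_on_subset[OF _ Dall_sub])
  qed
  have cev: "continuous_on Dall (\<lambda>(c, \<sigma>, x). ev W (Xc c \<sigma> x) (Yc c \<sigma> x) \<sigma> x)"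
    by (rule uniform_limit_theorem[OF always_eventually[OF allI] ul]) (auto intro: fc)
  have fib: "(\<lambda>c. ev W (Xc c \<sigma> x) (Yc c \<sigma> x) \<sigma> x) holomorphic_on {c. (c, \<sigma>, x) \<in> Dall}"
    "(\<lambda>\<sigma>. ev W (Xc c \<sigma> x) (Yc c \<sigma> x) \<sigma> x) holomorphic_on {\<sigma>. (c, \<sigma>, x) \<in> Dall}"
    "(\<lambda>x. ev W (Xc c \<sigma> x) (Yc c \<sigma> x) \<sigma> x) holomorphic_on {x. (c, \<sigma>, x) \<in> Dall}" for c \<sigma> x
  proof -
    have c0: "c \<noteq> 0" if "(c, \<sigma>, x) \<in> Dall" for c using that by (simp add: Dall_def)
    show "(\<lambda>c. ev W (Xc c \<sigma> x) (Yc c \<sigma> x) \<sigma> x) holomorphic_on {c. (c, \<sigma>, x) \<in> Dall}"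
    proof (rule holomorphic_local_uniform_limit[OF open_fibers(1), of "\<lambda>N c. f N c \<sigma> x"])
      show "(\<lambda>c. f N c \<sigma> x) holomorphic_on {c. (c, \<sigma>, x) \<in> Dall}" for N
        unfolding f by (intro holomorphic_intros) (use c0 in auto)
      show "\<exists>U. open U \<and> z \<in> U \<and> uniform_limit U (\<lambda>N c. f N c \<sigma> x) (\<lambda>c. ev W (Xc c \<sigma> x) (Yc c \<sigma> x) \<sigma> x) sequentially"
        if "z \<in> {c. (c, \<sigma>, x) \<in> Dall}" for z
        using that open_fibers(1) uniform_limit_compose'[OF ul, of "\<lambda>c. (c, \<sigma>, x)" "{c. (c, \<sigma>, x) \<in> Dall}"]
        by (intro exI[of _ "{c. (c, \<sigma>, x) \<in> Dall}"]) auto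
    qed
    show "(\<lambda>\<sigma>. ev W (Xc c \<sigma> x) (Yc c \<sigma> x) \<sigma> x) holomorphic_on {\<sigma>. (c, \<sigma>, x) \<in> Dall}"
    proof (rule holomorphic_local_uniform_limit[OF open_fibers(2), of "\<lambda>N \<sigma>. f N c \<sigma> x"])
      show "(\<lambda>\<sigma>. f N c \<sigma> x) holomorphic_on {\<sigma>. (c, \<sigma>, x) \<in> Dall}" for N
        unfolding f by (intro holomorphic_on_sum holomorphic_on_mult holomorphic_on_const hol_fibers(1)[OF h])
      show "\<exists>U. open U \<and> z \<in> U \<and> uniform_limit U (\<lambda>N \<sigma>. f N c \<sigma> x) (\<lambda>\<sigma>. ev W (Xc c \<sigma> x) (Yc c \<sigma> x) \<sigma> x) sequentially"
        if "z \<in> {\<sigma>. (c, \<sigma>, x) \<in> Dall}" for z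
        using that open_fibers(2) uniform_limit_compose'[OF ul, of "\<lambda>\<sigma>. (c, \<sigma>, x)" "{\<sigma>. (c, \<sigma>, x) \<in> Dall}"]
        by (intro exI[of _ "{\<sigma>. (c, \<sigma>, x) \<in> Dall}"]) auto
    qed
    show "(\<lambda>x. ev W (Xc c \<sigma> x) (Yc c \<sigma> x) \<sigma> x) holomorphic_on {x. (c, \<sigma>, x) \<in> Dall}"
    proof (rule holomorphic_local_uniform_limit[OF open_fibers(3), of "\<lambda>N x. f N c \<sigma> x"])
      show "(\<lambda>x. f N c \<sigma> x) holomorphic_on {x. (c, \<sigma>, x) \<in> Dall}" for N
        unfolding f by (intro holomorphic_on_sum holomorphic_on_mult holomorphic_on_const hol_fibers(2)[OF h])
      show "\<exists>U. open U \<and> z \<in> U \<and> uniform_limit U (\<lambda>N x. f N c \<sigma> x) (\<lambda>x. ev W (Xc c \<sigma> x) (Yc c \<sigma> x) \<sigma> x) sequentially"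
        if "z \<in> {x. (c, \<sigma>, x) \<in> Dall}" for z
        using that open_fibers(3) uniform_limit_compose'[OF ul, of "\<lambda>x. (c, \<sigma>, x)" "{x. (c, \<sigma>, x) \<in> Dall}"]
        by (intro exI[of _ "{x. (c, \<sigma>, x) \<in> Dall}"]) auto
    qed
  qed
  \<comment> \<open>Writing \<open>e^x x^\<sigma>\<close> as \<open>x * Xvar\<close> reduces the
    prefactor to functions already known to be \<open>hol2\<close>.\<close>
  define k where "k \<sigma> x = x * Xvar \<sigma> x" for \<sigma> x
  define y where "y c \<sigma> x = c * k \<sigma> x * (1 + ev W (Xc c \<sigma> x) (Yc c \<sigma> x) \<sigma> x)" for c \<sigma> x
  have k: "hol2 A S k" using xX by (simp add: k_def[abs_def])
  have "holomorphic3_on (\<lambda>(c, \<sigma>, x). y c \<sigma> x) Dall"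
  proof (rule osgood3[OF open_Dall])
    show "continuous_on Dall (\<lambda>(c, \<sigma>, x). y c \<sigma> x)"
      using cev continuous_on_subset[OF continuous_on_hol2_triple[OF k] Dall_sub] unfolding y_def case_prod_unfold
      by (intro continuous_on_mult continuous_on_add continuous_on_const continuous_on_fst continuous_on_id)
    show "(\<lambda>c. y c \<sigma> x) holomorphic_on {c. (c, \<sigma>, x) \<in> Dall}" for \<sigma> x
      unfolding y_def by (intro holomorphic_on_mult holomorphic_on_add holomorphic_on_const fib holomorphic_on_ident)
    show "(\<lambda>\<sigma>. y c \<sigma> x) holomorphic_on {\<sigma>. (c, \<sigma>, x) \<in> Dall}" for c x
      unfolding y_def by (intro holomorphic_on_mult holomorphic_on_add holomorphic_on_const fib hol_fibers(1)[OF k])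
    show "(\<lambda>x. y c \<sigma> x) holomorphic_on {x. (c, \<sigma>, x) \<in> Dall}" for c \<sigma>
      unfolding y_def by (intro holomorphic_on_mult holomorphic_on_add holomorphic_on_const fib hol_fibers(2)[OF k])
  qed
  moreover have "yf c \<sigma> x = y c \<sigma> x" if "(c, \<sigma>, x) \<in> Dall" for c \<sigma> x
  proof -
    have "x \<noteq> 0" using that by (auto simp: Dall_def Dom_def dest: S_pos(2))
    then have "exp x * x powr \<sigma> = k \<sigma> x" using exp_powr_Xc[of x 1 \<sigma>] by (simp add: Xc_def k_def)
    then show ?thesis by (simp add: y_def yf_def Wf_def)
  qed
  ultimately show ?thesis by (elim holomorphic3_on_cong) auto
qed

end

subsection \<open>Collecting powers\<close>

text \<open>The map from \<open>(k, n)\<close> to \<open>(k + n, n)\<close> is injective and sends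
  the rectangle into the square of side \<open>K + N\<close>.\<close>

lemma square_sum_diagonal_le:
  fixes M :: "nat \<Rightarrow> nat \<Rightarrow> real"
  assumes "\<And>m n. 0 \<le> M m n"
  shows "(\<Sum>k\<le>K. \<Sum>n\<le>N. M (k + n) n) \<le> square_sum (K + N) M"
proof -
  have "(\<Sum>k\<le>K. \<Sum>n\<le>N. M (k + n) n) = (\<Sum>p\<in>{..K} \<times> {..N}. (\<lambda>(m, n). M m n) ((\<lambda>(k, n). (k + n, n)) p))"
    by (simp add: sum.cartesian_product case_prod_unfold)
  also have "\<dots> = (\<Sum>p\<in>(\<lambda>(k, n). (k + n, n)) ` ({..K} \<times> {..N}). (\<lambda>(m, n). M m n) p)"
    by (subst sum.reindex) (auto simp: inj_on_def)
  also have "\<dots> \<le> (\<Sum>p\<in>{..K + N} \<times> {..K + N}. (\<lambda>(m, n). M m n) p)"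
    by (rule sum_mono2) (use assms in auto)
  finally show ?thesis by (simp add: square_sum_eq)
qed

context pv_small
begin

text \<open>The coefficient of the \<open>k\<close>th power of the first variable after replacing the product of both by
  \<open>x^(-2)\<close>.\<close>

definition Gp :: "arr \<Rightarrow> nat \<Rightarrow> complex \<Rightarrow> complex \<Rightarrow> complex" where
  "Gp X k \<sigma> x = (\<Sum>n. X (k + n) n \<sigma> x * inverse x ^ (2 * n))"

lemma inverse_x_le: assumes "x \<in> S" shows "norm (inverse x) \<le> \<epsilon>\<^sup>2"
proof -
  have "1 / norm x \<le> \<epsilon>\<^sup>2"
    using S_large[OF assms] S_pos(1)[OF assms] by (simp add: pos_divide_le_eq mult.commute)
  then show ?thesis by (simp add: inverse_eq_divide norm_divide)
qed

text \<open>Growth \<open>x^n\<close> against \<open>x^(-2n)\<close> leaves \<open>x^(-n)\<close>,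
  of modulus at most \<open>\<epsilon>^(2n)\<close>. Thus \<open>e k n\<close> is the weight of
  \<open>X (k + n) n\<close> up to the factor \<open>\<epsilon>^k\<close>. Keeping \<open>J\<close>
  of the factors \<open>1/x\<close> unestimated gives the version used for remainders.\<close>

lemma Gp_majorant:
  assumes "good min R X"
  obtains e where "\<And>k n. 0 \<le> e k n" "\<And>k. summable (e k)"
    "\<And>k n \<sigma> x. \<sigma> \<in> A \<Longrightarrow> x \<in> S \<Longrightarrow> norm (X (k + n) n \<sigma> x * inverse x ^ (2 * n)) \<le> e k n"
    "\<And>k n J \<sigma> x. \<sigma> \<in> A \<Longrightarrow> x \<in> S \<Longrightarrow> J \<le> n \<Longrightarrow>
       norm (X (k + n) n \<sigma> x * inverse x ^ (2 * n)) \<le> e k n * (norm (inverse x) / \<epsilon>\<^sup>2) ^ J"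
    "\<And>N. (\<Sum>k\<le>N. (\<Sum>n. e k n) * \<epsilon> ^ k) \<le> R"
proof -
  obtain M where M: "\<And>m n. 0 \<le> M m n"
    "\<And>m n \<sigma> x. \<sigma> \<in> A \<Longrightarrow> x \<in> S \<Longrightarrow> norm (X m n \<sigma> x) \<le> M m n * norm x ^ min m n"
    "\<And>N. (\<Sum>m\<le>N. \<Sum>n\<le>N. M m n * \<epsilon> ^ (m + n)) \<le> R" using bndE[OF good_bnd[OF assms]] by blast
  define e where "e k n = M (k + n) n * (\<epsilon>\<^sup>2) ^ n" for k n
  have e0: "0 \<le> e k n" for k n using M(1) \<epsilon> by (simp add: e_def)
  have part: "(\<Sum>k\<le>K. (\<Sum>n\<le>N. e k n) * \<epsilon> ^ k) \<le> R" for K N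
  proof -
    have "(\<Sum>k\<le>K. (\<Sum>n\<le>N. e k n) * \<epsilon> ^ k) = (\<Sum>k\<le>K. \<Sum>n\<le>N. M (k + n) n * \<epsilon> ^ (k + n + n))"
      unfolding sum_distrib_right e_def
      by (intro sum.cong refl) (simp add: power_add power2_eq_square power_mult_distrib mult_ac)
    also have "\<dots> \<le> square_sum (K + N) (\<lambda>m n. M m n * \<epsilon> ^ (m + n))"
      using square_sum_diagonal_le[of "\<lambda>m n. M m n * \<epsilon> ^ (m + n)"] M(1) \<epsilon> by simp
    also have "\<dots> \<le> R" using M(3) by (simp add: square_sum_def)
    finally show ?thesis .
  qed
  have sm: "summable (e k)" for k
  proof (rule summableI_nonneg_bounded[of _ "R / \<epsilon> ^ k"])
    fix N
    have "(\<Sum>n<N. e k n) * \<epsilon> ^ k \<le> (\<Sum>n\<le>N. e k n) * \<epsilon> ^ k"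
      using e0 \<epsilon> by (intro mult_right_mono sum_mono2) auto
    also have "\<dots> \<le> (\<Sum>k\<le>k. (\<Sum>n\<le>N. e k n) * \<epsilon> ^ k)"
      by (rule member_le_sum) (use e0 \<epsilon> in \<open>auto intro!: mult_nonneg_nonneg sum_nonneg\<close>)
    also have "\<dots> \<le> R" by (rule part)
    finally show "(\<Sum>n<N. e k n) \<le> R / \<epsilon> ^ k" using \<epsilon> by (simp add: field_simps)
  qed (rule e0)
  have b1: "norm (X (k + n) n \<sigma> x * inverse x ^ (2 * n)) \<le> M (k + n) n * norm (inverse x) ^ n"
    if "\<sigma> \<in> A" "x \<in> S" for k n \<sigma> x
  proof -
    have "norm (X (k + n) n \<sigma> x) \<le> M (k + n) n * norm x ^ n"
      using M(2)[OF that, of "k + n" n] by (simp add: min_def split: if_splits)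
    then have "norm (X (k + n) n \<sigma> x) * norm (inverse x) ^ (2 * n) \<le> (M (k + n) n * norm x ^ n) * norm (inverse x) ^ (2 * n)"
      by (rule mult_right_mono) simp
    also have "\<dots> = M (k + n) n * norm (inverse x) ^ n * (norm x * norm (inverse x)) ^ n"
      unfolding mult_2 power_add power_mult_distrib by (rule mult.assoc[of "M (k + n) n", THEN trans]) (simp only: mult_ac)
    also have "norm x * norm (inverse x) = 1"
      using S_pos(2)[OF that(2)] by (simp flip: norm_mult)
    finally show ?thesis by (simp add: norm_mult norm_power)
  qed
  have b2: "norm (X (k + n) n \<sigma> x * inverse x ^ (2 * n)) \<le> e k n * (norm (inverse x) / \<epsilon>\<^sup>2) ^ J"
    if "\<sigma> \<in> A" "x \<in> S" "J \<le> n" for k n J \<sigma> x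
  proof -
    define s where "s = norm (inverse x)"
    have s: "0 \<le> s" "s \<le> \<epsilon>\<^sup>2" using inverse_x_le[OF that(2)] by (auto simp: s_def)
    have "s ^ n = s ^ J * s ^ (n - J)" using that(3) by (simp flip: power_add)
    \<comment> \<open>Only \<open>n - J\<close> factors are replaced by their bound; the other
      \<open>J\<close> supply the order of the remainder.\<close>
    also have "\<dots> \<le> s ^ J * (\<epsilon>\<^sup>2) ^ (n - J)" using s by (intro mult_left_mono power_mono) auto
    also have "\<dots> = (\<epsilon>\<^sup>2) ^ n * (s / \<epsilon>\<^sup>2) ^ J"
    proof -
      have "(\<epsilon>\<^sup>2) ^ n = (\<epsilon>\<^sup>2) ^ (n - J) * (\<epsilon>\<^sup>2) ^ J" using that(3) by (simp flip: power_add)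
      then show ?thesis using \<epsilon> by (simp add: power_divide)
    qed
    finally have "M (k + n) n * s ^ n \<le> M (k + n) n * ((\<epsilon>\<^sup>2) ^ n * (s / \<epsilon>\<^sup>2) ^ J)"
      by (rule mult_left_mono) (rule M)
    with b1[OF that(1,2), of k n] show ?thesis by (simp add: e_def s_def mult.assoc)
  qed
  have tot: "(\<Sum>k\<le>K. (\<Sum>n. e k n) * \<epsilon> ^ k) \<le> R" for K
  proof (rule LIMSEQ_le_const2)
    show "(\<lambda>N. \<Sum>k\<le>K. (\<Sum>n\<le>N. e k n) * \<epsilon> ^ k) \<longlonglongrightarrow> (\<Sum>k\<le>K. (\<Sum>n. e k n) * \<epsilon> ^ k)"
      by (intro tendsto_sum tendsto_mult tendsto_const summable_LIMSEQ' sm)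
  qed (use part in auto)
  show thesis
    by (rule that[OF e0 sm _ b2 tot]) (use b2[where J = 0] in auto)
qed

text \<open>Summability at radius \<epsilon> serves the uniform convergence of the collected series;
  the bound on \<open>g 0\<close> keeps their constant term small.\<close>

lemma Gp_bound:
  assumes "good min R X"
  obtains g where "\<And>k. 0 \<le> g k" "\<And>k \<sigma> x. \<sigma> \<in> A \<Longrightarrow> x \<in> S \<Longrightarrow> norm (Gp X k \<sigma> x) \<le> g k"
    "summable (\<lambda>k. g k * \<epsilon> ^ k)" "g 0 \<le> R"
proof -
  obtain e where e: "\<And>k n. 0 \<le> e k n" "\<And>k. summable (e k)"
    "\<And>k n \<sigma> x. \<sigma> \<in> A \<Longrightarrow> x \<in> S \<Longrightarrow> norm (X (k + n) n \<sigma> x * inverse x ^ (2 * n)) \<le> e k n"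
    "\<And>k n J \<sigma> x. \<sigma> \<in> A \<Longrightarrow> x \<in> S \<Longrightarrow> J \<le> n \<Longrightarrow>
       norm (X (k + n) n \<sigma> x * inverse x ^ (2 * n)) \<le> e k n * (norm (inverse x) / \<epsilon>\<^sup>2) ^ J"
    "\<And>N. (\<Sum>k\<le>N. (\<Sum>n. e k n) * \<epsilon> ^ k) \<le> R"
    using Gp_majorant[OF assms] by blast
  define g where "g k = (\<Sum>n. e k n)" for k
  have g0: "0 \<le> g k" for k unfolding g_def by (rule suminf_nonneg[OF e(2,1)])
  show thesis
  proof (rule that[OF g0])
    show "norm (Gp X k \<sigma> x) \<le> g k" if "\<sigma> \<in> A" "x \<in> S" for k \<sigma> x
      unfolding Gp_def g_def
      by (rule norm_suminf_le) (use e(2,3) that in auto)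
    show "summable (\<lambda>k. g k * \<epsilon> ^ k)"
    proof (rule summableI_nonneg_bounded[of _ R])
      show "0 \<le> g k * \<epsilon> ^ k" for k using g0 \<epsilon> by simp
      show "(\<Sum>k<N. g k * \<epsilon> ^ k) \<le> R" for N
      proof -
        have "(\<Sum>k<N. g k * \<epsilon> ^ k) \<le> (\<Sum>k\<le>N. g k * \<epsilon> ^ k)"
          using g0 \<epsilon> by (intro sum_mono2) auto
        also have "\<dots> \<le> R" using e(5) by (simp add: g_def)
        finally show ?thesis .
      qed
    qed
    show "g 0 \<le> R" using e(5)[of 0] by (simp add: g_def)
  qed
qed

lemma hol2_Gp: assumes "good min R X" shows "hol2 A S (Gp X k)"
proof -
  obtain e where e: "\<And>k n. 0 \<le> e k n" "\<And>k. summable (e k)"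
    "\<And>k n \<sigma> x. \<sigma> \<in> A \<Longrightarrow> x \<in> S \<Longrightarrow> norm (X (k + n) n \<sigma> x * inverse x ^ (2 * n)) \<le> e k n"
    "\<And>k n J \<sigma> x. \<sigma> \<in> A \<Longrightarrow> x \<in> S \<Longrightarrow> J \<le> n \<Longrightarrow>
       norm (X (k + n) n \<sigma> x * inverse x ^ (2 * n)) \<le> e k n * (norm (inverse x) / \<epsilon>\<^sup>2) ^ J"
    "\<And>N. (\<Sum>k\<le>N. (\<Sum>n. e k n) * \<epsilon> ^ k) \<le> R"
    using Gp_majorant[OF assms] by blast
  define F where "F N \<sigma> x = (\<Sum>n<N. X (k + n) n \<sigma> x * inverse x ^ (2 * n))" for N \<sigma> x
  show ?thesis
  proof (rule hol2_local_uniform_limit[OF open_A open_S, of F])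
    show "hol2 A S (F N)" for N
      unfolding F_def[abs_def] using assms S_pos
      by (intro hol2_sum hol2_mult hol2_power hol2_var holomorphic_intros) (auto simp: good_def)
    have "uniform_limit (A \<times> S) (\<lambda>N p. \<Sum>n<N. (\<lambda>(\<sigma>, x). X (k + n) n \<sigma> x * inverse x ^ (2 * n)) p)
        (\<lambda>p. \<Sum>n. (\<lambda>(\<sigma>, x). X (k + n) n \<sigma> x * inverse x ^ (2 * n)) p) sequentially"
      by (rule Weierstrass_m_test[OF _ e(2)[of k]]) (use e(3) in auto)
    then have "uniform_limit (A \<times> S) (\<lambda>N (\<sigma>, x). F N \<sigma> x) (\<lambda>(\<sigma>, x). Gp X k \<sigma> x) sequentially"
      by (simp add: F_def Gp_def case_prod_unfold)
    then show "\<exists>U V. open U \<and> \<sigma> \<in> U \<and> U \<subseteq> A \<and> open V \<and> x \<in> V \<and> V \<subseteq> S \<and>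
       uniform_limit (U \<times> V) (\<lambda>n (\<sigma>, x). F n \<sigma> x) (\<lambda>(\<sigma>, x). Gp X k \<sigma> x) sequentially"
      if "\<sigma> \<in> A" "x \<in> S" for \<sigma> x
      using that open_A open_S by (intro exI[of _ A] exI[of _ S]) auto
  qed
qed

lemma asy_divide_power: "asy S p g f \<Longrightarrow> asy S 0 (\<lambda>x. g x * inverse x ^ p) f"
proof (induction p arbitrary: g)
  case (Suc p)
  have "asy S 0 (\<lambda>x. (g x / x) * inverse x ^ p) f"
    by (rule Suc.IH[OF asy_divide_x[OF Suc.prems]])
  then show ?case by (simp add: divide_inverse mult.assoc)
qed simp

text \<open>The \<open>n\<close>-th summand is of order \<open>x^(-n)\<close>, so finitely many
  summands determine each coefficient. The summands from index \<open>J\<close> on are together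
  \<open>O(x^(-J))\<close>.\<close>

lemma asy_Gp:
  assumes X: "good min R X" and \<sigma>: "\<sigma> \<in> A" and f: "\<And>n. asy S n (X (k + n) n \<sigma>) (f n)"
  shows "asy S 0 (Gp X k \<sigma>) (\<lambda>j. \<Sum>n\<le>j. f n (j - n))"
  unfolding asy_def
proof
  fix J
  obtain e where e: "\<And>k n. 0 \<le> e k n" "\<And>k. summable (e k)"
    "\<And>k n \<sigma> x. \<sigma> \<in> A \<Longrightarrow> x \<in> S \<Longrightarrow> norm (X (k + n) n \<sigma> x * inverse x ^ (2 * n)) \<le> e k n"
    "\<And>k n J \<sigma> x. \<sigma> \<in> A \<Longrightarrow> x \<in> S \<Longrightarrow> J \<le> n \<Longrightarrow>
       norm (X (k + n) n \<sigma> x * inverse x ^ (2 * n)) \<le> e k n * (norm (inverse x) / \<epsilon>\<^sup>2) ^ J"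
    "\<And>N. (\<Sum>k\<le>N. (\<Sum>n. e k n) * \<epsilon> ^ k) \<le> R"
    using Gp_majorant[OF X] by blast
  define t where "t n x = X (k + n) n \<sigma> x * inverse x ^ (2 * n)" for n x
  \<comment> \<open>Dividing an expansion with leading power \<open>x^n\<close> by
    \<open>x^(2n)\<close> moves its coefficients \<open>n\<close> places down.\<close>
  define E where "E n j = (if j < n then 0 else f n (j - n))" for n j
  have tE: "asy S 0 (t n) (E n)" for n
  proof -
    have "asy S (0 + n) (\<lambda>x. X (k + n) n \<sigma> x * inverse x ^ n) (E n)"
      unfolding E_def by (rule asy_raise[OF asy_divide_power[OF f]])
    then have "asy S 0 (\<lambda>x. (X (k + n) n \<sigma> x * inverse x ^ n) * inverse x ^ n) (E n)"
      by (intro asy_divide_power) simp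
    then show ?thesis by (simp add: t_def[abs_def] mult_2 power_add mult.assoc)
  qed
  have split: "Gp X k \<sigma> x - x ^ 0 * (\<Sum>j<J. (\<Sum>n\<le>j. f n (j - n)) * inverse x ^ j)
      = (\<Sum>n<J. t n x - x ^ 0 * (\<Sum>j<J. E n j * inverse x ^ j)) + (\<Sum>n. t (n + J) x)" if x: "x \<in> S" for x
  proof -
    have "summable (\<lambda>n. t n x)"
      by (rule summable_comparison_test'[OF e(2)[of k], of 0]) (use e(3)[OF \<sigma> x] in \<open>simp add: t_def\<close>)
    then have "Gp X k \<sigma> x = (\<Sum>n. t (n + J) x) + (\<Sum>n<J. t n x)"
      unfolding Gp_def t_def[symmetric] by (rule suminf_split_initial_segment)
    moreover have "(\<Sum>j<J. (\<Sum>n\<le>j. f n (j - n)) * inverse x ^ j) = (\<Sum>n<J. \<Sum>j<J. E n j * inverse x ^ j)"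
    proof -
      have "(\<Sum>n\<le>j. f n (j - n)) = (\<Sum>n<J. E n j)" if "j < J" for j
        using that by (intro sum.mono_neutral_cong_left) (auto simp: E_def)
      then have "(\<Sum>j<J. (\<Sum>n\<le>j. f n (j - n)) * inverse x ^ j) = (\<Sum>j<J. \<Sum>n<J. E n j * inverse x ^ j)"
        by (intro sum.cong) (auto simp: sum_distrib_right)
      also have "\<dots> = (\<Sum>n<J. \<Sum>j<J. E n j * inverse x ^ j)" by (rule sum.swap)
      finally show ?thesis .
    qed
    ultimately show ?thesis by (simp add: sum_subtractf)
  qed
  have "bigO_on S (real 0 - real J) (\<lambda>x. \<Sum>n<J. t n x - x ^ 0 * (\<Sum>j<J. E n j * inverse x ^ j))"
    by (intro bigO_on_sum asyD tE)
  moreover have "bigO_on S (real 0 - real J) (\<lambda>x. \<Sum>n. t (n + J) x)"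
  proof (rule bigO_onI[of _ "(\<Sum>n. e k (n + J)) / (\<epsilon>\<^sup>2) ^ J"])
    fix x assume x: "x \<in> S"
    have s: "summable (\<lambda>n. e k (n + J))" using e(2) by (simp add: summable_iff_shift)
    define q where "q = (norm (inverse x) / \<epsilon>\<^sup>2) ^ J"
    have "norm (\<Sum>n. t (n + J) x) \<le> (\<Sum>n. e k (n + J) * q)"
      by (rule norm_suminf_le)
        (use e(4)[OF \<sigma> x le_add2] s in \<open>auto simp only: t_def q_def intro: summable_mult2\<close>)
    also have "\<dots> = (\<Sum>n. e k (n + J)) * q" by (rule suminf_mult2[OF s, symmetric])
    also have "q = norm x powr (real 0 - real J) / (\<epsilon>\<^sup>2) ^ J"
      using S_pos(1)[OF x] by (simp add: q_def power_divide powr_minus powr_realpow norm_inverse power_inverse)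
    finally show "norm (\<Sum>n. t (n + J) x) \<le> (\<Sum>n. e k (n + J)) / (\<epsilon>\<^sup>2) ^ J * norm x powr (real 0 - real J)"
      by (simp add: field_simps)
  qed
  ultimately have "bigO_on S (real 0 - real J) (\<lambda>x. (\<Sum>n<J. t n x - x ^ 0 * (\<Sum>j<J. E n j * inverse x ^ j)) + (\<Sum>n. t (n + J) x))"
    by (rule bigO_on_add)
  then show "bigO_on S (real 0 - real J) (\<lambda>x. Gp X k \<sigma> x - x ^ 0 * (\<Sum>j<J. (\<Sum>n\<le>j. f n (j - n)) * inverse x ^ j))"
    by (rule bigO_on_cong) (rule split)
qed

lemma ASY_Gp:
  assumes X: "good min R X" shows "ASY 0 (Gp X k)"
proof -
  have "\<exists>f. (\<forall>j. f j \<in> Q) \<and> (\<forall>c. \<forall>\<sigma>\<in>A. asy S n (X (k + n) n \<sigma>) (\<lambda>j. f j c \<sigma>))" for n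
  proof -
    have "ASY (min (k + n) n) (X (k + n) n)" using X unfolding good_def by blast
    then show ?thesis by (simp add: ASY_def min_def split: if_splits)
  qed
  then obtain f where f: "\<And>n j. f n j \<in> Q" "\<And>n c \<sigma>. \<sigma> \<in> A \<Longrightarrow> asy S n (X (k + n) n \<sigma>) (\<lambda>j. f n j c \<sigma>)"
    by metis
  show ?thesis unfolding ASY_def
  proof (intro exI conjI allI ballI)
    show "(\<lambda>c \<sigma>. \<Sum>n\<le>j. f n (j - n) c \<sigma>) \<in> Q" for j by (intro Q0_sum f)
    show "asy S 0 (Gp X k \<sigma>) (\<lambda>j. \<Sum>n\<le>j. f n (j - n) c \<sigma>)" if "\<sigma> \<in> A" for c \<sigma>
      by (rule asy_Gp[OF X that f(2)[OF that]])
  qed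
qed

abbreviation Finf :: "complex filter" where "Finf \<equiv> inf at_infinity (principal S)"

text \<open>The filter must be proper for limits to be unique. Far points of the positive imaginary
  axis lie in the sector, as \<open>sin \<delta> < 1\<close>.\<close>

lemma Finf_nontrivial: "Finf \<noteq> bot"
  unfolding trivial_limit_def eventually_inf_principal eventually_at_infinity
proof
  assume "\<exists>b. \<forall>x. b \<le> norm x \<longrightarrow> x \<in> S \<longrightarrow> False"
  then obtain b where b: "\<And>x. b \<le> norm x \<Longrightarrow> x \<notin> S" by blast
  define R where "R = max \<bar>b\<bar> r + 1"
  have R: "0 < R" "b \<le> R" "r < R" by (auto simp: R_def)
  have "sin \<delta> < 1"
    using sin_monotone_2pi[of \<delta> "pi / 2"] \<delta> by simp
  then have "sin \<delta> * R < 1 * R" using R by (intro mult_strict_right_mono) auto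
  then have "\<i> * of_real R \<in> S" using R by (simp add: S_iff norm_mult)
  moreover have "b \<le> norm (\<i> * of_real R)" using R by (simp add: norm_mult)
  ultimately show False using b by blast
qed

text \<open>Only the summand \<open>n = 0\<close> contributes to the limit, all others being at most
  of order \<open>1/x\<close>.\<close>

lemma Gp_tendsto:
  assumes X: "good min R X" and \<sigma>: "\<sigma> \<in> A" and l: "(X k 0 \<sigma> \<longlongrightarrow> l) Finf"
  shows "(Gp X k \<sigma> \<longlongrightarrow> l) Finf"
proof -
  have "\<exists>f. asy S n (X (k + n) n \<sigma>) f" for n
  proof -
    have "ASY (min (k + n) n) (X (k + n) n)" using X unfolding good_def by blast
    then show ?thesis using \<sigma> by (auto simp: ASY_def min_def split: if_splits)
  qed
  then obtain f where f: "\<And>n. asy S n (X (k + n) n \<sigma>) (f n)" by metis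
  have "asy S 0 (X k 0 \<sigma>) (f 0)" using f[of 0] by simp
  then have "(X k 0 \<sigma> \<longlongrightarrow> f 0 0) Finf" by (rule asy_tendsto)
  then have "l = f 0 0" using l Finf_nontrivial tendsto_unique by blast
  with asy_tendsto[OF asy_Gp[OF X \<sigma> f]] show ?thesis by simp
qed

text \<open>On the diagonal of difference \<open>k\<close> the product of both variables is
  \<open>x^(-2)\<close>, leaving a pure power of one of them. Diagonals with more of the second
  variable are those of the swapped array.\<close>

lemma ev_collect:
  assumes X: "good min R X" and \<sigma>: "\<sigma> \<in> A" and c: "c \<noteq> 0" and x: "x \<in> Dom c \<sigma>"
  shows "ev X (Xc c \<sigma> x) (Yc c \<sigma> x) \<sigma> x
      = Gp X 0 \<sigma> x + (\<Sum>k. Gp X (Suc k) \<sigma> x * Xc c \<sigma> x ^ Suc k) + (\<Sum>k. Gp (swap X) (Suc k) \<sigma> x * Yc c \<sigma> x ^ Suc k)"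
proof -
  have xS: "x \<in> S" using x by (simp add: Dom_def)
  define a where "a = Xc c \<sigma> x"
  define b where "b = Yc c \<sigma> x"
  have ab: "a ^ n * b ^ n = inverse x ^ (2 * n)" for n
    using XcYc[OF S_pos(2)[OF xS] c, of \<sigma>]
    by (simp add: a_def b_def power_mult power_mult_distrib[symmetric] divide_inverse power_inverse)
  have s: "abssum (\<lambda>(m, n). trm X a b \<sigma> x m n) UNIV"
    unfolding a_def b_def by (rule ev_abs_summable[OF \<sigma> xS Dom_adm[OF x c] good_bnd[OF X]])
  have sm: "summable (\<lambda>n. Y (k + n) n \<sigma> x * inverse x ^ (2 * n))" if Y: "good min R Y" for Y k
  proof -
    obtain e where e: "\<And>k n. 0 \<le> e k n" "\<And>k. summable (e k)"
    "\<And>k n \<sigma> x. \<sigma> \<in> A \<Longrightarrow> x \<in> S \<Longrightarrow> norm (Y (k + n) n \<sigma> x * inverse x ^ (2 * n)) \<le> e k n"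
    "\<And>k n J \<sigma> x. \<sigma> \<in> A \<Longrightarrow> x \<in> S \<Longrightarrow> J \<le> n \<Longrightarrow>
       norm (Y (k + n) n \<sigma> x * inverse x ^ (2 * n)) \<le> e k n * (norm (inverse x) / \<epsilon>\<^sup>2) ^ J"
    "\<And>N. (\<Sum>k\<le>N. (\<Sum>n. e k n) * \<epsilon> ^ k) \<le> R"
    using Gp_majorant[OF Y] by blast
    show ?thesis by (rule summable_comparison_test'[OF e(2)[of k], of 0]) (use e(3)[OF \<sigma> xS] in simp)
  qed
  have sw: "good min R (swap X)" by (rule good_swap[OF X]) (simp add: min.commute)
  have 1: "(\<Sum>n. trm X a b \<sigma> x (k + n) n) = Gp X k \<sigma> x * a ^ k" for k
  proof -
    have "trm X a b \<sigma> x (k + n) n = X (k + n) n \<sigma> x * inverse x ^ (2 * n) * a ^ k" for n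
      unfolding trm_def ab[symmetric] by (simp add: power_add mult_ac)
    then show ?thesis unfolding Gp_def using suminf_mult2[OF sm[OF X]] by simp
  qed
  have 2: "(\<Sum>n. trm X a b \<sigma> x n (k + n)) = Gp (swap X) k \<sigma> x * b ^ k" for k
  proof -
    have "trm X a b \<sigma> x n (k + n) = swap X (k + n) n \<sigma> x * inverse x ^ (2 * n) * b ^ k" for n
      unfolding trm_def ab[symmetric] swap_def by (simp add: power_add mult_ac)
    then show ?thesis unfolding Gp_def using suminf_mult2[OF sm[OF sw]] by simp
  qed
  note d = double_sum_diagonals[OF s, unfolded 1 2]
  have "(\<Sum>k. Gp X k \<sigma> x * a ^ k) = Gp X 0 \<sigma> x + (\<Sum>k. Gp X (Suc k) \<sigma> x * a ^ Suc k)"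
    using suminf_split_head[OF d(2)] by simp
  then show ?thesis using d(1) by (simp add: ev_def a_def b_def)
qed

end

subsection \<open>The normalized coefficients\<close>

text \<open>With constant coefficient 1, the recursion for the inverse power series involves no
  division and stays in the ring.\<close>

lemma Q0_fps_inverse:
  assumes f: "\<And>j. f j \<in> Q0 \<theta>0 \<theta>x \<theta>inf" and f0: "f 0 = (\<lambda>c \<sigma>. 1)"
  shows "(\<lambda>c \<sigma>. fps_nth (inverse (Abs_fps (\<lambda>j. f j c \<sigma>))) n) \<in> Q0 \<theta>0 \<theta>x \<theta>inf"
proof (induction n rule: less_induct)
  case (less n)
  define e where "e j c \<sigma> = fps_nth (inverse (Abs_fps (\<lambda>j. f j c \<sigma>))) j" for j c \<sigma>
  have "(\<Sum>i=0..n. f i c \<sigma> * e (n - i) c \<sigma>) = (if n = 0 then 1 else 0)" for c \<sigma>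
  proof -
    have "Abs_fps (\<lambda>j. f j c \<sigma>) * inverse (Abs_fps (\<lambda>j. f j c \<sigma>)) = 1"
      by (rule inverse_mult_eq_1') (simp add: f0)
    then have "fps_nth (Abs_fps (\<lambda>j. f j c \<sigma>) * inverse (Abs_fps (\<lambda>j. f j c \<sigma>))) n = (if n = 0 then 1 else 0)"
      by simp
    then show ?thesis by (simp add: fps_mult_nth e_def)
  qed
  moreover have "(\<Sum>i=0..n. f i c \<sigma> * e (n - i) c \<sigma>) = e n c \<sigma> + (\<Sum>i\<in>{1..n}. f i c \<sigma> * e (n - i) c \<sigma>)" for c \<sigma>
    by (simp add: sum.atLeast_Suc_atMost f0)
  ultimately have "e n = (\<lambda>c \<sigma>. (if n = 0 then 1 else 0) - (\<Sum>i\<in>{1..n}. f i c \<sigma> * e (n - i) c \<sigma>))"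
    by (auto simp: fun_eq_iff algebra_simps)
  also have "\<dots> \<in> Q0 \<theta>0 \<theta>x \<theta>inf"
    using less unfolding e_def[abs_def] by (intro Q0_diff Q0_sum Q0_mult f) (auto intro: Q0_rat)
  finally show ?case by (simp add: e_def[abs_def])
qed

lemma Q0_holomorphic:
  assumes "f \<in> Q0 \<theta>0 \<theta>x \<theta>inf" and B: "\<And>c. c \<in> B \<Longrightarrow> c \<noteq> 0"
    and A: "\<And>\<sigma>. \<sigma> \<in> A \<Longrightarrow> \<sigma> + 2 * \<theta>0 - \<theta>inf \<noteq> 0" "\<And>\<sigma>. \<sigma> \<in> A \<Longrightarrow> - \<sigma> + 2 * \<theta>x - \<theta>inf \<noteq> 0"
  shows "continuous_on (B \<times> A) (\<lambda>p. f (fst p) (snd p))"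
    and "c \<in> B \<Longrightarrow> f c holomorphic_on A" and "\<sigma> \<in> A \<Longrightarrow> (\<lambda>c. f c \<sigma>) holomorphic_on B"
proof -
  have "continuous_on (B \<times> A) (\<lambda>p. f (fst p) (snd p)) \<and> (\<forall>c\<in>B. f c holomorphic_on A)
      \<and> (\<forall>\<sigma>\<in>A. (\<lambda>c. f c \<sigma>) holomorphic_on B)"
    using assms(1)
    by induction (use A B in \<open>auto intro!: continuous_intros holomorphic_intros\<close>)
  then show "continuous_on (B \<times> A) (\<lambda>p. f (fst p) (snd p))"
    and "c \<in> B \<Longrightarrow> f c holomorphic_on A" and "\<sigma> \<in> A \<Longrightarrow> (\<lambda>c. f c \<sigma>) holomorphic_on B" by auto
qed

context pv_small
begin

lemma asy_head: "asy S 0 g f \<Longrightarrow> (g \<longlongrightarrow> l) Finf \<Longrightarrow> f 0 = l"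
  using asy_tendsto Finf_nontrivial tendsto_unique by blast

lemma ASY_inverse:
  assumes G: "ASY 0 G" and one: "\<And>\<sigma>. \<sigma> \<in> A \<Longrightarrow> (G \<sigma> \<longlongrightarrow> 1) Finf"
    and low: "\<And>\<sigma> x. \<sigma> \<in> A \<Longrightarrow> x \<in> S \<Longrightarrow> 1 / 2 \<le> norm (G \<sigma> x)"
  shows "ASY 0 (\<lambda>\<sigma> x. inverse (G \<sigma> x))"
proof -
  obtain f where f: "\<And>j. f j \<in> Q" "\<And>c \<sigma>. \<sigma> \<in> A \<Longrightarrow> asy S 0 (G \<sigma>) (\<lambda>j. f j c \<sigma>)"
    using G unfolding ASY_def by blast
  \<comment> \<open>The head coefficient is known to be 1 only for \<sigma> in \<open>A\<close>; as
    a ring element it is replaced by the constant 1, which changes nothing on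
    \<open>A\<close>.\<close>
  define e where "e j = (if j = 0 then (\<lambda>c \<sigma>. 1) else f j)" for j :: nat
  have e: "e j \<in> Q" for j using f(1) by (auto simp: e_def intro: Q0_rat)
  have eq: "e j c \<sigma> = f j c \<sigma>" if "\<sigma> \<in> A" for j c \<sigma>
    using asy_head[OF f(2)[OF that] one[OF that]] by (simp add: e_def)
  show ?thesis unfolding ASY_def
  proof (intro exI conjI allI ballI)
    show "(\<lambda>c \<sigma>. fps_nth (inverse (Abs_fps (\<lambda>j. e j c \<sigma>))) j) \<in> Q" for j
      by (rule Q0_fps_inverse[OF e]) (simp add: e_def)
    show "asy S 0 (\<lambda>x. inverse (G \<sigma> x)) (\<lambda>j. fps_nth (inverse (Abs_fps (\<lambda>j. e j c \<sigma>))) j)"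
      if "\<sigma> \<in> A" for c \<sigma>
      using asy_inverse[OF f(2)[OF that, of c] _ low[OF that]] asy_head[OF f(2)[OF that] one[OF that]]
      by (simp add: eq[OF that])
  qed
qed

text \<open>The head of the expansion is the constant in the ring, and the function minus its head
  is the bracket. As the head is the limit at infinity, knowing the limit identifies the
  constant.\<close>

lemma bracket_monomial:
  assumes h: "hol2 A S h" and H: "ASY 0 h" and e: "e \<in> Q" and "open B"
    and B: "\<And>c. c \<in> B \<Longrightarrow> c \<noteq> 0"
    and den: "\<And>\<sigma>. \<sigma> \<in> A \<Longrightarrow> \<sigma> + 2 * \<theta>0 - \<theta>inf \<noteq> 0" "\<And>\<sigma>. \<sigma> \<in> A \<Longrightarrow> - \<sigma> + 2 * \<theta>x - \<theta>inf \<noteq> 0"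
  obtains a where "a \<in> Q" "bracket \<theta>0 \<theta>x \<theta>inf B A S (\<lambda>c \<sigma> x. e c \<sigma> * h \<sigma> x - a c \<sigma>)"
    "\<And>c \<sigma> l. \<sigma> \<in> A \<Longrightarrow> (h \<sigma> \<longlongrightarrow> l) Finf \<Longrightarrow> a c \<sigma> = e c \<sigma> * l"
proof -
  obtain f where f: "\<And>j. f j \<in> Q" "\<And>c \<sigma>. \<sigma> \<in> A \<Longrightarrow> asy S 0 (h \<sigma>) (\<lambda>j. f j c \<sigma>)"
    using H unfolding ASY_def by blast
  define F where "F j c \<sigma> = e c \<sigma> * f j c \<sigma>" for j c \<sigma>
  have F: "F j \<in> Q" for j unfolding F_def[abs_def] by (rule Q0_mult[OF e f(1)])
  have asy: "asy S 0 (\<lambda>x. e c \<sigma> * h \<sigma> x) (\<lambda>j. F j c \<sigma>)" if "\<sigma> \<in> A" for c \<sigma>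
  proof -
    have "(\<Sum>i\<le>j. (if i = 0 then e c \<sigma> else 0) * f (j - i) c \<sigma>) = F j c \<sigma>" for j
      by (simp add: F_def if_distrib[of "\<lambda>t. t * _"] sum.delta cong: if_cong)
    then show ?thesis using asy_mult[OF asy_const f(2)[OF that], of "e c \<sigma>" c] by simp
  qed
  note Qe = Q0_holomorphic[OF e B den] and QF = Q0_holomorphic[OF F[of 0] B den]
  have hol: "holomorphic3_on (\<lambda>(c, \<sigma>, x). e c \<sigma> * h \<sigma> x - F 0 c \<sigma>) (B \<times> A \<times> S)"
  proof (rule osgood3)
    show "open (B \<times> A \<times> S)" by (intro open_Times \<open>open B\<close> open_A open_S)
    have pr: "continuous_on (B \<times> A \<times> S) (\<lambda>p. q (fst p) (fst (snd p)))"
      if "continuous_on (B \<times> A) (\<lambda>p. q (fst p) (snd p))" for q :: "complex \<Rightarrow> complex \<Rightarrow> complex"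
    proof -
      have "continuous_on (B \<times> A \<times> S) (\<lambda>p. (fst p, fst (snd p)))"
        by (intro continuous_on_Pair continuous_on_fst continuous_on_snd continuous_on_id)
      from continuous_on_compose2[OF that this] show ?thesis by fastforce
    qed
    have "continuous_on (B \<times> A \<times> S) (\<lambda>(c, \<sigma>, x). h \<sigma> x)"
      by (rule continuous_on_subset[OF continuous_on_hol2_triple[OF h]]) (use B in auto)
    then show "continuous_on (B \<times> A \<times> S) (\<lambda>(c, \<sigma>, x). e c \<sigma> * h \<sigma> x - F 0 c \<sigma>)"
      using pr[OF Qe(1)] pr[OF QF(1)] unfolding case_prod_unfold
      by (intro continuous_on_diff continuous_on_mult)
    fix c \<sigma> x
    have "(\<lambda>c. e c \<sigma> * h \<sigma> x - F 0 c \<sigma>) holomorphic_on {c. c \<in> B \<and> \<sigma> \<in> A}"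
      by (cases "\<sigma> \<in> A") (auto intro!: holomorphic_intros Qe QF simp: holomorphic_on_def[of _ "{}"])
    then show "(\<lambda>c. e c \<sigma> * h \<sigma> x - F 0 c \<sigma>) holomorphic_on {c. (c, \<sigma>, x) \<in> B \<times> A \<times> S}"
      by (rule holomorphic_on_subset) auto
    have "(\<lambda>\<sigma>. e c \<sigma> * h \<sigma> x - F 0 c \<sigma>) holomorphic_on {\<sigma>. c \<in> B \<and> x \<in> S \<and> \<sigma> \<in> A}"
    proof (cases "c \<in> B \<and> x \<in> S")
      case True
      then show ?thesis using h by (auto intro!: holomorphic_intros Qe QF simp: hol2_def)
    next
      case False
      then have "{\<sigma>. c \<in> B \<and> x \<in> S \<and> \<sigma> \<in> A} = {}" by auto
      then show ?thesis by (simp only: holomorphic_on_empty)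
    qed
    then show "(\<lambda>\<sigma>. e c \<sigma> * h \<sigma> x - F 0 c \<sigma>) holomorphic_on {\<sigma>. (c, \<sigma>, x) \<in> B \<times> A \<times> S}"
      by (rule holomorphic_on_subset) auto
    have "(\<lambda>x. e c \<sigma> * h \<sigma> x - F 0 c \<sigma>) holomorphic_on {x. \<sigma> \<in> A \<and> x \<in> S}"
      using h by (cases "\<sigma> \<in> A") (auto intro!: holomorphic_intros simp: hol2_def holomorphic_on_def[of _ "{}"])
    then show "(\<lambda>x. e c \<sigma> * h \<sigma> x - F 0 c \<sigma>) holomorphic_on {x. (c, \<sigma>, x) \<in> B \<times> A \<times> S}"
      by (rule holomorphic_on_subset) auto
  qed
  have "bracket \<theta>0 \<theta>x \<theta>inf B A S (\<lambda>c \<sigma> x. e c \<sigma> * h \<sigma> x - F 0 c \<sigma>)"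
    unfolding bracket_def
  proof (intro conjI exI allI ballI)
    show "F (Suc j) \<in> Q" for j by (rule F)
    show "asymp_inv_series S (\<lambda>x. e c \<sigma> * h \<sigma> x - F 0 c \<sigma>) (\<lambda>j. F (Suc j) c \<sigma>)" if "\<sigma> \<in> A" for c \<sigma>
      by (rule asy_imp_asymp_inv_series[OF asy[OF that]])
  qed (rule hol)
  moreover have "F 0 c \<sigma> = e c \<sigma> * l" if "\<sigma> \<in> A" "(h \<sigma> \<longlongrightarrow> l) Finf" for c \<sigma> l
    using asy_head[OF f(2)[OF that(1)] that(2)] by (simp add: F_def)
  ultimately show thesis using that[of "F 0"] F by blast
qed

section \<open>Leading coefficients and normalization\<close>

lemma rhs_w10: "rhs_w U W (Suc 0) 0 \<sigma> x = 4 * U (Suc 0) 0 \<sigma> x / x - P1 \<sigma>"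
  by (simp add: rhs_w_def add_def neg_def shiftX_def shiftY_def divx_def conv_def cst_def U00 W00)

lemma rhs_w01: "rhs_w U W 0 (Suc 0) \<sigma> x = 4 * U 0 (Suc 0) \<sigma> x / x - R1 \<sigma>"
  by (simp add: rhs_w_def add_def neg_def shiftX_def shiftY_def divx_def conv_def cst_def U00 W00)

text \<open>The term with \<open>u\<close> is \<open>O(1/x)\<close>, so the right-hand side tends to
  \<open>- l\<close>; for nonzero \<open>k\<close> the leading coefficient of the solution is that
  of the right-hand side divided by \<open>k\<close>.\<close>

lemma Sol_leading_tendsto:
  assumes \<sigma>: "\<sigma> \<in> A" and k: "k \<noteq> 0" and u: "hol2 A S u" "ASY 0 u" "\<And>x. x \<in> S \<Longrightarrow> norm (u \<sigma> x) \<le> M"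
    and F: "\<And>x. F x = 4 * u \<sigma> x / x - l"
  shows "(Sol k N \<sigma> F \<longlongrightarrow> - l / of_int k) Finf"
proof -
  obtain f where f: "asy S 0 (u \<sigma>) f" using u(2) \<sigma> unfolding ASY_def by blast
  have 4: "asy S (0 + 0) (\<lambda>x. 4 * u \<sigma> x) (\<lambda>j. \<Sum>i\<le>j. (if i = 0 then 4 else 0) * f (j - i))" (is "asy S _ _ ?f")
    by (rule asy_mult[OF asy_const f])
  have "asy S 0 (\<lambda>x. 4 * u \<sigma> x / x) (\<lambda>j. if j < 1 then 0 else ?f (j - 1))"
    by (rule asy_divide_x) (use asy_raise[OF 4, of 1] in simp)
  from asy_add[OF this asy_const[of "- l"]]
  have a: "asy S 0 F (\<lambda>j. (if j < 1 then 0 else ?f (j - 1)) + (if j = 0 then - l else 0))"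
    unfolding F[abs_def] by simp
  have c: "continuous_on S F"
  proof -
    have "u \<sigma> holomorphic_on S" using u(1) \<sigma> by (simp add: hol2_def)
    then have "(\<lambda>x. 4 * u \<sigma> x / x - l) holomorphic_on S"
      by (intro holomorphic_intros) (use S_pos in auto)
    then show ?thesis unfolding F by (simp add: holomorphic_on_imp_continuous_on F[abs_def])
  qed
  have b: "norm (F x) \<le> (4 * M + norm l) * norm x powr real 0" if x: "x \<in> S" for x
  proof -
    have "norm (4 * u \<sigma> x / x) \<le> 4 * M / 1"
      unfolding norm_divide norm_mult by (rule frac_le) (use u(3)[OF x] far[OF x] order_trans[OF norm_ge_zero u(3)[OF x]] in auto)
    then show ?thesis using norm_triangle_ineq4[of "4 * u \<sigma> x / x" l] S_pos(2)[OF x] by (simp add: F)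
  qed
  have "asy S 0 (Sol k N \<sigma> F) (sol_coeff \<sigma> k N 0 (\<lambda>j. (if j < 1 then 0 else ?f (j - 1)) + (if j = 0 then - l else 0)))"
    by (rule asy_Sol_nonresonant[OF \<sigma> k _ c b a]) simp
  from asy_tendsto[OF this] show ?thesis by simp
qed

lemma W_leading:
  assumes \<sigma>: "\<sigma> \<in> A"
  shows "(W (Suc 0) 0 \<sigma> \<longlongrightarrow> - P1 \<sigma>) Finf" "(W 0 (Suc 0) \<sigma> \<longlongrightarrow> R1 \<sigma>) Finf"
proof -
  obtain M where M: "\<And>m n. 0 \<le> M m n"
    "\<And>m n \<sigma> x. \<sigma> \<in> A \<Longrightarrow> x \<in> S \<Longrightarrow> norm (U m n \<sigma> x) \<le> M m n * norm x ^ min m n"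
    "\<And>N. (\<Sum>m\<le>N. \<Sum>n\<le>N. M m n * \<epsilon> ^ (m + n)) \<le> Ru" using bndE[OF good_bnd[OF good_U]] by blast
  have g: "hol2 A S (U m n)" "ASY (min m n) (U m n)" for m n
    using good_U unfolding good_def by blast+
  have "W (Suc 0) 0 \<sigma> = Sol 1 1 \<sigma> (rhs_w U W (Suc 0) 0 \<sigma>)"
    by (subst W_eq) (simp add: Lop_def fun_eq_iff)
  then show "(W (Suc 0) 0 \<sigma> \<longlongrightarrow> - P1 \<sigma>) Finf"
    using Sol_leading_tendsto[OF \<sigma> _ g(1) _ _ rhs_w10, of 1 "M (Suc 0) 0" 1] g(2)[of "Suc 0" 0] M(2)[OF \<sigma>, of _ "Suc 0" 0]
    by simp
  \<comment> \<open>Here \<open>k = - 1\<close>, which reverses the sign of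
    \<open>- R1 \<sigma>\<close>.\<close>
  have "W 0 (Suc 0) \<sigma> = Sol (- 1) 1 \<sigma> (rhs_w U W 0 (Suc 0) \<sigma>)"
    by (subst W_eq) (simp add: Lop_def fun_eq_iff)
  then show "(W 0 (Suc 0) \<sigma> \<longlongrightarrow> R1 \<sigma>) Finf"
    using Sol_leading_tendsto[OF \<sigma> _ g(1) _ _ rhs_w01, of "- 1" "M 0 (Suc 0)" 1] g(2)[of 0 "Suc 0"] M(2)[OF \<sigma>, of _ 0 "Suc 0"]
    by simp
qed

text \<open>The part of \<open>1 + w\<close> free of \<open>X\<close> and \<open>Y\<close> after
  collecting powers. It tends to 1 and stays at distance at most \<open>1/2\<close> from 1, so it
  can be factored out; \<open>Aq\<close> and \<open>Bq\<close> are the quotients.\<close>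

definition G where "G \<sigma> x = 1 + Gp W 0 \<sigma> x"
definition Aq where "Aq n \<sigma> x = Gp W n \<sigma> x * inverse (G \<sigma> x)"
definition Bq where "Bq n \<sigma> x = Gp (swap W) n \<sigma> x * inverse (G \<sigma> x)"

lemma good_swap_W: "good min (1/2) (swap W)"
  by (rule good_swap[OF good_W]) (simp add: min.commute)

lemma G_low: "\<sigma> \<in> A \<Longrightarrow> x \<in> S \<Longrightarrow> 1 / 2 \<le> norm (G \<sigma> x)"
proof -
  assume \<sigma>: "\<sigma> \<in> A" and x: "x \<in> S"
  obtain g where g: "\<And>k. 0 \<le> g k" "\<And>k \<sigma> x. \<sigma> \<in> A \<Longrightarrow> x \<in> S \<Longrightarrow> norm (Gp W k \<sigma> x) \<le> g k"
    "summable (\<lambda>k. g k * \<epsilon> ^ k)" "g 0 \<le> 1 / 2" using Gp_bound[OF good_W] by blast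
  have "norm (Gp W 0 \<sigma> x) \<le> 1 / 2" using g(2)[OF \<sigma> x, of 0] g(4) by linarith
  then show ?thesis using norm_diff_ineq[of 1 "Gp W 0 \<sigma> x"] by (simp add: G_def)
qed

lemma Gp0_tendsto: "\<sigma> \<in> A \<Longrightarrow> (Gp W 0 \<sigma> \<longlongrightarrow> 0) Finf"
  by (rule Gp_tendsto[OF good_W]) (simp_all add: W00)

lemma G_tendsto: "\<sigma> \<in> A \<Longrightarrow> (G \<sigma> \<longlongrightarrow> 1) Finf"
  using tendsto_add[OF tendsto_const Gp0_tendsto, of \<sigma> 1] by (simp add: G_def[abs_def])

lemma hol2_G_inverse: "hol2 A S (\<lambda>\<sigma> x. inverse (G \<sigma> x))"
  unfolding G_def
  by (intro hol2_inverse hol2_add hol2_const hol2_Gp[OF good_W])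
    (use G_low in \<open>force simp: G_def\<close>)

lemma ASY_G_inverse: "ASY 0 (\<lambda>\<sigma> x. inverse (G \<sigma> x))"
proof (rule ASY_inverse[OF _ G_tendsto G_low])
  show "ASY 0 G" unfolding G_def[abs_def]
    by (intro ASY_add ASY_Gp[OF good_W] ASY_param Q0_rat) simp
qed

lemma quotient_bound:
  assumes "good min (1/2) X"
  obtains g where "\<And>k. 0 \<le> g k" "summable (\<lambda>k. g k * \<epsilon> ^ k)"
    "\<And>k \<sigma> x. \<sigma> \<in> A \<Longrightarrow> x \<in> S \<Longrightarrow> norm (Gp X k \<sigma> x * inverse (G \<sigma> x)) \<le> g k"
proof -
  obtain g where g: "\<And>k. 0 \<le> g k" "\<And>k \<sigma> x. \<sigma> \<in> A \<Longrightarrow> x \<in> S \<Longrightarrow> norm (Gp X k \<sigma> x) \<le> g k"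
    "summable (\<lambda>k. g k * \<epsilon> ^ k)" "g 0 \<le> 1 / 2" using Gp_bound[OF assms] by blast
  have "norm (Gp X k \<sigma> x * inverse (G \<sigma> x)) \<le> 2 * g k" if "\<sigma> \<in> A" "x \<in> S" for k \<sigma> x
  proof -
    have "norm (inverse (G \<sigma> x)) \<le> 2"
      using le_imp_inverse_le[OF G_low[OF that]] by (simp add: norm_inverse)
    then have "norm (Gp X k \<sigma> x) * norm (inverse (G \<sigma> x)) \<le> g k * 2"
      using g(1) by (intro mult_mono g(2) that) auto
    then show ?thesis by (simp add: norm_mult mult.commute)
  qed
  then show thesis using that[of "\<lambda>k. 2 * g k"] g(1) summable_mult[OF g(3), of 2] by (simp add: mult.assoc)
qed

lemma hol2_AB: "hol2 A S (Aq n)" "hol2 A S (Bq n)"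
  unfolding Aq_def[abs_def] Bq_def[abs_def]
  by (intro hol2_mult hol2_G_inverse hol2_Gp[OF good_W] hol2_Gp[OF good_swap_W])+

lemma ASY_AB: "ASY 0 (Aq n)" "ASY 0 (Bq n)"
  unfolding Aq_def[abs_def] Bq_def[abs_def]
  using ASY_mult[OF ASY_Gp[OF good_W] ASY_G_inverse] ASY_mult[OF ASY_Gp[OF good_swap_W] ASY_G_inverse]
  by simp_all

lemma AB_tendsto:
  assumes \<sigma>: "\<sigma> \<in> A"
  shows "(Aq (Suc 0) \<sigma> \<longlongrightarrow> (- \<sigma> + \<theta>0 + \<theta>x) / 2) Finf" "(Bq (Suc 0) \<sigma> \<longlongrightarrow> (\<sigma> + \<theta>0 + \<theta>x) / 2) Finf"
proof -
  have i: "((\<lambda>x. inverse (G \<sigma> x)) \<longlongrightarrow> 1) Finf"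
    using tendsto_inverse[OF G_tendsto[OF \<sigma>]] by simp
  have "- P1 \<sigma> = (- \<sigma> + \<theta>0 + \<theta>x) / 2"
    by (simp add: P1_def zeta_def pa_def field_simps)
  with tendsto_mult[OF Gp_tendsto[OF good_W \<sigma> W_leading(1)[OF \<sigma>]] i]
  show "(Aq (Suc 0) \<sigma> \<longlongrightarrow> (- \<sigma> + \<theta>0 + \<theta>x) / 2) Finf"
    by (simp add: Aq_def[abs_def])
  have R1: "R1 \<sigma> = (\<sigma> + \<theta>0 + \<theta>x) / 2"
    by (simp add: R1_def zeta_def pb_def field_simps)
  have "(swap W (Suc 0) 0 \<sigma> \<longlongrightarrow> R1 \<sigma>) Finf"
    using W_leading(2)[OF \<sigma>] by (simp add: swap_def[abs_def])
  then show "(Bq (Suc 0) \<sigma> \<longlongrightarrow> (\<sigma> + \<theta>0 + \<theta>x) / 2) Finf"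
    using tendsto_mult[OF Gp_tendsto[OF good_swap_W \<sigma>] i, of "Suc 0" "R1 \<sigma>"]
    unfolding R1[symmetric] by (simp add: Bq_def[abs_def])
qed

lemma quotient_expansion:
  assumes \<sigma>: "\<sigma> \<in> A" and c: "c \<noteq> 0" and x: "x \<in> Dom c \<sigma>"
  shows "Wf c \<sigma> x = G \<sigma> x * (1 + (\<Sum>k. Aq (Suc k) \<sigma> x * Xc c \<sigma> x ^ Suc k) + (\<Sum>k. Bq (Suc k) \<sigma> x * Yc c \<sigma> x ^ Suc k))"
proof -
  have xS: "x \<in> S" using x by (simp add: Dom_def)
  have G0: "G \<sigma> x \<noteq> 0" using G_low[OF \<sigma> xS] by auto
  have sm: "summable (\<lambda>k. (Gp X (Suc k) \<sigma> x * inverse (G \<sigma> x)) * z ^ Suc k)"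
    if X: "good min (1/2) X" and z: "norm z < \<epsilon>" for X z
  proof -
    obtain g where g: "\<And>k. 0 \<le> g k" "summable (\<lambda>k. g k * \<epsilon> ^ k)"
      "\<And>k \<sigma> x. \<sigma> \<in> A \<Longrightarrow> x \<in> S \<Longrightarrow> norm (Gp X k \<sigma> x * inverse (G \<sigma> x)) \<le> g k"
      using quotient_bound[OF X] by blast
    have "summable (\<lambda>k. (Gp X k \<sigma> x * inverse (G \<sigma> x)) * z ^ k)"
    proof (rule summable_comparison_test'[OF g(2), of 0])
      fix k
      show "norm ((Gp X k \<sigma> x * inverse (G \<sigma> x)) * z ^ k) \<le> g k * \<epsilon> ^ k"
        unfolding norm_mult[of _ "z ^ k"] norm_power
        using z g(1) by (intro mult_mono g(3)[OF \<sigma> xS] power_mono) auto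
    qed
    then show ?thesis by (rule summable_Suc_iff[THEN iffD2])
  qed
  have z: "norm (Xc c \<sigma> x) < \<epsilon>" "norm (Yc c \<sigma> x) < \<epsilon>" using x by (auto simp: Dom_def)
  have "G \<sigma> x * (\<Sum>k. Aq (Suc k) \<sigma> x * Xc c \<sigma> x ^ Suc k) = (\<Sum>k. Gp W (Suc k) \<sigma> x * Xc c \<sigma> x ^ Suc k)"
    unfolding Aq_def suminf_mult[OF sm[OF good_W z(1)], symmetric]
    using G0 by (intro suminf_cong) (simp add: field_simps)
  moreover have "G \<sigma> x * (\<Sum>k. Bq (Suc k) \<sigma> x * Yc c \<sigma> x ^ Suc k) = (\<Sum>k. Gp (swap W) (Suc k) \<sigma> x * Yc c \<sigma> x ^ Suc k)"
    unfolding Bq_def suminf_mult[OF sm[OF good_swap_W z(2)], symmetric]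
    using G0 by (intro suminf_cong) (simp add: field_simps)
  ultimately show ?thesis
    unfolding Wf_def ev_collect[OF good_W \<sigma> c x] distrib_left by (simp add: G_def)
qed

lemma quotient_uniform:
  assumes X: "good min (1/2) X" and D: "\<And>c \<sigma> x. (c, \<sigma>, x) \<in> D \<Longrightarrow> \<sigma> \<in> A \<and> x \<in> S \<and> norm (z c \<sigma> x) \<le> \<epsilon>"
  shows "uniformly_convergent_on D (\<lambda>N (c, \<sigma>, x). \<Sum>n=1..N. (Gp X n \<sigma> x * inverse (G \<sigma> x)) * z c \<sigma> x ^ n)"
proof -
  obtain g where g: "\<And>k. 0 \<le> g k" "summable (\<lambda>k. g k * \<epsilon> ^ k)"
    "\<And>k \<sigma> x. \<sigma> \<in> A \<Longrightarrow> x \<in> S \<Longrightarrow> norm (Gp X k \<sigma> x * inverse (G \<sigma> x)) \<le> g k"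
    using quotient_bound[OF X] by blast
  have "uniformly_convergent_on D (\<lambda>N p. \<Sum>k<N. (\<lambda>(c, \<sigma>, x). (Gp X (Suc k) \<sigma> x * inverse (G \<sigma> x)) * z c \<sigma> x ^ Suc k) p)"
  proof (rule Weierstrass_m_test'[where M = "\<lambda>k. g (Suc k) * \<epsilon> ^ Suc k"])
    show "summable (\<lambda>k. g (Suc k) * \<epsilon> ^ Suc k)" using g(2) by (rule summable_Suc_iff[THEN iffD2])
    fix k p assume "p \<in> D"
    moreover obtain c \<sigma> x where p: "p = (c, \<sigma>, x)" by (metis prod_cases3)
    ultimately have d: "\<sigma> \<in> A" "x \<in> S" "norm (z c \<sigma> x) \<le> \<epsilon>" using D by auto
    have "norm ((Gp X (Suc k) \<sigma> x * inverse (G \<sigma> x)) * z c \<sigma> x ^ Suc k) \<le> g (Suc k) * \<epsilon> ^ Suc k"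
      unfolding norm_mult[of _ "z c \<sigma> x ^ Suc k"] norm_power
      using d g(1) by (intro mult_mono g(3) power_mono) auto
    then show "norm ((\<lambda>(c, \<sigma>, x). (Gp X (Suc k) \<sigma> x * inverse (G \<sigma> x)) * z c \<sigma> x ^ Suc k) p) \<le> g (Suc k) * \<epsilon> ^ Suc k"
      by (simp add: p)
  qed
  then show ?thesis by (simp add: case_prod_unfold sum.atLeast1_atMost_eq)
qed

text \<open>The last two hypotheses pass from conditions on \<open>Xvar\<close>, \<open>Yvar\<close>
  with radius \<open>e\<close> to conditions with radius \<epsilon> on these variables multiplied by
  \<open>c\<close> and \<open>inverse c\<close>.\<close>

lemma PV_family:
  assumes "open B" and B: "\<And>c. c \<in> B \<Longrightarrow> c \<noteq> 0"
    and den: "\<And>\<sigma>. \<sigma> \<in> A \<Longrightarrow> \<sigma> + 2 * \<theta>0 - \<theta>inf \<noteq> 0" "\<And>\<sigma>. \<sigma> \<in> A \<Longrightarrow> - \<sigma> + 2 * \<theta>x - \<theta>inf \<noteq> 0"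
    and e: "\<And>c. c \<in> B \<Longrightarrow> norm c * e \<le> \<epsilon>" "\<And>c. c \<in> B \<Longrightarrow> norm (inverse c) * e \<le> \<epsilon>"
  shows "\<exists>y a b g0 g h.
       holomorphic3_on (\<lambda>(c, \<sigma>, x). y c \<sigma> x) (B \<times> D_dom A e r \<delta>) \<and>
       (\<forall>c\<in>B. \<forall>\<sigma>\<in>A. solves_PV_on \<theta>0 \<theta>x \<theta>inf (y c \<sigma>) (Sigma_dom \<sigma> e r \<delta>)) \<and>
       (\<forall>n\<ge>1. a n \<in> Q0 \<theta>0 \<theta>x \<theta>inf \<and> b n \<in> Q0 \<theta>0 \<theta>x \<theta>inf) \<and>
       (\<forall>c\<in>B. \<forall>\<sigma>\<in>A. a 1 c \<sigma> = c * (- \<sigma> + \<theta>0 + \<theta>x) / 2 \<and>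
                       b 1 c \<sigma> = inverse c * (\<sigma> + \<theta>0 + \<theta>x) / 2) \<and>
       bracket \<theta>0 \<theta>x \<theta>inf B A (sector \<delta> r) g0 \<and>
       (\<forall>n\<ge>1. bracket \<theta>0 \<theta>x \<theta>inf B A (sector \<delta> r) (g n) \<and>
               bracket \<theta>0 \<theta>x \<theta>inf B A (sector \<delta> r) (h n)) \<and>
       converges_on a g Xvar (B \<times> D_dom A e r \<delta>) \<and>
       converges_on b h Yvar (B \<times> D_dom A e r \<delta>) \<and>
       (\<forall>c\<in>B. \<forall>(\<sigma>, x)\<in>D_dom A e r \<delta>.
          y c \<sigma> x = c * (1 + g0 c \<sigma> x) * (exp x * x powr \<sigma>) *
            (1 + (\<Sum>n. (a (Suc n) c \<sigma> + g (Suc n) c \<sigma> x) * Xvar \<sigma> x ^ Suc n)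
               + (\<Sum>n. (b (Suc n) c \<sigma> + h (Suc n) c \<sigma> x) * Yvar \<sigma> x ^ Suc n)))"
proof -
  have D: "\<sigma> \<in> A" "x \<in> S" "x \<in> Dom c \<sigma>" if "c \<in> B" "\<sigma> \<in> A" "x \<in> Sigma_dom \<sigma> e r \<delta>" for c \<sigma> x
  proof -
    have x: "x \<in> S" "norm (Xvar \<sigma> x) < e" "norm (Yvar \<sigma> x) < e" using that(3) by (auto simp: Sigma_dom_def)
    have "norm c * norm (Xvar \<sigma> x) < norm c * e" "norm (inverse c) * norm (Yvar \<sigma> x) < norm (inverse c) * e"
      using x B[OF that(1)] by (intro mult_strict_left_mono; simp)+
    then show "\<sigma> \<in> A" "x \<in> S" "x \<in> Dom c \<sigma>"
      using e[OF that(1)] x that by (auto simp: Dom_def Xc_def Yc_def norm_mult)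
  qed
  have Ddom: "\<sigma> \<in> A \<and> x \<in> S \<and> x \<in> Dom c \<sigma>" if "c \<in> B" "(\<sigma>, x) \<in> D_dom A e r \<delta>" for c \<sigma> x
    using that D by (auto simp: D_dom_def)
  have one: "(\<lambda>c \<sigma>. 1) \<in> Q" by (rule Q0_rat) simp
  \<comment> \<open>Bundles the conclusions of \<open>bracket_monomial\<close>, so that the
    constants for all \<open>n\<close> can be chosen together.\<close>
  define P where "P q e a \<longleftrightarrow> a \<in> Q \<and> bracket \<theta>0 \<theta>x \<theta>inf B A S (\<lambda>c \<sigma> x. e c \<sigma> * q \<sigma> x - a c \<sigma>) \<and>
      (\<forall>c \<sigma> l. \<sigma> \<in> A \<longrightarrow> (q \<sigma> \<longlongrightarrow> l) Finf \<longrightarrow> a c \<sigma> = e c \<sigma> * l)" for q e a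
  have P: "\<exists>a. P q e a" if "hol2 A S q" "ASY 0 q" "e \<in> Q" for q e
    by (rule bracket_monomial[OF that \<open>open B\<close> B den]) (auto simp: P_def)
  have PD: "a \<in> Q" "bracket \<theta>0 \<theta>x \<theta>inf B A S (\<lambda>c \<sigma> x. e c \<sigma> * q \<sigma> x - a c \<sigma>)"
    "\<And>c \<sigma> l. \<sigma> \<in> A \<Longrightarrow> (q \<sigma> \<longlongrightarrow> l) Finf \<Longrightarrow> a c \<sigma> = e c \<sigma> * l" if "P q e a" for q e a
    using that unfolding P_def by blast+
  obtain a where "\<And>n. P (Aq n) (\<lambda>c \<sigma>. c ^ n) (a n)"
    using choice[of "\<lambda>n. P (Aq n) (\<lambda>c \<sigma>. c ^ n)"] P[OF hol2_AB(1) ASY_AB(1) Q0_power[OF Q0_c]] by blast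
  note a = PD[OF this]
  obtain b where "\<And>n. P (Bq n) (\<lambda>c \<sigma>. inverse c ^ n) (b n)"
    using choice[of "\<lambda>n. P (Bq n) (\<lambda>c \<sigma>. inverse c ^ n)"] P[OF hol2_AB(2) ASY_AB(2) Q0_power[OF Q0_inv_c]] by blast
  note b = PD[OF this]
  obtain a0 where "P (Gp W 0) (\<lambda>c \<sigma>. 1) a0"
    using P[OF hol2_Gp[OF good_W] ASY_Gp[OF good_W] one] by blast
  note a0 = PD[OF this]
  define g0 where "g0 c \<sigma> x = 1 * Gp W 0 \<sigma> x - a0 c \<sigma>" for c \<sigma> x
  define g where "g n c \<sigma> x = c ^ n * Aq n \<sigma> x - a n c \<sigma>" for n c \<sigma> x
  define h where "h n c \<sigma> x = inverse c ^ n * Bq n \<sigma> x - b n c \<sigma>" for n c \<sigma> x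
  have ag: "(a n c \<sigma> + g n c \<sigma> x) * Xvar \<sigma> x ^ n = Aq n \<sigma> x * Xc c \<sigma> x ^ n"
    and bh: "(b n c \<sigma> + h n c \<sigma> x) * Yvar \<sigma> x ^ n = Bq n \<sigma> x * Yc c \<sigma> x ^ n" for n c \<sigma> x
    by (simp_all add: g_def h_def Xc_def Yc_def power_mult_distrib mult_ac)
  \<comment> \<open>The constant \<open>a0\<close> vanishes on \<open>A\<close> because
    \<open>Gp W 0\<close> tends to 0; so \<open>1 + g0\<close> is exactly the factor
    \<open>G\<close>.\<close>
  have g0: "1 + g0 c \<sigma> x = G \<sigma> x" if "\<sigma> \<in> A" for c \<sigma> x
    using a0(3)[OF that Gp0_tendsto[OF that]] by (simp add: g0_def G_def)
  show ?thesis
  proof (rule exI[of _ yf], rule exI[of _ a], rule exI[of _ b], rule exI[of _ g0], rule exI[of _ g], rule exI[of _ h],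
      intro conjI)
    show "holomorphic3_on (\<lambda>(c, \<sigma>, x). yf c \<sigma> x) (B \<times> D_dom A e r \<delta>)"
      by (rule holomorphic3_on_subset[OF yf_holomorphic3]) (use Ddom B in \<open>auto simp: Dall_def\<close>)
    show "\<forall>c\<in>B. \<forall>\<sigma>\<in>A. solves_PV_on \<theta>0 \<theta>x \<theta>inf (yf c \<sigma>) (Sigma_dom \<sigma> e r \<delta>)"
      by (intro ballI yf_solves) (use B D in auto)
    show "\<forall>n\<ge>1. a n \<in> Q \<and> b n \<in> Q" using a(1) b(1) by blast
    show "\<forall>c\<in>B. \<forall>\<sigma>\<in>A. a 1 c \<sigma> = c * (- \<sigma> + \<theta>0 + \<theta>x) / 2 \<and> b 1 c \<sigma> = inverse c * (\<sigma> + \<theta>0 + \<theta>x) / 2"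
      using a(3)[OF _ AB_tendsto(1)] b(3)[OF _ AB_tendsto(2)] by simp
    show "bracket \<theta>0 \<theta>x \<theta>inf B A S g0" using a0(2) unfolding g0_def[abs_def] .
    show "\<forall>n\<ge>1. bracket \<theta>0 \<theta>x \<theta>inf B A S (g n) \<and> bracket \<theta>0 \<theta>x \<theta>inf B A S (h n)"
      using a(2) b(2) unfolding g_def[abs_def] h_def[abs_def] by blast
    show "converges_on a g Xvar (B \<times> D_dom A e r \<delta>)"
      unfolding converges_on_def ag unfolding Aq_def
      by (rule quotient_uniform[OF good_W]) (use Ddom in \<open>auto simp: Dom_def intro: less_imp_le\<close>)
    show "converges_on b h Yvar (B \<times> D_dom A e r \<delta>)"
      unfolding converges_on_def bh unfolding Bq_def
      by (rule quotient_uniform[OF good_swap_W]) (use Ddom in \<open>auto simp: Dom_def intro: less_imp_le\<close>)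
    show "\<forall>c\<in>B. \<forall>(\<sigma>, x)\<in>D_dom A e r \<delta>.
          yf c \<sigma> x = c * (1 + g0 c \<sigma> x) * (exp x * x powr \<sigma>) *
            (1 + (\<Sum>n. (a (Suc n) c \<sigma> + g (Suc n) c \<sigma> x) * Xvar \<sigma> x ^ Suc n)
               + (\<Sum>n. (b (Suc n) c \<sigma> + h (Suc n) c \<sigma> x) * Yvar \<sigma> x ^ Suc n))"
      unfolding ag bh
    proof (intro ballI, clarify)
      fix c \<sigma> x assume c: "c \<in> B" and "(\<sigma>, x) \<in> D_dom A e r \<delta>"
      then have d: "\<sigma> \<in> A" "x \<in> Dom c \<sigma>" using Ddom by auto
      show "yf c \<sigma> x = c * (1 + g0 c \<sigma> x) * (exp x * x powr \<sigma>) *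
            (1 + (\<Sum>n. Aq (Suc n) \<sigma> x * Xc c \<sigma> x ^ Suc n) + (\<Sum>n. Bq (Suc n) \<sigma> x * Yc c \<sigma> x ^ Suc n))"
        unfolding yf_def quotient_expansion[OF d(1) B[OF c] d(2)] g0[OF d(1)] by (simp only: mult_ac)
    qed
  qed
qed

end

subsection \<open>The two-parameter family\<close>

text \<open>Boundedness of both domains and the positive distance of \<open>B\<close> from 0 provide
  constants \<open>Smax\<close>, \<open>K\<close>, \<open>c0\<close> and \<open>c1\<close> valid for
  all parameters; \<epsilon> and \<open>r\<close> are computed from these and \<delta>.\<close>

theorem theorem2p18:
  fixes \<theta>0 \<theta>x \<theta>inf :: complex and \<delta> :: real and B Bs :: "complex set"
  assumes "0 < \<delta>" and "\<delta> < pi / 2"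
    and "is_domain B" and "bounded B" and "0 \<notin> closure B"
    and "is_domain Bs" and "bounded Bs"
    and "setdist {- 2 * \<theta>0 + \<theta>inf, 2 * \<theta>x - \<theta>inf} Bs > 0"
  shows "\<exists>\<epsilon> r. 0 < \<epsilon> \<and> 1 / \<epsilon> < r \<and>
    (\<exists>y a b g0 g h.
       holomorphic3_on (\<lambda>(c, \<sigma>, x). y c \<sigma> x) (B \<times> D_dom Bs \<epsilon> r \<delta>) \<and>
       (\<forall>c\<in>B. \<forall>\<sigma>\<in>Bs. solves_PV_on \<theta>0 \<theta>x \<theta>inf (y c \<sigma>) (Sigma_dom \<sigma> \<epsilon> r \<delta>)) \<and>
       (\<forall>n\<ge>1. a n \<in> Q0 \<theta>0 \<theta>x \<theta>inf \<and> b n \<in> Q0 \<theta>0 \<theta>x \<theta>inf) \<and>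
       (\<forall>c\<in>B. \<forall>\<sigma>\<in>Bs. a 1 c \<sigma> = c * (- \<sigma> + \<theta>0 + \<theta>x) / 2 \<and>
                       b 1 c \<sigma> = inverse c * (\<sigma> + \<theta>0 + \<theta>x) / 2) \<and>
       bracket \<theta>0 \<theta>x \<theta>inf B Bs (sector \<delta> r) g0 \<and>
       (\<forall>n\<ge>1. bracket \<theta>0 \<theta>x \<theta>inf B Bs (sector \<delta> r) (g n) \<and>
               bracket \<theta>0 \<theta>x \<theta>inf B Bs (sector \<delta> r) (h n)) \<and>
       converges_on a g Xvar (B \<times> D_dom Bs \<epsilon> r \<delta>) \<and>
       converges_on b h Yvar (B \<times> D_dom Bs \<epsilon> r \<delta>) \<and>
       (\<forall>c\<in>B. \<forall>(\<sigma>, x)\<in>D_dom Bs \<epsilon> r \<delta>.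
          y c \<sigma> x = c * (1 + g0 c \<sigma> x) * (exp x * x powr \<sigma>) *
            (1 + (\<Sum>n. (a (Suc n) c \<sigma> + g (Suc n) c \<sigma> x) * Xvar \<sigma> x ^ Suc n)
               + (\<Sum>n. (b (Suc n) c \<sigma> + h (Suc n) c \<sigma> x) * Yvar \<sigma> x ^ Suc n))))"
proof -
  have sl: "0 < slope \<delta>" by (rule slope_bounds[OF assms(1,2)])
  have opn: "open B" "open Bs" using assms(3,6) by (auto simp: is_domain_def)
  obtain Smax where Smax_le: "\<And>\<sigma>. \<sigma> \<in> Bs \<Longrightarrow> norm \<sigma> \<le> Smax" using assms(7) by (auto simp: bounded_iff)
  obtain c1 where c1: "0 < c1" "\<And>c. c \<in> B \<Longrightarrow> norm c \<le> c1" using assms(4) by (auto simp: bounded_pos)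
  obtain c0 where c0: "0 < c0" "\<And>c. c \<in> B \<Longrightarrow> c0 \<le> norm c"
    using assms(5) by (force simp: closure_approachable not_less)
  have den: "\<sigma> \<noteq> - 2 * \<theta>0 + \<theta>inf" "\<sigma> \<noteq> 2 * \<theta>x - \<theta>inf" if "\<sigma> \<in> Bs" for \<sigma>
    using assms(8) setdist_eq_0I[OF _ that, of "{- 2 * \<theta>0 + \<theta>inf, 2 * \<theta>x - \<theta>inf}"] by auto
  \<comment> \<open>A continuous function is bounded on the compact closure of \<open>Bs\<close>;
    this is applied to the four polynomials entering \<open>K\<close>.\<close>
  have bdd: "\<And>thesis. (\<And>k. (\<And>\<sigma>. \<sigma> \<in> Bs \<Longrightarrow> norm (f \<sigma>) \<le> k) \<Longrightarrow> thesis) \<Longrightarrow> thesis" if "continuous_on UNIV f" for f :: "complex \<Rightarrow> complex"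
  proof -
    have "compact (f ` closure Bs)"
      using assms(7) by (intro compact_continuous_image continuous_on_subset[OF that]) (auto simp: compact_closure)
    then obtain k where "\<And>z. z \<in> f ` closure Bs \<Longrightarrow> norm z \<le> k"
      using compact_imp_bounded[of "f ` closure Bs"] unfolding bounded_iff by blast
    then show "\<And>thesis. (\<And>k. (\<And>\<sigma>. \<sigma> \<in> Bs \<Longrightarrow> norm (f \<sigma>) \<le> k) \<Longrightarrow> thesis) \<Longrightarrow> thesis"
      using closure_subset[of Bs] by blast
  qed
  let ?\<zeta> = "\<lambda>\<sigma>. (\<sigma> - 2 * \<theta>0 - \<theta>inf) / 4"
  let ?pa = "(\<theta>0 - \<theta>x + \<theta>inf) / 2" and ?pb = "(\<theta>0 + \<theta>x + \<theta>inf) / 2"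
  obtain k0 where k0: "\<And>\<sigma>. \<sigma> \<in> Bs \<Longrightarrow> norm (?\<zeta> \<sigma> * (?\<zeta> \<sigma> + ?pa)) \<le> k0"
    by (rule bdd[of "\<lambda>\<sigma>. ?\<zeta> \<sigma> * (?\<zeta> \<sigma> + ?pa)"]) (blast | (intro continuous_intros; simp))+
  obtain k1 where k1: "\<And>\<sigma>. \<sigma> \<in> Bs \<Longrightarrow> norm (2 * ?\<zeta> \<sigma> + ?pa) \<le> k1"
    by (rule bdd[of "\<lambda>\<sigma>. 2 * ?\<zeta> \<sigma> + ?pa"]) (blast | (intro continuous_intros; simp))+
  obtain k2 where k2: "\<And>\<sigma>. \<sigma> \<in> Bs \<Longrightarrow> norm ((?\<zeta> \<sigma> + \<theta>0) * (?\<zeta> \<sigma> + ?pb)) \<le> k2"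
    by (rule bdd[of "\<lambda>\<sigma>. (?\<zeta> \<sigma> + \<theta>0) * (?\<zeta> \<sigma> + ?pb)"]) (blast | (intro continuous_intros; simp))+
  obtain k3 where k3: "\<And>\<sigma>. \<sigma> \<in> Bs \<Longrightarrow> norm (2 * ?\<zeta> \<sigma> + \<theta>0 + ?pb) \<le> k3"
    by (rule bdd[of "\<lambda>\<sigma>. 2 * ?\<zeta> \<sigma> + \<theta>0 + ?pb"]) (blast | (intro continuous_intros; simp))+
  define K where "K = Max {1, k0, k1, k2, k3}"
  have Kge: "1 \<le> K" "k0 \<le> K" "k1 \<le> K" "k2 \<le> K" "k3 \<le> K" by (auto simp: K_def)
  \<comment> \<open>The largest value allowed by the invariance of the ball.\<close>
  define \<epsilon> where "\<epsilon> = 1 / (200 * K * (4 / slope \<delta>)\<^sup>2)"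
  have eps: "0 < \<epsilon>" "200 * K * (4 / slope \<delta>)\<^sup>2 * \<epsilon> \<le> 1" using Kge(1) sl by (auto simp: \<epsilon>_def)
  \<comment> \<open>The radius for the variables without \<open>c\<close>: multiplication by
    \<open>c\<close> costs at most \<open>c1\<close>, by \<open>inverse c\<close> at most
    \<open>1 / c0\<close>.\<close>
  define e where "e = min (\<epsilon> / c1) (\<epsilon> * c0)"
  have e: "0 < e" using eps c0 c1 by (simp add: e_def)
  \<comment> \<open>The summands answer separate demands: distance at least 1, absorption of
    \<open>x^(k \<sigma>)\<close>, the inequality \<open>1 \<le> r * \<epsilon>^2\<close>, and
    \<open>1 / e < r\<close>.\<close>
  define r where "r = 1 + 4 * \<bar>Smax\<bar> / slope \<delta> + 1 / \<epsilon>\<^sup>2 + 1 / e"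
  have t: "0 \<le> 4 * \<bar>Smax\<bar> / slope \<delta>" "0 < 1 / \<epsilon>\<^sup>2" "0 < 1 / e" using sl eps e by auto
  have r1: "1 \<le> r" "1 / e < r" using t unfolding r_def by linarith+
  have "4 * \<bar>Smax\<bar> / slope \<delta> \<le> r" "1 / \<epsilon>\<^sup>2 \<le> r" using t unfolding r_def by linarith+
  then have "4 * \<bar>Smax\<bar> \<le> slope \<delta> * r" and r\<epsilon>: "1 \<le> r * \<epsilon>\<^sup>2" using sl eps by (simp_all add: field_simps)
  then have rS: "4 * Smax \<le> slope \<delta> * r" by linarith
  interpret pv_arrays \<delta> r Smax Bs \<theta>0 \<theta>x \<theta>inf \<epsilon>
    by unfold_locales (use assms(1,2) r1 opn Smax_le rS eps in auto)
  interpret pv_small \<delta> r Smax Bs \<theta>0 \<theta>x \<theta>inf \<epsilon> K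
  proof
    fix \<sigma> assume \<sigma>: "\<sigma> \<in> Bs"
    show "norm (P0 \<sigma>) \<le> K" "norm (P1 \<sigma>) \<le> K" "norm (R0 \<sigma>) \<le> K" "norm (R1 \<sigma>) \<le> K"
      unfolding P0_def P1_def R0_def R1_def zeta_def pa_def pb_def
      using k0[OF \<sigma>] k1[OF \<sigma>] k2[OF \<sigma>] k3[OF \<sigma>] Kge by linarith+
  qed (use Kge(1) r\<epsilon> eps in auto)
  have eB: "norm c * e \<le> \<epsilon>" "norm (inverse c) * e \<le> \<epsilon>" if c: "c \<in> B" for c
  proof -
    have "norm c * e \<le> c1 * (\<epsilon> / c1)" using c1 c e by (intro mult_mono) (auto simp: e_def)
    then show "norm c * e \<le> \<epsilon>" using c1(1) by simp
    have "inverse (norm c) * e \<le> inverse c0 * (\<epsilon> * c0)"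
      using c0 c e by (intro mult_mono le_imp_inverse_le) (auto simp: e_def)
    also have "inverse c0 * (\<epsilon> * c0) = \<epsilon>" using c0(1) by simp
    finally show "norm (inverse c) * e \<le> \<epsilon>" by (simp only: norm_inverse)
  qed
  show ?thesis
    by (rule exI[of _ e], rule exI[of _ r], intro conjI e r1(2), rule PV_family[OF opn(1) _ _ _ eB])
      (use c0 den in \<open>force simp: algebra_simps\<close>)+
qed

end
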